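(* For any Hausdorff manifold $M$, the functor $$\mathcal{C}^{\infty}_{c}:\mathrm{Sh}(M)\to\mathrm{CoAlg}(\mathcal{C}^{\infty}_{c}(M)),\qquad E\mapsto\mathcal{C}^{\infty}_{c}(E),\quad\phi\mapsto\phi_{+},$$ is fully faithful and left adjoint to the spectral sheaf functor $\mathcal{E}_{sp}:\mathrm{CoAlg}(\mathcal{C}^{\infty}_{c}(M))\to\mathrm{Sh}(M)$.
   Context: All manifolds and maps are smooth; $\mathbb{F}\in\{\mathbb{R},\mathbb{C}\}$ is fixed; $M$ is a Hausdorff manifold; $R=\mathcal{C}^{\infty}_{c}(M)$ is the ring of $\mathbb{F}$-valued smooth functions with compact support; "$f_{x}=1$" means that the germ of $f$ at $x$ is that of the constant $1$. Coalgebras. A left $R$-module $C$ is locally unitary if for all $c_{1},\dots,c_{k}\in C$ there is $r\in R$ with $rc_{i}=c_{i}$ for all $i$. A coalgebra over $R$ is a locally unitary $R$-module $C$ with $R$-linear maps $\Delta:C\to C\otimes_{R}C$ and $\epsilon:C\to R$ with $(\mathrm{id}\otimes\epsilon)\circ\Delta=\mathrm{id}=(\epsilon\otimes\mathrm{id})\circ\Delta$ (coassociativity and cocommutativity are not assumed). Homomorphisms are $R$-linear maps $\alpha$ with $(\alpha\otimes\alpha)\circ\Delta=\Delta\circ\alpha$, $\epsilon\circ\alpha=\epsilon$. The category is $\mathrm{CoAlg}(R)$. An element $c$ is weakly grouplike if $\Delta(c)=c\otimes c'$ for some $c'\in C$. Sheaves. $\mathrm{Sh}(M)$: objects are local diffeomorphisms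 $\pi:E\to M$ with $E$ a manifold, not necessarily Hausdorff (no second countability required); morphisms are smooth maps over $M$. An open $U\subset E$ is $\pi$-elementary if $\pi|_{U}$ is injective. With $\mathcal{C}^{\infty}_{E}$ the sheaf of germs of smooth $\mathbb{F}$-valued functions, $\mathcal{C}^{\infty}_{c}(E)$ is the subspace of the space of all (not necessarily continuous) global sections of $\mathcal{C}^{\infty}_{E}$ spanned by the extensions by zero of functions in $\mathcal{C}^{\infty}_{c}(U)$, $U\subset E$ Hausdorff open; it consists of sums of elements $f\circ\pi|_{U}$ (extended by zero), $U$ $\pi$-elementary, $f\in\mathcal{C}^{\infty}_{c}(\pi(U))$. Module structure: $p(f\circ\pi|_{U})=pf\circ\pi|_{U}$. Coalgebra structure: $\Delta(f\circ\pi|_{U})=(f\circ\pi|_{U})\otimes(\eta\circ\pi|_{U})$ for any $\eta\in\mathcal{C}^{\infty}_{c}(\pi(U))$ with $\eta f=f$, and $\epsilon(f\circ\pi|_{U})=f$. A morphism $\phi:E\to F$ to $\xi:F\to M$ induces $\phi_{+}$ with $\phi_{+}(f\circ\pi|_{U})=f\circ\xi|_{\phi(U)}$. Spectral sheaf. For a coalgebra $C$ over $R$ and $x\in M$, put $N_{x}(C)=\{c\in C: fc=0$ for some $f\in\mathcal{C}^{\infty}_{c}(M)$ with $f_{x}=1\}$, $C_{x}=C/N_{x}(C)$, $c_{x}=c+N_{x}(C)$. With the induced maps $\Delta_{x},\epsilon_{x}$ (using $(C\otimes_{R}C)_{x}=C_{x}\otimes_{R_{x}}C_{x}$) $C_{x}$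 is a coalgebra over the ring of germs $R_{x}=(\mathcal{C}^{\infty}_{M})_{x}$; $G(C_{x})=\{\zeta:\Delta_{x}(\zeta)=\zeta\otimes\zeta,\ \epsilon_{x}(\zeta)=1\}$. $c$ is normalized on $W\subset M$ if $\epsilon(c)_{x}=1$ for all $x\in W$. $\mathcal{E}_{sp}(C)$ is the sheaf on $M$ with stalks $\mathcal{E}_{sp}(C)_{x}=G(C_{x})$ and topology with basis the sets $c_{W}=\{c_{x}:x\in W\}$, $W\subset M$ open, $c$ weakly grouplike and normalized on $W$ (each projecting diffeomorphically to $W$). For a homomorphism $\alpha:C\to D$, $\mathcal{E}_{sp}(\alpha)(c_{x})=\alpha(c)_{x}$. *)

theory Defs
  imports "HOL-Analysis.Analysis" "HOL-Algebra.AbelCoset" "HOL-Algebra.Module" "HOL-Algebra.Free_Abelian_Groups" "HOL-Library.Function_Algebras"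
begin

section \<open>Smooth manifolds\<close>

text \<open>C-k maps between open subsets of normed spaces, by recursion on k over all directional
  derivatives. On a finite-dimensional space this is the usual notion. S is always open below.\<close>

primrec Ck_on :: "nat \<Rightarrow> 'a::real_normed_vector set \<Rightarrow> ('a \<Rightarrow> 'b::real_normed_vector) \<Rightarrow> bool" where
  "Ck_on 0 S f \<longleftrightarrow> continuous_on S f"
| "Ck_on (Suc k) S f \<longleftrightarrow> (\<forall>x\<in>S. f differentiable (at x)) \<and>
     (\<forall>v. Ck_on k S (\<lambda>x. frechet_derivative f (at x) v))"

definition smooth_on :: "'a::real_normed_vector set \<Rightarrow> ('a \<Rightarrow> 'b::real_normed_vector) \<Rightarrow> bool" where
  "smooth_on S f \<longleftrightarrow> (\<forall>k. Ck_on k S f)"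

text \<open>A chart is a pair of its domain and a coordinate function, whose values off the domain are
  irrelevant. The atlas need not be maximal. The model space is a finite-dimensional inner product
  space, rather than a type of class \<open>euclidean_space\<close>, so as not to exclude dimension 0.
  Neither the Hausdorff property nor second countability is part of \<open>manifold\<close>.\<close>

record ('a, 'b) mfd =
  mtop :: "'a topology"
  atlas :: "('a set \<times> ('a \<Rightarrow> 'b)) set"

abbreviation points :: "('a, 'b, 'z) mfd_scheme \<Rightarrow> 'a set" where
  "points X \<equiv> topspace (mtop X)"

definition manifold :: "('a, 'b::real_inner) mfd \<Rightarrow> bool" where
  "manifold X \<longleftrightarrow>
     (\<exists>B::'b set. finite B \<and> span B = UNIV) \<and>
     (\<forall>(U, \<phi>)\<in>atlas X. openin (mtop X) U \<and> open (\<phi> ` U) \<and>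
        homeomorphic_map (subtopology (mtop X) U) (top_of_set (\<phi> ` U)) \<phi>) \<and>
     (\<Union>(U, \<phi>)\<in>atlas X. U) = points X \<and>
     (\<forall>(U, \<phi>)\<in>atlas X. \<forall>(V, \<psi>)\<in>atlas X. smooth_on (\<phi> ` (U \<inter> V)) (\<psi> \<circ> inv_into U \<phi>))"

definition open_sub :: "('a, 'b) mfd \<Rightarrow> 'a set \<Rightarrow> ('a, 'b) mfd" where
  "open_sub X W = \<lparr>mtop = subtopology (mtop X) W, atlas = (\<lambda>(U, \<phi>). (U \<inter> W, \<phi>)) ` atlas X\<rparr>"

definition smooth_fun :: "('a, 'b::real_inner) mfd \<Rightarrow> ('a \<Rightarrow> 'k::real_normed_vector) \<Rightarrow> bool" where
  "smooth_fun X f \<longleftrightarrow> (\<forall>(U, \<phi>)\<in>atlas X. smooth_on (\<phi> ` U) (f \<circ> inv_into U \<phi>))"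

definition smooth_map :: "('a, 'b::real_inner) mfd \<Rightarrow> ('c, 'd::real_inner) mfd \<Rightarrow> ('a \<Rightarrow> 'c) \<Rightarrow> bool" where
  "smooth_map X Y f \<longleftrightarrow> continuous_map (mtop X) (mtop Y) f \<and>
     (\<forall>(U, \<phi>)\<in>atlas X. \<forall>(V, \<psi>)\<in>atlas Y.
        smooth_on (\<phi> ` (U \<inter> f -` V)) (\<psi> \<circ> f \<circ> inv_into U \<phi>))"

definition diffeo :: "('a, 'b::real_inner) mfd \<Rightarrow> ('c, 'd::real_inner) mfd \<Rightarrow> ('a \<Rightarrow> 'c) \<Rightarrow> bool" where
  "diffeo X Y f \<longleftrightarrow> bij_betw f (points X) (points Y) \<and>
     smooth_map X Y f \<and> smooth_map Y X (inv_into (points X) f)"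

definition local_diffeo :: "('a, 'b::real_inner) mfd \<Rightarrow> ('c, 'd::real_inner) mfd \<Rightarrow> ('a \<Rightarrow> 'c) \<Rightarrow> bool" where
  "local_diffeo X Y f \<longleftrightarrow> (\<forall>x\<in>points X. \<exists>U. openin (mtop X) U \<and> x \<in> U \<and>
     openin (mtop Y) (f ` U) \<and> diffeo (open_sub X U) (open_sub Y (f ` U)) f)"

text \<open>The scalar field is a type of class \<open>real_normed_field\<close>; up to isomorphism the only
  such fields are the real and the complex numbers (Mazur). Functions on a manifold are total
  functions on the underlying type, normalized to be 0 off the manifold, so that the elements of
  \<open>Cc (open_sub X U)\<close> are already extended by zero.\<close>

definition Cc :: "('a, 'b::real_inner) mfd \<Rightarrow> ('a \<Rightarrow> 'k::real_normed_field) set" where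
  "Cc X = {f. smooth_fun X f \<and> (\<forall>x. x \<notin> points X \<longrightarrow> f x = 0) \<and>
     compactin (mtop X) (mtop X closure_of {x. f x \<noteq> 0})}"

text \<open>The germ at a point is the set of all functions that agree with the given one near the point.\<close>

definition germ :: "('a, 'b) mfd \<Rightarrow> 'a \<Rightarrow> ('a \<Rightarrow> 'k) \<Rightarrow> ('a \<Rightarrow> 'k) set" where
  "germ X x f = {g. \<exists>W. openin (mtop X) W \<and> x \<in> W \<and> (\<forall>y\<in>W. g y = f y)}"

definition germ_ring :: "('a, 'b::real_inner) mfd \<Rightarrow> 'a \<Rightarrow> ('a \<Rightarrow> 'k::real_normed_field) set set" where
  "germ_ring X x = {germ X x f | f W. openin (mtop X) W \<and> x \<in> W \<and> smooth_fun (open_sub X W) f}"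


section \<open>Modules, tensor products and coalgebras\<close>

text \<open>The scalar ring is a subset R of a commutative ring type and need not have a unit, so the
  library locale \<open>module\<close> does not apply. Its record type is reused; the multiplicative
  fields \<open>mult\<close> and \<open>one\<close> inherited from \<open>ring\<close> play no role.\<close>

definition locally_unitary_module :: "'r::comm_ring set \<Rightarrow> ('r, 'c, 'z) module_scheme \<Rightarrow> bool" where
  "locally_unitary_module R C \<longleftrightarrow> abelian_group C \<and>
     (\<forall>r\<in>R. \<forall>c\<in>carrier C. r \<odot>\<^bsub>C\<^esub> c \<in> carrier C) \<and>
     (\<forall>r\<in>R. \<forall>s\<in>R. \<forall>c\<in>carrier C. (r + s) \<odot>\<^bsub>C\<^esub> c = r \<odot>\<^bsub>C\<^esub> c \<oplus>\<^bsub>C\<^esub> s \<odot>\<^bsub>C\<^esub> c) \<and>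
     (\<forall>r\<in>R. \<forall>c\<in>carrier C. \<forall>d\<in>carrier C. r \<odot>\<^bsub>C\<^esub> (c \<oplus>\<^bsub>C\<^esub> d) = r \<odot>\<^bsub>C\<^esub> c \<oplus>\<^bsub>C\<^esub> r \<odot>\<^bsub>C\<^esub> d) \<and>
     (\<forall>r\<in>R. \<forall>s\<in>R. \<forall>c\<in>carrier C. (r * s) \<odot>\<^bsub>C\<^esub> c = r \<odot>\<^bsub>C\<^esub> (s \<odot>\<^bsub>C\<^esub> c)) \<and>
     (\<forall>F. finite F \<and> F \<subseteq> carrier C \<longrightarrow> (\<exists>r\<in>R. \<forall>c\<in>F. r \<odot>\<^bsub>C\<^esub> c = c))"

definition linear_map :: "'r set \<Rightarrow> ('r, 'c, 'z) module_scheme \<Rightarrow> ('r, 'd, 'w) module_scheme \<Rightarrow> ('c \<Rightarrow> 'd) \<Rightarrow> bool" where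
  "linear_map R C D h \<longleftrightarrow> h \<in> carrier C \<rightarrow> carrier D \<and>
     (\<forall>c\<in>carrier C. \<forall>d\<in>carrier C. h (c \<oplus>\<^bsub>C\<^esub> d) = h c \<oplus>\<^bsub>D\<^esub> h d) \<and>
     (\<forall>r\<in>R. \<forall>c\<in>carrier C. h (r \<odot>\<^bsub>C\<^esub> c) = r \<odot>\<^bsub>D\<^esub> h c)"

definition regular_module :: "'r::comm_ring set \<Rightarrow> ('r, 'r) module" where
  "regular_module R = \<lparr>carrier = R, monoid.mult = undefined, monoid.one = undefined,
     ring.zero = 0, ring.add = (+), smult = (*)\<rparr>"

text \<open>The tensor product as the free abelian group on pairs modulo the bilinearity and balancing
  relations; only the scalar actions matter, so \<open>R\<close> may be any set of scalars.\<close>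

definition tensor_relations ::
  "'r set \<Rightarrow> ('r, 'c, 'z) module_scheme \<Rightarrow> ('r, 'd, 'w) module_scheme \<Rightarrow> ('c \<times> 'd \<Rightarrow>\<^sub>0 int) set" where
  "tensor_relations R C D =
     {frag_of (c \<oplus>\<^bsub>C\<^esub> c', d) - frag_of (c, d) - frag_of (c', d) | c c' d.
        c \<in> carrier C \<and> c' \<in> carrier C \<and> d \<in> carrier D} \<union>
     {frag_of (c, d \<oplus>\<^bsub>D\<^esub> d') - frag_of (c, d) - frag_of (c, d') | c d d'.
        c \<in> carrier C \<and> d \<in> carrier D \<and> d' \<in> carrier D} \<union>
     {frag_of (r \<odot>\<^bsub>C\<^esub> c, d) - frag_of (c, r \<odot>\<^bsub>D\<^esub> d) | r c d.
        r \<in> R \<and> c \<in> carrier C \<and> d \<in> carrier D}"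

definition tensor_class ::
  "'r set \<Rightarrow> ('r, 'c, 'z) module_scheme \<Rightarrow> ('r, 'd, 'w) module_scheme \<Rightarrow> ('c \<times> 'd \<Rightarrow>\<^sub>0 int) \<Rightarrow> ('c \<times> 'd \<Rightarrow>\<^sub>0 int) set" where
  "tensor_class R C D t =
     (let G = free_Abelian_group (carrier C \<times> carrier D)
      in generate G (tensor_relations R C D) #>\<^bsub>G\<^esub> t)"

definition tensor ::
  "'r set \<Rightarrow> ('r, 'c, 'z) module_scheme \<Rightarrow> ('r, 'd, 'w) module_scheme \<Rightarrow> ('r, ('c \<times> 'd \<Rightarrow>\<^sub>0 int) set) module" where
  "tensor R C D =
     (let G = free_Abelian_group (carrier C \<times> carrier D);
          Q = G Mod generate G (tensor_relations R C D)
      in \<lparr>carrier = carrier Q, monoid.mult = undefined, monoid.one = undefined,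
          ring.zero = \<one>\<^bsub>Q\<^esub>, ring.add = (\<otimes>\<^bsub>Q\<^esub>),
          smult = (\<lambda>r T. the_elem ((\<lambda>t. tensor_class R C D
                     (frag_extend (\<lambda>(c, d). frag_of (r \<odot>\<^bsub>C\<^esub> c, d)) t)) ` T))\<rparr>)"

definition pure_tensor ::
  "'r set \<Rightarrow> ('r, 'c, 'z) module_scheme \<Rightarrow> ('r, 'd, 'w) module_scheme \<Rightarrow> 'c \<Rightarrow> 'd \<Rightarrow> ('c \<times> 'd \<Rightarrow>\<^sub>0 int) set" where
  "pure_tensor R C D c d = tensor_class R C D (frag_of (c, d))"

text \<open>The map of tensor products over possibly different rings induced by \<open>g \<otimes> h\<close>; the
  arguments \<open>S\<close>, \<open>C'\<close>, \<open>D'\<close> describe the codomain.\<close>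

definition tensor_map ::
  "'s set \<Rightarrow> ('s, 'e, 'z) module_scheme \<Rightarrow> ('s, 'f, 'w) module_scheme \<Rightarrow> ('c \<Rightarrow> 'e) \<Rightarrow> ('d \<Rightarrow> 'f) \<Rightarrow>
   ('c \<times> 'd \<Rightarrow>\<^sub>0 int) set \<Rightarrow> ('e \<times> 'f \<Rightarrow>\<^sub>0 int) set" where
  "tensor_map S C' D' g h T =
     the_elem ((\<lambda>t. tensor_class S C' D' (frag_extend (\<lambda>(c, d). frag_of (g c, h d)) t)) ` T)"

text \<open>The additive map on a tensor product with values in C induced by a balanced biadditive map.\<close>

definition tensor_lift :: "('c, 'z) ring_scheme \<Rightarrow> ('a \<Rightarrow> 'b \<Rightarrow> 'c) \<Rightarrow> ('a \<times> 'b \<Rightarrow>\<^sub>0 int) set \<Rightarrow> 'c" where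
  "tensor_lift C \<beta> T =
     the_elem ((\<lambda>t. \<Oplus>\<^bsub>C\<^esub>p\<in>Poly_Mapping.keys t.
                  add_pow C (Poly_Mapping.lookup t p) (\<beta> (fst p) (snd p))) ` T)"

record ('r, 'c) coalg = "('r, 'c) module" +
  comult :: "'c \<Rightarrow> ('c \<times> 'c \<Rightarrow>\<^sub>0 int) set"
  counit :: "'c \<Rightarrow> 'r"

text \<open>In the two counit laws \<open>C \<otimes> R\<close> and \<open>R \<otimes> C\<close> are identified with
  \<open>C\<close>, so that \<open>id \<otimes> \<epsilon>\<close> maps \<open>c \<otimes> d\<close> to \<open>\<epsilon>(d) c\<close> and \<open>\<epsilon> \<otimes> id\<close> maps it to
  \<open>\<epsilon>(c) d\<close>.\<close>

definition coalgebra :: "'r::comm_ring set \<Rightarrow> ('r, 'c) coalg \<Rightarrow> bool" where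
  "coalgebra R C \<longleftrightarrow> locally_unitary_module R C \<and>
     linear_map R C (tensor R C C) (comult C) \<and>
     linear_map R C (regular_module R) (counit C) \<and>
     (\<forall>c\<in>carrier C. tensor_lift C (\<lambda>a b. counit C b \<odot>\<^bsub>C\<^esub> a) (comult C c) = c) \<and>
     (\<forall>c\<in>carrier C. tensor_lift C (\<lambda>a b. counit C a \<odot>\<^bsub>C\<^esub> b) (comult C c) = c)"

text \<open>Morphisms, here and for sheaves below, are extensional functions on the carrier, so that equality of
  functions is equality of morphisms.\<close>

definition coalg_hom :: "'r set \<Rightarrow> ('r, 'c) coalg \<Rightarrow> ('r, 'd) coalg \<Rightarrow> ('c \<Rightarrow> 'd) set" where
  "coalg_hom R C D = {\<alpha> \<in> extensional (carrier C). linear_map R C D \<alpha> \<and>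
     (\<forall>c\<in>carrier C. tensor_map R D D \<alpha> \<alpha> (comult C c) = comult D (\<alpha> c)) \<and>
     (\<forall>c\<in>carrier C. counit D (\<alpha> c) = counit C c)}"

definition weakly_grouplike :: "'r set \<Rightarrow> ('r, 'c) coalg \<Rightarrow> 'c \<Rightarrow> bool" where
  "weakly_grouplike R C c \<longleftrightarrow> c \<in> carrier C \<and> (\<exists>c'\<in>carrier C. comult C c = pure_tensor R C C c c')"


section \<open>Sheaves as local diffeomorphisms\<close>

record ('e, 'b, 'x) etale =
  total :: "('e, 'b) mfd"
  proj :: "'e \<Rightarrow> 'x"

abbreviation epoints :: "('e, 'b, 'x) etale \<Rightarrow> 'e set" where
  "epoints E \<equiv> points (total E)"

definition sh_obj :: "('x, 'b::real_inner) mfd \<Rightarrow> ('e, 'b, 'x) etale \<Rightarrow> bool" where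
  "sh_obj M E \<longleftrightarrow> manifold (total E) \<and> local_diffeo (total E) M (proj E)"

definition sh_hom :: "('e, 'b::real_inner, 'x) etale \<Rightarrow> ('f, 'b, 'x) etale \<Rightarrow> ('e \<Rightarrow> 'f) set" where
  "sh_hom E F = {\<phi> \<in> extensional (epoints E). smooth_map (total E) (total F) \<phi> \<and>
     (\<forall>e\<in>epoints E. proj F (\<phi> e) = proj E e)}"

definition elementary :: "('e, 'b, 'x) etale \<Rightarrow> 'e set \<Rightarrow> bool" where
  "elementary E U \<longleftrightarrow> openin (mtop (total E)) U \<and> inj_on (proj E) U"


section \<open>The coalgebra of smooth functions with compact support on a sheaf\<close>

text \<open>A global, not necessarily continuous, section of the sheaf of germs assigns a germ to every point.\<close>

definition ext_zero :: "('a, 'b) mfd \<Rightarrow> 'a set \<Rightarrow> ('a \<Rightarrow> 'k::zero) \<Rightarrow> 'a \<Rightarrow> ('a \<Rightarrow> 'k) set" where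
  "ext_zero X U f = (\<lambda>e\<in>points X. if e \<in> U then germ X e f else germ X e 0)"

definition sec_add :: "('a, 'b) mfd \<Rightarrow> ('a \<Rightarrow> ('a \<Rightarrow> 'k::plus) set) \<Rightarrow> ('a \<Rightarrow> ('a \<Rightarrow> 'k) set) \<Rightarrow> 'a \<Rightarrow> ('a \<Rightarrow> 'k) set" where
  "sec_add X s t = (\<lambda>e\<in>points X. \<Union>f\<in>s e. \<Union>g\<in>t e. germ X e (f + g))"

definition sec_mult :: "('a, 'b) mfd \<Rightarrow> ('a \<Rightarrow> 'k::times) \<Rightarrow> ('a \<Rightarrow> ('a \<Rightarrow> 'k) set) \<Rightarrow> 'a \<Rightarrow> ('a \<Rightarrow> 'k) set" where
  "sec_mult X q s = (\<lambda>e\<in>points X. \<Union>f\<in>s e. germ X e (q * f))"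

inductive_set Cc_sections :: "('a, 'b::real_inner) mfd \<Rightarrow> ('a \<Rightarrow> ('a \<Rightarrow> 'k::real_normed_field) set) set"
  for X :: "('a, 'b) mfd" where
  gen: "openin (mtop X) U \<Longrightarrow> Hausdorff_space (subtopology (mtop X) U) \<Longrightarrow> f \<in> Cc (open_sub X U)
        \<Longrightarrow> ext_zero X U f \<in> Cc_sections X"
| add: "s \<in> Cc_sections X \<Longrightarrow> t \<in> Cc_sections X \<Longrightarrow> sec_add X s t \<in> Cc_sections X"
| scale: "s \<in> Cc_sections X \<Longrightarrow> sec_mult X (\<lambda>_. a) s \<in> Cc_sections X"

text \<open>The element of the sheaf coalgebra given by the pullback of f along the projection
  restricted to U.\<close>

definition pullback :: "('e, 'b, 'x) etale \<Rightarrow> 'e set \<Rightarrow> ('x \<Rightarrow> 'k::zero) \<Rightarrow> 'e \<Rightarrow> ('e \<Rightarrow> 'k) set" where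
  "pullback E U f = ext_zero (total E) U (f \<circ> proj E)"

definition Cc_module :: "('e, 'b::real_inner, 'x) etale \<Rightarrow>
    ('x \<Rightarrow> 'k::real_normed_field, 'e \<Rightarrow> ('e \<Rightarrow> 'k) set) module" where
  "Cc_module E = \<lparr>carrier = Cc_sections (total E), monoid.mult = undefined, monoid.one = undefined,
     ring.zero = ext_zero (total E) {} 0, ring.add = sec_add (total E),
     smult = (\<lambda>p. sec_mult (total E) (p \<circ> proj E))\<rparr>"

text \<open>The comultiplication, the counit and the maps induced by sheaf morphisms are the linear
  maps with the prescribed values on the additive generators.\<close>

definition Cc_comult :: "('x, 'b::real_inner) mfd \<Rightarrow> ('e, 'b, 'x) etale \<Rightarrow>
    ('e \<Rightarrow> ('e \<Rightarrow> 'k::real_normed_field) set) \<Rightarrow>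
    (('e \<Rightarrow> ('e \<Rightarrow> 'k) set) \<times> ('e \<Rightarrow> ('e \<Rightarrow> 'k) set) \<Rightarrow>\<^sub>0 int) set" where
  "Cc_comult M E = (let R = Cc M; C = Cc_module E in
     THE \<Delta>. \<Delta> \<in> extensional (carrier C) \<and> linear_map R C (tensor R C C) \<Delta> \<and>
       (\<forall>U f \<eta>. elementary E U \<and> f \<in> Cc (open_sub M (proj E ` U)) \<and>
          \<eta> \<in> Cc (open_sub M (proj E ` U)) \<and> \<eta> * f = f \<longrightarrow>
          \<Delta> (pullback E U f) = pure_tensor R C C (pullback E U f) (pullback E U \<eta>)))"

definition Cc_counit :: "('x, 'b::real_inner) mfd \<Rightarrow> ('e, 'b, 'x) etale \<Rightarrow>
    ('e \<Rightarrow> ('e \<Rightarrow> 'k::real_normed_field) set) \<Rightarrow> 'x \<Rightarrow> 'k" where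
  "Cc_counit M E = (let R = Cc M; C = Cc_module E in
     THE \<epsilon>. \<epsilon> \<in> extensional (carrier C) \<and> linear_map R C (regular_module R) \<epsilon> \<and>
       (\<forall>U f. elementary E U \<and> f \<in> Cc (open_sub M (proj E ` U)) \<longrightarrow> \<epsilon> (pullback E U f) = f))"

definition Cc_coalg :: "('x, 'b::real_inner) mfd \<Rightarrow> ('e, 'b, 'x) etale \<Rightarrow>
    ('x \<Rightarrow> 'k::real_normed_field, 'e \<Rightarrow> ('e \<Rightarrow> 'k) set) coalg" where
  "Cc_coalg M E = module.extend (Cc_module E) \<lparr>comult = Cc_comult M E, counit = Cc_counit M E\<rparr>"

definition Cc_map :: "('x, 'b::real_inner) mfd \<Rightarrow> ('e, 'b, 'x) etale \<Rightarrow> ('f, 'b, 'x) etale \<Rightarrow> ('e \<Rightarrow> 'f) \<Rightarrow>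
    ('e \<Rightarrow> ('e \<Rightarrow> 'k::real_normed_field) set) \<Rightarrow> 'f \<Rightarrow> ('f \<Rightarrow> 'k) set" where
  "Cc_map M E F \<phi> = (THE h. h \<in> extensional (carrier (Cc_module E)) \<and>
     linear_map (Cc M) (Cc_module E) (Cc_module F) h \<and>
     (\<forall>U f. elementary E U \<and> f \<in> Cc (open_sub M (proj E ` U)) \<longrightarrow>
        h (pullback E U f) = pullback F (\<phi> ` U) f))"


section \<open>The spectral sheaf\<close>

definition null_at :: "('x, 'b::real_inner) mfd \<Rightarrow> ('x \<Rightarrow> 'k::real_normed_field, 'c) coalg \<Rightarrow> 'x \<Rightarrow> 'c set" where
  "null_at M C x = {c \<in> carrier C. \<exists>f\<in>Cc M. germ M x f = germ M x 1 \<and> f \<odot>\<^bsub>C\<^esub> c = \<zero>\<^bsub>C\<^esub>}"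

definition stalk_class :: "('x, 'b::real_inner) mfd \<Rightarrow> ('x \<Rightarrow> 'k::real_normed_field, 'c) coalg \<Rightarrow> 'x \<Rightarrow> 'c \<Rightarrow> 'c set" where
  "stalk_class M C x c = null_at M C x +>\<^bsub>C\<^esub> c"

text \<open>The stalk as a module over the ring of germs; every germ is the germ of an element of
  \<open>Cc M\<close>, by which it acts.\<close>

definition stalk :: "('x, 'b::real_inner) mfd \<Rightarrow> ('x \<Rightarrow> 'k::real_normed_field, 'c) coalg \<Rightarrow> 'x \<Rightarrow>
    (('x \<Rightarrow> 'k) set, 'c set) module" where
  "stalk M C x = \<lparr>carrier = stalk_class M C x ` carrier C, monoid.mult = undefined, monoid.one = undefined,
     ring.zero = null_at M C x, ring.add = set_add C,
     smult = (\<lambda>\<rho> \<zeta>. the_elem {stalk_class M C x (r \<odot>\<^bsub>C\<^esub> c) | r c. r \<in> \<rho> \<inter> Cc M \<and> c \<in> \<zeta>})\<rparr>"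

definition stalk_comult :: "('x, 'b::real_inner) mfd \<Rightarrow> ('x \<Rightarrow> 'k::real_normed_field, 'c) coalg \<Rightarrow> 'x \<Rightarrow>
    'c set \<Rightarrow> ('c set \<times> 'c set \<Rightarrow>\<^sub>0 int) set" where
  "stalk_comult M C x \<zeta> = the_elem
     ((\<lambda>c. tensor_map (germ_ring M x) (stalk M C x) (stalk M C x)
             (stalk_class M C x) (stalk_class M C x) (comult C c)) ` \<zeta>)"

definition stalk_counit :: "('x, 'b::real_inner) mfd \<Rightarrow> ('x \<Rightarrow> 'k::real_normed_field, 'c) coalg \<Rightarrow> 'x \<Rightarrow>
    'c set \<Rightarrow> ('x \<Rightarrow> 'k) set" where
  "stalk_counit M C x \<zeta> = the_elem ((\<lambda>c. germ M x (counit C c)) ` \<zeta>)"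

definition stalk_grouplikes :: "('x, 'b::real_inner) mfd \<Rightarrow> ('x \<Rightarrow> 'k::real_normed_field, 'c) coalg \<Rightarrow> 'x \<Rightarrow> 'c set set" where
  "stalk_grouplikes M C x = {\<zeta> \<in> carrier (stalk M C x).
     stalk_comult M C x \<zeta> = pure_tensor (germ_ring M x) (stalk M C x) (stalk M C x) \<zeta> \<zeta> \<and>
     stalk_counit M C x \<zeta> = germ M x 1}"

definition normalized_on :: "('x, 'b::real_inner) mfd \<Rightarrow> ('x \<Rightarrow> 'k::real_normed_field, 'c) coalg \<Rightarrow> 'x set \<Rightarrow> 'c \<Rightarrow> bool" where
  "normalized_on M C W c \<longleftrightarrow> (\<forall>x\<in>W. germ M x (counit C c) = germ M x 1)"

definition spectral_points :: "('x, 'b::real_inner) mfd \<Rightarrow> ('x \<Rightarrow> 'k::real_normed_field, 'c) coalg \<Rightarrow> ('x \<times> 'c set) set" where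
  "spectral_points M C = (SIGMA x:points M. stalk_grouplikes M C x)"

definition spectral_patch :: "('x, 'b::real_inner) mfd \<Rightarrow> ('x \<Rightarrow> 'k::real_normed_field, 'c) coalg \<Rightarrow> 'c \<Rightarrow> 'x set \<Rightarrow> ('x \<times> 'c set) set" where
  "spectral_patch M C c W = (\<lambda>x. (x, stalk_class M C x c)) ` W"

text \<open>The whole space is listed as a generator only to make it the underlying set by definition.
  The charts are those of M, transported along the projection to the sets of the basis.\<close>

definition spectral_sheaf :: "('x, 'b::real_inner) mfd \<Rightarrow> ('x \<Rightarrow> 'k::real_normed_field, 'c) coalg \<Rightarrow>
    ('x \<times> 'c set, 'b, 'x) etale" where
  "spectral_sheaf M C =
    \<lparr>total =
      \<lparr>mtop = topology_generated_by (insert (spectral_points M C)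
         {spectral_patch M C c W | c W. openin (mtop M) W \<and> weakly_grouplike (Cc M) C c \<and>
            normalized_on M C W c}),
       atlas = {(spectral_patch M C c W, \<kappa> \<circ> fst) | c W V \<kappa>. openin (mtop M) W \<and>
            weakly_grouplike (Cc M) C c \<and> normalized_on M C W c \<and> (V, \<kappa>) \<in> atlas M \<and> W \<subseteq> V}\<rparr>,
     proj = fst\<rparr>"

definition spectral_map :: "('x, 'b::real_inner) mfd \<Rightarrow> ('x \<Rightarrow> 'k::real_normed_field, 'c) coalg \<Rightarrow>
    ('x \<Rightarrow> 'k, 'd) coalg \<Rightarrow> ('c \<Rightarrow> 'd) \<Rightarrow> 'x \<times> 'c set \<Rightarrow> 'x \<times> 'd set" where
  "spectral_map M C D \<alpha> = (\<lambda>(x, \<zeta>)\<in>spectral_points M C.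
     (x, the_elem ((\<lambda>c. stalk_class M D x (\<alpha> c)) ` \<zeta>)))"

text \<open>The unit of the adjunction sends e to the class at the base point of any pullback
  \<open>f \<circ> \<pi>|U\<close> with \<open>e \<in> U\<close> and f equal to 1 near the base point. A homomorphism is transposed
  by composing its spectral map with the unit. The bijection is named explicitly because types cannot
  be quantified inside a proposition: naming it makes it one family over sheaves and coalgebras of all types.\<close>

definition adj_unit :: "('x, 'b::real_inner) mfd \<Rightarrow> ('e, 'b, 'x) etale \<Rightarrow>
    'e \<Rightarrow> 'x \<times> ('e \<Rightarrow> ('e \<Rightarrow> 'k::real_normed_field) set) set" where
  "adj_unit M E = (\<lambda>e\<in>epoints E. (proj E e, the_elem
     {stalk_class M (Cc_coalg M E) (proj E e) (pullback E U f) | U f.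
        elementary E U \<and> e \<in> U \<and> f \<in> Cc (open_sub M (proj E ` U)) \<and>
        germ M (proj E e) f = germ M (proj E e) 1}))"

definition transpose_hom :: "('x, 'b::real_inner) mfd \<Rightarrow> ('e, 'b, 'x) etale \<Rightarrow> ('x \<Rightarrow> 'k::real_normed_field, 'c) coalg \<Rightarrow>
    (('e \<Rightarrow> ('e \<Rightarrow> 'k) set) \<Rightarrow> 'c) \<Rightarrow> 'e \<Rightarrow> 'x \<times> 'c set" where
  "transpose_hom M E C \<alpha> = compose (epoints E) (spectral_map M (Cc_coalg M E) C \<alpha>) (adj_unit M E)"

end

theory Submission
  imports Defs
begin

text \<open>An element of a locally unitary module over \<open>Cc M\<close> is determined by its germs, and a linear map
  out of the sections of E is the same as a locally constant family, indexed by the points of E, of elements of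
  the stalks of the target. Applied to a coalgebra C, a homomorphism from the sections of E to C becomes a
  family of elements in the stalks of C; it is grouplike at each point, so it is a sheaf morphism from E to the spectral
  sheaf, and this gives the adjunction. A stalk of the coalgebra of sections of E is free on the points of E over the base
  point, and a grouplike element has orthogonal idempotent coefficients with sum 1. These are germs of continuous
  functions in a local ring, so the grouplike elements are exactly the points of E: the unit is bijective, which is
  full faithfulness.\<close>

section \<open>Smooth functions on finite-dimensional spaces\<close>

text \<open>The ring \<open>Cc M\<close> has no unit, M need not be paracompact and E need not be
  Hausdorff, so an element of \<open>Cc_sections (total E)\<close> is a possibly discontinuous
  section of germs that is a sum of pullbacks in many ways. A formula on pullbacks therefore needs a
  proof of well-definedness: the germs of s at the points over x give finitely many coefficients,
  which fix the value of the desired linear map near x, and that a value exists is an induction over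
  sums of pullbacks. The counit, the comultiplication, the maps induced by sheaf morphisms and the
  inverse of transposition all arise in this way. Equalities are glued with finite covers of the
  compact support of a local unit. Germs in a module are compared by \<open>eq_at\<close>:
  multiplication by a function that is 1 near x makes the elements equal. Grouplikeness of a germ
  lives in a tensor product over the ring of germs and is translated back by comparing the tensor
  square of the stalk with the stalk of the tensor square; the resulting equation survives
  multiplication by a bump function, so that a grouplike germ extends to a weakly grouplike
  element.\<close>

lemma Ck_on_subset: "Ck_on k S f \<Longrightarrow> T \<subseteq> S \<Longrightarrow> Ck_on k T f"
  by (induction k arbitrary: f) (auto intro: continuous_on_subset)

text \<open>Congruence is a premise because \<open>Ck_on_cong\<close> is proved by induction through
  this rule and supplies its own induction hypothesis; \<open>Ck_on_derivI\<close> then discharges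
  the premise. It is needed since f' is the derivative only on S, while
  \<open>frechet_derivative f\<close> is a total function.\<close>

lemma Ck_on_SucI:
  fixes f :: "'a::real_normed_vector \<Rightarrow> 'b::real_normed_vector"
  assumes "open S" "\<And>x. x \<in> S \<Longrightarrow> (f has_derivative f' x) (at x)"
    and "\<And>v. Ck_on k S (\<lambda>x. f' x v)"
    and cong: "\<And>g h :: 'a \<Rightarrow> 'b. (\<And>x. x \<in> S \<Longrightarrow> g x = h x) \<Longrightarrow> Ck_on k S g \<Longrightarrow> Ck_on k S h"
  shows "Ck_on (Suc k) S f"
proof -
  have "f' x = frechet_derivative f (at x)" if "x \<in> S" for x
    using assms(2)[OF that] by (rule frechet_derivative_at)
  then show ?thesis
    using assms by (auto simp: differentiable_def intro!: cong[OF _ assms(3)])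
qed

lemma Ck_on_cong:
  assumes "open S" "\<And>x. x \<in> S \<Longrightarrow> f x = g x" "Ck_on k S f"
  shows "Ck_on k S g"
  using assms(2,3)
proof (induction k arbitrary: f g)
  case 0
  then show ?case by (simp cong: continuous_on_cong)
next
  case (Suc k)
  show ?case
  proof (rule Ck_on_SucI[OF assms(1)])
    fix x assume "x \<in> S"
    moreover from this have "(f has_derivative frechet_derivative f (at x)) (at x)"
      using Suc.prems by (simp add: frechet_derivative_works)
    ultimately show "(g has_derivative frechet_derivative f (at x)) (at x)"
      using assms(1) Suc.prems(1) has_derivative_transform_within_open by metis
  qed (use Suc in auto)
qed

lemma Ck_on_derivI:
  assumes "open S" "\<And>x. x \<in> S \<Longrightarrow> (f has_derivative f' x) (at x)"
    and "\<And>v. Ck_on k S (\<lambda>x. f' x v)"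
  shows "Ck_on (Suc k) S f"
  using assms by (rule Ck_on_SucI) (use Ck_on_cong[OF assms(1)] in blast)+

lemma Ck_on_SucD:
  assumes "Ck_on (Suc k) S f"
  shows "Ck_on k S f"
  using assms
proof (induction k arbitrary: f)
  case 0
  then show ?case
    by (auto intro!: continuous_at_imp_continuous_on differentiable_imp_continuous_within)
qed auto

text \<open>Derivatives in \<open>Ck_on\<close> are taken in the whole space and not within S, so
  all the neighbourhoods speak of the same directional derivatives and the recursion goes
  through.\<close>

lemma Ck_on_local:
  assumes "\<And>x. x \<in> S \<Longrightarrow> \<exists>N. open N \<and> x \<in> N \<and> Ck_on k N f"
  shows "Ck_on k S f"
  using assms
proof (induction k arbitrary: f)
  case 0
  then show ?case
    by (metis Ck_on.simps(1) continuous_at_imp_continuous_on continuous_on_eq_continuous_at)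
next
  case (Suc k)
  have "f differentiable at x" if "x \<in> S" for x
    using Suc.prems[OF that] by auto
  moreover have "Ck_on k S (\<lambda>x. frechet_derivative f (at x) v)" for v
    using Suc.prems by (intro Suc.IH) (metis Ck_on.simps(2))
  ultimately show ?case by simp
qed

lemma Ck_on_const: "Ck_on k S (\<lambda>x. c)"
proof (induction k arbitrary: c)
  case (Suc k)
  have "frechet_derivative (\<lambda>x. c) (at x) = (\<lambda>v. 0)" for x
    by (metis frechet_derivative_at has_derivative_const)
  then show ?case using Suc by simp
qed simp

lemma Ck_on_bounded_linear:
  assumes "bounded_linear h" "Ck_on k S f" "open S"
  shows "Ck_on k S (\<lambda>x. h (f x))"
  using assms(2)
proof (induction k arbitrary: f)
  case 0
  then show ?case using assms(1) by (auto intro: bounded_linear.continuous_on)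
next
  case (Suc k)
  show ?case
  proof (rule Ck_on_derivI[OF assms(3)])
    fix x assume "x \<in> S"
    then show "((\<lambda>x. h (f x)) has_derivative (\<lambda>v. h (frechet_derivative f (at x) v))) (at x)"
      using Suc.prems by (intro bounded_linear.has_derivative[OF assms(1)])
        (simp add: frechet_derivative_works)
  qed (use Suc in auto)
qed

lemma Ck_on_add:
  assumes "Ck_on k S f" "Ck_on k S g" "open S"
  shows "Ck_on k S (\<lambda>x. f x + g x)"
  using assms(1,2)
proof (induction k arbitrary: f g)
  case 0
  then show ?case by (auto intro: continuous_on_add)
next
  case (Suc k)
  show ?case
  proof (rule Ck_on_derivI[OF assms(3)])
    fix x assume "x \<in> S"
    then show "((\<lambda>x. f x + g x) has_derivative
        (\<lambda>v. frechet_derivative f (at x) v + frechet_derivative g (at x) v)) (at x)"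
      using Suc.prems by (intro has_derivative_add) (simp_all add: frechet_derivative_works)
  qed (use Suc in auto)
qed

lemma Ck_on_sum:
  assumes "\<And>i. i \<in> A \<Longrightarrow> Ck_on k S (f i)" "open S"
  shows "Ck_on k S (\<lambda>x. \<Sum>i\<in>A. f i x)"
  using assms(1)
  by (induction A rule: infinite_finite_induct) (auto intro: Ck_on_const Ck_on_add assms(2))

lemma Ck_on_bounded_bilinear:
  assumes "bounded_bilinear h" "Ck_on k S f" "Ck_on k S g" "open S"
  shows "Ck_on k S (\<lambda>x. h (f x) (g x))"
  using assms(2,3)
proof (induction k arbitrary: f g)
  case 0
  then show ?case using assms(1) by (auto intro: bounded_bilinear.continuous_on)
next
  case (Suc k)
  show ?case
  proof (rule Ck_on_derivI[OF assms(4)])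
    fix x assume "x \<in> S"
    then show "((\<lambda>x. h (f x) (g x)) has_derivative (\<lambda>v. h (f x) (frechet_derivative g (at x) v)
        + h (frechet_derivative f (at x) v) (g x))) (at x)"
      using Suc.prems by (intro bounded_bilinear.FDERIV[OF assms(1)])
        (simp_all add: frechet_derivative_works)
  next
    \<comment> \<open>The product rule keeps an undifferentiated factor, for which one degree of
      smoothness is given away.\<close>
    have "Ck_on k S f" "Ck_on k S g" using Suc.prems Ck_on_SucD by blast+
    then show "Ck_on k S (\<lambda>x. h (f x) (frechet_derivative g (at x) v)
        + h (frechet_derivative f (at x) v) (g x))" for v
      using Suc.prems by (intro Ck_on_add[OF _ _ assms(4)] Suc.IH) auto
  qed
qed

text \<open>An orthogonal spanning set makes the coordinates inner products, hence bounded linear. A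
  zero vector in C does no harm: its coordinate is a quotient by 0, which is 0.\<close>

lemma coordinates_exist:
  fixes B :: "'a::real_inner set"
  assumes "finite B" "span B = UNIV"
  obtains C :: "'a set" and l :: "'a \<Rightarrow> 'a \<Rightarrow> real"
  where "finite C" "\<And>c. bounded_linear (l c)" "\<And>x. x = (\<Sum>c\<in>C. l c x *\<^sub>R c)"
proof -
  obtain C where C: "finite C" "span C = (UNIV :: 'a set)" "pairwise orthogonal C"
    using basis_orthogonal[OF assms(1)] assms(2) by metis
  define l where "l c x = (c \<bullet> x) / (c \<bullet> c)" for c x :: 'a
  have lin: "bounded_linear (l c)" for c
    unfolding l_def divide_inverse
    by (intro bounded_linear_compose[OF bounded_linear_mult_left] bounded_linear_inner_right)
  have "x = (\<Sum>c\<in>C. l c x *\<^sub>R c)" for x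
  proof -
    have "x \<in> span C" using C by simp
    then show ?thesis
    proof (induction rule: span_induct_alt)
      case base
      then show ?case by (simp add: l_def)
    next
      case (step r c y)
      have "l d (r *\<^sub>R c + y) = r * l d c + l d y" for d
        by (simp add: l_def inner_simps add_divide_distrib)
      moreover have "(\<Sum>d\<in>C. l d c *\<^sub>R d) = c"
      proof -
        have "l d c *\<^sub>R d = (if d = c then c else 0)" if "d \<in> C" for d
          using C(3) that step by (auto simp: l_def pairwise_def orthogonal_def)
        then have "(\<Sum>d\<in>C. l d c *\<^sub>R d) = (\<Sum>d\<in>C. if d = c then c else 0)"
          by (intro sum.cong) auto
        then show ?thesis using step C by simp
      qed
      ultimately have "(\<Sum>d\<in>C. l d (r *\<^sub>R c + y) *\<^sub>R d) = r *\<^sub>R c + (\<Sum>d\<in>C. l d y *\<^sub>R d)"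
        by (simp add: algebra_simps sum.distrib flip: scaleR_sum_right scaleR_scaleR)
      then show ?case using step by simp
    qed
  qed
  then show ?thesis using that C(1) lin by blast
qed

text \<open>The chain rule applies the derivative of g to a direction that moves with x, whereas
  \<open>Ck_on\<close> only controls derivatives in a fixed direction. Expanding the moving
  direction in finitely many coordinates turns it into a sum of products of known functions; this is
  the use of the finite spanning set.\<close>

lemma Ck_on_compose:
  fixes f :: "'a::real_normed_vector \<Rightarrow> 'b::real_inner" and g :: "'b \<Rightarrow> 'c::real_normed_vector"
  assumes B: "finite B" "span B = (UNIV :: 'b set)"
    and S: "open S" "f ` S \<subseteq> T" and f: "Ck_on k S f" and g: "Ck_on k T g"
  shows "Ck_on k S (\<lambda>x. g (f x))"
  using f g
proof (induction k arbitrary: g)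
  case 0
  then show ?case using S by (auto intro: continuous_on_compose2)
next
  case (Suc k)
  obtain C :: "'b set" and l where C: "finite C" "\<And>c. bounded_linear (l c)"
      "\<And>x. x = (\<Sum>c\<in>C. l c x *\<^sub>R c)"
    using coordinates_exist[OF B] by metis
  show ?case
  proof (rule Ck_on_derivI[OF S(1)])
    fix x assume x: "x \<in> S"
    have f': "(f has_derivative frechet_derivative f (at x)) (at x)"
      using x Suc.prems by (simp add: frechet_derivative_works)
    have g': "(g has_derivative frechet_derivative g (at (f x))) (at (f x))"
      using x S Suc.prems by (auto simp: frechet_derivative_works)
    have "frechet_derivative g (at (f x)) (frechet_derivative f (at x) v) =
       (\<Sum>c\<in>C. l c (frechet_derivative f (at x) v) *\<^sub>R frechet_derivative g (at (f x)) c)" for v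
    proof -
      interpret bounded_linear "frechet_derivative g (at (f x))"
        using g' by (rule has_derivative_bounded_linear)
      show ?thesis
        using arg_cong[OF C(3)[of "frechet_derivative f (at x) v"], of "frechet_derivative g (at (f x))"]
        by (simp add: sum scaleR)
    qed
    then show "((\<lambda>x. g (f x)) has_derivative (\<lambda>v. \<Sum>c\<in>C. l c (frechet_derivative f (at x) v) *\<^sub>R
        frechet_derivative g (at (f x)) c)) (at x)"
      using has_derivative_compose[OF f' g'] by simp
  next
    fix v
    have fk: "Ck_on k S f" using Suc.prems Ck_on_SucD by blast
    show "Ck_on k S (\<lambda>x. \<Sum>c\<in>C. l c (frechet_derivative f (at x) v) *\<^sub>R
        frechet_derivative g (at (f x)) c)"
      using Suc.prems
      by (intro Ck_on_sum Ck_on_bounded_bilinear[OF bounded_bilinear_scaleR] S(1)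
          Ck_on_bounded_linear[OF C(2)] Suc.IH[OF fk, of "\<lambda>y. frechet_derivative g (at y) c" for c]) auto
  qed
qed

lemma smooth_on_subset: "smooth_on S f \<Longrightarrow> T \<subseteq> S \<Longrightarrow> smooth_on T f"
  by (auto simp: smooth_on_def intro: Ck_on_subset)

lemma smooth_on_cong:
  "smooth_on S f \<Longrightarrow> open S \<Longrightarrow> (\<And>x. x \<in> S \<Longrightarrow> f x = g x) \<Longrightarrow> smooth_on S g"
  unfolding smooth_on_def by (metis Ck_on_cong)

lemma smooth_on_local:
  "(\<And>x. x \<in> S \<Longrightarrow> \<exists>N. open N \<and> x \<in> N \<and> smooth_on N f) \<Longrightarrow> smooth_on S f"
  unfolding smooth_on_def by (meson Ck_on_local)

lemma smooth_on_imp_continuous_on: "smooth_on S f \<Longrightarrow> continuous_on S f"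
  unfolding smooth_on_def by (metis Ck_on.simps(1))

lemma smooth_on_const: "smooth_on S (\<lambda>x. c)"
  by (simp add: smooth_on_def Ck_on_const)

lemma smooth_on_bounded_linear:
  "bounded_linear h \<Longrightarrow> smooth_on S f \<Longrightarrow> open S \<Longrightarrow> smooth_on S (\<lambda>x. h (f x))"
  by (simp add: smooth_on_def Ck_on_bounded_linear)

lemma smooth_on_id: "open S \<Longrightarrow> smooth_on S (\<lambda>x. x)"
proof -
  assume S: "open S"
  have "Ck_on k S (\<lambda>x. x)" for k
    by (cases k) (auto intro!: Ck_on_derivI[OF S, where f' = "\<lambda>x v. v"] Ck_on_const)
  then show ?thesis by (simp add: smooth_on_def)
qed

lemma smooth_on_add:
  "smooth_on S f \<Longrightarrow> smooth_on S g \<Longrightarrow> open S \<Longrightarrow> smooth_on S (\<lambda>x. f x + g x)"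
  by (simp add: smooth_on_def Ck_on_add)

lemma smooth_on_bilinear:
  "bounded_bilinear h \<Longrightarrow> smooth_on S f \<Longrightarrow> smooth_on S g \<Longrightarrow> open S \<Longrightarrow> smooth_on S (\<lambda>x. h (f x) (g x))"
  by (simp add: smooth_on_def Ck_on_bounded_bilinear)

lemmas smooth_on_mult = smooth_on_bilinear[OF bounded_bilinear_mult]

lemma smooth_on_compose:
  fixes f :: "'a::real_normed_vector \<Rightarrow> 'b::real_inner"
  assumes "finite B" "span B = (UNIV :: 'b set)" "open S" "f ` S \<subseteq> T" "smooth_on S f" "smooth_on T g"
  shows "smooth_on S (\<lambda>x. g (f x))"
  using assms(5,6) Ck_on_compose[OF assms(1-4), where g = g] by (simp add: smooth_on_def)

lemma smooth_on_compose_real: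
  fixes f :: "'a::real_normed_vector \<Rightarrow> real"
  assumes "open S" "smooth_on S f" "smooth_on UNIV g"
  shows "smooth_on S (\<lambda>x. g (f x))"
proof -
  have "span {1 :: real} = UNIV" by (simp add: span_singleton)
  then show ?thesis using assms smooth_on_compose[of "{1}" S f UNIV g] by simp
qed

text \<open>The derivative of the inverse is a product of inverses of f and a derivative of f, so
  the case k yields the case k + 1.\<close>

lemma smooth_on_inverse:
  fixes f :: "'a::real_normed_vector \<Rightarrow> 'k::real_normed_field"
  assumes "open S" "smooth_on S f" "\<And>x. x \<in> S \<Longrightarrow> f x \<noteq> 0"
  shows "smooth_on S (\<lambda>x. inverse (f x))"
proof -
  have "Ck_on k S (\<lambda>x. inverse (f x))" for k
  proof (induction k)
    case 0
    then show ?case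
      using assms by (auto intro: continuous_on_inverse smooth_on_imp_continuous_on)
  next
    case (Suc k)
    have f: "Ck_on (Suc k) S f" using assms by (simp add: smooth_on_def)
    show ?case
    proof (rule Ck_on_derivI[OF assms(1)])
      fix x assume "x \<in> S"
      then show "((\<lambda>x. inverse (f x)) has_derivative
         (\<lambda>v. (- 1) * (inverse (f x) * frechet_derivative f (at x) v * inverse (f x)))) (at x)"
        using f assms(3) by (intro has_derivative_eq_rhs[OF Deriv.has_derivative_inverse])
          (auto simp: frechet_derivative_works)
    next
      show "Ck_on k S (\<lambda>x. (- 1) * (inverse (f x) * frechet_derivative f (at x) v * inverse (f x)))" for v
        using f Suc by (intro Ck_on_bounded_bilinear[OF bounded_bilinear_mult] assms(1) Ck_on_const) auto
    qed
  qed
  then show ?thesis by (simp add: smooth_on_def)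
qed

section \<open>Smooth bump functions and compactness of balls\<close>

text \<open>The index n makes the family closed under differentiation up to linear combinations; n =
  0 is the classical smooth function that is flat at 0.\<close>

definition flat_exp :: "nat \<Rightarrow> real \<Rightarrow> real" where
  "flat_exp n t = (if t > 0 then (1 / t) ^ n * exp (- 1 / t) else 0)"

text \<open>With s = 1 / t, the limit from the right says that the exponential of s outgrows the
  n-th power of s.\<close>

lemma flat_exp_tendsto_0: "(flat_exp n \<longlongrightarrow> 0) (at 0)"
proof -
  have "((\<lambda>t. inverse t ^ n / exp (inverse t)) \<longlongrightarrow> (0::real)) (at_right 0)"
    using filterlim_compose[OF tendsto_power_div_exp_0 filterlim_inverse_at_top_right] .
  moreover have "\<forall>\<^sub>F t in at_right 0. inverse t ^ n / exp (inverse t) = flat_exp n t"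
    by (auto simp: eventually_at_right_field flat_exp_def exp_minus field_simps intro!: exI[of _ 1])
  ultimately have "(flat_exp n \<longlongrightarrow> 0) (at_right 0)"
    using tendsto_cong by force
  moreover have "(flat_exp n \<longlongrightarrow> 0) (at_left 0)"
    by (rule Lim_transform_eventually[OF tendsto_const])
       (auto simp: eventually_at_left_field flat_exp_def intro!: exI[of _ "-1"])
  ultimately show ?thesis by (simp add: filterlim_at_split)
qed

lemma flat_exp_derivative:
  "(flat_exp n has_real_derivative (flat_exp (n + 2) t - real n * flat_exp (n + 1) t)) (at t)"
proof -
  consider "t > 0" | "t < 0" | "t = 0" by linarith
  then show ?thesis
  proof cases
    case 1
    have "((\<lambda>t. (1 / t) ^ n * exp (- 1 / t)) has_real_derivative
        (flat_exp (n + 2) t - real n * flat_exp (n + 1) t)) (at t)"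
    proof -
      have "((\<lambda>t. inverse t ^ n * exp (- inverse t)) has_real_derivative
          inverse t ^ n * (exp (- inverse t) * inverse t ^ 2)
          - (of_nat n * inverse t ^ 2 * inverse t ^ (n - 1)) * exp (- inverse t)) (at t)"
        using 1 by (auto intro!: derivative_eq_intros simp: power2_eq_square)
      moreover have "of_nat n * inverse t ^ 2 * inverse t ^ (n - 1) = of_nat n * inverse t ^ (n + 1)"
        by (cases n) (auto simp: power2_eq_square)
      ultimately have "((\<lambda>t. inverse t ^ n * exp (- inverse t)) has_real_derivative
          inverse t ^ n * (exp (- inverse t) * inverse t ^ 2)
          - (of_nat n * inverse t ^ (n + 1)) * exp (- inverse t)) (at t)" by metis
      then show ?thesis
        using 1 by (simp add: flat_exp_def inverse_eq_divide power_add mult_ac power2_eq_square)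
    qed
    then show ?thesis
      by (rule has_field_derivative_transform_within_open[where S = "{0<..}"])
         (use 1 in \<open>auto simp: flat_exp_def\<close>)
  next
    case 2
    have "((\<lambda>_. 0) has_real_derivative 0) (at t)" by simp
    then have "(flat_exp n has_real_derivative 0) (at t)"
      by (rule has_field_derivative_transform_within_open[where S = "{..<0}"])
        (use 2 in \<open>auto simp: flat_exp_def\<close>)
    then show ?thesis using 2 by (simp add: flat_exp_def)
  next
    case 3
    \<comment> \<open>The difference quotient at 0 of the function of index n is the function of
      index n + 1, whose limit is known.\<close>
    have "((\<lambda>h. (flat_exp n (0 + h) - flat_exp n 0) / h) \<longlongrightarrow> 0) (at 0)"
    proof (rule Lim_transform_eventually[OF flat_exp_tendsto_0[of "Suc n"]])
      show "\<forall>\<^sub>F h in at 0. flat_exp (Suc n) h = (flat_exp n (0 + h) - flat_exp n 0) / h"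
        by (rule eventually_at_filter[THEN iffD2]) (auto simp: flat_exp_def)
    qed
    then have "(flat_exp n has_real_derivative 0) (at 0)" by (simp only: DERIV_def)
    then show ?thesis using 3 by (simp add: flat_exp_def)
  qed
qed

lemma smooth_on_flat_exp: "smooth_on UNIV (flat_exp n)"
proof -
  have "Ck_on k UNIV (flat_exp n)" for k
  proof (induction k arbitrary: n)
    case 0
    then show ?case
      using DERIV_isCont[OF flat_exp_derivative] by (auto intro: continuous_at_imp_continuous_on)
  next
    case (Suc k)
    show ?case
    proof (rule Ck_on_derivI)
      show "(flat_exp n has_derivative (\<lambda>v. (flat_exp (n + 2) t + (- real n) * flat_exp (n + 1) t) * v)) (at t)" for t
        using flat_exp_derivative[of n t] by (simp add: has_field_derivative_def)
      show "Ck_on k UNIV (\<lambda>t. (flat_exp (n + 2) t + (- real n) * flat_exp (n + 1) t) * v)" for v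
        by (intro Ck_on_bounded_bilinear[OF bounded_bilinear_mult] Ck_on_add Ck_on_const Suc) auto
    qed auto
  qed
  then show ?thesis by (simp add: smooth_on_def)
qed

text \<open>The bump is u / (u + v) at t, the squared distance to the centre, where u vanishes
  exactly for t at least 4 r^2 and v exactly for t at most r^2. They never vanish together, so the
  denominator is positive. Squaring the norm removes its singularity at the centre.\<close>

lemma bump_function_exists:
  fixes a :: "'b::real_inner"
  assumes "r > 0"
  obtains b :: "'b \<Rightarrow> real" where "smooth_on UNIV b" "\<And>x. norm (x - a) < r \<Longrightarrow> b x = 1"
    "\<And>x. norm (x - a) \<ge> 2 * r \<Longrightarrow> b x = 0"
proof -
  define q where "q x = (x - a) \<bullet> (x - a)" for x
  define c where "c t = flat_exp 0 (4 * r\<^sup>2 - t) * inverse (flat_exp 0 (4 * r\<^sup>2 - t) + flat_exp 0 (t - r\<^sup>2))" for t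
  have lin: "smooth_on UNIV (\<lambda>x :: real. x + v)" for v
    by (intro smooth_on_add smooth_on_id smooth_on_const) auto
  have lin': "smooth_on UNIV (\<lambda>x. x - a)"
    using smooth_on_add[OF smooth_on_id smooth_on_const[of UNIV "- a"]] by simp
  have pos: "flat_exp 0 (4 * r\<^sup>2 - t) + flat_exp 0 (t - r\<^sup>2) > 0" for t
    using assms by (auto simp: flat_exp_def add_pos_pos add_pos_nonneg add_nonneg_pos)
      (smt (verit) zero_less_power)
  have neg: "smooth_on UNIV (\<lambda>t::real. 4 * r\<^sup>2 - t)"
    using smooth_on_add[OF smooth_on_const[of UNIV "4 * r\<^sup>2"]
      smooth_on_bounded_linear[OF bounded_linear_minus[OF bounded_linear_ident] smooth_on_id]] by simp
  have "smooth_on UNIV c"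
    unfolding c_def
    using pos lin[of "- (r\<^sup>2)"] neg
    by (intro smooth_on_mult smooth_on_inverse smooth_on_add smooth_on_compose_real[OF _ _ smooth_on_flat_exp])
       (auto simp: less_imp_neq[symmetric])
  moreover have "smooth_on UNIV q"
    unfolding q_def using lin'
    by (intro smooth_on_bilinear[OF bounded_bilinear_inner]) auto
  ultimately have "smooth_on UNIV (\<lambda>x. c (q x))"
    using smooth_on_compose_real[of UNIV q c] by simp
  moreover have "c (q x) = 1" if "norm (x - a) < r" for x
  proof -
    have "q x < r\<^sup>2" using that by (simp add: q_def dot_square_norm power_strict_mono)
    then have "flat_exp 0 (q x - r\<^sup>2) = 0" by (simp add: flat_exp_def)
    then show ?thesis using pos[of "q x"] by (simp add: c_def)
  qed
  moreover have "c (q x) = 0" if "norm (x - a) \<ge> 2 * r" for x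
  proof -
    have "q x \<ge> (2 * r)\<^sup>2" using that assms by (simp only: q_def dot_square_norm) (intro power_mono; simp)
    then show ?thesis by (simp add: c_def flat_exp_def power_mult_distrib)
  qed
  ultimately show ?thesis using that by blast
qed

text \<open>The model space is of class \<open>real_inner\<close> and not a Heine-Borel space by
  type. The ball is closed and lies in the set of combinations with bounded coefficients, which is a
  finite sum of compact segments.\<close>

lemma compact_cball_finite_span:
  fixes B :: "'a::real_inner set"
  assumes "finite B" "span B = UNIV"
  shows "compact (cball (a :: 'a) r)"
proof -
  obtain C :: "'a set" and l where C: "finite C" "\<And>c. bounded_linear (l c)"
      "\<And>x. x = (\<Sum>c\<in>C. l c x *\<^sub>R c)"
    using coordinates_exist[OF assms] by metis
  define K where "K m = {\<Sum>c\<in>C. t c *\<^sub>R c | t. \<forall>c\<in>C. \<bar>t c\<bar> \<le> m}" for m :: real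
  have "compact {\<Sum>c\<in>A. t c *\<^sub>R c | t. \<forall>c\<in>A. \<bar>t c\<bar> \<le> m}" if "finite A" for A :: "'a set" and m :: real
    using that
  proof (induction A)
    case empty
    then show ?case by simp
  next
    case (insert a A)
    have seg: "compact ((\<lambda>t. t *\<^sub>R a) ` {-m..m})"
      by (intro compact_continuous_image continuous_intros) auto
    have "{\<Sum>c\<in>insert a A. t c *\<^sub>R c | t. \<forall>c\<in>insert a A. \<bar>t c\<bar> \<le> m} =
        {x + y | x y. x \<in> (\<lambda>t. t *\<^sub>R a) ` {-m..m} \<and> y \<in> {\<Sum>c\<in>A. t c *\<^sub>R c | t. \<forall>c\<in>A. \<bar>t c\<bar> \<le> m}}"
      (is "?L = ?R")
    proof
      show "?L \<subseteq> ?R"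
        using insert by (fastforce simp: abs_le_iff)
    next
      show "?R \<subseteq> ?L"
      proof clarify
        fix s t assume *: "s \<in> {- m..m}" "\<forall>c\<in>A. \<bar>t c\<bar> \<le> m"
        show "\<exists>u. s *\<^sub>R a + (\<Sum>c\<in>A. t c *\<^sub>R c) = (\<Sum>c\<in>insert a A. u c *\<^sub>R c) \<and> (\<forall>c\<in>insert a A. \<bar>u c\<bar> \<le> m)"
          using * insert by (intro exI[of _ "t(a := s)"]) (auto simp: abs_le_iff intro!: sum.cong)
      qed
    qed
    then show ?case using compact_sums[OF seg insert.IH] by simp
  qed
  then have K: "compact (K m)" for m using C by (simp add: K_def)
  have "\<forall>c. \<exists>k. \<forall>x. \<bar>l c x\<bar> \<le> norm x * k"
    using C(2) bounded_linear.bounded by (metis real_norm_def)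
  then obtain k where k: "\<And>c x. \<bar>l c x\<bar> \<le> norm x * k c" by metis
  \<comment> \<open>A common bound for the coordinates on the ball: the one along c is at most the
    norm times \<open>k c\<close>, and the sum over C dominates each of its nonnegative
    terms.\<close>
  define m where "m = (\<Sum>c\<in>C. \<bar>k c\<bar> * (norm a + \<bar>r\<bar>))"
  have "cball a r \<subseteq> K m"
  proof
    fix x assume "x \<in> cball a r"
    then have x: "norm x \<le> norm a + \<bar>r\<bar>"
      using norm_triangle_ineq2[of x a] by (simp add: dist_norm norm_minus_commute)
    have "\<bar>l c x\<bar> \<le> m" if "c \<in> C" for c
    proof -
      have "\<bar>l c x\<bar> \<le> norm x * \<bar>k c\<bar>"
        using k[of c x] by (smt (verit) mult_left_mono norm_ge_zero)
      also have "\<dots> \<le> \<bar>k c\<bar> * (norm a + \<bar>r\<bar>)"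
        using x by (metis abs_ge_zero mult.commute mult_right_mono)
      also have "\<dots> \<le> m"
        unfolding m_def using that C(1) by (intro member_le_sum) auto
      finally show ?thesis .
    qed
    then show "x \<in> K m" unfolding K_def mem_Collect_eq using C(3)[of x] by (intro exI[of _ "\<lambda>c. l c x"]) auto
  qed
  then show ?thesis
    using compact_Int_closed[OF K closed_cball] by (metis inf.absorb_iff2)
qed

section \<open>Manifolds\<close>

lemma points_open_sub [simp]: "points (open_sub X W) = points X \<inter> W"
  and mtop_open_sub: "mtop (open_sub X W) = subtopology (mtop X) W"
  and atlas_open_sub: "atlas (open_sub X W) = (\<lambda>(U, \<phi>). (U \<inter> W, \<phi>)) ` atlas X"
  by (simp_all add: open_sub_def)

lemma openin_open_sub_iff:
  "openin (mtop X) W \<Longrightarrow> openin (mtop (open_sub X W)) V \<longleftrightarrow> openin (mtop X) V \<and> V \<subseteq> W"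
  by (simp add: mtop_open_sub openin_open_subtopology)

lemma open_sub_open_sub: "open_sub (open_sub X W) V = open_sub X (W \<inter> V)"
  by (auto simp: open_sub_def subtopology_subtopology image_image case_prod_beta Int_assoc intro!: image_cong)

lemma
  assumes "manifold X" "(U, \<phi>) \<in> atlas X"
  shows chart_openin: "openin (mtop X) U"
    and chart_subset: "U \<subseteq> points X"
    and chart_inj: "inj_on \<phi> U"
    and chart_homeomorphic: "homeomorphic_map (subtopology (mtop X) U) (top_of_set (\<phi> ` U)) \<phi>"
    and chart_image: "openin (mtop X) W \<Longrightarrow> open (\<phi> ` (U \<inter> W))"
    and chart_preimage: "open N \<Longrightarrow> openin (mtop X) {x \<in> U. \<phi> x \<in> N}"
proof -
  have *: "openin (mtop X) U" "open (\<phi> ` U)"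
      "homeomorphic_map (subtopology (mtop X) U) (top_of_set (\<phi> ` U)) \<phi>"
    using assms unfolding manifold_def by blast+
  then show "openin (mtop X) U" "homeomorphic_map (subtopology (mtop X) U) (top_of_set (\<phi> ` U)) \<phi>"
    by simp_all
  show U: "U \<subseteq> points X" using * openin_subset by blast
  show "inj_on \<phi> U"
    using homeomorphic_imp_injective_map[OF *(3)] U by (simp add: inf.absorb2)
  show "open (\<phi> ` (U \<inter> W))" if "openin (mtop X) W"
  proof -
    have "openin (subtopology (mtop X) U) (U \<inter> W)"
      using that * by (simp add: openin_open_subtopology openin_Int)
    then have "openin (top_of_set (\<phi> ` U)) (\<phi> ` (U \<inter> W))"
      using homeomorphic_imp_open_map[OF *(3)] by (simp add: open_map_def)
    then show ?thesis using *(2) by (simp add: openin_open_eq)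
  qed
  show "openin (mtop X) {x \<in> U. \<phi> x \<in> N}" if "open N"
  proof -
    have "openin (top_of_set (\<phi> ` U)) (\<phi> ` U \<inter> N)"
      using that by (simp add: openin_open_Int)
    then have "openin (subtopology (mtop X) U) {x \<in> topspace (subtopology (mtop X) U). \<phi> x \<in> \<phi> ` U \<inter> N}"
      using homeomorphic_imp_continuous_map[OF *(3)] openin_continuous_map_preimage by blast
    moreover have "{x \<in> topspace (subtopology (mtop X) U). \<phi> x \<in> \<phi> ` U \<inter> N} = {x \<in> U. \<phi> x \<in> N}"
      using U by auto
    ultimately show ?thesis using * by (simp add: openin_open_subtopology)
  qed
qed

lemma chart_exists:
  assumes "manifold X" "x \<in> points X"
  obtains U \<phi> where "(U, \<phi>) \<in> atlas X" "x \<in> U"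
proof -
  have "x \<in> (\<Union>(U, \<phi>)\<in>atlas X. U)" using assms by (simp add: manifold_def)
  then show ?thesis using that by auto
qed

lemma manifold_finite_span:
  fixes X :: "('a, 'b::real_inner) mfd"
  assumes "manifold X"
  obtains B :: "'b set" where "finite B" "span B = UNIV"
proof -
  have "\<exists>B::'b set. finite B \<and> span B = UNIV" using assms by (simp add: manifold_def)
  then show ?thesis using that by blast
qed

text \<open>Charts of \<open>open_sub\<close> have smaller domains, and \<open>inv_into\<close>
  depends on the domain. On the image of the smaller set the two inverses agree, so smoothness on W
  can be tested in the original charts.\<close>

lemma smooth_fun_open_sub_iff:
  assumes X: "manifold X" and W: "openin (mtop X) W"
  shows "smooth_fun (open_sub X W) f \<longleftrightarrow>
    (\<forall>(U, \<phi>)\<in>atlas X. smooth_on (\<phi> ` (U \<inter> W)) (f \<circ> inv_into U \<phi>))"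
proof -
  have "smooth_on (\<phi> ` (U \<inter> W)) (f \<circ> inv_into (U \<inter> W) \<phi>) \<longleftrightarrow> smooth_on (\<phi> ` (U \<inter> W)) (f \<circ> inv_into U \<phi>)"
    if c: "(U, \<phi>) \<in> atlas X" for U \<phi>
  proof -
    have "inv_into (U \<inter> W) \<phi> y = inv_into U \<phi> y" if "y \<in> \<phi> ` (U \<inter> W)" for y
      using that chart_inj[OF X c] by (auto simp: inv_into_f_f inj_on_Int)
    then show ?thesis
      using chart_image[OF X c W] by (auto elim!: smooth_on_cong)
  qed
  then show ?thesis
    by (fastforce simp: smooth_fun_def atlas_open_sub)
qed

lemma smooth_fun_open_sub_points:
  assumes "manifold X" shows "smooth_fun (open_sub X (points X)) f \<longleftrightarrow> smooth_fun X f"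
proof -
  have "U \<inter> points X = U" if "(U, \<phi>) \<in> atlas X" for U \<phi>
    using chart_subset[OF assms that] by auto
  then show ?thesis
    using assms by (simp add: smooth_fun_open_sub_iff) (fastforce simp: smooth_fun_def)
qed

lemma smooth_fun_mono:
  assumes X: "manifold X" and W: "openin (mtop X) W" "openin (mtop X) V" "V \<subseteq> W"
    and f: "smooth_fun (open_sub X W) f"
  shows "smooth_fun (open_sub X V) f"
  unfolding smooth_fun_open_sub_iff[OF X W(2)]
proof clarify
  fix U \<phi> assume "(U, \<phi>) \<in> atlas X"
  then have "smooth_on (\<phi> ` (U \<inter> W)) (f \<circ> inv_into U \<phi>)"
    using f unfolding smooth_fun_open_sub_iff[OF X W(1)] by blast
  then show "smooth_on (\<phi> ` (U \<inter> V)) (f \<circ> inv_into U \<phi>)"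
    by (rule smooth_on_subset) (use W(3) in blast)
qed

text \<open>The smooth representative g may change from point to point. This is how extensions by
  zero are shown to be smooth, with g = 0 off the support.\<close>

lemma smooth_fun_local:
  assumes X: "manifold X" and W: "openin (mtop X) W"
    and loc: "\<And>x. x \<in> W \<Longrightarrow> \<exists>V g. openin (mtop X) V \<and> x \<in> V \<and> smooth_fun (open_sub X V) g
        \<and> (\<forall>y\<in>V \<inter> W. f y = g y)"
  shows "smooth_fun (open_sub X W) f"
  unfolding smooth_fun_open_sub_iff[OF X W]
proof (clarify, rule smooth_on_local)
  fix U \<phi> y assume c: "(U, \<phi>) \<in> atlas X" and "y \<in> \<phi> ` (U \<inter> W)"
  then obtain x where x: "x \<in> U" "x \<in> W" "y = \<phi> x" by auto
  then obtain V g where V: "openin (mtop X) V" "x \<in> V" "smooth_fun (open_sub X V) g" "\<forall>y\<in>V \<inter> W. f y = g y"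
    using loc by meson
  let ?N = "\<phi> ` (U \<inter> (V \<inter> W))"
  have N: "open ?N" using V W by (intro chart_image[OF X c]) auto
  have "smooth_on (\<phi> ` (U \<inter> V)) (g \<circ> inv_into U \<phi>)"
    using V c X by (auto simp: smooth_fun_open_sub_iff)
  then have "smooth_on ?N (g \<circ> inv_into U \<phi>)" by (rule smooth_on_subset) auto
  moreover have "(g \<circ> inv_into U \<phi>) z = (f \<circ> inv_into U \<phi>) z" if "z \<in> ?N" for z
    using that V(4) chart_inj[OF X c] by (auto simp: inv_into_f_f)
  ultimately have "smooth_on ?N (f \<circ> inv_into U \<phi>)" using N smooth_on_cong by blast
  then show "\<exists>N. open N \<and> y \<in> N \<and> smooth_on N (f \<circ> inv_into U \<phi>)"
    using N x V by (intro exI[of _ ?N]) auto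
qed

lemma smooth_fun_cong:
  assumes "manifold X" "openin (mtop X) W" "smooth_fun (open_sub X W) g" "\<And>y. y \<in> W \<Longrightarrow> f y = g y"
  shows "smooth_fun (open_sub X W) f"
  using assms by (intro smooth_fun_local) auto

lemma smooth_fun_const: "smooth_fun X (\<lambda>_. c)"
  by (auto simp: smooth_fun_def o_def smooth_on_const)

lemma smooth_fun_bilinear:
  assumes h: "bounded_bilinear h" and X: "manifold X" "openin (mtop X) W"
    and f: "smooth_fun (open_sub X W) f" "smooth_fun (open_sub X W) g"
  shows "smooth_fun (open_sub X W) (\<lambda>x. h (f x) (g x))"
  unfolding smooth_fun_open_sub_iff[OF X]
proof clarify
  fix U \<phi> assume c: "(U, \<phi>) \<in> atlas X"
  then have "smooth_on (\<phi> ` (U \<inter> W)) (\<lambda>y. h (f (inv_into U \<phi> y)) (g (inv_into U \<phi> y)))"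
    using f chart_image[OF X(1) c X(2)] unfolding smooth_fun_open_sub_iff[OF X]
    by (intro smooth_on_bilinear[OF h]) (auto simp: o_def)
  then show "smooth_on (\<phi> ` (U \<inter> W)) ((\<lambda>x. h (f x) (g x)) \<circ> inv_into U \<phi>)"
    by (simp add: o_def)
qed

lemma smooth_fun_add:
  assumes X: "manifold X" "openin (mtop X) W"
    and f: "smooth_fun (open_sub X W) f" "smooth_fun (open_sub X W) g"
  shows "smooth_fun (open_sub X W) (\<lambda>x. f x + g x)"
  unfolding smooth_fun_open_sub_iff[OF X]
proof clarify
  fix U \<phi> assume c: "(U, \<phi>) \<in> atlas X"
  then have "smooth_on (\<phi> ` (U \<inter> W)) (\<lambda>y. f (inv_into U \<phi> y) + g (inv_into U \<phi> y))"
    using f chart_image[OF X(1) c X(2)] unfolding smooth_fun_open_sub_iff[OF X]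
    by (intro smooth_on_add) (auto simp: o_def)
  then show "smooth_on (\<phi> ` (U \<inter> W)) ((\<lambda>x. f x + g x) \<circ> inv_into U \<phi>)"
    by (simp add: o_def)
qed

lemmas smooth_fun_mult = smooth_fun_bilinear[OF bounded_bilinear_mult]

lemma smooth_fun_compose:
  fixes h :: "'a \<Rightarrow> 'c::real_inner"
  assumes B: "finite B" "span B = (UNIV :: 'c set)" and X: "manifold X" "openin (mtop X) W"
    and h: "smooth_fun (open_sub X W) h" "h ` W \<subseteq> T" and G: "smooth_on T G"
  shows "smooth_fun (open_sub X W) (\<lambda>x. G (h x))"
  unfolding smooth_fun_open_sub_iff[OF X]
proof clarify
  fix U \<phi> assume c: "(U, \<phi>) \<in> atlas X"
  have "smooth_on (\<phi> ` (U \<inter> W)) (\<lambda>y. G (h (inv_into U \<phi> y)))"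
  proof (rule smooth_on_compose[OF B])
    show "(\<lambda>y. h (inv_into U \<phi> y)) ` \<phi> ` (U \<inter> W) \<subseteq> T"
      using h(2) chart_inj[OF X(1) c] by (auto simp: inv_into_f_f)
    show "smooth_on (\<phi> ` (U \<inter> W)) (\<lambda>y. h (inv_into U \<phi> y))"
      using h(1) c unfolding smooth_fun_open_sub_iff[OF X] by (auto simp: o_def)
  qed (use G chart_image[OF X(1) c X(2)] in auto)
  then show "smooth_on (\<phi> ` (U \<inter> W)) ((\<lambda>x. G (h x)) \<circ> inv_into U \<phi>)"
    by (simp add: o_def)
qed

text \<open>Compatibility of the atlas, read as smoothness of a vector-valued function on the chart
  domain. Restriction, locality and composition of smooth functions then apply to transition maps as
  well.\<close>

lemma smooth_fun_chart:
  assumes X: "manifold X" and c: "(U, \<phi>) \<in> atlas X"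
  shows "smooth_fun (open_sub X U) \<phi>"
proof -
  have "smooth_on (\<psi> ` (V \<inter> U)) (\<phi> \<circ> inv_into V \<psi>)" if "(V, \<psi>) \<in> atlas X" for V \<psi>
  proof -
    have "\<forall>(U, \<phi>)\<in>atlas X. \<forall>(V, \<psi>)\<in>atlas X. smooth_on (\<phi> ` (U \<inter> V)) (\<psi> \<circ> inv_into U \<phi>)"
      using X by (simp add: manifold_def)
    then show ?thesis using c that by fastforce
  qed
  then show ?thesis using chart_openin[OF X c] by (auto simp: smooth_fun_open_sub_iff[OF X])
qed

lemma manifold_open_sub:
  fixes X :: "('a, 'b::real_inner) mfd"
  assumes X: "manifold X" and W: "openin (mtop X) W"
  shows "manifold (open_sub X W)"
  unfolding manifold_def
proof (intro conjI)
  show "\<exists>B::'b set. finite B \<and> span B = UNIV" using X by (simp add: manifold_def)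
  show "\<forall>(U, \<phi>)\<in>atlas (open_sub X W). openin (mtop (open_sub X W)) U \<and> open (\<phi> ` U) \<and>
        homeomorphic_map (subtopology (mtop (open_sub X W)) U) (top_of_set (\<phi> ` U)) \<phi>"
  proof clarify
    fix U' \<phi> assume "(U', \<phi>) \<in> atlas (open_sub X W)"
    then obtain U where c: "(U, \<phi>) \<in> atlas X" and U': "U' = U \<inter> W"
      by (auto simp: atlas_open_sub)
    have "homeomorphic_map (subtopology (subtopology (mtop X) U) (U \<inter> W))
        (subtopology (top_of_set (\<phi> ` U)) (\<phi> ` (U \<inter> W))) \<phi>"
      using chart_subset[OF X c] chart_inj[OF X c]
      by (intro homeomorphic_map_subtopologies[OF chart_homeomorphic[OF X c]]) (auto simp: inj_on_def)
    then have "homeomorphic_map (subtopology (mtop X) (W \<inter> (U \<inter> W))) (top_of_set (\<phi> ` (U \<inter> W))) \<phi>"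
      by (simp add: subtopology_subtopology Int_ac inf.absorb2 image_mono)
    then show "openin (mtop (open_sub X W)) U' \<and> open (\<phi> ` U') \<and>
        homeomorphic_map (subtopology (mtop (open_sub X W)) U') (top_of_set (\<phi> ` U')) \<phi>"
      using chart_openin[OF X c] chart_image[OF X c W] W
      unfolding U' openin_open_sub_iff[OF W] by (simp add: mtop_open_sub subtopology_subtopology openin_Int)
  qed
  show "(\<Union>(U, \<phi>)\<in>atlas (open_sub X W). U) = points (open_sub X W)"
  proof -
    have "(\<Union>(U, \<phi>)\<in>atlas X. U) = points X" using X by (simp add: manifold_def)
    moreover have "(\<Union>(U, \<phi>)\<in>atlas (open_sub X W). U) = (\<Union>(U, \<phi>)\<in>atlas X. U) \<inter> W"
      by (auto simp: atlas_open_sub)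
    ultimately show ?thesis by simp
  qed
  show "\<forall>(U, \<phi>)\<in>atlas (open_sub X W). \<forall>(V, \<psi>)\<in>atlas (open_sub X W).
      smooth_on (\<phi> ` (U \<inter> V)) (\<psi> \<circ> inv_into U \<phi>)"
  proof clarify
    fix U' \<phi> V' \<psi> assume "(U', \<phi>) \<in> atlas (open_sub X W)" "(V', \<psi>) \<in> atlas (open_sub X W)"
    then obtain U V where c: "(U, \<phi>) \<in> atlas X" "(V, \<psi>) \<in> atlas X" and U': "U' = U \<inter> W" "V' = V \<inter> W"
      by (auto simp: atlas_open_sub)
    have VW: "openin (mtop X) (V \<inter> W)" using chart_openin[OF X c(2)] W by blast
    \<comment> \<open>A transition map of the restricted atlas is the coordinate expression of
      \<psi> as a smooth function on the overlap; what remains is to exchange the inverse of \<phi>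
      for the one on the other domain.\<close>
    have "smooth_fun (open_sub X (V \<inter> W)) \<psi>"
      using smooth_fun_mono[OF X chart_openin[OF X c(2)] VW _ smooth_fun_chart[OF X c(2)]] by blast
    then have "smooth_fun (open_sub (open_sub X W) (V \<inter> W)) \<psi>"
      by (simp add: open_sub_open_sub Int_ac)
    then have "smooth_on (\<phi> ` (U \<inter> W \<inter> (V \<inter> W))) (\<psi> \<circ> inv_into (U \<inter> W \<inter> (V \<inter> W)) \<phi>)"
      using c by (force simp: smooth_fun_def atlas_open_sub)
    then show "smooth_on (\<phi> ` (U' \<inter> V')) (\<psi> \<circ> inv_into U' \<phi>)"
      unfolding U'
    proof (rule smooth_on_cong)
      show "open (\<phi> ` (U \<inter> W \<inter> (V \<inter> W)))"
        using chart_image[OF X c(1), of "W \<inter> (V \<inter> W)"] VW W by (simp add: Int_assoc openin_Int)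
      show "(\<psi> \<circ> inv_into (U \<inter> W \<inter> (V \<inter> W)) \<phi>) y = (\<psi> \<circ> inv_into (U \<inter> W) \<phi>) y"
        if "y \<in> \<phi> ` (U \<inter> W \<inter> (V \<inter> W))" for y
      proof -
        obtain x where x: "x \<in> U \<inter> W \<inter> (V \<inter> W)" "y = \<phi> x" using \<open>y \<in> _\<close> by blast
        have "inj_on \<phi> (U \<inter> W)" "inj_on \<phi> (U \<inter> W \<inter> (V \<inter> W))"
          using chart_inj[OF X c(1)] by (auto simp: inj_on_def)
        then show ?thesis using x by (simp add: inv_into_f_f)
      qed
    qed
  qed
qed

lemma smooth_mapI:
  assumes X: "manifold X" and Y: "manifold Y" and h: "continuous_map (mtop X) (mtop Y) h"
    and s: "\<And>V \<psi>. (V, \<psi>) \<in> atlas Y \<Longrightarrow> smooth_fun (open_sub X (points X \<inter> h -` V)) (\<psi> \<circ> h)"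
  shows "smooth_map X Y h"
  unfolding smooth_map_def
proof (intro conjI h, clarify)
  fix U \<phi> V \<psi> assume c: "(U, \<phi>) \<in> atlas X" "(V, \<psi>) \<in> atlas Y"
  have "openin (mtop X) (points X \<inter> h -` V)"
    using h chart_openin[OF Y c(2)] by (auto simp: continuous_map_def vimage_def Int_def)
  then have "smooth_on (\<phi> ` (U \<inter> (points X \<inter> h -` V))) ((\<psi> \<circ> h) \<circ> inv_into U \<phi>)"
    using s[OF c(2)] c(1) by (auto simp: smooth_fun_open_sub_iff[OF X])
  moreover have "U \<inter> (points X \<inter> h -` V) = U \<inter> h -` V" using chart_subset[OF X c(1)] by auto
  ultimately show "smooth_on (\<phi> ` (U \<inter> h -` V)) (\<psi> \<circ> h \<circ> inv_into U \<phi>)" by simp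
qed

lemma openin_map_vimage:
  "continuous_map T T' h \<Longrightarrow> openin T' V \<Longrightarrow> openin T (topspace T \<inter> h -` V)"
  by (auto simp: continuous_map_def vimage_def Int_def)

text \<open>Near x the composite factors through a chart around h x: it is the coordinate expression
  of g after the smooth vector-valued function \<psi> \<circ> h. The chain rule uses that the model
  space has a finite spanning set.\<close>

lemma smooth_map_compose_fun:
  assumes X: "manifold X" and Y: "manifold Y" and h: "smooth_map X Y h"
    and W: "openin (mtop Y) W" and g: "smooth_fun (open_sub Y W) g"
  shows "smooth_fun (open_sub X (points X \<inter> h -` W)) (g \<circ> h)"
proof (rule smooth_fun_local[OF X])
  have cont: "continuous_map (mtop X) (mtop Y) h" using h by (simp add: smooth_map_def)
  show "openin (mtop X) (points X \<inter> h -` W)" using cont W by (rule openin_map_vimage)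
  fix x assume x: "x \<in> points X \<inter> h -` W"
  then have "h x \<in> points Y" using W openin_subset by blast
  then obtain V \<psi> where c: "(V, \<psi>) \<in> atlas Y" "h x \<in> V" using chart_exists[OF Y] by blast
  let ?N = "points X \<inter> h -` (V \<inter> W)" and ?P = "points X \<inter> h -` V"
  have N: "openin (mtop X) ?N" "openin (mtop X) ?P"
    using openin_map_vimage[OF cont, of "V \<inter> W"] openin_map_vimage[OF cont, of V] chart_openin[OF Y c(1)] W
    by (simp_all add: openin_Int)
  have "smooth_on (\<phi> ` (U \<inter> ?P)) ((\<psi> \<circ> h) \<circ> inv_into U \<phi>)" if c': "(U, \<phi>) \<in> atlas X" for U \<phi>
  proof -
    have "U \<inter> ?P = U \<inter> h -` V" using chart_subset[OF X c'] by auto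
    then show ?thesis using h c c' by (auto simp: smooth_map_def)
  qed
  then have "smooth_fun (open_sub X ?P) (\<psi> \<circ> h)"
    by (auto simp: smooth_fun_open_sub_iff[OF X N(2)])
  then have "smooth_fun (open_sub X ?N) (\<psi> \<circ> h)"
    by (rule smooth_fun_mono[OF X N(2,1), rotated]) auto
  moreover have "(\<psi> \<circ> h) ` ?N \<subseteq> \<psi> ` (V \<inter> W)" by auto
  moreover have "smooth_on (\<psi> ` (V \<inter> W)) (g \<circ> inv_into V \<psi>)"
    using g c by (auto simp: smooth_fun_open_sub_iff[OF Y W])
  ultimately have "smooth_fun (open_sub X ?N) (\<lambda>x. (g \<circ> inv_into V \<psi>) ((\<psi> \<circ> h) x))"
    using manifold_finite_span[OF Y] smooth_fun_compose[OF _ _ X N(1)] by metis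
  moreover have "(g \<circ> h) y = (g \<circ> inv_into V \<psi>) ((\<psi> \<circ> h) y)" if "y \<in> ?N" for y
    using that chart_inj[OF Y c(1)] by (auto simp: inv_into_f_f)
  ultimately show "\<exists>V g'. openin (mtop X) V \<and> x \<in> V \<and> smooth_fun (open_sub X V) g' \<and>
      (\<forall>y\<in>V \<inter> (points X \<inter> h -` W). (g \<circ> h) y = g' y)"
    using N(1) x c by (intro exI[of _ ?N] exI[of _ "\<lambda>x. (g \<circ> inv_into V \<psi>) ((\<psi> \<circ> h) x)"]) auto
qed

section \<open>Germs and compactly supported functions\<close>

text \<open>A filter rather than an explicit neighbourhood, so that finitely many germ conditions
  combine by \<open>eventually_elim\<close>. At a point outside the space the filter is trivial and
  every predicate holds near it, hence the recurring hypothesis that x belongs to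
  \<open>points M\<close>.\<close>

abbreviation near :: "('a, 'b) mfd \<Rightarrow> 'a \<Rightarrow> ('a \<Rightarrow> bool) \<Rightarrow> bool" where
  "near X x P \<equiv> eventually P (nhdsin (mtop X) x)"

lemma near_iff: "x \<in> points X \<Longrightarrow> near X x P \<longleftrightarrow> (\<exists>W. openin (mtop X) W \<and> x \<in> W \<and> (\<forall>y\<in>W. P y))"
  by (simp add: eventually_nhdsin)

lemma nearI: "openin (mtop X) W \<Longrightarrow> x \<in> W \<Longrightarrow> (\<And>y. y \<in> W \<Longrightarrow> P y) \<Longrightarrow> near X x P"
  by (metis eventually_nhdsin)

lemma near_imp_at: "near X x P \<Longrightarrow> x \<in> points X \<Longrightarrow> P x"
  by (auto simp: near_iff)

lemma mem_germ_iff: "x \<in> points X \<Longrightarrow> g \<in> germ X x f \<longleftrightarrow> near X x (\<lambda>y. g y = f y)"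
  by (simp add: germ_def near_iff)

lemma germ_eq_iff:
  assumes "x \<in> points X"
  shows "germ X x f = germ X x g \<longleftrightarrow> near X x (\<lambda>y. f y = g y)"
proof
  assume "germ X x f = germ X x g"
  moreover have "f \<in> germ X x f" using assms by (simp add: mem_germ_iff)
  ultimately show "near X x (\<lambda>y. f y = g y)" using assms by (simp add: mem_germ_iff)
next
  assume *: "near X x (\<lambda>y. f y = g y)"
  have "near X x (\<lambda>y. h y = f y) \<longleftrightarrow> near X x (\<lambda>y. h y = g y)" for h
  proof
    show "near X x (\<lambda>y. h y = g y)" if "near X x (\<lambda>y. h y = f y)"
      using that * by eventually_elim simp
    show "near X x (\<lambda>y. h y = f y)" if "near X x (\<lambda>y. h y = g y)"
      using that * by eventually_elim simp
  qed
  then show "germ X x f = germ X x g" using assms by (auto simp: mem_germ_iff)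
qed

text \<open>In a Hausdorff space a compact set K that contains the nonzero points is closed, so the
  closure of these points is a closed part of K.\<close>

lemma Cc_iff:
  assumes "manifold X" "Hausdorff_space (mtop X)"
  shows "f \<in> Cc X \<longleftrightarrow> smooth_fun X f \<and> (\<exists>K. compactin (mtop X) K \<and> {x. f x \<noteq> 0} \<subseteq> K)"
proof safe
  assume f: "f \<in> Cc X"
  then show "smooth_fun X f" by (simp add: Cc_def)
  have "{x. f x \<noteq> 0} \<subseteq> mtop X closure_of {x. f x \<noteq> 0}"
    using f by (intro closure_of_subset) (auto simp: Cc_def)
  then show "\<exists>K. compactin (mtop X) K \<and> {x. f x \<noteq> 0} \<subseteq> K" using f by (auto simp: Cc_def)
next
  fix K assume *: "smooth_fun X f" "compactin (mtop X) K" "{x. f x \<noteq> 0} \<subseteq> K"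
  have "closedin (mtop X) K" using * assms compactin_imp_closedin by blast
  then have "mtop X closure_of {x. f x \<noteq> 0} \<subseteq> K" using *(3) by (simp add: closure_of_minimal)
  then have "compactin (mtop X) (mtop X closure_of {x. f x \<noteq> 0})"
    using closed_compactin[OF *(2)] by simp
  moreover have "f x = 0" if "x \<notin> points X" for x
    using *(2,3) that by (auto dest: compactin_subset_topspace)
  ultimately show "f \<in> Cc X" using * by (simp add: Cc_def)
qed

section \<open>Compactly supported functions on a Hausdorff manifold\<close>

locale hausdorff_manifold =
  fixes M :: "('x, 'b::real_inner) mfd"
  assumes manifold: "manifold M" and hausdorff: "Hausdorff_space (mtop M)"
begin

text \<open>A compact part K of W is closed in M, so a function supported in K is smooth on all of
  M, being 0 on the open complement of K. Smoothness and support can then be treated separately, and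
  all these function spaces become subsets of \<open>Cc M\<close>.\<close>

lemma Cc_open_sub_iff:
  fixes f :: "'x \<Rightarrow> 'k::real_normed_field"
  assumes W: "openin (mtop M) W"
  shows "f \<in> Cc (open_sub M W) \<longleftrightarrow>
    smooth_fun M f \<and> (\<exists>K. compactin (mtop M) K \<and> K \<subseteq> W \<and> {x. f x \<noteq> 0} \<subseteq> K)"
proof -
  have h: "Hausdorff_space (mtop (open_sub M W))"
    by (simp add: mtop_open_sub hausdorff Hausdorff_space_subtopology)
  have "smooth_fun (open_sub M W) f \<longleftrightarrow> smooth_fun M f"
    if K: "compactin (mtop M) K" "K \<subseteq> W" "{x. f x \<noteq> 0} \<subseteq> K" for K
  proof
    assume f: "smooth_fun (open_sub M W) f"
    have "smooth_fun (open_sub M (points M)) f"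
    proof (rule smooth_fun_local[OF manifold])
      fix x assume x: "x \<in> points M"
      show "\<exists>V g. openin (mtop M) V \<and> x \<in> V \<and> smooth_fun (open_sub M V) g \<and> (\<forall>y\<in>V \<inter> points M. f y = g y)"
      proof (cases "x \<in> W")
        case True
        then show ?thesis using f W by blast
      next
        case False
        have "openin (mtop M) (points M - K)"
          using compactin_imp_closedin[OF hausdorff K(1)] by blast
        then show ?thesis
          using K x False by (intro exI[of _ "points M - K"] exI[of _ "\<lambda>_. 0"]) (auto intro: smooth_fun_const)
      qed
    qed simp
    then show "smooth_fun M f" by (simp add: smooth_fun_open_sub_points[OF manifold])
  next
    assume "smooth_fun M f"
    then show "smooth_fun (open_sub M W) f"
      using smooth_fun_mono[OF manifold _ W] openin_subset[OF W]
      by (metis openin_topspace smooth_fun_open_sub_points[OF manifold])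
  qed
  then show ?thesis
    unfolding Cc_iff[OF manifold_open_sub[OF manifold W] h]
    by (auto simp: mtop_open_sub compactin_subtopology)
qed

lemma Cc_M_iff: "f \<in> Cc M \<longleftrightarrow> smooth_fun M f \<and> (\<exists>K. compactin (mtop M) K \<and> {x. f x \<noteq> 0} \<subseteq> K)"
  by (rule Cc_iff[OF manifold hausdorff])

lemma Cc_open_sub_mono:
  "openin (mtop M) W \<Longrightarrow> openin (mtop M) V \<Longrightarrow> W \<subseteq> V \<Longrightarrow> f \<in> Cc (open_sub M W) \<Longrightarrow> f \<in> Cc (open_sub M V)"
  by (auto simp: Cc_open_sub_iff)

lemma Cc_open_sub_subset: "openin (mtop M) W \<Longrightarrow> f \<in> Cc (open_sub M W) \<Longrightarrow> f \<in> Cc M"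
  by (auto simp: Cc_open_sub_iff Cc_M_iff)

lemma smooth_fun_M_add: "smooth_fun M f \<Longrightarrow> smooth_fun M g \<Longrightarrow> smooth_fun M (\<lambda>x. f x + g x)"
  using smooth_fun_add[OF manifold openin_topspace] by (simp add: smooth_fun_open_sub_points[OF manifold])

lemma smooth_fun_M_mult:
  fixes f g :: "'x \<Rightarrow> 'k::real_normed_field"
  shows "smooth_fun M f \<Longrightarrow> smooth_fun M g \<Longrightarrow> smooth_fun M (\<lambda>x. f x * g x)"
  using smooth_fun_mult[OF manifold openin_topspace] by (simp add: smooth_fun_open_sub_points[OF manifold])

lemma Cc_open_sub_add:
  fixes f g :: "'x \<Rightarrow> 'k::real_normed_field"
  assumes "openin (mtop M) W" "f \<in> Cc (open_sub M W)" "g \<in> Cc (open_sub M W)"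
  shows "f + g \<in> Cc (open_sub M W)"
proof -
  obtain K L where "compactin (mtop M) K" "K \<subseteq> W" "{x. f x \<noteq> 0} \<subseteq> K"
      "compactin (mtop M) L" "L \<subseteq> W" "{x. g x \<noteq> 0} \<subseteq> L"
    using assms by (auto simp: Cc_open_sub_iff)
  moreover from this have "x \<in> K \<union> L" if "(f + g) x \<noteq> 0" for x
    using that by (cases "f x = 0"; cases "g x = 0") auto
  ultimately have "\<exists>K. compactin (mtop M) K \<and> K \<subseteq> W \<and> {x. (f + g) x \<noteq> 0} \<subseteq> K"
    by (intro exI[of _ "K \<union> L"] conjI) (blast intro: compactin_Un)+
  then show ?thesis using assms smooth_fun_M_add by (auto simp: Cc_open_sub_iff plus_fun_def)
qed

lemma Cc_open_sub_smooth_mult: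
  fixes f g :: "'x \<Rightarrow> 'k::real_normed_field"
  assumes "openin (mtop M) W" "smooth_fun M f" "g \<in> Cc (open_sub M W)"
  shows "f * g \<in> Cc (open_sub M W)"
proof -
  obtain L where "compactin (mtop M) L" "L \<subseteq> W" "{x. g x \<noteq> 0} \<subseteq> L"
    using assms by (auto simp: Cc_open_sub_iff)
  then have "\<exists>K. compactin (mtop M) K \<and> K \<subseteq> W \<and> {x. (f * g) x \<noteq> 0} \<subseteq> K"
    by (intro exI[of _ "L"]) auto
  then show ?thesis using assms smooth_fun_M_mult by (auto simp: Cc_open_sub_iff times_fun_def)
qed

lemma Cc_smooth: "f \<in> Cc M \<Longrightarrow> smooth_fun M f"
  by (simp add: Cc_def)

lemma Cc_open_sub_mult:
  "openin (mtop M) W \<Longrightarrow> f \<in> Cc M \<Longrightarrow> g \<in> Cc (open_sub M W) \<Longrightarrow> f * g \<in> Cc (open_sub M W)"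
  by (simp add: Cc_open_sub_smooth_mult Cc_smooth)

lemma Cc_open_sub_0: "openin (mtop M) W \<Longrightarrow> 0 \<in> Cc (open_sub M W)"
  using smooth_fun_const[of M 0] by (auto simp: Cc_open_sub_iff zero_fun_def intro!: exI[of _ "{}"])

lemma Cc_open_sub_scale: "openin (mtop M) W \<Longrightarrow> f \<in> Cc (open_sub M W) \<Longrightarrow> (\<lambda>_. a) * f \<in> Cc (open_sub M W)"
  by (simp add: Cc_open_sub_smooth_mult smooth_fun_const)

lemma Cc_open_sub_uminus: "openin (mtop M) W \<Longrightarrow> f \<in> Cc (open_sub M W) \<Longrightarrow> - f \<in> Cc (open_sub M W)"
  using Cc_open_sub_scale[of W f "-1"] by (simp add: times_fun_def fun_Compl_def)

lemma open_sub_points: "Cc (open_sub M (points M)) = Cc M"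
  using compactin_subset_topspace by (fastforce simp: Cc_open_sub_iff Cc_M_iff)

lemma Cc_0: "0 \<in> Cc M" and Cc_add: "f \<in> Cc M \<Longrightarrow> g \<in> Cc M \<Longrightarrow> f + g \<in> Cc M"
  and Cc_mult: "f \<in> Cc M \<Longrightarrow> g \<in> Cc M \<Longrightarrow> f * g \<in> Cc M"
  and Cc_uminus: "f \<in> Cc M \<Longrightarrow> - f \<in> Cc M"
  using Cc_open_sub_0 Cc_open_sub_add Cc_open_sub_mult Cc_open_sub_uminus
  by (metis open_sub_points openin_topspace)+

lemma Cc_off_near_0:
  assumes W: "openin (mtop M) W" and "f \<in> Cc (open_sub M W)" "x \<in> points M" "x \<notin> W"
  shows "near M x (\<lambda>y. f y = 0)"
proof -
  obtain K where "compactin (mtop M) K" "K \<subseteq> W" "{x. f x \<noteq> 0} \<subseteq> K"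
    using assms by (auto simp: Cc_open_sub_iff)
  moreover from this have "openin (mtop M) (points M - K)"
    using compactin_imp_closedin[OF hausdorff] by blast
  ultimately show ?thesis using assms by (intro nearI[of _ "points M - K"]) auto
qed

text \<open>A bump on the model space is transported through a chart and extended by 0. The closed
  ball is chosen inside the chart image of U \<inter> W, and the bump has value 1 on the ball of
  half its radius.\<close>

lemma Cc_bump:
  assumes W: "openin (mtop M) W" and x: "x \<in> W"
  obtains f :: "'x \<Rightarrow> 'k::real_normed_field" where "f \<in> Cc (open_sub M W)" "near M x (\<lambda>y. f y = 1)"
proof -
  obtain U \<phi> where c: "(U, \<phi>) \<in> atlas M" "x \<in> U"
    using chart_exists[OF manifold] openin_subset[OF W] x by blast
  obtain B :: "'b set" where B: "finite B" "span B = UNIV"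
    using manifold_finite_span[OF manifold] .
  have U: "openin (mtop M) U" using chart_openin[OF manifold c(1)] .
  have "open (\<phi> ` (U \<inter> W))" "\<phi> x \<in> \<phi> ` (U \<inter> W)"
    using chart_image[OF manifold c(1) W] c x by auto
  then obtain r where r: "r > 0" "cball (\<phi> x) r \<subseteq> \<phi> ` (U \<inter> W)"
    using open_contains_cball by blast
  obtain b :: "'b \<Rightarrow> real" where b: "smooth_on UNIV b" "\<And>y. norm (y - \<phi> x) < r / 2 \<Longrightarrow> b y = 1"
    "\<And>y. norm (y - \<phi> x) \<ge> 2 * (r / 2) \<Longrightarrow> b y = 0"
    using bump_function_exists[of "r / 2" "\<phi> x"] r by auto
  \<comment> \<open>The part of U \<inter> W that the chart sends into the closed ball. It is
    compact as the image of that ball under the inverse chart, and it contains the support of the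
    transported bump.\<close>
  define K where "K = {y \<in> U \<inter> W. \<phi> y \<in> cball (\<phi> x) r}"
  have inv: "inv_into U \<phi> ` cball (\<phi> x) r = K"
  proof (safe)
    fix y assume y: "y \<in> cball (\<phi> x) r"
    then obtain z where "z \<in> U \<inter> W" "y = \<phi> z" using r by blast
    then show "inv_into U \<phi> y \<in> K"
      using chart_inj[OF manifold c(1)] y by (simp add: K_def inv_into_f_f)
  next
    fix y assume "y \<in> K"
    then show "y \<in> inv_into U \<phi> ` cball (\<phi> x) r"
      using chart_inj[OF manifold c(1)] by (auto simp: K_def image_iff inv_into_f_f intro!: bexI[of _ "\<phi> y"])
  qed
  have "compactin (subtopology (mtop M) U) K"
  proof -
    obtain \<psi> where "homeomorphic_maps (subtopology (mtop M) U) (top_of_set (\<phi> ` U)) \<phi> \<psi>"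
      using chart_homeomorphic[OF manifold c(1)] by (auto simp: homeomorphic_map_maps)
    then have "continuous_map (top_of_set (\<phi> ` U)) (subtopology (mtop M) U) \<psi>"
        "\<And>y. y \<in> U \<Longrightarrow> \<psi> (\<phi> y) = y"
      using chart_subset[OF manifold c(1)] by (auto simp: homeomorphic_maps_def)
    then have "continuous_map (top_of_set (\<phi> ` U)) (subtopology (mtop M) U) (inv_into U \<phi>)"
      using chart_inj[OF manifold c(1)] by (elim continuous_map_eq) (auto simp: inv_into_f_f)
    moreover have "compactin (top_of_set (\<phi> ` U)) (cball (\<phi> x) r)"
      using r(2) compact_cball_finite_span[OF B] by (auto simp: compactin_subtopology)
    ultimately show ?thesis using image_compactin inv by metis
  qed
  then have K: "compactin (mtop M) K" "K \<subseteq> W"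
    by (auto simp: compactin_subtopology K_def)
  define f :: "'x \<Rightarrow> 'k" where "f y = (if y \<in> U \<inter> W then of_real (b (\<phi> y)) else 0)" for y
  have fK: "{y. f y \<noteq> 0} \<subseteq> K"
  proof
    fix y assume "y \<in> {y. f y \<noteq> 0}"
    then have "y \<in> U \<inter> W" "b (\<phi> y) \<noteq> 0" by (auto simp: f_def split: if_splits)
    then show "y \<in> K" using b(3)[of "\<phi> y"] by (force simp: K_def dist_norm norm_minus_commute)
  qed
  have UW: "openin (mtop M) (U \<inter> W)" using U W by blast
  have "smooth_fun (open_sub M (points M)) f"
  proof (rule smooth_fun_local[OF manifold])
    fix y assume y: "y \<in> points M"
    show "\<exists>V g. openin (mtop M) V \<and> y \<in> V \<and> smooth_fun (open_sub M V) g \<and> (\<forall>z\<in>V \<inter> points M. f z = g z)"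
    proof (cases "y \<in> U \<inter> W")
      case True
      have "smooth_on UNIV (\<lambda>z. of_real (b z) :: 'k)"
        using smooth_on_bounded_linear[OF bounded_linear_of_real b(1)] by simp
      moreover have "smooth_fun (open_sub M (U \<inter> W)) \<phi>"
        using smooth_fun_mono[OF manifold U UW _ smooth_fun_chart[OF manifold c(1)]] by blast
      ultimately have "smooth_fun (open_sub M (U \<inter> W)) (\<lambda>y. of_real (b (\<phi> y)) :: 'k)"
        using smooth_fun_compose[OF B manifold UW, of \<phi> UNIV "\<lambda>z. of_real (b z)"] by simp
      then show ?thesis using UW True by (intro exI[of _ "U \<inter> W"] exI) (auto simp: f_def)
    next
      case False
      have "openin (mtop M) (points M - K)"
        using compactin_imp_closedin[OF hausdorff K(1)] by blast
      moreover have "y \<notin> K" using False by (auto simp: K_def)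
      ultimately show ?thesis
        using fK y by (intro exI[of _ "points M - K"] exI[of _ "\<lambda>_. 0"]) (auto intro: smooth_fun_const)
    qed
  qed simp
  then have "smooth_fun M f" by (simp add: smooth_fun_open_sub_points[OF manifold])
  then have "f \<in> Cc (open_sub M W)" using K fK by (auto simp: Cc_open_sub_iff[OF W])
  moreover have "near M x (\<lambda>y. f y = 1)"
  proof (rule nearI)
    show "openin (mtop M) ({y \<in> U. \<phi> y \<in> ball (\<phi> x) (r / 2)} \<inter> W)"
      using chart_preimage[OF manifold c(1), of "ball (\<phi> x) (r / 2)"] W by (simp add: openin_Int)
  qed (use x c r b(2) in \<open>auto simp: f_def dist_norm norm_minus_commute\<close>)
  ultimately show ?thesis using that by blast
qed

text \<open>The form in which bumps meet germ conditions: a property that holds near x is turned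
  into one that holds wherever f is nonzero, and so into an identity of products with f.\<close>

lemma Cc_bump_near:
  assumes "x \<in> points M" "near M x P"
  obtains f :: "'x \<Rightarrow> 'k::real_normed_field"
  where "f \<in> Cc M" "near M x (\<lambda>y. f y = 1)" "\<And>y. f y \<noteq> 0 \<Longrightarrow> P y"
proof -
  obtain W where W: "openin (mtop M) W" "x \<in> W" "\<forall>y\<in>W. P y"
    using assms by (auto simp: near_iff)
  obtain f :: "'x \<Rightarrow> 'k" where f: "f \<in> Cc (open_sub M W)" "near M x (\<lambda>y. f y = 1)"
    using Cc_bump[OF W(1,2)] .
  then have "P y" if "f y \<noteq> 0" for y using W that by (auto simp: Cc_open_sub_iff)
  then show ?thesis using that f Cc_open_sub_subset W by blast
qed

lemma Cc_bump_compact: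
  assumes W: "openin (mtop M) W" and K: "compactin (mtop M) K" "K \<subseteq> W"
  obtains f :: "'x \<Rightarrow> 'k::real_normed_field" where "f \<in> Cc (open_sub M W)" "\<And>x. x \<in> K \<Longrightarrow> near M x (\<lambda>y. f y = 1)"
proof -
  define \<O> where "\<O> = {V. openin (mtop M) V \<and> (\<exists>f::'x \<Rightarrow> 'k. f \<in> Cc (open_sub M W) \<and> (\<forall>y\<in>V. f y = 1))}"
  have "K \<subseteq> \<Union>\<O>"
  proof
    fix x assume x: "x \<in> K"
    then obtain f :: "'x \<Rightarrow> 'k" where "f \<in> Cc (open_sub M W)" "near M x (\<lambda>y. f y = 1)"
      using Cc_bump[OF W, of x] K(2) by blast
    then show "x \<in> \<Union>\<O>" using x K W openin_subset unfolding \<O>_def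
      by (subst (asm) near_iff) blast+
  qed
  then obtain \<F> where F: "finite \<F>" "\<F> \<subseteq> \<O>" "K \<subseteq> \<Union>\<F>"
    using K(1) unfolding compactin_def \<O>_def by (metis (no_types, lifting) mem_Collect_eq)
  have "\<exists>f::'x \<Rightarrow> 'k. f \<in> Cc (open_sub M W) \<and> (\<forall>y\<in>\<Union>\<F>. f y = 1)" using F(1,2)
  proof (induction \<F>)
    case empty
    then show ?case using Cc_open_sub_0[OF W] by auto
  next
    case (insert V \<F>)
    then obtain f g :: "'x \<Rightarrow> 'k" where *: "f \<in> Cc (open_sub M W)" "\<forall>y\<in>\<Union>\<F>. f y = 1"
      "g \<in> Cc (open_sub M W)" "\<forall>y\<in>V. g y = 1" by (auto simp: \<O>_def)
    \<comment> \<open>This is 1 - (1 - f)(1 - g), which is 1 wherever f or g is, and is written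
      without the constant 1 because that has no compact support in general.\<close>
    have "f + (g + - (f * g)) \<in> Cc (open_sub M W)"
      using * by (intro Cc_open_sub_add Cc_open_sub_uminus Cc_open_sub_mult W) (auto intro: Cc_open_sub_subset W)
    moreover have "\<forall>y\<in>\<Union>(insert V \<F>). (f + (g + - (f * g))) y = 1" using * by auto
    ultimately show ?case by blast
  qed
  then obtain f :: "'x \<Rightarrow> 'k" where f: "f \<in> Cc (open_sub M W)" "\<forall>y\<in>\<Union>\<F>. f y = 1" by blast
  moreover have "near M x (\<lambda>y. f y = 1)" if "x \<in> K" for x
    using F f that by (intro nearI[of _ "\<Union>\<F>"]) (auto simp: \<O>_def)
  ultimately show ?thesis using that by blast
qed

text \<open>Supplies the function \<eta> in the formula for the comultiplication, supported over the
  same elementary set as f.\<close>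

lemma Cc_local_unit:
  fixes f :: "'x \<Rightarrow> 'k::real_normed_field"
  assumes "openin (mtop M) W" "f \<in> Cc (open_sub M W)"
  obtains h :: "'x \<Rightarrow> 'k" where "h \<in> Cc (open_sub M W)" "h * f = f"
proof -
  obtain K where K: "compactin (mtop M) K" "K \<subseteq> W" "{x. f x \<noteq> 0} \<subseteq> K"
    using assms by (auto simp: Cc_open_sub_iff)
  obtain h :: "'x \<Rightarrow> 'k" where h: "h \<in> Cc (open_sub M W)" "\<And>x. x \<in> K \<Longrightarrow> near M x (\<lambda>y. h y = 1)"
    using Cc_bump_compact[OF assms(1) K(1,2)] by blast
  have "h x * f x = f x" for x
    using h(2)[of x] K near_imp_at[of _ M x] compactin_subset_topspace[OF K(1)] by (cases "f x = 0") auto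
  then have "h * f = f" by (simp add: fun_eq_iff)
  then show ?thesis using that h by blast
qed

end

section \<open>Sheaves\<close>

lemma elementary_subset: "elementary E U \<Longrightarrow> openin (mtop (total E)) V \<Longrightarrow> V \<subseteq> U \<Longrightarrow> elementary E V"
  by (auto simp: elementary_def intro: inj_on_subset)

lemma elementary_openin: "elementary E U \<Longrightarrow> openin (mtop (total E)) U"
  and elementary_inj: "elementary E U \<Longrightarrow> inj_on (proj E) U"
  by (simp_all add: elementary_def)

lemma elementary_Int: "elementary E U \<Longrightarrow> openin (mtop (total E)) V \<Longrightarrow> elementary E (U \<inter> V)"
  by (intro elementary_subset[of E U "U \<inter> V"]) (auto simp: elementary_openin)

locale sheaf = hausdorff_manifold M for M :: "('x, 'b::real_inner) mfd" +
  fixes E :: "('e, 'b, 'x) etale"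
  assumes sh_obj: "sh_obj M E"
begin

lemma total_manifold: "manifold (total E)"
  using sh_obj by (simp add: sh_obj_def)

lemma diffeo_nbhd:
  assumes "e \<in> epoints E"
  obtains U where "openin (mtop (total E)) U" "e \<in> U" "openin (mtop M) (proj E ` U)" "inj_on (proj E) U"
    "smooth_map (open_sub (total E) U) (open_sub M (proj E ` U)) (proj E)"
    "smooth_map (open_sub M (proj E ` U)) (open_sub (total E) U) (inv_into U (proj E))"
proof -
  obtain U where U: "openin (mtop (total E)) U" "e \<in> U" "openin (mtop M) (proj E ` U)"
      "diffeo (open_sub (total E) U) (open_sub M (proj E ` U)) (proj E)"
    using sh_obj assms unfolding sh_obj_def local_diffeo_def by blast
  moreover have "points (total E) \<inter> U = U" using openin_subset[OF U(1)] by auto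
  ultimately show ?thesis using that by (auto simp: diffeo_def bij_betw_def)
qed

lemma proj_continuous: "continuous_map (mtop (total E)) (mtop M) (proj E)"
proof -
  have pts: "proj E e \<in> points M" if e: "e \<in> epoints E" for e
    using diffeo_nbhd[OF e] openin_subset by (metis image_subset_iff)
  have "openin (mtop (total E)) {e \<in> epoints E. proj E e \<in> A}" if A: "openin (mtop M) A" for A
  proof (subst openin_subopen, clarify)
    fix e assume e: "e \<in> epoints E" "proj E e \<in> A"
    then obtain U where U: "openin (mtop (total E)) U" "e \<in> U" "openin (mtop M) (proj E ` U)"
      "smooth_map (open_sub (total E) U) (open_sub M (proj E ` U)) (proj E)"
      using diffeo_nbhd by metis
    have "openin (mtop (open_sub M (proj E ` U))) (proj E ` U \<inter> A)"
      using A U by (simp add: openin_open_sub_iff openin_Int)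
    then have "openin (mtop (open_sub (total E) U)) (points (open_sub (total E) U) \<inter> proj E -` (proj E ` U \<inter> A))"
      using U(4) unfolding smooth_map_def by (blast intro: openin_map_vimage)
    then have "openin (mtop (total E)) (epoints E \<inter> U \<inter> proj E -` (proj E ` U \<inter> A))"
      using U by (simp add: openin_open_sub_iff)
    then show "\<exists>T. openin (mtop (total E)) T \<and> e \<in> T \<and> T \<subseteq> {e \<in> epoints E. proj E e \<in> A}"
      using e U by (intro exI[of _ "epoints E \<inter> U \<inter> proj E -` (proj E ` U \<inter> A)"]) auto
  qed
  then show ?thesis using pts by (auto simp: continuous_map_def)
qed

lemma proj_in_points: "e \<in> epoints E \<Longrightarrow> proj E e \<in> points M"
  using proj_continuous by (auto simp: continuous_map_def)

lemma proj_open: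
  assumes W: "openin (mtop (total E)) W" shows "openin (mtop M) (proj E ` W)"
proof (subst openin_subopen, clarify)
  fix e assume e: "e \<in> W"
  then obtain U where U: "openin (mtop (total E)) U" "e \<in> U" "openin (mtop M) (proj E ` U)" "inj_on (proj E) U"
      "smooth_map (open_sub M (proj E ` U)) (open_sub (total E) U) (inv_into U (proj E))"
    using diffeo_nbhd[of e] openin_subset[OF W] by blast
  have "openin (mtop (open_sub (total E) U)) (U \<inter> W)"
    using W U by (simp add: openin_open_sub_iff openin_Int)
  then have "openin (mtop (open_sub M (proj E ` U))) (points (open_sub M (proj E ` U)) \<inter> inv_into U (proj E) -` (U \<inter> W))"
    using U(5) unfolding smooth_map_def by (blast intro: openin_map_vimage)
  then have "openin (mtop M) (points M \<inter> proj E ` U \<inter> inv_into U (proj E) -` (U \<inter> W))"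
    using U by (simp add: openin_open_sub_iff)
  moreover have "points M \<inter> proj E ` U \<inter> inv_into U (proj E) -` (U \<inter> W) = proj E ` (U \<inter> W)"
    using U openin_subset[OF U(3)] by (auto simp: inv_into_f_f)
  ultimately show "\<exists>T. openin (mtop M) T \<and> proj E e \<in> T \<and> T \<subseteq> proj E ` W"
    using e U by (intro exI[of _ "proj E ` (U \<inter> W)"]) auto
qed

lemma elementary_nbhd:
  assumes "openin (mtop (total E)) W" "e \<in> W"
  obtains U where "elementary E U" "e \<in> U" "U \<subseteq> W"
proof -
  obtain U where "openin (mtop (total E)) U" "e \<in> U" "inj_on (proj E) U"
    using diffeo_nbhd[of e] openin_subset[OF assms(1)] assms(2) by (metis subsetD)
  then have "elementary E (U \<inter> W)" using assms by (auto simp: elementary_def intro: inj_on_subset)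
  then show ?thesis using that \<open>e \<in> U\<close> assms by blast
qed

lemma elementary_point:
  assumes "e \<in> epoints E" obtains U where "elementary E U" "e \<in> U"
  using elementary_nbhd[OF openin_topspace assms] by metis

lemma elementary_image: "elementary E U \<Longrightarrow> openin (mtop M) (proj E ` U)"
  by (simp add: elementary_openin proj_open)

lemma elementary_vimage:
  assumes U: "elementary E U" and W: "openin (mtop M) W"
  shows "elementary E (U \<inter> proj E -` W)"
proof -
  have "U \<inter> proj E -` W = U \<inter> (epoints E \<inter> proj E -` W)"
    using openin_subset[OF elementary_openin[OF U]] by auto
  then show ?thesis
    using elementary_Int[OF U openin_map_vimage[OF proj_continuous W]] by simp
qed

text \<open>The projection maps U injectively and continuously into the Hausdorff space M, even if E
  itself has inseparable points.\<close>

lemma elementary_Hausdorff: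
  assumes U: "elementary E U"
  shows "Hausdorff_space (subtopology (mtop (total E)) U)"
proof -
  have "continuous_map (subtopology (mtop (total E)) U) (mtop M) (proj E)"
    using proj_continuous by (rule continuous_map_from_subtopology)
  then show ?thesis
    by (rule Hausdorff_space_injective_preimage[OF hausdorff])
      (use inj_on_subset[OF elementary_inj[OF U]] in auto)
qed

text \<open>The projection is open for one direction and continuous for the other. Germs at e of
  functions pulled back from the base are thus germs at the base point.\<close>

lemma near_proj_iff:
  assumes e: "e \<in> epoints E"
  shows "near (total E) e (\<lambda>y. P (proj E y)) \<longleftrightarrow> near M (proj E e) P"
proof
  assume "near (total E) e (\<lambda>y. P (proj E y))"
  then obtain W where "openin (mtop (total E)) W" "e \<in> W" "\<forall>y\<in>W. P (proj E y)"
    using e by (auto simp: near_iff)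
  then show "near M (proj E e) P" by (intro nearI[of _ "proj E ` W"]) (auto intro: proj_open)
next
  assume "near M (proj E e) P"
  then obtain W where "openin (mtop M) W" "proj E e \<in> W" "\<forall>y\<in>W. P y"
    using proj_in_points[OF e] by (auto simp: near_iff)
  then show "near (total E) e (\<lambda>y. P (proj E y))"
    using e by (intro nearI[of _ "epoints E \<inter> proj E -` W"]) (auto intro: openin_map_vimage[OF proj_continuous])
qed

lemma smooth_fun_comp_proj:
  assumes W: "openin (mtop M) W" and f: "smooth_fun (open_sub M W) f"
  shows "smooth_fun (open_sub (total E) (epoints E \<inter> proj E -` W)) (f \<circ> proj E)"
proof (rule smooth_fun_local[OF total_manifold openin_map_vimage[OF proj_continuous W]])
  fix e assume e: "e \<in> epoints E \<inter> proj E -` W"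
  then obtain U where U: "openin (mtop (total E)) U" "e \<in> U" "openin (mtop M) (proj E ` U)"
      "smooth_map (open_sub (total E) U) (open_sub M (proj E ` U)) (proj E)"
    using diffeo_nbhd by blast
  let ?Y = "open_sub M (proj E ` U)" and ?X = "open_sub (total E) U"
  have "smooth_fun (open_sub M (proj E ` U \<inter> W)) f"
    using smooth_fun_mono[OF manifold W _ _ f] U W by (simp add: openin_Int)
  then have "smooth_fun (open_sub ?Y (proj E ` U \<inter> W)) f"
    by (simp add: open_sub_open_sub Int_absorb Int_assoc[symmetric])
  then have "smooth_fun (open_sub ?X (points ?X \<inter> proj E -` (proj E ` U \<inter> W))) (f \<circ> proj E)"
    using U W by (intro smooth_map_compose_fun[OF _ _ U(4)])
      (auto intro!: manifold_open_sub total_manifold manifold simp: openin_open_sub_iff)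
  then have "smooth_fun (open_sub (total E) (U \<inter> (epoints E \<inter> U \<inter> proj E -` (proj E ` U \<inter> W)))) (f \<circ> proj E)"
    by (simp add: open_sub_open_sub)
  moreover have "U \<inter> (epoints E \<inter> U \<inter> proj E -` (proj E ` U \<inter> W)) = U \<inter> (epoints E \<inter> proj E -` W)" by auto
  ultimately have "smooth_fun (open_sub (total E) (U \<inter> (epoints E \<inter> proj E -` W))) (f \<circ> proj E)" by simp
  then show "\<exists>V g. openin (mtop (total E)) V \<and> e \<in> V \<and> smooth_fun (open_sub (total E) V) g \<and>
      (\<forall>y\<in>V \<inter> (epoints E \<inter> proj E -` W). (f \<circ> proj E) y = g y)"
    using e U openin_map_vimage[OF proj_continuous W]
    by (intro exI[of _ "U \<inter> (epoints E \<inter> proj E -` W)"] exI[of _ "f \<circ> proj E"]) auto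
qed

text \<open>An elementary set is only assumed open with injective projection. Near each of its
  points the inverse of the projection agrees with the one of a neighbourhood supplied by
  \<open>local_diffeo\<close>, and that one is smooth.\<close>

lemma smooth_fun_comp_section:
  assumes U: "elementary E U" and g: "smooth_fun (open_sub (total E) U) g"
  shows "smooth_fun (open_sub M (proj E ` U)) (g \<circ> inv_into U (proj E))"
proof (rule smooth_fun_local[OF manifold elementary_image[OF U]], clarify)
  fix e assume e: "e \<in> U"
  then obtain V where V: "openin (mtop (total E)) V" "e \<in> V" "openin (mtop M) (proj E ` V)" "inj_on (proj E) V"
      "smooth_map (open_sub M (proj E ` V)) (open_sub (total E) V) (inv_into V (proj E))"
    using diffeo_nbhd[of e] openin_subset[OF elementary_openin[OF U]] by blast
  let ?Y = "open_sub M (proj E ` V)" and ?X = "open_sub (total E) V"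
  have UV: "openin (mtop (total E)) (V \<inter> U)" using V elementary_openin[OF U] by blast
  have "smooth_fun (open_sub (total E) (V \<inter> U)) g"
    using smooth_fun_mono[OF total_manifold elementary_openin[OF U] UV _ g] by blast
  then have "smooth_fun (open_sub ?X (V \<inter> U)) g"
    by (simp add: open_sub_open_sub Int_absorb Int_assoc[symmetric])
  then have "smooth_fun (open_sub ?Y (points ?Y \<inter> inv_into V (proj E) -` (V \<inter> U))) (g \<circ> inv_into V (proj E))"
    using V UV by (intro smooth_map_compose_fun[OF _ _ V(5)])
      (auto intro!: manifold_open_sub total_manifold manifold simp: openin_open_sub_iff)
  then have "smooth_fun (open_sub M (proj E ` V \<inter> (points M \<inter> proj E ` V \<inter> inv_into V (proj E) -` (V \<inter> U)))) (g \<circ> inv_into V (proj E))"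
    by (simp add: open_sub_open_sub)
  moreover have "proj E ` V \<inter> (points M \<inter> proj E ` V \<inter> inv_into V (proj E) -` (V \<inter> U)) = proj E ` (V \<inter> U)"
    using V(4) openin_subset[OF V(3)] by (auto simp: inv_into_f_f)
  ultimately have "smooth_fun (open_sub M (proj E ` (V \<inter> U))) (g \<circ> inv_into V (proj E))" by simp
  moreover have "inv_into V (proj E) y = inv_into U (proj E) y" if "y \<in> proj E ` (V \<inter> U)" for y
    using that V(4) elementary_inj[OF U] by (auto simp: inv_into_f_f)
  ultimately have "smooth_fun (open_sub M (proj E ` (V \<inter> U))) (g \<circ> inv_into U (proj E))"
    using smooth_fun_cong[OF manifold proj_open[OF UV], of "g \<circ> inv_into V (proj E)"] by simp
  then show "\<exists>N h. openin (mtop M) N \<and> proj E e \<in> N \<and> smooth_fun (open_sub M N) h \<and>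
      (\<forall>y\<in>N \<inter> proj E ` U. (g \<circ> inv_into U (proj E)) y = h y)"
    using e V(2) proj_open[OF UV]
    by (intro exI[of _ "proj E ` (V \<inter> U)"] exI[of _ "g \<circ> inv_into U (proj E)"]) auto
qed

end

locale two_sheaves = sheaf M E + F: sheaf M F
  for M :: "('x, 'b::real_inner) mfd" and E :: "('e, 'b, 'x) etale" and F :: "('f, 'b, 'x) etale"
begin

text \<open>Over V the map is forced to be the projection of E followed by the inverse of the
  projection of F on U. Continuity and smoothness are inherited from these two, so neither appears
  among the hypotheses.\<close>

lemma sh_homI:
  assumes ext: "\<phi> \<in> extensional (epoints E)"
    and pr: "\<And>e. e \<in> epoints E \<Longrightarrow> proj F (\<phi> e) = proj E e"
    and loc: "\<And>e. e \<in> epoints E \<Longrightarrow> \<exists>V U. openin (mtop (total E)) V \<and> e \<in> V \<and> elementary F U \<and> \<phi> ` V \<subseteq> U"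
  shows "\<phi> \<in> sh_hom E F"
proof -
  have pts: "\<phi> e \<in> epoints F" if "e \<in> epoints E" for e
    using loc[OF that] openin_subset elementary_openin by blast
  \<comment> \<open>Injectivity of the projection on U lets the preimage of A be computed from
    projections alone; openness is then visible.\<close>
  have key: "openin (mtop (total E)) (V \<inter> proj E -` (proj F ` (U \<inter> A)))"
      "V \<inter> proj E -` (proj F ` (U \<inter> A)) = V \<inter> \<phi> -` A"
    if V: "openin (mtop (total E)) V" and U: "elementary F U" "\<phi> ` V \<subseteq> U" and A: "openin (mtop (total F)) A" for V U A
  proof -
    have eV: "e \<in> epoints E" if "e \<in> V" for e using openin_subset[OF V] that by auto
    have "openin (mtop M) (proj F ` (U \<inter> A))"
      using U A by (simp add: F.proj_open elementary_openin openin_Int)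
    then have "openin (mtop (total E)) (V \<inter> (epoints E \<inter> proj E -` (proj F ` (U \<inter> A))))"
      using V openin_map_vimage[OF proj_continuous] by blast
    moreover have "V \<inter> (epoints E \<inter> proj E -` (proj F ` (U \<inter> A))) = V \<inter> proj E -` (proj F ` (U \<inter> A))"
      using eV by auto
    ultimately show "openin (mtop (total E)) (V \<inter> proj E -` (proj F ` (U \<inter> A)))" by simp
    have "\<phi> e \<in> A \<longleftrightarrow> proj E e \<in> proj F ` (U \<inter> A)" if "e \<in> V" for e
    proof -
      have "\<phi> e \<in> U" using that U by auto
      moreover have "u = \<phi> e" if "u \<in> U" "proj E e = proj F u" for u
        using inj_onD[OF elementary_inj[OF U(1)], of u "\<phi> e"] that \<open>\<phi> e \<in> U\<close> pr[OF eV[OF \<open>e \<in> V\<close>]] by simp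
      moreover have "proj E e = proj F (\<phi> e)" using pr[OF eV[OF that]] by simp
      ultimately show ?thesis by blast
    qed
    then show "V \<inter> proj E -` (proj F ` (U \<inter> A)) = V \<inter> \<phi> -` A" by blast
  qed
  have "openin (mtop (total E)) {e \<in> epoints E. \<phi> e \<in> A}" if A: "openin (mtop (total F)) A" for A
  proof (subst openin_subopen, clarify)
    fix e assume e: "e \<in> epoints E" "\<phi> e \<in> A"
    then obtain V U where V: "openin (mtop (total E)) V" "e \<in> V" "elementary F U" "\<phi> ` V \<subseteq> U" using loc by blast
    then show "\<exists>T. openin (mtop (total E)) T \<and> e \<in> T \<and> T \<subseteq> {e \<in> epoints E. \<phi> e \<in> A}"
      using key[OF V(1,3,4) A] e openin_subset[OF V(1)] by (intro exI[of _ "V \<inter> \<phi> -` A"]) auto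
  qed
  then have cont: "continuous_map (mtop (total E)) (mtop (total F)) \<phi>"
    using pts by (auto simp: continuous_map_def)
  have "smooth_map (total E) (total F) \<phi>"
  proof (rule smooth_mapI[OF total_manifold F.total_manifold cont])
    fix Q \<psi> assume c: "(Q, \<psi>) \<in> atlas (total F)"
    have Q: "openin (mtop (total F)) Q" using chart_openin[OF F.total_manifold c] .
    show "smooth_fun (open_sub (total E) (epoints E \<inter> \<phi> -` Q)) (\<psi> \<circ> \<phi>)"
    proof (rule smooth_fun_local[OF total_manifold openin_map_vimage[OF cont Q]])
      fix e assume e: "e \<in> epoints E \<inter> \<phi> -` Q"
      then obtain V U where V: "openin (mtop (total E)) V" "e \<in> V" "elementary F U" "\<phi> ` V \<subseteq> U" using loc by blast
      let ?U = "U \<inter> Q" and ?N = "V \<inter> proj E -` (proj F ` (U \<inter> Q))"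
      have U: "elementary F ?U" using V(3) Q by (rule elementary_Int)
      have "smooth_fun (open_sub (total F) ?U) \<psi>"
        using smooth_fun_mono[OF F.total_manifold Q elementary_openin[OF U] _ smooth_fun_chart[OF F.total_manifold c]] by blast
      then have "smooth_fun (open_sub M (proj F ` ?U)) (\<psi> \<circ> inv_into ?U (proj F))"
        using F.smooth_fun_comp_section[OF U] by blast
      then have *: "smooth_fun (open_sub (total E) (epoints E \<inter> proj E -` (proj F ` ?U))) (\<psi> \<circ> inv_into ?U (proj F) \<circ> proj E)"
        using smooth_fun_comp_proj[OF F.elementary_image[OF U]] by blast
      have N: "openin (mtop (total E)) ?N" "?N = V \<inter> \<phi> -` Q" using key[OF V(1,3,4) Q] by auto
      have "smooth_fun (open_sub (total E) ?N) (\<psi> \<circ> inv_into ?U (proj F) \<circ> proj E)"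
        using openin_subset[OF V(1)]
        by (intro smooth_fun_mono[OF total_manifold openin_map_vimage[OF proj_continuous F.elementary_image[OF U]] N(1) _ *]) auto
      moreover have "(\<psi> \<circ> \<phi>) y = (\<psi> \<circ> inv_into ?U (proj F) \<circ> proj E) y" if "y \<in> ?N" for y
      proof -
        have "y \<in> V" "\<phi> y \<in> ?U" using that N(2) V(4) by auto
        then have "inv_into ?U (proj F) (proj F (\<phi> y)) = \<phi> y" using elementary_inj[OF U] by simp
        moreover have "proj F (\<phi> y) = proj E y" using pr \<open>y \<in> V\<close> openin_subset[OF V(1)] by blast
        ultimately show ?thesis by simp
      qed
      moreover have "e \<in> ?N" using e V N(2) by auto
      ultimately show "\<exists>V g. openin (mtop (total E)) V \<and> e \<in> V \<and> smooth_fun (open_sub (total E) V) g \<and>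
          (\<forall>y\<in>V \<inter> (epoints E \<inter> \<phi> -` Q). (\<psi> \<circ> \<phi>) y = g y)"
        using N(1) by (intro exI[of _ ?N] exI[of _ "\<psi> \<circ> inv_into ?U (proj F) \<circ> proj E"]) auto
    qed
  qed
  then show ?thesis using ext pr by (simp add: sh_hom_def)
qed

lemma
  assumes "\<phi> \<in> sh_hom E F"
  shows sh_hom_proj: "e \<in> epoints E \<Longrightarrow> proj F (\<phi> e) = proj E e"
    and sh_hom_continuous: "continuous_map (mtop (total E)) (mtop (total F)) \<phi>"
    and sh_hom_points: "e \<in> epoints E \<Longrightarrow> \<phi> e \<in> epoints F"
  using assms by (auto simp: sh_hom_def smooth_map_def continuous_map_def)

text \<open>Morphisms of sheaves are open: inside an elementary set W around \<phi> e, a point with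
  the same projection as some e' near e must be \<phi> e'. This makes the induced map on pullbacks
  meaningful.\<close>

lemma sh_hom_elementary:
  assumes \<phi>: "\<phi> \<in> sh_hom E F" and U: "elementary E U"
  shows "elementary F (\<phi> ` U)" and "proj F ` \<phi> ` U = proj E ` U"
proof -
  have UE: "U \<subseteq> epoints E" using openin_subset[OF elementary_openin[OF U]] .
  have pr: "proj F (\<phi> e) = proj E e" if "e \<in> U" for e using sh_hom_proj[OF \<phi>] UE that by blast
  show "proj F ` \<phi> ` U = proj E ` U" using pr by (auto simp: image_image)
  have "inj_on (proj F) (\<phi> ` U)"
    using elementary_inj[OF U] pr by (auto simp: inj_on_def)
  moreover have "openin (mtop (total F)) (\<phi> ` U)"
  proof (subst openin_subopen, clarify)
    fix e assume e: "e \<in> U"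
    then obtain W where W: "elementary F W" "\<phi> e \<in> W"
      using F.elementary_point sh_hom_points[OF \<phi>] UE by blast
    let ?V = "U \<inter> (epoints E \<inter> \<phi> -` W)"
    have V: "openin (mtop (total E)) ?V"
      using elementary_openin[OF U] openin_map_vimage[OF sh_hom_continuous[OF \<phi>] elementary_openin[OF W(1)]] by blast
    have "openin (mtop (total F)) (W \<inter> proj F -` (proj E ` ?V))"
      using F.elementary_vimage[OF W(1) proj_open[OF V]] elementary_openin by blast
    moreover have "W \<inter> proj F -` (proj E ` ?V) \<subseteq> \<phi> ` U"
    proof clarify
      fix w e' assume w: "w \<in> W" "proj F w = proj E e'" "e' \<in> U" "\<phi> e' \<in> W"
      then have "w = \<phi> e'" using pr[OF w(3)] by (intro inj_onD[OF elementary_inj[OF W(1)]]) simp_all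
      then show "w \<in> \<phi> ` U" using w by simp
    qed
    ultimately show "\<exists>T. openin (mtop (total F)) T \<and> \<phi> e \<in> T \<and> T \<subseteq> \<phi> ` U"
      using e W UE pr by (intro exI[of _ "W \<inter> proj F -` (proj E ` ?V)"]) auto
  qed
  ultimately show "elementary F (\<phi> ` U)" by (simp add: elementary_def)
qed

end

section \<open>Tensor products\<close>

lemma tensor_relations_cases [consumes 1, case_names add_left add_right balanced]:
  assumes "n \<in> tensor_relations R C D"
  obtains c c' d where "n = frag_of (c \<oplus>\<^bsub>C\<^esub> c', d) - frag_of (c, d) - frag_of (c', d)"
      "c \<in> carrier C" "c' \<in> carrier C" "d \<in> carrier D"
  | c d d' where "n = frag_of (c, d \<oplus>\<^bsub>D\<^esub> d') - frag_of (c, d) - frag_of (c, d')"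
      "c \<in> carrier C" "d \<in> carrier D" "d' \<in> carrier D"
  | r c d where "n = frag_of (r \<odot>\<^bsub>C\<^esub> c, d) - frag_of (c, r \<odot>\<^bsub>D\<^esub> d)"
      "r \<in> R" "c \<in> carrier C" "d \<in> carrier D"
  using assms unfolding tensor_relations_def by blast

lemma tensor_relations_add_left:
    "c \<in> carrier C \<Longrightarrow> c' \<in> carrier C \<Longrightarrow> d \<in> carrier D \<Longrightarrow>
      frag_of (c \<oplus>\<^bsub>C\<^esub> c', d) - frag_of (c, d) - frag_of (c', d) \<in> tensor_relations R C D"
  and tensor_relations_add_right:
    "c \<in> carrier C \<Longrightarrow> d \<in> carrier D \<Longrightarrow> d' \<in> carrier D \<Longrightarrow>
      frag_of (c, d \<oplus>\<^bsub>D\<^esub> d') - frag_of (c, d) - frag_of (c, d') \<in> tensor_relations R C D"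
  and tensor_relations_balanced:
    "r \<in> R \<Longrightarrow> c \<in> carrier C \<Longrightarrow> d \<in> carrier D \<Longrightarrow>
      frag_of (r \<odot>\<^bsub>C\<^esub> c, d) - frag_of (c, r \<odot>\<^bsub>D\<^esub> d) \<in> tensor_relations R C D"
  unfolding tensor_relations_def by blast+

lemma
  assumes "linear_map R C D h"
  shows linear_map_closed: "c \<in> carrier C \<Longrightarrow> h c \<in> carrier D"
    and linear_map_add: "c \<in> carrier C \<Longrightarrow> d \<in> carrier C \<Longrightarrow> h (c \<oplus>\<^bsub>C\<^esub> d) = h c \<oplus>\<^bsub>D\<^esub> h d"
    and linear_map_smult: "r \<in> R \<Longrightarrow> c \<in> carrier C \<Longrightarrow> h (r \<odot>\<^bsub>C\<^esub> c) = r \<odot>\<^bsub>D\<^esub> h c"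
  using assms by (auto simp: linear_map_def)

text \<open>Only closure of the operations is required, so that the same facts serve modules over
  \<open>Cc M\<close> and stalks over the ring of germs, for which no module laws are
  established.\<close>

locale tensor_pair =
  fixes R :: "'r set" and C :: "('r, 'c, 'z) module_scheme" and D :: "('r, 'd, 'w) module_scheme"
  assumes add_closed_left: "\<And>c c'. c \<in> carrier C \<Longrightarrow> c' \<in> carrier C \<Longrightarrow> c \<oplus>\<^bsub>C\<^esub> c' \<in> carrier C"
    and add_closed_right: "\<And>d d'. d \<in> carrier D \<Longrightarrow> d' \<in> carrier D \<Longrightarrow> d \<oplus>\<^bsub>D\<^esub> d' \<in> carrier D"
    and smult_closed_left: "\<And>r c. r \<in> R \<Longrightarrow> c \<in> carrier C \<Longrightarrow> r \<odot>\<^bsub>C\<^esub> c \<in> carrier C"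
    and smult_closed_right: "\<And>r d. r \<in> R \<Longrightarrow> d \<in> carrier D \<Longrightarrow> r \<odot>\<^bsub>D\<^esub> d \<in> carrier D"
begin

definition frags :: "('c \<times> 'd \<Rightarrow>\<^sub>0 int) set" where
  "frags = {t. Poly_Mapping.keys t \<subseteq> carrier C \<times> carrier D}"

definition null_frags :: "('c \<times> 'd \<Rightarrow>\<^sub>0 int) set" where
  "null_frags = generate (free_Abelian_group (carrier C \<times> carrier D)) (tensor_relations R C D)"

abbreviation "cls \<equiv> tensor_class R C D"
abbreviation "pure \<equiv> pure_tensor R C D"

lemma frags_0 [simp]: "0 \<in> frags"
  and frags_add: "t \<in> frags \<Longrightarrow> u \<in> frags \<Longrightarrow> t + u \<in> frags"
  and frags_uminus: "t \<in> frags \<Longrightarrow> - t \<in> frags"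
  and frags_diff: "t \<in> frags \<Longrightarrow> u \<in> frags \<Longrightarrow> t - u \<in> frags"
  and frags_of [simp]: "frag_of (c, d) \<in> frags \<longleftrightarrow> c \<in> carrier C \<and> d \<in> carrier D"
  unfolding frags_def using keys_add[of t u] keys_diff[of t u] by auto

lemma frags_induct [consumes 1, case_names zero pure diff]:
  assumes "t \<in> frags" "P 0" "\<And>c d. c \<in> carrier C \<Longrightarrow> d \<in> carrier D \<Longrightarrow> P (frag_of (c, d))"
    and "\<And>t u. t \<in> frags \<Longrightarrow> u \<in> frags \<Longrightarrow> P t \<Longrightarrow> P u \<Longrightarrow> P (t - u)"
  shows "P t"
proof -
  have "Poly_Mapping.keys t \<subseteq> carrier C \<times> carrier D" using assms(1) by (simp add: frags_def)
  then have "t \<in> frags \<and> P t"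
    by (induction t rule: frag_induction) (use assms frags_diff in auto)
  then show ?thesis ..
qed

lemma tensor_relations_subset: "tensor_relations R C D \<subseteq> frags"
  unfolding tensor_relations_def
  by (auto intro!: frags_diff add_closed_left add_closed_right smult_closed_left smult_closed_right)

lemma null_frags_induct [consumes 1, case_names zero rel add uminus]:
  assumes "n \<in> null_frags" "P 0" "\<And>r. r \<in> tensor_relations R C D \<Longrightarrow> P r"
    and "\<And>a b. P a \<Longrightarrow> P b \<Longrightarrow> P (a + b)" "\<And>a. P a \<Longrightarrow> P (- a)"
  shows "P n"
  using assms(1) unfolding null_frags_def
proof (induction rule: generate.induct)
  case (inv h)
  \<comment> \<open>The group inverse in \<open>free_Abelian_group\<close> is negation on the
    carrier, hence the membership.\<close>
  then have "h \<in> frags" using tensor_relations_subset by blast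
  then show ?case using assms(3,5) inv by (simp add: frags_def)
qed (use assms in auto)

lemma null_frags_0: "0 \<in> null_frags"
  and null_frags_rel: "r \<in> tensor_relations R C D \<Longrightarrow> r \<in> null_frags"
  and null_frags_add: "a \<in> null_frags \<Longrightarrow> b \<in> null_frags \<Longrightarrow> a + b \<in> null_frags"
  unfolding null_frags_def
  using generate.one[of "free_Abelian_group (carrier C \<times> carrier D)"] generate.incl
    generate.eng[of _ "free_Abelian_group (carrier C \<times> carrier D)"] by auto

lemma null_frags_subset: "null_frags \<subseteq> frags"
proof
  fix n assume "n \<in> null_frags"
  then show "n \<in> frags"
    by (induction rule: null_frags_induct) (use tensor_relations_subset frags_add frags_uminus in auto)
qed

lemma null_frags_uminus:
  assumes "a \<in> null_frags" shows "- a \<in> null_frags"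
proof -
  have G: "group (free_Abelian_group (carrier C \<times> carrier D))" by simp
  have "tensor_relations R C D \<subseteq> carrier (free_Abelian_group (carrier C \<times> carrier D))"
    using tensor_relations_subset by (auto simp: frags_def)
  then have "inv\<^bsub>free_Abelian_group (carrier C \<times> carrier D)\<^esub> a \<in> null_frags"
    using group.generate_m_inv_closed[OF G] assms unfolding null_frags_def by blast
  then show ?thesis using assms null_frags_subset by (auto simp: frags_def)
qed

lemma null_frags_diff: "a \<in> null_frags \<Longrightarrow> b \<in> null_frags \<Longrightarrow> a - b \<in> null_frags"
  using null_frags_add[of a "- b"] null_frags_uminus[of b] by simp

lemma mem_cls_iff: "u \<in> cls t \<longleftrightarrow> u - t \<in> null_frags"
proof -
  have "cls t = (\<Union>n\<in>null_frags. {n + t})"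
    by (simp add: tensor_class_def Let_def r_coset_def null_frags_def)
  then show ?thesis by (auto simp: algebra_simps) (metis diff_add_cancel)
qed

lemma cls_self: "t \<in> cls t"
  by (simp add: mem_cls_iff null_frags_0)

lemma cls_eq_iff: "cls t = cls u \<longleftrightarrow> t - u \<in> null_frags"
proof
  assume "cls t = cls u" then show "t - u \<in> null_frags" using cls_self[of t] mem_cls_iff by simp
next
  assume *: "t - u \<in> null_frags"
  have "v - t \<in> null_frags \<longleftrightarrow> v - u \<in> null_frags" for v
    using null_frags_add[OF _ *, of "v - t"] null_frags_diff[OF _ *, of "v - u"] by auto
  then show "cls t = cls u" by (auto simp: mem_cls_iff)
qed

lemma cls_subset: "t \<in> frags \<Longrightarrow> u \<in> cls t \<Longrightarrow> u \<in> frags"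
  using null_frags_subset frags_add[of "u - t" t] by (auto simp: mem_cls_iff)

text \<open>Scalar multiplication, induced maps and lifts on the tensor product are all defined by
  \<open>the_elem\<close> over a coset; each of them is evaluated by this independence of the
  representative.\<close>

lemma the_elem_cls:
  assumes "\<And>u. u \<in> cls t \<Longrightarrow> F u = F t"
  shows "the_elem (F ` cls t) = F t"
proof -
  have "F ` cls t \<subseteq> {F t}" using assms by blast
  then have "F ` cls t = {F t}" using cls_self[of t] by blast
  then show ?thesis by simp
qed

lemma tensor_carrier: "carrier (tensor R C D) = cls ` frags"
  by (auto simp: tensor_def tensor_class_def Let_def FactGroup_def RCOSETS_def frags_def)

lemma tensor_zero: "\<zero>\<^bsub>tensor R C D\<^esub> = cls 0"
proof -
  have "\<zero>\<^bsub>tensor R C D\<^esub> = null_frags" by (simp add: tensor_def Let_def null_frags_def)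
  also have "\<dots> = cls 0" by (auto simp: mem_cls_iff)
  finally show ?thesis .
qed

lemma tensor_add: "cls t \<oplus>\<^bsub>tensor R C D\<^esub> cls u = cls (t + u)"
proof -
  have "cls t \<oplus>\<^bsub>tensor R C D\<^esub> cls u = {a + b | a b. a \<in> cls t \<and> b \<in> cls u}"
    by (auto simp: tensor_def Let_def set_mult_def)
  also have "\<dots> = cls (t + u)"
  proof safe
    fix a b assume "a \<in> cls t" "b \<in> cls u"
    then show "a + b \<in> cls (t + u)" using null_frags_add[of "a - t" "b - u"] by (simp add: mem_cls_iff algebra_simps)
  next
    fix v assume "v \<in> cls (t + u)"
    then have "v - u \<in> cls t" by (simp add: mem_cls_iff algebra_simps)
    then show "\<exists>a b. v = a + b \<and> a \<in> cls t \<and> b \<in> cls u"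
      using cls_self by (intro exI[of _ "v - u"] exI[of _ u]) simp
  qed
  finally show ?thesis .
qed

lemma tensor_abelian_group: "abelian_group (tensor R C D)"
proof (rule abelian_groupI)
  fix x assume "x \<in> carrier (tensor R C D)"
  then obtain t where t: "t \<in> frags" "x = cls t" by (auto simp: tensor_carrier)
  then have "cls (- t) \<in> carrier (tensor R C D)" by (auto simp: tensor_carrier frags_uminus)
  then show "\<exists>y\<in>carrier (tensor R C D). y \<oplus>\<^bsub>tensor R C D\<^esub> x = \<zero>\<^bsub>tensor R C D\<^esub>"
    using t by (intro bexI) (auto simp: tensor_zero tensor_add)
qed (auto simp: tensor_carrier tensor_zero tensor_add frags_add algebra_simps)

lemma pure_closed: "c \<in> carrier C \<Longrightarrow> d \<in> carrier D \<Longrightarrow> pure c d \<in> carrier (tensor R C D)"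
  by (simp add: pure_tensor_def tensor_carrier)

lemma pure_add_left:
  "c \<in> carrier C \<Longrightarrow> c' \<in> carrier C \<Longrightarrow> d \<in> carrier D \<Longrightarrow>
    pure (c \<oplus>\<^bsub>C\<^esub> c') d = pure c d \<oplus>\<^bsub>tensor R C D\<^esub> pure c' d"
  unfolding pure_tensor_def tensor_add cls_eq_iff
  by (rule null_frags_rel) (auto simp: tensor_relations_def diff_diff_eq)

lemma pure_add_right:
  "c \<in> carrier C \<Longrightarrow> d \<in> carrier D \<Longrightarrow> d' \<in> carrier D \<Longrightarrow>
    pure c (d \<oplus>\<^bsub>D\<^esub> d') = pure c d \<oplus>\<^bsub>tensor R C D\<^esub> pure c d'"
  unfolding pure_tensor_def tensor_add cls_eq_iff
  by (rule null_frags_rel) (auto simp: tensor_relations_def diff_diff_eq)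

lemma pure_balanced:
  "r \<in> R \<Longrightarrow> c \<in> carrier C \<Longrightarrow> d \<in> carrier D \<Longrightarrow> pure (r \<odot>\<^bsub>C\<^esub> c) d = pure c (r \<odot>\<^bsub>D\<^esub> d)"
  unfolding pure_tensor_def cls_eq_iff
  by (rule null_frags_rel) (auto simp: tensor_relations_def)

text \<open>Subtraction appears as an equation V + U = T between classes, so that an additive map
  can be followed through the step by cancellation.\<close>

lemma tensor_induct [consumes 1, case_names pure zero diff]:
  assumes "T \<in> carrier (tensor R C D)"
    and "\<And>c d. c \<in> carrier C \<Longrightarrow> d \<in> carrier D \<Longrightarrow> P (pure c d)"
    and "P \<zero>\<^bsub>tensor R C D\<^esub>"
    and "\<And>T U V. T \<in> carrier (tensor R C D) \<Longrightarrow> U \<in> carrier (tensor R C D) \<Longrightarrow> V \<in> carrier (tensor R C D) \<Longrightarrow>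
      V \<oplus>\<^bsub>tensor R C D\<^esub> U = T \<Longrightarrow> P T \<Longrightarrow> P U \<Longrightarrow> P V"
  shows "P T"
proof -
  have "P (cls t)" if "t \<in> frags" for t using that
  proof (induction t rule: frags_induct)
    case (diff t u)
    then show ?case
      using assms(4)[of "cls t" "cls u" "cls (t - u)"] by (auto simp: tensor_carrier tensor_add frags_diff)
  qed (use assms in \<open>auto simp: tensor_zero pure_tensor_def\<close>)
  then show ?thesis using assms(1) by (auto simp: tensor_carrier)
qed

text \<open>The scalar rings of source and target may differ, so instead of linearity it is required
  that each defining relation is sent to a null fragment. Both linear maps and the passage to stalks
  satisfy this.\<close>

lemma tensor_map_cls:
  assumes TP: "tensor_pair S C' D'"
    and rel: "\<And>n. n \<in> tensor_relations R C D \<Longrightarrow>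
      frag_extend (\<lambda>(c, d). frag_of (g c, h d)) n \<in> tensor_pair.null_frags S C' D'"
  shows "tensor_map S C' D' g h (cls t) = tensor_class S C' D' (frag_extend (\<lambda>(c, d). frag_of (g c, h d)) t)"
  unfolding tensor_map_def
proof (rule the_elem_cls)
  interpret T: tensor_pair S C' D' by (rule TP)
  let ?F = "frag_extend (\<lambda>(c, d). frag_of (g c, h d))"
  fix u assume "u \<in> cls t"
  then have "u - t \<in> null_frags" by (simp add: mem_cls_iff)
  then have "?F (u - t) \<in> T.null_frags"
    by (induction rule: null_frags_induct)
      (use rel T.null_frags_0 T.null_frags_add T.null_frags_uminus in \<open>auto simp: frag_extend_add frag_extend_minus\<close>)
  then show "T.cls (?F u) = T.cls (?F t)" by (simp add: T.cls_eq_iff frag_extend_diff)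
qed

end

lemma tensor_map_linear_rel:
  assumes TP: "tensor_pair R C D" and TP': "tensor_pair R C' D'"
    and g: "linear_map R C C' g" and h: "linear_map R D D' h" and n: "n \<in> tensor_relations R C D"
  shows "frag_extend (\<lambda>(c, d). frag_of (g c, h d)) n \<in> tensor_pair.null_frags R C' D'"
proof -
  interpret T': tensor_pair R C' D' by (rule TP')
  have "frag_extend (\<lambda>(c, d). frag_of (g c, h d)) n \<in> tensor_relations R C' D'"
    using n
  proof (cases rule: tensor_relations_cases)
    case (add_left c c' d)
    then show ?thesis
      using tensor_relations_add_left[of "g c" C' "g c'" "h d" D'] linear_map_add[OF g]
      by (simp add: frag_extend_diff linear_map_closed[OF g] linear_map_closed[OF h])
  next
    case (add_right c d d')
    then show ?thesis
      using tensor_relations_add_right[of "g c" C' "h d" D' "h d'"] linear_map_add[OF h]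
      by (simp add: frag_extend_diff linear_map_closed[OF g] linear_map_closed[OF h])
  next
    case (balanced r c d)
    then show ?thesis
      using tensor_relations_balanced[of r R "g c" C' "h d" D'] linear_map_smult[OF g] linear_map_smult[OF h]
      by (simp add: frag_extend_diff linear_map_closed[OF g] linear_map_closed[OF h])
  qed
  then show ?thesis by (rule T'.null_frags_rel)
qed

section \<open>Integer combinations in an abelian group\<close>

text \<open>The expression under \<open>the_elem\<close> in \<open>tensor_lift\<close>, isolated in
  order to evaluate lifts and, later, to read off coefficients of tensors.\<close>

definition frag_sum :: "('c, 'z) ring_scheme \<Rightarrow> ('p \<Rightarrow> 'c) \<Rightarrow> ('p \<Rightarrow>\<^sub>0 int) \<Rightarrow> 'c" where
  "frag_sum G b t = (\<Oplus>\<^bsub>G\<^esub>p\<in>Poly_Mapping.keys t. add_pow G (Poly_Mapping.lookup t p) (b p))"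

context abelian_group
begin

lemma add_pow_int_closed: "x \<in> carrier G \<Longrightarrow> add_pow G (k::int) x \<in> carrier G"
  by (rule add.int_pow_closed)

text \<open>Keys of a sum may cancel, so both summands and their sum are computed over the union of
  the key sets, with zero terms added.\<close>

lemma frag_sum_superset:
  assumes "finite A" "Poly_Mapping.keys t \<subseteq> A" "b \<in> A \<rightarrow> carrier G"
  shows "frag_sum G b t = (\<Oplus>p\<in>A. add_pow G (Poly_Mapping.lookup t p) (b p))"
  unfolding frag_sum_def
proof (rule add.finprod_mono_neutral_cong_left)
  show "add_pow G (Poly_Mapping.lookup t i) (b i) = \<zero>" if "i \<in> A - Poly_Mapping.keys t" for i
    using that by (simp add: in_keys_iff add_pow_def)
  show "(\<lambda>p. add_pow G (Poly_Mapping.lookup t p) (b p)) \<in> A \<rightarrow> carrier G"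
    using assms(3) by (auto intro: add_pow_int_closed)
qed (use assms in auto)

lemma frag_sum_closed: "b \<in> Poly_Mapping.keys t \<rightarrow> carrier G \<Longrightarrow> frag_sum G b t \<in> carrier G"
  unfolding frag_sum_def by (rule finsum_closed) (auto intro: add_pow_int_closed)

lemma frag_sum_add:
  assumes "b \<in> Poly_Mapping.keys t \<rightarrow> carrier G" "b \<in> Poly_Mapping.keys u \<rightarrow> carrier G"
  shows "frag_sum G b (t + u) = frag_sum G b t \<oplus> frag_sum G b u"
proof -
  let ?A = "Poly_Mapping.keys t \<union> Poly_Mapping.keys u"
  have b: "b \<in> ?A \<rightarrow> carrier G" using assms by auto
  have "frag_sum G b (t + u) = (\<Oplus>p\<in>?A. add_pow G (Poly_Mapping.lookup (t + u) p) (b p))"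
    by (rule frag_sum_superset) (use b keys_add[of t u] in auto)
  also have "\<dots> = (\<Oplus>p\<in>?A. add_pow G (Poly_Mapping.lookup t p) (b p) \<oplus> add_pow G (Poly_Mapping.lookup u p) (b p))"
    using b by (intro finsum_cong') (auto simp: lookup_add Pi_iff intro!: add.int_pow_mult)
  also have "\<dots> = (\<Oplus>p\<in>?A. add_pow G (Poly_Mapping.lookup t p) (b p)) \<oplus> (\<Oplus>p\<in>?A. add_pow G (Poly_Mapping.lookup u p) (b p))"
    using b by (intro finsum_addf) (auto intro!: add_pow_int_closed)
  also have "\<dots> = frag_sum G b t \<oplus> frag_sum G b u"
    using b by (subst (1 2) frag_sum_superset[of ?A]) auto
  finally show ?thesis .
qed

lemma frag_sum_0: "frag_sum G b 0 = \<zero>"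
  by (simp add: frag_sum_def)

lemma frag_sum_of: "b p \<in> carrier G \<Longrightarrow> frag_sum G b (frag_of p) = b p"
  by (simp add: frag_sum_def)

lemma frag_sum_uminus:
  assumes "b \<in> Poly_Mapping.keys t \<rightarrow> carrier G"
  shows "frag_sum G b (- t) = \<ominus> frag_sum G b t"
proof -
  have "frag_sum G b (- t) \<oplus> frag_sum G b t = \<zero>"
    using frag_sum_add[of b "- t" t] assms by (simp add: frag_sum_0)
  then show ?thesis
    using frag_sum_closed[of b t] frag_sum_closed[of b "- t"] assms by (simp add: minus_equality)
qed

lemma tensor_lift_cls:
  assumes TP: "tensor_pair R C D"
    and \<beta>: "\<And>c d. c \<in> carrier C \<Longrightarrow> d \<in> carrier D \<Longrightarrow> \<beta> c d \<in> carrier G"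
    and rel: "\<And>n. n \<in> tensor_relations R C D \<Longrightarrow> frag_sum G (\<lambda>p. \<beta> (fst p) (snd p)) n = \<zero>"
    and t: "t \<in> tensor_pair.frags C D"
  shows "tensor_lift G \<beta> (tensor_class R C D t) = frag_sum G (\<lambda>p. \<beta> (fst p) (snd p)) t"
proof -
  interpret T: tensor_pair R C D by (rule TP)
  let ?b = "\<lambda>p. \<beta> (fst p) (snd p)"
  have b: "?b \<in> Poly_Mapping.keys u \<rightarrow> carrier G" if "u \<in> T.frags" for u
    using that \<beta> by (auto simp: T.frags_def)
  have "frag_sum G ?b u = frag_sum G ?b t" if u: "u \<in> T.cls t" for u
  proof -
    have n: "u - t \<in> T.null_frags" using u by (simp add: T.mem_cls_iff)
    then have "u - t \<in> T.frags \<and> frag_sum G ?b (u - t) = \<zero>"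
    proof (induction rule: T.null_frags_induct)
      case (rel r)
      then show ?case using assms(3) T.tensor_relations_subset by auto
    qed (auto simp: frag_sum_0 frag_sum_add frag_sum_uminus b T.frags_add T.frags_uminus)
    then have "frag_sum G ?b (u - t + t) = \<zero> \<oplus> frag_sum G ?b t"
      using t b by (subst frag_sum_add) auto
    then show ?thesis using frag_sum_closed[OF b[OF t]] by simp
  qed
  then show ?thesis
    unfolding tensor_lift_def frag_sum_def[symmetric] by (rule T.the_elem_cls)
qed

end

section \<open>Locally unitary modules\<close>

locale lu_module =
  fixes R :: "'r::comm_ring set" and C :: "('r, 'c, 'z) module_scheme" (structure)
  assumes lu: "locally_unitary_module R C"

sublocale lu_module \<subseteq> abelian_group C
  using lu by (simp add: locally_unitary_module_def)

context lu_module
begin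

lemma smult_closed [simp]: "r \<in> R \<Longrightarrow> c \<in> carrier C \<Longrightarrow> r \<odot> c \<in> carrier C"
  and smult_l_distr: "r \<in> R \<Longrightarrow> s \<in> R \<Longrightarrow> c \<in> carrier C \<Longrightarrow> (r + s) \<odot> c = r \<odot> c \<oplus> s \<odot> c"
  and smult_r_distr: "r \<in> R \<Longrightarrow> c \<in> carrier C \<Longrightarrow> d \<in> carrier C \<Longrightarrow> r \<odot> (c \<oplus> d) = r \<odot> c \<oplus> r \<odot> d"
  and smult_assoc: "r \<in> R \<Longrightarrow> s \<in> R \<Longrightarrow> c \<in> carrier C \<Longrightarrow> (r * s) \<odot> c = r \<odot> (s \<odot> c)"
  and unit_exists: "finite F \<Longrightarrow> F \<subseteq> carrier C \<Longrightarrow> \<exists>r\<in>R. \<forall>c\<in>F. r \<odot> c = c"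
  using lu by (simp_all add: locally_unitary_module_def)

lemma smult_commute: "r \<in> R \<Longrightarrow> s \<in> R \<Longrightarrow> c \<in> carrier C \<Longrightarrow> r \<odot> (s \<odot> c) = s \<odot> (r \<odot> c)"
  using smult_assoc by (metis mult.commute)

lemma smult_zero: "r \<in> R \<Longrightarrow> r \<odot> \<zero> = \<zero>"
  using smult_r_distr[of r \<zero> \<zero>] by (simp add: add.l_cancel_one')

lemma smult_minus: "r \<in> R \<Longrightarrow> c \<in> carrier C \<Longrightarrow> r \<odot> (\<ominus> c) = \<ominus> (r \<odot> c)"
  using smult_r_distr[of r "\<ominus> c" c] by (simp add: smult_zero l_neg minus_equality)

lemma zero_smult: "0 \<in> R \<Longrightarrow> c \<in> carrier C \<Longrightarrow> 0 \<odot> c = \<zero>"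
  using smult_l_distr[of 0 0 c] by (simp add: add.l_cancel_one')

lemma tensor_pair: "lu_module R D \<Longrightarrow> tensor_pair R C D"
  by unfold_locales (simp_all add: lu_module.smult_closed abelian_group.axioms(1)
      abelian_monoid.a_closed lu_module_def locally_unitary_module_def)

end

lemma linear_map_zero:
  assumes h: "linear_map R C D h" and "abelian_group C" "abelian_group D"
  shows "h \<zero>\<^bsub>C\<^esub> = \<zero>\<^bsub>D\<^esub>"
proof -
  interpret C: abelian_group C by fact
  interpret D: abelian_group D by fact
  show ?thesis using linear_map_add[OF h, of "\<zero>\<^bsub>C\<^esub>" "\<zero>\<^bsub>C\<^esub>"] linear_map_closed[OF h, of "\<zero>\<^bsub>C\<^esub>"]
    by (simp add: D.add.l_cancel_one')
qed

lemma linear_map_compose: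
  assumes "lu_module R C" "linear_map R C D g" "linear_map R D G h"
  shows "linear_map R C G (compose (carrier C) h g)"
proof -
  interpret lu_module R C by fact
  show ?thesis using assms(2,3) by (auto simp: linear_map_def compose_def Pi_iff)
qed

locale lu_module_pair = C: lu_module R C + D: lu_module R D
  for R :: "'r::comm_ring set" and C :: "('r, 'c, 'z) module_scheme" and D :: "('r, 'd, 'w) module_scheme"

sublocale lu_module_pair \<subseteq> tensor_pair R C D
  by (rule C.tensor_pair) unfold_locales

context lu_module_pair
begin

abbreviation smult_frag :: "'r \<Rightarrow> ('c \<times> 'd \<Rightarrow>\<^sub>0 int) \<Rightarrow> ('c \<times> 'd \<Rightarrow>\<^sub>0 int)" where
  "smult_frag r \<equiv> frag_extend (\<lambda>(c, d). frag_of (r \<odot>\<^bsub>C\<^esub> c, d))"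

lemma smult_frag_closed:
  assumes "r \<in> R" "t \<in> frags" shows "smult_frag r t \<in> frags"
  using assms(2) by (induction rule: frags_induct) (auto simp: frag_extend_diff frags_diff assms(1))

lemma smult_frag_null:
  assumes r: "r \<in> R" and n: "n \<in> null_frags" shows "smult_frag r n \<in> null_frags"
  using n
proof (induction rule: null_frags_induct)
  case (rel n)
  then have "smult_frag r n \<in> tensor_relations R C D"
  proof (cases rule: tensor_relations_cases)
    case (add_left c c' d)
    then show ?thesis
      using r tensor_relations_add_left[of "r \<odot>\<^bsub>C\<^esub> c" C "r \<odot>\<^bsub>C\<^esub> c'"] by (simp add: frag_extend_diff C.smult_r_distr)
  next
    case (add_right c d d')
    then show ?thesis
      using r tensor_relations_add_right[of "r \<odot>\<^bsub>C\<^esub> c" C] by (simp add: frag_extend_diff)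
  next
    case (balanced s c d)
    then show ?thesis
      using r tensor_relations_balanced[of s R "r \<odot>\<^bsub>C\<^esub> c" C d D] C.smult_commute[OF r balanced(2)]
      by (simp add: frag_extend_diff)
  qed
  then show ?case by (rule null_frags_rel)
qed (auto simp: null_frags_0 frag_extend_add frag_extend_minus null_frags_add null_frags_uminus)

lemma tensor_smult: "r \<in> R \<Longrightarrow> r \<odot>\<^bsub>tensor R C D\<^esub> cls t = cls (smult_frag r t)"
proof -
  assume r: "r \<in> R"
  have "the_elem ((\<lambda>t. cls (smult_frag r t)) ` cls t) = cls (smult_frag r t)"
  proof (rule the_elem_cls)
    fix u assume "u \<in> cls t"
    then show "cls (smult_frag r u) = cls (smult_frag r t)"
      using smult_frag_null[OF r, of "u - t"] by (simp add: mem_cls_iff cls_eq_iff frag_extend_diff)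
  qed
  then show ?thesis by (simp add: tensor_def Let_def)
qed

lemma tensor_smult_pure: "r \<in> R \<Longrightarrow> r \<odot>\<^bsub>tensor R C D\<^esub> pure c d = pure (r \<odot>\<^bsub>C\<^esub> c) d"
  by (simp add: pure_tensor_def tensor_smult)

lemma smult_frag_unit:
  assumes "\<And>p. p \<in> Poly_Mapping.keys t \<Longrightarrow> r \<odot>\<^bsub>C\<^esub> fst p = fst p"
  shows "smult_frag r t = t"
proof -
  have "smult_frag r t = frag_extend frag_of t"
    by (rule frag_extend_eq) (use assms in auto)
  then show ?thesis by (metis frag_expansion)
qed

text \<open>On fragments the two sides differ: (r + s) c is one generator and r c, s c are two. They
  are identified by additivity of the tensor product in its left argument, so the equality concerns
  classes.\<close>

lemma smult_frag_add_scalar: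
  assumes "r \<in> R" "s \<in> R" "t \<in> frags"
  shows "cls (smult_frag (r + s) t) = cls (smult_frag r t + smult_frag s t)"
  using assms(3)
proof (induction rule: frags_induct)
  case (pure c d)
  then show ?case
    using assms pure_add_left[of "r \<odot>\<^bsub>C\<^esub> c" "s \<odot>\<^bsub>C\<^esub> c" d] tensor_add
    by (simp add: C.smult_l_distr pure_tensor_def)
next
  case (diff t u)
  then show ?case
    using null_frags_diff[of "smult_frag (r + s) t - (smult_frag r t + smult_frag s t)"
        "smult_frag (r + s) u - (smult_frag r u + smult_frag s u)"]
    by (simp add: cls_eq_iff frag_extend_diff algebra_simps)
qed simp

lemma smult_frag_assoc:
  assumes "r \<in> R" "s \<in> R" "t \<in> frags"
  shows "smult_frag (r * s) t = smult_frag r (smult_frag s t)"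
  using assms(3) by (induction rule: frags_induct) (auto simp: frag_extend_diff C.smult_assoc assms)

lemma tensor_lu_module: "lu_module R (tensor R C D)"
proof
  let ?T = "tensor R C D"
  have 1: "\<forall>r\<in>R. \<forall>c\<in>carrier ?T. r \<odot>\<^bsub>?T\<^esub> c \<in> carrier ?T"
    by (auto simp: tensor_carrier tensor_smult smult_frag_closed)
  have 2: "\<forall>r\<in>R. \<forall>s\<in>R. \<forall>c\<in>carrier ?T. (r + s) \<odot>\<^bsub>?T\<^esub> c = r \<odot>\<^bsub>?T\<^esub> c \<oplus>\<^bsub>?T\<^esub> s \<odot>\<^bsub>?T\<^esub> c"
  proof (intro ballI)
    fix r s T assume *: "r \<in> R" "s \<in> R" "T \<in> carrier ?T"
    \<comment> \<open>The set of scalars is not assumed closed under addition, so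
      \<open>tensor_smult\<close> does not apply to r + s and independence of the representative is
      checked directly. The product r * s is treated in the same way below.\<close>
    have sum: "(r + s) \<odot>\<^bsub>?T\<^esub> cls t = cls (smult_frag (r + s) t)" if "t \<in> frags" for t
    proof -
      have "cls (smult_frag (r + s) u) = cls (smult_frag (r + s) t)" if "u \<in> cls t" for u
      proof -
        have "u \<in> frags" using cls_subset \<open>t \<in> frags\<close> that by blast
        then have "cls (smult_frag (r + s) u) = cls (smult_frag r u) \<oplus>\<^bsub>?T\<^esub> cls (smult_frag s u)"
          using smult_frag_add_scalar[OF *(1,2)] by (simp add: tensor_add)
        also have "\<dots> = cls (smult_frag r t) \<oplus>\<^bsub>?T\<^esub> cls (smult_frag s t)"
          using smult_frag_null[OF *(1), of "u - t"] smult_frag_null[OF *(2), of "u - t"] that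
          by (simp add: mem_cls_iff cls_eq_iff[symmetric] frag_extend_diff)
        also have "\<dots> = cls (smult_frag (r + s) t)"
          using smult_frag_add_scalar[OF *(1,2) \<open>t \<in> frags\<close>] by (simp add: tensor_add)
        finally show ?thesis .
      qed
      then show ?thesis
        using the_elem_cls[of t "\<lambda>t. cls (smult_frag (r + s) t)"] by (simp add: tensor_def Let_def)
    qed
    show "(r + s) \<odot>\<^bsub>?T\<^esub> T = r \<odot>\<^bsub>?T\<^esub> T \<oplus>\<^bsub>?T\<^esub> s \<odot>\<^bsub>?T\<^esub> T"
      using * sum by (auto simp: tensor_carrier tensor_smult tensor_add smult_frag_add_scalar)
  qed
  have 3: "\<forall>r\<in>R. \<forall>c\<in>carrier ?T. \<forall>d\<in>carrier ?T. r \<odot>\<^bsub>?T\<^esub> (c \<oplus>\<^bsub>?T\<^esub> d) = r \<odot>\<^bsub>?T\<^esub> c \<oplus>\<^bsub>?T\<^esub> r \<odot>\<^bsub>?T\<^esub> d"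
    by (auto simp: tensor_carrier tensor_smult tensor_add frag_extend_add)
  have 4: "\<forall>r\<in>R. \<forall>s\<in>R. \<forall>c\<in>carrier ?T. (r * s) \<odot>\<^bsub>?T\<^esub> c = r \<odot>\<^bsub>?T\<^esub> (s \<odot>\<^bsub>?T\<^esub> c)"
  proof (intro ballI)
    fix r s T assume *: "r \<in> R" "s \<in> R" "T \<in> carrier ?T"
    then obtain t where t: "t \<in> frags" "T = cls t" by (auto simp: tensor_carrier)
    have "cls (smult_frag (r * s) u) = cls (smult_frag (r * s) t)" if "u \<in> cls t" for u
    proof -
      have "u - t \<in> null_frags" using that by (simp add: mem_cls_iff)
      then have "smult_frag r (smult_frag s (u - t)) \<in> null_frags"
        using * smult_frag_null by blast
      then have "smult_frag (r * s) u - smult_frag (r * s) t \<in> null_frags"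
        using smult_frag_assoc[OF *(1,2)] cls_subset[OF t(1) that] t(1) by (simp add: frag_extend_diff)
      then show ?thesis by (simp add: cls_eq_iff)
    qed
    then have "(r * s) \<odot>\<^bsub>?T\<^esub> T = cls (smult_frag (r * s) t)"
      using the_elem_cls[of t "\<lambda>t. cls (smult_frag (r * s) t)"] t by (simp add: tensor_def Let_def)
    then show "(r * s) \<odot>\<^bsub>?T\<^esub> T = r \<odot>\<^bsub>?T\<^esub> (s \<odot>\<^bsub>?T\<^esub> T)"
      using * t by (simp add: tensor_smult smult_frag_assoc)
  qed
  have 5: "\<exists>r\<in>R. \<forall>c\<in>F. r \<odot>\<^bsub>?T\<^esub> c = c" if F: "finite F" "F \<subseteq> carrier ?T" for F
  proof -
    have "\<forall>T\<in>F. \<exists>t. t \<in> frags \<and> T = cls t" using F by (auto simp: tensor_carrier)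
    then obtain t where t: "\<And>T. T \<in> F \<Longrightarrow> t T \<in> frags" "\<And>T. T \<in> F \<Longrightarrow> T = cls (t T)" by metis
    \<comment> \<open>Scalars act through the left factors, so a local unit for the finitely many
      left factors of chosen representatives is one for the tensors.\<close>
    let ?F = "\<Union>T\<in>F. fst ` Poly_Mapping.keys (t T)"
    have "finite ?F" "?F \<subseteq> carrier C" using F t(1) by (auto simp: frags_def) fastforce
    then obtain r where r: "r \<in> R" "\<And>c. c \<in> ?F \<Longrightarrow> r \<odot>\<^bsub>C\<^esub> c = c" using C.unit_exists by meson
    have "r \<odot>\<^bsub>?T\<^esub> T = T" if T: "T \<in> F" for T
    proof -
      have "smult_frag r (t T) = t T" by (rule smult_frag_unit) (use r T in auto)
      then show ?thesis using tensor_smult[OF r(1), of "t T"] t(2)[OF T] by simp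
    qed
    then show ?thesis using r(1) by blast
  qed
  show "locally_unitary_module R ?T"
    using tensor_abelian_group 1 2 3 4 5 by (simp add: locally_unitary_module_def)
qed

lemma tensor_map_linear:
  assumes P': "lu_module_pair R C' D'" and g: "linear_map R C C' g" and h: "linear_map R D D' h"
  shows "linear_map R (tensor R C D) (tensor R C' D') (tensor_map R C' D' g h)"
    and "\<And>c d. tensor_map R C' D' g h (pure c d) = pure_tensor R C' D' (g c) (h d)"
proof -
  interpret P': lu_module_pair R C' D' by (rule P')
  let ?F = "frag_extend (\<lambda>(c, d). frag_of (g c, h d))"
  have cls: "tensor_map R C' D' g h (cls t) = P'.cls (?F t)" for t
    using tensor_map_cls[OF P'.tensor_pair_axioms tensor_map_linear_rel[OF tensor_pair_axioms P'.tensor_pair_axioms g h]] .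
  have fr: "?F t \<in> P'.frags" if "t \<in> frags" for t using that
    by (induction rule: frags_induct)
      (auto simp: frag_extend_diff P'.frags_diff linear_map_closed[OF g] linear_map_closed[OF h])
  have sm: "?F (smult_frag r t) = P'.smult_frag r (?F t)" if "r \<in> R" "t \<in> frags" for r t
    using that(2) by (induction rule: frags_induct)
      (auto simp: frag_extend_diff linear_map_smult[OF g] that)
  show "linear_map R (tensor R C D) (tensor R C' D') (tensor_map R C' D' g h)"
    unfolding linear_map_def
    by (auto simp: tensor_carrier P'.tensor_carrier cls fr tensor_add P'.tensor_add frag_extend_add
        tensor_smult P'.tensor_smult sm)
  show "tensor_map R C' D' g h (pure c d) = pure_tensor R C' D' (g c) (h d)" for c d
    by (simp add: pure_tensor_def cls)
qed

lemma tensor_map_pure: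
  assumes P': "lu_module_pair R C' D'" and g: "linear_map R C C' g" and h: "linear_map R D D' h"
  shows "tensor_map R C' D' g h (pure c d) = pure_tensor R C' D' (g c) (h d)"
  using tensor_map_linear(2)[OF assms] .

end

text \<open>Balancedness of \<beta> is split into two scalar laws because the left one also yields
  compatibility of the induced map with scalars. The intended maps are the two sides of the counit
  laws.\<close>

lemma (in lu_module_pair) tensor_lift_linear:
  assumes G: "lu_module R G"
    and closed: "\<And>c d. c \<in> carrier C \<Longrightarrow> d \<in> carrier D \<Longrightarrow> \<beta> c d \<in> carrier G"
    and add_left: "\<And>c c' d. c \<in> carrier C \<Longrightarrow> c' \<in> carrier C \<Longrightarrow> d \<in> carrier D \<Longrightarrow>
      \<beta> (c \<oplus>\<^bsub>C\<^esub> c') d = \<beta> c d \<oplus>\<^bsub>G\<^esub> \<beta> c' d"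
    and add_right: "\<And>c d d'. c \<in> carrier C \<Longrightarrow> d \<in> carrier D \<Longrightarrow> d' \<in> carrier D \<Longrightarrow>
      \<beta> c (d \<oplus>\<^bsub>D\<^esub> d') = \<beta> c d \<oplus>\<^bsub>G\<^esub> \<beta> c d'"
    and smult_left: "\<And>r c d. r \<in> R \<Longrightarrow> c \<in> carrier C \<Longrightarrow> d \<in> carrier D \<Longrightarrow> \<beta> (r \<odot>\<^bsub>C\<^esub> c) d = r \<odot>\<^bsub>G\<^esub> \<beta> c d"
    and smult_right: "\<And>r c d. r \<in> R \<Longrightarrow> c \<in> carrier C \<Longrightarrow> d \<in> carrier D \<Longrightarrow> \<beta> c (r \<odot>\<^bsub>D\<^esub> d) = r \<odot>\<^bsub>G\<^esub> \<beta> c d"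
  shows "linear_map R (tensor R C D) G (tensor_lift G \<beta>)"
    and "\<And>c d. c \<in> carrier C \<Longrightarrow> d \<in> carrier D \<Longrightarrow> tensor_lift G \<beta> (pure c d) = \<beta> c d"
proof -
  interpret G: lu_module R G by fact
  let ?b = "\<lambda>p. \<beta> (fst p) (snd p)"
  have b: "?b \<in> Poly_Mapping.keys u \<rightarrow> carrier G" if "u \<in> frags" for u
    using that closed by (auto simp: frags_def)
  have of: "frag_sum G ?b (frag_of (c, d)) = \<beta> c d" if "c \<in> carrier C" "d \<in> carrier D" for c d
    using closed that by (simp add: G.frag_sum_of)
  have diff: "frag_sum G ?b (t - u) = frag_sum G ?b t \<oplus>\<^bsub>G\<^esub> \<ominus>\<^bsub>G\<^esub> frag_sum G ?b u"
    if "t \<in> frags" "u \<in> frags" for t u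
    using G.frag_sum_add[OF b[OF that(1)], of "- u"] G.frag_sum_uminus[OF b[OF that(2)]] b that by simp
  have fr: "frag_of (c, d) - u \<in> frags" "frag_of (c, d) \<in> frags"
    if "u \<in> frags" "c \<in> carrier C" "d \<in> carrier D" for u c d
    using that frags_diff by auto
  have rel: "frag_sum G ?b n = \<zero>\<^bsub>G\<^esub>" if "n \<in> tensor_relations R C D" for n
    using that
  proof (cases rule: tensor_relations_cases)
    case (add_left c c' d)
    then show ?thesis
      using assms(3) closed by (simp add: diff fr of add_closed_left) (simp add: G.a_ac G.r_neg G.minus_add)
  next
    case (add_right c d d')
    then show ?thesis
      using assms(4) closed by (simp add: diff fr of add_closed_right) (simp add: G.a_ac G.r_neg G.minus_add)
  next
    case (balanced r c d)
    then show ?thesis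
      using assms(5,6) closed by (simp add: diff fr of smult_closed_left smult_closed_right G.r_neg)
  qed
  have cls: "tensor_lift G \<beta> (cls t) = frag_sum G ?b t" if "t \<in> frags" for t
    using G.tensor_lift_cls[OF tensor_pair_axioms closed rel that] by simp
  have sm: "frag_sum G ?b (smult_frag r t) = r \<odot>\<^bsub>G\<^esub> frag_sum G ?b t" if r: "r \<in> R" and t: "t \<in> frags" for r t
    using t
  proof (induction rule: frags_induct)
    case (diff t u)
    then show ?case
      using r b \<open>\<And>u t. _ \<Longrightarrow> _ \<Longrightarrow> frag_sum G ?b (t - u) = _\<close>
      by (simp add: frag_extend_diff smult_frag_closed G.smult_r_distr G.smult_minus G.frag_sum_closed)
  qed (use r closed smult_left in \<open>auto simp: G.frag_sum_0 G.smult_zero of\<close>)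
  show "linear_map R (tensor R C D) G (tensor_lift G \<beta>)"
    unfolding linear_map_def
    by (auto simp: tensor_carrier cls tensor_add frags_add b G.frag_sum_closed G.frag_sum_add tensor_smult smult_frag_closed sm)
  show "tensor_lift G \<beta> (pure c d) = \<beta> c d" if "c \<in> carrier C" "d \<in> carrier D" for c d
    using that by (simp add: pure_tensor_def cls of)
qed

section \<open>Modules over the ring of compactly supported functions\<close>

text \<open>Equality of the classes in the stalk at x without the quotient: f annihilates the
  difference of c and d and is 1 near x. The form with two products also makes sense before any
  module law is known.\<close>

definition eq_at :: "('x, 'b::real_inner) mfd \<Rightarrow> ('x \<Rightarrow> 'k::real_normed_field, 'c, 'z) module_scheme \<Rightarrow> 'x \<Rightarrow> 'c \<Rightarrow> 'c \<Rightarrow> bool" where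
  "eq_at M C x c d \<longleftrightarrow> (\<exists>f\<in>Cc M. near M x (\<lambda>y. f y = 1) \<and> f \<odot>\<^bsub>C\<^esub> c = f \<odot>\<^bsub>C\<^esub> d)"

lemma eq_at_sym: "eq_at M C x c d \<Longrightarrow> eq_at M C x d c"
  by (auto simp: eq_at_def)

locale Cc_lu_module = hausdorff_manifold M + lu_module "Cc M" C
  for M :: "('x, 'b::real_inner) mfd" and C :: "('x \<Rightarrow> 'k::real_normed_field, 'c, 'z) module_scheme" (structure)
begin

lemma smult_0: "c \<in> carrier C \<Longrightarrow> 0 \<odot> c = \<zero>"
  by (simp add: zero_smult Cc_0)

lemma eq_at_refl:
  assumes "x \<in> points M" shows "eq_at M C x c c"
proof -
  obtain f :: "'x \<Rightarrow> 'k" where "f \<in> Cc M" "near M x (\<lambda>y. f y = 1)"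
    using Cc_bump_near[of x "\<lambda>_. True"] assms by auto
  then show ?thesis by (auto simp: eq_at_def)
qed

lemma near_1_mult:
  fixes f g :: "'x \<Rightarrow> 'k"
  assumes "near M x (\<lambda>y. f y = 1)" "near M x (\<lambda>y. g y = 1)"
  shows "near M x (\<lambda>y. (f * g) y = 1)"
  using assms by eventually_elim simp

text \<open>The product of two witnesses is again 1 near x and witnesses both equalities;
  compatibility with sums and transitivity follow.\<close>

lemma eq_at_common:
  assumes "eq_at M C x c d" "eq_at M C x c' d'" "c \<in> carrier C" "d \<in> carrier C" "c' \<in> carrier C" "d' \<in> carrier C"
  obtains f where "f \<in> Cc M" "near M x (\<lambda>y. f y = 1)" "f \<odot> c = f \<odot> d" "f \<odot> c' = f \<odot> d'"
proof -
  obtain f g where fg: "f \<in> Cc M" "near M x (\<lambda>y. f y = 1)" "f \<odot> c = f \<odot> d"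
      "g \<in> Cc M" "near M x (\<lambda>y. g y = 1)" "g \<odot> c' = g \<odot> d'"
    using assms by (auto simp: eq_at_def)
  have "(f * g) \<odot> e = g \<odot> (f \<odot> e)" "(f * g) \<odot> e = f \<odot> (g \<odot> e)" if "e \<in> carrier C" for e
    using fg that smult_assoc[of g f e] smult_assoc[of f g e] by (simp_all add: mult.commute)
  then have "(f * g) \<odot> c = (f * g) \<odot> d" "(f * g) \<odot> c' = (f * g) \<odot> d'"
    using fg assms by metis+
  then show ?thesis using that[of "f * g"] fg Cc_mult near_1_mult by blast
qed

lemma eq_at_trans:
  assumes "eq_at M C x c d" "eq_at M C x d e" "c \<in> carrier C" "d \<in> carrier C" "e \<in> carrier C"
  shows "eq_at M C x c e"
  using eq_at_common[OF assms(1,2,3,4,4,5)] by (metis eq_at_def)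

lemma eq_at_add:
  assumes "eq_at M C x c d" "eq_at M C x c' d'" "c \<in> carrier C" "d \<in> carrier C" "c' \<in> carrier C" "d' \<in> carrier C"
  shows "eq_at M C x (c \<oplus> c') (d \<oplus> d')"
proof -
  obtain f where "f \<in> Cc M" "near M x (\<lambda>y. f y = 1)" "f \<odot> c = f \<odot> d" "f \<odot> c' = f \<odot> d'"
    using eq_at_common[OF assms] .
  then show ?thesis using assms by (auto simp: eq_at_def smult_r_distr intro!: bexI[of _ f])
qed

lemma eq_at_smult:
  assumes "eq_at M C x c d" "r \<in> Cc M" "c \<in> carrier C" "d \<in> carrier C"
  shows "eq_at M C x (r \<odot> c) (r \<odot> d)"
proof -
  obtain f where f: "f \<in> Cc M" "near M x (\<lambda>y. f y = 1)" "f \<odot> c = f \<odot> d"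
    using assms by (auto simp: eq_at_def)
  then have "f \<odot> (r \<odot> c) = f \<odot> (r \<odot> d)" using assms smult_commute[of f r] by simp
  then show ?thesis using f by (auto simp: eq_at_def)
qed

text \<open>A bump h supported where f and g agree satisfies h f = h g, and is the witness.\<close>

lemma eq_at_smult_near:
  assumes x: "x \<in> points M" and "near M x (\<lambda>y. f y = g y)" "f \<in> Cc M" "g \<in> Cc M" "c \<in> carrier C"
  shows "eq_at M C x (f \<odot> c) (g \<odot> c)"
proof -
  obtain h :: "'x \<Rightarrow> 'k" where h: "h \<in> Cc M" "near M x (\<lambda>y. h y = 1)" "\<And>y. h y \<noteq> 0 \<Longrightarrow> f y = g y"
    using Cc_bump_near[OF x assms(2)] by blast
  then have "h * f = h * g" by (auto simp: fun_eq_iff)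
  then have "h \<odot> (f \<odot> c) = h \<odot> (g \<odot> c)" using smult_assoc assms h by metis
  then show ?thesis using h by (auto simp: eq_at_def)
qed

lemma eq_at_near_1:
  assumes x: "x \<in> points M" and "near M x (\<lambda>y. f y = 1)" "f \<in> Cc M" "c \<in> carrier C"
  shows "eq_at M C x (f \<odot> c) c"
proof -
  \<comment> \<open>The constant 1 need not act on C, so c is written as u c with a local unit u,
    and f u is compared with u.\<close>
  obtain u where u: "u \<in> Cc M" "u \<odot> c = c" using unit_exists[of "{c}"] assms by auto
  have "near M x (\<lambda>y. (f * u) y = u y)" using assms(2) by eventually_elim simp
  then have "eq_at M C x ((f * u) \<odot> c) (u \<odot> c)"
    using assms u by (intro eq_at_smult_near) (auto intro: Cc_mult)
  then show ?thesis using u assms by (simp add: smult_assoc)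
qed

lemma eq_at_near_0:
  assumes x: "x \<in> points M" and "near M x (\<lambda>y. f y = 0)" "f \<in> Cc M" "c \<in> carrier C"
  shows "eq_at M C x (f \<odot> c) \<zero>"
  using eq_at_smult_near[OF x, of f 0 c] assms by (simp add: Cc_0 smult_0)

text \<open>The witness is 1 on a whole neighbourhood and serves all of its points. This openness
  later makes the patches of the spectral sheaf a basis of a topology.\<close>

lemma eq_at_near:
  assumes "x \<in> points M" "eq_at M C x c d"
  shows "near M x (\<lambda>y. eq_at M C y c d)"
proof -
  obtain f where f: "f \<in> Cc M" "near M x (\<lambda>y. f y = 1)" "f \<odot> c = f \<odot> d"
    using assms by (auto simp: eq_at_def)
  then obtain W where W: "openin (mtop M) W" "x \<in> W" "\<forall>y\<in>W. f y = 1" using assms by (auto simp: near_iff)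
  then have "eq_at M C y c d" if "y \<in> W" for y
    using f that W nearI[of M W y "\<lambda>y. f y = 1"] by (auto simp: eq_at_def)
  then show ?thesis using W by (intro nearI) auto
qed

text \<open>A local unit u for c and d has compact support. Finitely many witnesses whose sets of
  value 1 cover that support combine into one f with f c = f d, and f u = u removes f again. No
  partition of unity on M is involved.\<close>

lemma eq_at_imp_eq:
  assumes cd: "c \<in> carrier C" "d \<in> carrier C" and eq: "\<And>x. x \<in> points M \<Longrightarrow> eq_at M C x c d"
  shows "c = d"
proof -
  obtain u where u: "u \<in> Cc M" "u \<odot> c = c" "u \<odot> d = d" using unit_exists[of "{c, d}"] cd by auto
  then obtain K where K: "compactin (mtop M) K" "{x. u x \<noteq> 0} \<subseteq> K" by (auto simp: Cc_M_iff)
  define \<O> where "\<O> = {V. openin (mtop M) V \<and> (\<exists>f\<in>Cc M. (\<forall>y\<in>V. f y = 1) \<and> f \<odot> c = f \<odot> d)}"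
  have "K \<subseteq> \<Union>\<O>"
  proof
    fix x assume "x \<in> K"
    then have x: "x \<in> points M" using compactin_subset_topspace[OF K(1)] by blast
    then obtain f where f: "f \<in> Cc M" "near M x (\<lambda>y. f y = 1)" "f \<odot> c = f \<odot> d"
      using eq by (auto simp: eq_at_def)
    then obtain V where "openin (mtop M) V" "x \<in> V" "\<forall>y\<in>V. f y = 1" using x by (auto simp: near_iff)
    then show "x \<in> \<Union>\<O>" using f by (auto simp: \<O>_def)
  qed
  then obtain \<F> where F: "finite \<F>" "\<F> \<subseteq> \<O>" "K \<subseteq> \<Union>\<F>"
    using K(1) unfolding compactin_def \<O>_def by (metis (no_types, lifting) mem_Collect_eq)
  have "\<exists>f\<in>Cc M. (\<forall>y\<in>\<Union>\<F>. f y = 1) \<and> f \<odot> c = f \<odot> d" using F(1,2)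
  proof (induction \<F>)
    case empty
    have "0 \<odot> c = 0 \<odot> d" using smult_0 cd by metis
    then show ?case using Cc_0 by blast
  next
    case (insert V \<F>)
    then obtain f g where *: "f \<in> Cc M" "\<forall>y\<in>\<Union>\<F>. f y = 1" "f \<odot> c = f \<odot> d"
      "g \<in> Cc M" "\<forall>y\<in>V. g y = 1" "g \<odot> c = g \<odot> d" by (auto simp: \<O>_def)
    \<comment> \<open>This is 1 - (1 - f)(1 - g). Its product with e is a combination of f e, g e
      and f (g e), on which c and d already agree.\<close>
    let ?h = "f + (g + - f * g)"
    have h1: "- f \<in> Cc M" using * Cc_uminus by blast
    have h2: "- f * g \<in> Cc M" using * h1 Cc_mult by blast
    have h3: "g + - f * g \<in> Cc M" using * h2 Cc_add by blast
    have "?h \<in> Cc M" using * h3 Cc_add by blast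
    note h = this h1 h2 h3
    have "?h \<odot> e = f \<odot> e \<oplus> (g \<odot> e \<oplus> (- f) \<odot> (g \<odot> e))" if "e \<in> carrier C" for e
      using h * that by (simp add: smult_l_distr smult_assoc del: mult_minus_left)
    then have "?h \<odot> c = ?h \<odot> d" using * cd by simp
    moreover have "\<forall>y\<in>\<Union>(insert V \<F>). ?h y = 1" using * by auto
    ultimately show ?case using h by blast
  qed
  then obtain f where f: "f \<in> Cc M" "\<forall>y\<in>\<Union>\<F>. f y = 1" "f \<odot> c = f \<odot> d" by blast
  \<comment> \<open>Wherever u is nonzero f is 1; so multiplication by f fixes c = u c and d = u
    d.\<close>
  have "f * u = u" using f(2) F(3) K(2) by (auto simp: fun_eq_iff)
  moreover have "(f * u) \<odot> c = (f * u) \<odot> d"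
    using f u cd smult_assoc[of u f] by (simp add: mult.commute)
  ultimately show ?thesis using u by simp
qed

lemma eq_at_finsum:
  assumes x: "x \<in> points M" and "finite A" "c \<in> A \<rightarrow> carrier C" "d \<in> A \<rightarrow> carrier C" "\<And>i. i \<in> A \<Longrightarrow> eq_at M C x (c i) (d i)"
  shows "eq_at M C x (\<Oplus>i\<in>A. c i) (\<Oplus>i\<in>A. d i)"
  using assms(2-)
proof (induction A)
  case empty
  then show ?case using eq_at_refl[OF x] by simp
next
  case (insert a A)
  then have "eq_at M C x (c a \<oplus> (\<Oplus>i\<in>A. c i)) (d a \<oplus> (\<Oplus>i\<in>A. d i))"
    by (intro eq_at_add) (auto intro!: finsum_closed)
  then show ?case using insert by simp
qed

lemma smult_finsum:
  assumes "r \<in> Cc M" "finite A" "c \<in> A \<rightarrow> carrier C"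
  shows "r \<odot> (\<Oplus>i\<in>A. c i) = (\<Oplus>i\<in>A. r \<odot> c i)"
  using assms(2,3)
proof (induction A)
  case (insert a A)
  then show ?case using assms(1) by (simp add: smult_r_distr Pi_iff finsum_closed)
qed (simp add: smult_zero assms)

end

lemma eq_at_linear_map:
  assumes h: "linear_map (Cc M) C D h" and "eq_at M C x c d" "c \<in> carrier C" "d \<in> carrier C"
  shows "eq_at M D x (h c) (h d)"
  using assms linear_map_smult[OF h] unfolding eq_at_def by metis

text \<open>A bump that is 1 on a compact set containing the supports of finitely many functions is
  a common local unit. The ring is the target of the counit, so linear maps into it fall under the
  general theory.\<close>

lemma (in hausdorff_manifold) regular_Cc_lu_module:
  "Cc_lu_module M (regular_module (Cc M :: ('x \<Rightarrow> 'k::real_normed_field) set))"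
proof
  let ?R = "regular_module (Cc M :: ('x \<Rightarrow> 'k) set)"
  have "abelian_group ?R"
    by (rule abelian_groupI)
      (auto simp: regular_module_def Cc_add Cc_0 algebra_simps intro!: bexI[OF _ Cc_uminus])
  moreover have "\<exists>r\<in>Cc M. \<forall>c\<in>F. r * c = c" if F: "finite F" "F \<subseteq> Cc M" for F :: "('x \<Rightarrow> 'k) set"
  proof -
    have "\<exists>K. compactin (mtop M) K \<and> (\<forall>f\<in>F. {x. f x \<noteq> 0} \<subseteq> K)" using F
    proof (induction F)
      case (insert f F)
      then obtain K L where "compactin (mtop M) K" "\<forall>f\<in>F. {x. f x \<noteq> 0} \<subseteq> K"
        "compactin (mtop M) L" "{x. f x \<noteq> 0} \<subseteq> L" by (auto simp: Cc_M_iff)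
      then show ?case by (intro exI[of _ "K \<union> L"]) (auto intro: compactin_Un)
    qed (auto intro: exI[of _ "{}"])
    then obtain K where K: "compactin (mtop M) K" "\<forall>f\<in>F. {x. f x \<noteq> 0} \<subseteq> K" by blast
    obtain r :: "'x \<Rightarrow> 'k" where r: "r \<in> Cc (open_sub M (points M))" "\<And>x. x \<in> K \<Longrightarrow> near M x (\<lambda>y. r y = 1)"
      using Cc_bump_compact[OF openin_topspace K(1) compactin_subset_topspace[OF K(1)]] by blast
    have "r * f = f" if "f \<in> F" for f
    proof
      fix x
      show "(r * f) x = f x"
        using that K r(2)[of x] near_imp_at[of _ M x] compactin_subset_topspace[OF K(1)]
        by (cases "f x = 0") (auto simp: subset_iff)
    qed
    then show ?thesis using r open_sub_points by auto
  qed
  ultimately show "locally_unitary_module (Cc M) ?R"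
    by (simp add: locally_unitary_module_def) (simp add: regular_module_def Cc_mult algebra_simps)
qed

lemma (in hausdorff_manifold) eq_at_regular_iff:
  fixes f g :: "'x \<Rightarrow> 'k::real_normed_field"
  assumes x: "x \<in> points M" and fg: "f \<in> Cc M" "g \<in> Cc M"
  shows "eq_at M (regular_module (Cc M)) x f g \<longleftrightarrow> near M x (\<lambda>y. f y = g y)"
proof
  assume "eq_at M (regular_module (Cc M)) x f g"
  then obtain h :: "'x \<Rightarrow> 'k" where h: "near M x (\<lambda>y. h y = 1)" "h * f = h * g" by (auto simp: eq_at_def regular_module_def)
  from h(1) show "near M x (\<lambda>y. f y = g y)"
    by eventually_elim (use h(2) in \<open>metis mult_1 times_fun_apply\<close>)
next
  assume "near M x (\<lambda>y. f y = g y)"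
  then obtain h :: "'x \<Rightarrow> 'k" where h: "h \<in> Cc M" "near M x (\<lambda>y. h y = 1)" "\<And>y. h y \<noteq> 0 \<Longrightarrow> f y = g y"
    using Cc_bump_near[OF x, of "\<lambda>y. f y = g y"] by metis
  then have "h * f = h * g" by (auto simp: fun_eq_iff)
  then show "eq_at M (regular_module (Cc M)) x f g" using h by (auto simp: eq_at_def regular_module_def)
qed

locale Cc_lu_module_pair = hausdorff_manifold M + lu_module_pair "Cc M" C D
  for M :: "('x, 'b::real_inner) mfd" and C :: "('x \<Rightarrow> 'k::real_normed_field, 'c, 'z) module_scheme"
    and D :: "('x \<Rightarrow> 'k, 'd, 'w) module_scheme"

sublocale Cc_lu_module_pair \<subseteq> Cl: Cc_lu_module M C + Dl: Cc_lu_module M D ..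

sublocale Cc_lu_module_pair \<subseteq> T: Cc_lu_module M "tensor (Cc M) C D"
  using tensor_lu_module hausdorff_manifold_axioms by (simp add: Cc_lu_module_def)

context Cc_lu_module_pair
begin

lemma eq_at_pure:
  assumes "eq_at M C x c c'" "eq_at M D x d d'" "c \<in> carrier C" "c' \<in> carrier C" "d \<in> carrier D" "d' \<in> carrier D"
  shows "eq_at M (tensor (Cc M) C D) x (pure c d) (pure c' d')"
proof -
  obtain f g where fg: "f \<in> Cc M" "near M x (\<lambda>y. f y = 1)" "f \<odot>\<^bsub>C\<^esub> c = f \<odot>\<^bsub>C\<^esub> c'"
      "g \<in> Cc M" "near M x (\<lambda>y. g y = 1)" "g \<odot>\<^bsub>D\<^esub> d = g \<odot>\<^bsub>D\<^esub> d'"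
    using assms by (auto simp: eq_at_def)
  have "(f * g) \<odot>\<^bsub>tensor (Cc M) C D\<^esub> pure a b = pure (f \<odot>\<^bsub>C\<^esub> a) (g \<odot>\<^bsub>D\<^esub> b)"
    if "a \<in> carrier C" "b \<in> carrier D" for a b
    using fg that by (simp add: tensor_smult_pure Cc_mult mult.commute[of f g] C.smult_assoc pure_balanced)
  then show ?thesis
    using fg assms Cl.near_1_mult[OF fg(2,5)] Cc_mult[OF fg(1,4)] by (auto simp: eq_at_def intro!: bexI[of _ "f * g"])
qed

text \<open>Fragments whose class vanishes in the stalk at x of the tensor product. The notion stays
  on the level of fragments because the comparison with the tensor product of stalks is made between
  free abelian groups.\<close>

definition near_null_frags :: "'x \<Rightarrow> ('c \<times> 'd \<Rightarrow>\<^sub>0 int) set" where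
  "near_null_frags x = {t. \<exists>f\<in>Cc M. near M x (\<lambda>y. f y = 1) \<and> smult_frag f t \<in> null_frags}"

lemma eq_at_cls_iff: "eq_at M (tensor (Cc M) C D) x (cls t) (cls u) \<longleftrightarrow> t - u \<in> near_null_frags x"
  by (simp add: eq_at_def near_null_frags_def tensor_smult cls_eq_iff frag_extend_diff cong: bex_cong)

lemma near_null_frags_uminus: "t \<in> near_null_frags x \<Longrightarrow> - t \<in> near_null_frags x"
  by (auto simp: near_null_frags_def frag_extend_minus null_frags_uminus)

lemma near_null_frags_add:
  assumes "t \<in> near_null_frags x" "u \<in> near_null_frags x" "t \<in> frags" "u \<in> frags"
  shows "t + u \<in> near_null_frags x"
proof -
  obtain f g where fg: "f \<in> Cc M" "near M x (\<lambda>y. f y = 1)" "smult_frag f t \<in> null_frags"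
      "g \<in> Cc M" "near M x (\<lambda>y. g y = 1)" "smult_frag g u \<in> null_frags"
    using assms by (auto simp: near_null_frags_def)
  have "smult_frag (f * g) (t + u) = smult_frag g (smult_frag f t) + smult_frag f (smult_frag g u)"
    using fg assms smult_frag_assoc[of f g u] smult_frag_assoc[of g f t]
    by (simp add: frag_extend_add mult.commute)
  then have "smult_frag (f * g) (t + u) \<in> null_frags"
    using fg by (simp add: smult_frag_null null_frags_add)
  then show ?thesis
    unfolding near_null_frags_def using Cc_mult[OF fg(1,4)] Cl.near_1_mult[OF fg(2,5)] by blast
qed

lemma near_null_frags_diff:
  "t \<in> near_null_frags x \<Longrightarrow> u \<in> near_null_frags x \<Longrightarrow> t \<in> frags \<Longrightarrow> u \<in> frags \<Longrightarrow> t - u \<in> near_null_frags x"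
  using near_null_frags_add[of t x "- u"] near_null_frags_uminus[of u] frags_uminus by simp

end

section \<open>Stalks of a coalgebra\<close>

locale Cc_coalgebra = hausdorff_manifold M
  for M :: "('x, 'b::real_inner) mfd" +
  fixes C :: "('x \<Rightarrow> 'k::real_normed_field, 'c) coalg"
  assumes coalgebra: "coalgebra (Cc M) C"

sublocale Cc_coalgebra \<subseteq> Cc_lu_module_pair M C C
  using coalgebra by unfold_locales (auto simp: coalgebra_def)

context Cc_coalgebra
begin

abbreviation "CC \<equiv> tensor (Cc M) C C"

lemma comult_linear: "linear_map (Cc M) C CC (comult C)"
  and counit_linear: "linear_map (Cc M) C (regular_module (Cc M)) (counit C)"
  and counit_right: "c \<in> carrier C \<Longrightarrow> tensor_lift C (\<lambda>a b. counit C b \<odot>\<^bsub>C\<^esub> a) (comult C c) = c"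
  and counit_left: "c \<in> carrier C \<Longrightarrow> tensor_lift C (\<lambda>a b. counit C a \<odot>\<^bsub>C\<^esub> b) (comult C c) = c"
  using coalgebra by (auto simp: coalgebra_def)

lemma counit_closed: "c \<in> carrier C \<Longrightarrow> counit C c \<in> Cc M"
  and counit_add: "c \<in> carrier C \<Longrightarrow> d \<in> carrier C \<Longrightarrow> counit C (c \<oplus>\<^bsub>C\<^esub> d) = counit C c + counit C d"
  and counit_smult: "r \<in> Cc M \<Longrightarrow> c \<in> carrier C \<Longrightarrow> counit C (r \<odot>\<^bsub>C\<^esub> c) = r * counit C c"
  using linear_map_closed[OF counit_linear] linear_map_add[OF counit_linear] linear_map_smult[OF counit_linear]
  by (auto simp: regular_module_def)

lemma comult_closed: "c \<in> carrier C \<Longrightarrow> comult C c \<in> carrier CC"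
  using linear_map_closed[OF comult_linear] .

text \<open>The two counit laws evaluated on a pure tensor. The second one shows that c and c' agree
  wherever the counit of c is 1.\<close>

lemma weakly_grouplike_counit:
  assumes "c \<in> carrier C" "c' \<in> carrier C" "comult C c = pure c c'"
  shows "c = counit C c' \<odot>\<^bsub>C\<^esub> c" "c = counit C c \<odot>\<^bsub>C\<^esub> c'"
proof -
  have "tensor_lift C (\<lambda>a b. counit C b \<odot>\<^bsub>C\<^esub> a) (pure c c') = counit C c' \<odot>\<^bsub>C\<^esub> c"
    by (rule tensor_lift_linear(2)[OF C.lu_module_axioms])
      (use assms in \<open>auto simp: counit_closed counit_add counit_smult C.smult_r_distr C.smult_l_distr C.smult_assoc C.smult_commute\<close>)
  then show "c = counit C c' \<odot>\<^bsub>C\<^esub> c" using counit_right[OF assms(1)] unfolding assms(3) by metis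
  have "tensor_lift C (\<lambda>a b. counit C a \<odot>\<^bsub>C\<^esub> b) (pure c c') = counit C c \<odot>\<^bsub>C\<^esub> c'"
    by (rule tensor_lift_linear(2)[OF C.lu_module_axioms])
      (use assms in \<open>auto simp: counit_closed counit_add counit_smult C.smult_r_distr C.smult_l_distr C.smult_assoc C.smult_commute\<close>)
  then show "c = counit C c \<odot>\<^bsub>C\<^esub> c'" using counit_left[OF assms(1)] unfolding assms(3) by metis
qed

lemma mem_null_at_iff:
  assumes "x \<in> points M"
  shows "n \<in> null_at M C x \<longleftrightarrow> n \<in> carrier C \<and> eq_at M C x n \<zero>\<^bsub>C\<^esub>"
  using assms by (auto simp: null_at_def eq_at_def germ_eq_iff one_fun_def C.smult_zero)

lemma stalk_class_eq:
  assumes x: "x \<in> points M" and c: "c \<in> carrier C"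
  shows "stalk_class M C x c = {d \<in> carrier C. eq_at M C x d c}"
proof -
  have "stalk_class M C x c = {n \<oplus>\<^bsub>C\<^esub> c | n. n \<in> null_at M C x}"
    by (auto simp: stalk_class_def a_r_coset_def r_coset_def)
  also have "\<dots> = {d \<in> carrier C. eq_at M C x d c}"
  proof safe
    fix n assume "n \<in> null_at M C x"
    then have n: "n \<in> carrier C" "eq_at M C x n \<zero>\<^bsub>C\<^esub>" using mem_null_at_iff[OF x] by auto
    then show "n \<oplus>\<^bsub>C\<^esub> c \<in> carrier C" using c by simp
    show "eq_at M C x (n \<oplus>\<^bsub>C\<^esub> c) c"
      using Cl.eq_at_add[OF n(2) Cl.eq_at_refl[OF x], of c] n c by simp
  next
    fix d assume d: "d \<in> carrier C" "eq_at M C x d c"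
    have "eq_at M C x (d \<oplus>\<^bsub>C\<^esub> \<ominus>\<^bsub>C\<^esub> c) (c \<oplus>\<^bsub>C\<^esub> \<ominus>\<^bsub>C\<^esub> c)"
      using d c by (intro Cl.eq_at_add Cl.eq_at_refl x) auto
    then have "d \<oplus>\<^bsub>C\<^esub> \<ominus>\<^bsub>C\<^esub> c \<in> null_at M C x" using d c by (simp add: mem_null_at_iff[OF x] C.r_neg)
    moreover have "d \<oplus>\<^bsub>C\<^esub> \<ominus>\<^bsub>C\<^esub> c \<oplus>\<^bsub>C\<^esub> c = d" using d c by (simp add: C.a_assoc C.l_neg)
    ultimately show "\<exists>n. d = n \<oplus>\<^bsub>C\<^esub> c \<and> n \<in> null_at M C x" by metis
  qed
  finally show ?thesis .
qed

lemma stalk_class_eq_iff: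
  assumes x: "x \<in> points M" and cd: "c \<in> carrier C" "d \<in> carrier C"
  shows "stalk_class M C x c = stalk_class M C x d \<longleftrightarrow> eq_at M C x c d"
proof
  assume "stalk_class M C x c = stalk_class M C x d"
  then show "eq_at M C x c d" using stalk_class_eq x cd Cl.eq_at_refl[OF x] by blast
next
  assume *: "eq_at M C x c d"
  have "eq_at M C x e c \<longleftrightarrow> eq_at M C x e d" if "e \<in> carrier C" for e
    using Cl.eq_at_trans * eq_at_sym that cd by metis
  then show "stalk_class M C x c = stalk_class M C x d" using stalk_class_eq x cd by auto
qed

lemma the_elem_stalk_class:
  assumes x: "x \<in> points M" and c: "c \<in> carrier C"
    and F: "\<And>d. d \<in> carrier C \<Longrightarrow> eq_at M C x d c \<Longrightarrow> F d = F c"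
  shows "the_elem (F ` stalk_class M C x c) = F c"
proof -
  have "F ` stalk_class M C x c \<subseteq> {F c}" using F by (auto simp: stalk_class_eq[OF x c])
  moreover have "c \<in> stalk_class M C x c" using c Cl.eq_at_refl[OF x] by (simp add: stalk_class_eq[OF x c])
  ultimately have "F ` stalk_class M C x c = {F c}" by blast
  then show ?thesis by simp
qed

lemma carrier_stalk: "carrier (stalk M C x) = stalk_class M C x ` carrier C"
  by (simp add: stalk_def)

lemma stalk_add:
  assumes x: "x \<in> points M" and cd: "c \<in> carrier C" "d \<in> carrier C"
  shows "stalk_class M C x c \<oplus>\<^bsub>stalk M C x\<^esub> stalk_class M C x d = stalk_class M C x (c \<oplus>\<^bsub>C\<^esub> d)"
proof -
  have "stalk_class M C x c \<oplus>\<^bsub>stalk M C x\<^esub> stalk_class M C x d =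
      {a \<oplus>\<^bsub>C\<^esub> b | a b. a \<in> stalk_class M C x c \<and> b \<in> stalk_class M C x d}"
    by (auto simp: stalk_def set_add_def set_mult_def)
  also have "\<dots> = stalk_class M C x (c \<oplus>\<^bsub>C\<^esub> d)"
    unfolding stalk_class_eq[OF x cd(1)] stalk_class_eq[OF x cd(2)] stalk_class_eq[OF x C.a_closed[OF cd]]
  proof safe
    fix e assume e: "e \<in> carrier C" "eq_at M C x e (c \<oplus>\<^bsub>C\<^esub> d)"
    have "eq_at M C x (e \<oplus>\<^bsub>C\<^esub> \<ominus>\<^bsub>C\<^esub> d) (c \<oplus>\<^bsub>C\<^esub> d \<oplus>\<^bsub>C\<^esub> \<ominus>\<^bsub>C\<^esub> d)"
      using e cd by (intro Cl.eq_at_add Cl.eq_at_refl x) auto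
    then show "\<exists>a b. e = a \<oplus>\<^bsub>C\<^esub> b \<and> a \<in> {d \<in> carrier C. eq_at M C x d c} \<and> b \<in> {da \<in> carrier C. eq_at M C x da d}"
      using e cd Cl.eq_at_refl[OF x]
      by (intro exI[of _ "e \<oplus>\<^bsub>C\<^esub> \<ominus>\<^bsub>C\<^esub> d"] exI[of _ d]) (simp add: C.a_assoc C.l_neg C.r_neg)
  qed (use cd in \<open>auto intro: Cl.eq_at_add\<close>)
  finally show ?thesis .
qed

text \<open>A germ is given by a function smooth near x only; its product with a bump supported in
  that neighbourhood is globally smooth with compact support and has the same germ.\<close>

lemma germ_ring_rep:
  assumes x: "x \<in> points M" and \<rho>: "\<rho> \<in> germ_ring M x"
  obtains r :: "'x \<Rightarrow> 'k" where "r \<in> Cc M" "\<rho> = germ M x r"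
proof -
  obtain f W where f: "openin (mtop M) W" "x \<in> W" "smooth_fun (open_sub M W) f" "\<rho> = germ M x f"
    using \<rho> by (auto simp: germ_ring_def)
  obtain b :: "'x \<Rightarrow> 'k" where b: "b \<in> Cc (open_sub M W)" "near M x (\<lambda>y. b y = 1)"
    using Cc_bump[OF f(1,2)] .
  then obtain K where K: "compactin (mtop M) K" "K \<subseteq> W" "{x. b x \<noteq> 0} \<subseteq> K" by (auto simp: Cc_open_sub_iff[OF f(1)])
  have "smooth_fun (open_sub M (points M)) (b * f)"
  proof (rule smooth_fun_local[OF manifold])
    fix y assume y: "y \<in> points M"
    show "\<exists>V g. openin (mtop M) V \<and> y \<in> V \<and> smooth_fun (open_sub M V) g \<and> (\<forall>z\<in>V \<inter> points M. (b * f) z = g z)"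
    proof (cases "y \<in> W")
      case True
      have "smooth_fun (open_sub M W) b" using b(1) by (simp add: Cc_def)
      then have "smooth_fun (open_sub M W) (\<lambda>z. b z * f z)"
        using f smooth_fun_mult[OF manifold f(1)] by blast
      then show ?thesis using f True by (intro exI[of _ W] exI[of _ "\<lambda>z. b z * f z"]) auto
    next
      case False
      have "openin (mtop M) (points M - K)" using compactin_imp_closedin[OF hausdorff K(1)] by blast
      then show ?thesis
        using K y False by (intro exI[of _ "points M - K"] exI[of _ "\<lambda>_. 0"]) (auto intro: smooth_fun_const)
    qed
  qed simp
  then have "b * f \<in> Cc M"
    using K by (auto simp: Cc_M_iff smooth_fun_open_sub_points[OF manifold] intro!: exI[of _ K])
  moreover have "near M x (\<lambda>y. f y = (b * f) y)" using b(2) by eventually_elim simp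
  ultimately show ?thesis using that f(4) germ_eq_iff[OF x] by metis
qed

lemma germ_in_germ_ring: "x \<in> points M \<Longrightarrow> r \<in> Cc M \<Longrightarrow> germ M x r \<in> germ_ring M x"
  using Cc_smooth smooth_fun_open_sub_points[OF manifold] unfolding germ_ring_def by blast

lemma stalk_smult:
  assumes x: "x \<in> points M" and c: "c \<in> carrier C" and r: "r \<in> Cc M"
  shows "germ M x r \<odot>\<^bsub>stalk M C x\<^esub> stalk_class M C x c = stalk_class M C x (r \<odot>\<^bsub>C\<^esub> c)"
proof -
  have "stalk_class M C x (s \<odot>\<^bsub>C\<^esub> d) = stalk_class M C x (r \<odot>\<^bsub>C\<^esub> c)"
    if s: "s \<in> germ M x r \<inter> Cc M" and d: "d \<in> stalk_class M C x c" for s d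
  proof -
    have d: "d \<in> carrier C" "eq_at M C x d c" using d by (auto simp: stalk_class_eq[OF x c])
    have "near M x (\<lambda>y. s y = r y)" "s \<in> Cc M" using s by (auto simp: mem_germ_iff[OF x])
    then have "eq_at M C x (s \<odot>\<^bsub>C\<^esub> d) (r \<odot>\<^bsub>C\<^esub> d)" using d r by (intro Cl.eq_at_smult_near x)
    moreover have "eq_at M C x (r \<odot>\<^bsub>C\<^esub> d) (r \<odot>\<^bsub>C\<^esub> c)" using d c r by (intro Cl.eq_at_smult)
    ultimately have "eq_at M C x (s \<odot>\<^bsub>C\<^esub> d) (r \<odot>\<^bsub>C\<^esub> c)"
      using d c r \<open>s \<in> Cc M\<close> Cl.eq_at_trans[of x "s \<odot>\<^bsub>C\<^esub> d" "r \<odot>\<^bsub>C\<^esub> d"] by simp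
    then show ?thesis using d c r \<open>s \<in> Cc M\<close> by (simp add: stalk_class_eq_iff[OF x])
  qed
  moreover have "r \<in> germ M x r \<inter> Cc M" "c \<in> stalk_class M C x c"
    using r c by (auto simp: mem_germ_iff[OF x] stalk_class_eq[OF x] Cl.eq_at_refl[OF x])
  ultimately have "{stalk_class M C x (s \<odot>\<^bsub>C\<^esub> d) | s d. s \<in> germ M x r \<inter> Cc M \<and> d \<in> stalk_class M C x c}
      = {stalk_class M C x (r \<odot>\<^bsub>C\<^esub> c)}" by blast
  then show ?thesis by (simp add: stalk_def)
qed

lemma stalk_tensor_pair:
  assumes x: "x \<in> points M"
  shows "tensor_pair (germ_ring M x) (stalk M C x) (stalk M C x)"
proof -
  have add: "\<zeta> \<oplus>\<^bsub>stalk M C x\<^esub> \<xi> \<in> carrier (stalk M C x)"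
    if "\<zeta> \<in> carrier (stalk M C x)" "\<xi> \<in> carrier (stalk M C x)" for \<zeta> \<xi>
    using that by (auto simp: carrier_stalk stalk_add[OF x])
  moreover have "\<rho> \<odot>\<^bsub>stalk M C x\<^esub> \<zeta> \<in> carrier (stalk M C x)"
    if "\<rho> \<in> germ_ring M x" "\<zeta> \<in> carrier (stalk M C x)" for \<rho> \<zeta>
    using that by (auto simp: carrier_stalk stalk_smult[OF x] elim!: germ_ring_rep[OF x])
  ultimately show ?thesis by (simp add: tensor_pair_def)
qed

abbreviation stalk_frag :: "'x \<Rightarrow> ('c \<times> 'c \<Rightarrow>\<^sub>0 int) \<Rightarrow> ('c set \<times> 'c set \<Rightarrow>\<^sub>0 int)" where
  "stalk_frag x \<equiv> frag_extend (\<lambda>(c, d). frag_of (stalk_class M C x c, stalk_class M C x d))"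

abbreviation "stalk_null x \<equiv> tensor_pair.null_frags (germ_ring M x) (stalk M C x) (stalk M C x)"

lemma stalk_frag_null:
  assumes x: "x \<in> points M" and n: "n \<in> tensor_relations (Cc M) C C"
  shows "stalk_frag x n \<in> stalk_null x"
proof -
  interpret S: tensor_pair "germ_ring M x" "stalk M C x" "stalk M C x" by (rule stalk_tensor_pair[OF x])
  have mem: "stalk_class M C x c \<in> carrier (stalk M C x)" if "c \<in> carrier C" for c
    using that by (simp add: carrier_stalk)
  have "stalk_frag x n \<in> tensor_relations (germ_ring M x) (stalk M C x) (stalk M C x)"
    using n
  proof (cases rule: tensor_relations_cases)
    case (add_left c c' d)
    then show ?thesis using tensor_relations_add_left[OF mem[of c] mem[of c'] mem[of d]]
      by (simp add: frag_extend_diff stalk_add[OF x])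
  next
    case (add_right c d d')
    then show ?thesis using tensor_relations_add_right[OF mem[of c] mem[of d] mem[of d']]
      by (simp add: frag_extend_diff stalk_add[OF x])
  next
    case (balanced r c d)
    then show ?thesis using tensor_relations_balanced[OF germ_in_germ_ring[OF x] mem[of c] mem[of d], of r]
      by (simp add: frag_extend_diff stalk_smult[OF x])
  qed
  then show ?thesis by (rule S.null_frags_rel)
qed

lemma stalk_tensor_map:
  assumes x: "x \<in> points M"
  shows "tensor_map (germ_ring M x) (stalk M C x) (stalk M C x) (stalk_class M C x) (stalk_class M C x) (cls t)
    = tensor_class (germ_ring M x) (stalk M C x) (stalk M C x) (stalk_frag x t)"
  by (rule tensor_map_cls[OF stalk_tensor_pair[OF x] stalk_frag_null[OF x]])

text \<open>The localization of the tensor product at a point maps injectively to the tensor product of the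
  stalks: choosing representatives of stalk elements gives an inverse modulo tensors vanishing near the point.\<close>

lemma stalk_frag_null_iff:
  assumes x: "x \<in> points M" and t: "t \<in> frags"
  shows "stalk_frag x t \<in> stalk_null x \<longleftrightarrow> t \<in> near_null_frags x"
proof -
  interpret S: tensor_pair "germ_ring M x" "stalk M C x" "stalk M C x" by (rule stalk_tensor_pair[OF x])
  show ?thesis
  proof
    assume "t \<in> near_null_frags x"
    then obtain f where f: "f \<in> Cc M" "near M x (\<lambda>y. f y = 1)" "smult_frag f t \<in> null_frags"
      by (auto simp: near_null_frags_def)
    have unit: "stalk_class M C x (f \<odot>\<^bsub>C\<^esub> c) = stalk_class M C x c" if "c \<in> carrier C" for c
      using f that Cl.eq_at_near_1[OF x] by (simp add: stalk_class_eq_iff[OF x])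
    \<comment> \<open>Multiplication by f does not move stalk classes, because f is 1 near
      x.\<close>
    have *: "stalk_frag x (smult_frag f t) = stalk_frag x t"
      using t by (induction rule: frags_induct) (auto simp: frag_extend_diff unit)
    have "stalk_frag x n \<in> stalk_null x" if "n \<in> null_frags" for n
      using that by (induction rule: null_frags_induct)
        (auto simp: frag_extend_add frag_extend_minus stalk_frag_null[OF x]
          S.null_frags_0 S.null_frags_add S.null_frags_uminus)
    then show "stalk_frag x t \<in> stalk_null x" using f(3) * by metis
  next
    define rep where "rep \<zeta> = (SOME c. c \<in> carrier C \<and> stalk_class M C x c = \<zeta>)" for \<zeta>
    have rep: "rep \<zeta> \<in> carrier C \<and> stalk_class M C x (rep \<zeta>) = \<zeta>" if "\<zeta> \<in> carrier (stalk M C x)" for \<zeta>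
      unfolding rep_def by (rule someI_ex) (use that in \<open>auto simp: carrier_stalk\<close>)
    have rep_eq: "eq_at M C x (rep (stalk_class M C x c)) c" if "c \<in> carrier C" for c
      using rep[of "stalk_class M C x c"] that by (simp add: carrier_stalk flip: stalk_class_eq_iff[OF x])
    \<comment> \<open>Chosen representatives respect neither sums nor scalars, so ?L respects the
      relations only up to fragments vanishing near x; in the same sense it is inverse to
      \<open>stalk_frag\<close>.\<close>
    let ?L = "frag_extend (\<lambda>(\<zeta>, \<xi>). frag_of (rep \<zeta>, rep \<xi>))"
    have Lfr: "?L u \<in> frags" if "u \<in> S.frags" for u
      using that by (induction rule: S.frags_induct) (auto simp: frag_extend_diff frags_diff rep)
    have L: "?L n \<in> near_null_frags x" if "n \<in> stalk_null x" for n
    proof -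
      have "?L n \<in> near_null_frags x \<and> ?L n \<in> frags" using that
      proof (induction rule: S.null_frags_induct)
        case zero
        then show ?case using Cl.eq_at_refl[OF x] eq_at_cls_iff[of x 0 0] T.eq_at_refl[OF x] by simp
      next
        case (rel n)
        have fr: "?L n \<in> frags" using rel S.tensor_relations_subset Lfr by blast
        have cl: "\<zeta> \<oplus>\<^bsub>stalk M C x\<^esub> \<xi> \<in> carrier (stalk M C x)"
            "eq_at M C x (rep (\<zeta> \<oplus>\<^bsub>stalk M C x\<^esub> \<xi>)) (rep \<zeta> \<oplus>\<^bsub>C\<^esub> rep \<xi>)"
          if "\<zeta> \<in> carrier (stalk M C x)" "\<xi> \<in> carrier (stalk M C x)" for \<zeta> \<xi>
        proof -
          show "\<zeta> \<oplus>\<^bsub>stalk M C x\<^esub> \<xi> \<in> carrier (stalk M C x)" using S.add_closed_left that .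
          have "stalk_class M C x (rep \<zeta> \<oplus>\<^bsub>C\<^esub> rep \<xi>) = \<zeta> \<oplus>\<^bsub>stalk M C x\<^esub> \<xi>"
            using rep that stalk_add[OF x] by metis
          then show "eq_at M C x (rep (\<zeta> \<oplus>\<^bsub>stalk M C x\<^esub> \<xi>)) (rep \<zeta> \<oplus>\<^bsub>C\<^esub> rep \<xi>)"
            using rep_eq[of "rep \<zeta> \<oplus>\<^bsub>C\<^esub> rep \<xi>"] rep that by simp
        qed
        from rel show ?case
        proof (cases rule: tensor_relations_cases)
          case (add_left \<zeta> \<zeta>' \<xi>)
          note r = rep[OF add_left(2)] rep[OF add_left(3)] rep[OF add_left(4)] rep[OF cl(1)[OF add_left(2,3)]]
          have "eq_at M CC x (pure (rep (\<zeta> \<oplus>\<^bsub>stalk M C x\<^esub> \<zeta>')) (rep \<xi>)) (pure (rep \<zeta> \<oplus>\<^bsub>C\<^esub> rep \<zeta>') (rep \<xi>))"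
            using r cl(2)[OF add_left(2,3)] Cl.eq_at_refl[OF x] by (intro eq_at_pure) auto
          then show ?thesis
            using r fr unfolding add_left(1)
            by (simp add: pure_add_left)
              (simp add: pure_tensor_def tensor_add eq_at_cls_iff frag_extend_diff frag_extend_add diff_diff_eq)
        next
          case (add_right \<zeta> \<xi> \<xi>')
          note r = rep[OF add_right(2)] rep[OF add_right(3)] rep[OF add_right(4)] rep[OF cl(1)[OF add_right(3,4)]]
          have "eq_at M CC x (pure (rep \<zeta>) (rep (\<xi> \<oplus>\<^bsub>stalk M C x\<^esub> \<xi>'))) (pure (rep \<zeta>) (rep \<xi> \<oplus>\<^bsub>C\<^esub> rep \<xi>'))"
            using r cl(2)[OF add_right(3,4)] Cl.eq_at_refl[OF x] by (intro eq_at_pure) auto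
          then show ?thesis
            using r fr unfolding add_right(1)
            by (simp add: pure_add_right)
              (simp add: pure_tensor_def tensor_add eq_at_cls_iff frag_extend_diff frag_extend_add diff_diff_eq)
        next
          case (balanced \<rho> \<zeta> \<xi>)
          obtain s where s: "s \<in> Cc M" "\<rho> = germ M x s" using germ_ring_rep[OF x balanced(2)] .
          note r = rep[OF balanced(3)] rep[OF balanced(4)] rep[OF S.smult_closed_left[OF balanced(2,3)]]
            rep[OF S.smult_closed_left[OF balanced(2,4)]]
          have e: "eq_at M C x (rep (\<rho> \<odot>\<^bsub>stalk M C x\<^esub> \<eta>)) (s \<odot>\<^bsub>C\<^esub> rep \<eta>)" if "\<eta> \<in> carrier (stalk M C x)" for \<eta>
          proof -
            have "stalk_class M C x (s \<odot>\<^bsub>C\<^esub> rep \<eta>) = \<rho> \<odot>\<^bsub>stalk M C x\<^esub> \<eta>"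
              using rep[OF that] s stalk_smult[OF x, of "rep \<eta>" s] by simp
            then show ?thesis using rep_eq[of "s \<odot>\<^bsub>C\<^esub> rep \<eta>"] rep[OF that] s by simp
          qed
          \<comment> \<open>The germ \<rho> is represented by a function s, and s is moved across
            the tensor sign between the chosen representatives. Balancing over germs thus becomes
            balancing over \<open>Cc M\<close>.\<close>
          have "eq_at M CC x (pure (rep (\<rho> \<odot>\<^bsub>stalk M C x\<^esub> \<zeta>)) (rep \<xi>)) (pure (s \<odot>\<^bsub>C\<^esub> rep \<zeta>) (rep \<xi>))"
            using r s e[OF balanced(3)] Cl.eq_at_refl[OF x] by (intro eq_at_pure) auto
          moreover have "eq_at M CC x (pure (rep \<zeta>) (s \<odot>\<^bsub>C\<^esub> rep \<xi>)) (pure (rep \<zeta>) (rep (\<rho> \<odot>\<^bsub>stalk M C x\<^esub> \<xi>)))"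
            using r s eq_at_sym[OF e[OF balanced(4)]] Cl.eq_at_refl[OF x] by (intro eq_at_pure) auto
          moreover have "pure (s \<odot>\<^bsub>C\<^esub> rep \<zeta>) (rep \<xi>) = pure (rep \<zeta>) (s \<odot>\<^bsub>C\<^esub> rep \<xi>)"
            using r s by (simp add: pure_balanced)
          ultimately have "eq_at M CC x (pure (rep (\<rho> \<odot>\<^bsub>stalk M C x\<^esub> \<zeta>)) (rep \<xi>)) (pure (rep \<zeta>) (rep (\<rho> \<odot>\<^bsub>stalk M C x\<^esub> \<xi>)))"
            using r s T.eq_at_trans[OF _ _ pure_closed pure_closed pure_closed] by (metis C.smult_closed)
          then show ?thesis
            using fr unfolding balanced(1) by (simp add: pure_tensor_def eq_at_cls_iff frag_extend_diff)
        qed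
      qed (auto simp: frag_extend_add frag_extend_minus near_null_frags_add near_null_frags_uminus frags_add frags_uminus)
      then show ?thesis ..
    qed
    have LF: "?L (stalk_frag x u) - u \<in> near_null_frags x \<and> ?L (stalk_frag x u) - u \<in> frags" if "u \<in> frags" for u
      using that
    proof (induction rule: frags_induct)
      case zero
      then show ?case using eq_at_cls_iff[of x 0 0] T.eq_at_refl[OF x] by simp
    next
      case (pure c d)
      have r: "rep (stalk_class M C x a) \<in> carrier C" if "a \<in> carrier C" for a
        using rep[of "stalk_class M C x a"] that by (simp add: carrier_stalk)
      have "eq_at M CC x (pure (rep (stalk_class M C x c)) (rep (stalk_class M C x d))) (pure c d)"
        using pure r by (intro eq_at_pure rep_eq) auto
      then show ?case using pure r by (simp add: pure_tensor_def eq_at_cls_iff frags_diff)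
    next
      case (diff t u)
      then show ?case
        using near_null_frags_diff[of "?L (stalk_frag x t) - t" x "?L (stalk_frag x u) - u"]
          frags_diff[of "?L (stalk_frag x t) - t" "?L (stalk_frag x u) - u"]
        by (simp add: frag_extend_diff algebra_simps)
    qed
    assume *: "stalk_frag x t \<in> stalk_null x"
    then have "?L (stalk_frag x t) \<in> near_null_frags x" "?L (stalk_frag x t) \<in> frags"
      using L Lfr S.null_frags_subset by blast+
    then show "t \<in> near_null_frags x"
      using LF[OF t] near_null_frags_diff[of "?L (stalk_frag x t)" x "?L (stalk_frag x t) - t"] by simp
  qed
qed

text \<open>The injective half of the identification of the stalk of the tensor square with the
  tensor square of the stalk; it suffices for reflecting equations.\<close>

lemma stalk_tensor_eq_iff:
  assumes x: "x \<in> points M" and T: "T \<in> carrier CC" "U \<in> carrier CC"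
  shows "tensor_map (germ_ring M x) (stalk M C x) (stalk M C x) (stalk_class M C x) (stalk_class M C x) T =
      tensor_map (germ_ring M x) (stalk M C x) (stalk M C x) (stalk_class M C x) (stalk_class M C x) U
    \<longleftrightarrow> eq_at M CC x T U"
proof -
  interpret S: tensor_pair "germ_ring M x" "stalk M C x" "stalk M C x" by (rule stalk_tensor_pair[OF x])
  obtain t u where t: "t \<in> frags" "T = cls t" "u \<in> frags" "U = cls u"
    using T by (auto simp: tensor_carrier)
  have "S.cls (stalk_frag x t) = S.cls (stalk_frag x u) \<longleftrightarrow> stalk_frag x (t - u) \<in> stalk_null x"
    by (simp add: S.cls_eq_iff frag_extend_diff)
  also have "\<dots> \<longleftrightarrow> eq_at M CC x T U"
    using stalk_frag_null_iff[OF x frags_diff[OF t(1,3)]] t by (simp add: eq_at_cls_iff)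
  finally show ?thesis by (simp add: t stalk_tensor_map[OF x])
qed

text \<open>Turns grouplikeness of a class into an equation in the tensor square of C that holds
  near x. Tensor products over the ring of germs do not occur after this point.\<close>

lemma stalk_grouplike_iff:
  assumes x: "x \<in> points M" and c: "c \<in> carrier C"
  shows "stalk_class M C x c \<in> stalk_grouplikes M C x \<longleftrightarrow>
    eq_at M CC x (comult C c) (pure c c) \<and> near M x (\<lambda>y. counit C c y = 1)"
proof -
  let ?m = "tensor_map (germ_ring M x) (stalk M C x) (stalk M C x) (stalk_class M C x) (stalk_class M C x)"
  have "stalk_comult M C x (stalk_class M C x c) = ?m (comult C c)"
    unfolding stalk_comult_def
    using eq_at_linear_map[OF comult_linear _ _ c] c
    by (intro the_elem_stalk_class[OF x c]) (simp add: stalk_tensor_eq_iff[OF x] comult_closed)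
  moreover have "?m (pure c c) = pure_tensor (germ_ring M x) (stalk M C x) (stalk M C x) (stalk_class M C x c) (stalk_class M C x c)"
    by (simp add: pure_tensor_def stalk_tensor_map[OF x])
  moreover have "stalk_counit M C x (stalk_class M C x c) = germ M x (counit C c)"
    unfolding stalk_counit_def
  proof (rule the_elem_stalk_class[OF x c])
    fix d assume "d \<in> carrier C" "eq_at M C x d c"
    then have "eq_at M (regular_module (Cc M)) x (counit C d) (counit C c)"
      using eq_at_linear_map[OF counit_linear] c by blast
    then show "germ M x (counit C d) = germ M x (counit C c)"
      using \<open>d \<in> carrier C\<close> c by (simp add: eq_at_regular_iff[OF x] counit_closed germ_eq_iff[OF x])
  qed
  ultimately show ?thesis
    using c stalk_tensor_eq_iff[OF x comult_closed[OF c] pure_closed[OF c c]]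
    by (simp add: stalk_grouplikes_def carrier_stalk germ_eq_iff[OF x] one_fun_def)
qed

end

section \<open>Sections of the sheaf of germs\<close>

lemma ext_zero_apply: "e \<in> points X \<Longrightarrow> ext_zero X U f e = germ X e (if e \<in> U then f else 0)"
  by (simp add: ext_zero_def)

lemma pullback_apply:
  "e \<in> epoints E \<Longrightarrow> pullback E U f e = germ (total E) e (if e \<in> U then f \<circ> proj E else 0)"
  by (simp add: pullback_def ext_zero_apply)

text \<open>The double union in \<open>sec_add\<close> ranges over representatives; all of them
  yield one germ, so the union is that germ.\<close>

lemma sec_add_apply:
  assumes e: "e \<in> points X" and "s e = germ X e f" "t e = germ X e g"
  shows "sec_add X s t e = germ X e (f + g)"
proof -
  have "germ X e (f' + g') = germ X e (f + g)" if "f' \<in> germ X e f" "g' \<in> germ X e g" for f' g'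
  proof -
    have "near X e (\<lambda>y. f' y = f y)" "near X e (\<lambda>y. g' y = g y)" using that e by (simp_all add: mem_germ_iff)
    then have "near X e (\<lambda>y. (f' + g') y = (f + g) y)" by eventually_elim simp
    then show ?thesis by (simp add: germ_eq_iff[OF e])
  qed
  moreover have "f \<in> germ X e f" "g \<in> germ X e g" using e by (simp_all add: mem_germ_iff)
  ultimately have "(\<Union>f'\<in>germ X e f. \<Union>g'\<in>germ X e g. germ X e (f' + g')) = germ X e (f + g)"
    by blast
  then show ?thesis using assms by (simp add: sec_add_def)
qed

lemma sec_mult_apply:
  assumes e: "e \<in> points X" and "s e = germ X e f"
  shows "sec_mult X q s e = germ X e (q * f)"
proof -
  have "germ X e (q * f') = germ X e (q * f)" if "f' \<in> germ X e f" for f'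
  proof -
    have "near X e (\<lambda>y. f' y = f y)" using that e by (simp add: mem_germ_iff)
    then have "near X e (\<lambda>y. (q * f') y = (q * f) y)" by eventually_elim simp
    then show ?thesis by (simp add: germ_eq_iff[OF e])
  qed
  moreover have "f \<in> germ X e f" using e by (simp add: mem_germ_iff)
  ultimately have "(\<Union>f'\<in>germ X e f. germ X e (q * f')) = germ X e (q * f)" by blast
  then show ?thesis using assms by (simp add: sec_mult_def)
qed

lemma ext_zero_extensional: "ext_zero X U f \<in> extensional (points X)"
  and sec_add_extensional: "sec_add X s t \<in> extensional (points X)"
  and sec_mult_extensional: "sec_mult X q u \<in> extensional (points X)"
  unfolding ext_zero_def sec_add_def sec_mult_def by (rule restrict_extensional)+

lemma pullback_extensional: "pullback E U f \<in> extensional (epoints E)"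
  unfolding pullback_def by (rule ext_zero_extensional)

lemma Cc_sections_extensional: "s \<in> Cc_sections X \<Longrightarrow> s \<in> extensional (points X)"
  by (induction rule: Cc_sections.induct)
    (simp_all only: ext_zero_extensional sec_add_extensional sec_mult_extensional)

lemma Cc_sections_germ:
  assumes "s \<in> Cc_sections X" "e \<in> points X"
  obtains f where "s e = germ X e f"
proof -
  have "\<exists>f. s e = germ X e f" using assms(1)
    by (induction rule: Cc_sections.induct)
      (use assms(2) ext_zero_apply[OF assms(2)] sec_add_apply[OF assms(2)] sec_mult_apply[OF assms(2)] in metis)+
  then show ?thesis using that by blast
qed

lemma Cc_sections_eqI:
  assumes "s \<in> extensional (points X)" "t \<in> extensional (points X)"
    and "\<And>e. e \<in> points X \<Longrightarrow> s e = t e"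
  shows "s = t"
  using assms by (rule extensionalityI)

lemmas section_extensional = ext_zero_extensional sec_add_extensional sec_mult_extensional pullback_extensional

lemma ext_zero_add:
  fixes f g :: "'a \<Rightarrow> 'k::monoid_add"
  shows "sec_add X (ext_zero X U f) (ext_zero X U g) = ext_zero X U (f + g)"
proof (rule Cc_sections_eqI)
  fix e assume e: "e \<in> points X"
  have "sec_add X (ext_zero X U f) (ext_zero X U g) e =
      germ X e ((if e \<in> U then f else 0) + (if e \<in> U then g else 0))"
    by (rule sec_add_apply[OF e]; rule ext_zero_apply[OF e])
  then show "sec_add X (ext_zero X U f) (ext_zero X U g) e = ext_zero X U (f + g) e"
    by (simp add: ext_zero_apply[OF e])
qed (simp_all add: section_extensional)

lemma pullback_mult: "sec_mult (total E) (q \<circ> proj E) (pullback E U (f :: _ \<Rightarrow> 'k::real_normed_field)) = pullback E U (q * f)"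
proof (rule Cc_sections_eqI)
  fix e assume e: "e \<in> epoints E"
  have "(q \<circ> proj E) * (f \<circ> proj E) = (q * f) \<circ> proj E" by (simp add: fun_eq_iff)
  moreover have "sec_mult (total E) (q \<circ> proj E) (pullback E U f) e =
      germ (total E) e ((q \<circ> proj E) * (if e \<in> U then f \<circ> proj E else 0))"
    by (rule sec_mult_apply[OF e]; rule pullback_apply[OF e])
  ultimately show "sec_mult (total E) (q \<circ> proj E) (pullback E U f) e = pullback E U (q * f) e"
    by (simp add: pullback_apply[OF e])
qed (simp_all add: section_extensional)

lemma pullback_scale:
  "sec_mult (total E) (\<lambda>_. a) (pullback E U (f :: _ \<Rightarrow> 'k::real_normed_field)) = pullback E U ((\<lambda>_. a) * f)"
  using pullback_mult[of E "\<lambda>_. a" U f] by (simp add: o_def)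

lemma pullback_0: "pullback E U (0 :: 'x \<Rightarrow> 'k::zero) = ext_zero (total E) {} 0"
proof -
  have "(0 :: 'x \<Rightarrow> 'k) \<circ> proj E = 0" by (simp add: fun_eq_iff)
  then show ?thesis by (simp add: pullback_def ext_zero_def)
qed

lemma scale_sec_add:
  fixes s t :: "'a \<Rightarrow> ('a \<Rightarrow> 'k::real_normed_field) set"
  assumes s: "s \<in> Cc_sections X" and t: "t \<in> Cc_sections X"
  shows "sec_mult X q (sec_add X s t) = sec_add X (sec_mult X q s) (sec_mult X q t)"
proof (rule Cc_sections_eqI)
  fix e assume e: "e \<in> points X"
  obtain f where f: "s e = germ X e f" using Cc_sections_germ[OF s e] .
  obtain g where g: "t e = germ X e g" using Cc_sections_germ[OF t e] .
  have "sec_mult X q (sec_add X s t) e = germ X e (q * (f + g))"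
    by (rule sec_mult_apply[OF e]; rule sec_add_apply[OF e]) (fact f g)+
  moreover have "sec_add X (sec_mult X q s) (sec_mult X q t) e = germ X e (q * f + q * g)"
    by (rule sec_add_apply[OF e]; rule sec_mult_apply[OF e]) (fact f g)+
  ultimately show "sec_mult X q (sec_add X s t) e = sec_add X (sec_mult X q s) (sec_mult X q t) e"
    by (simp add: distrib_left)
qed (simp_all add: section_extensional)

section \<open>Induction over sections and their module structure\<close>

context sheaf
begin

lemma elementary_section_continuous:
  assumes U: "elementary E U"
  shows "continuous_map (subtopology (mtop M) (proj E ` U)) (subtopology (mtop (total E)) U) (inv_into U (proj E))"
proof -
  have UE: "U \<subseteq> epoints E" using openin_subset[OF elementary_openin[OF U]] .
  have "openin (subtopology (mtop M) (proj E ` U)) {y \<in> proj E ` U. inv_into U (proj E) y \<in> A}"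
    if A: "openin (mtop (total E)) A" for A
  proof -
    have "{y \<in> proj E ` U. inv_into U (proj E) y \<in> A} = proj E ` (U \<inter> A)"
      using elementary_inj[OF U] by (auto simp: inv_into_f_f)
    then show ?thesis
      using proj_open[of "U \<inter> A"] elementary_openin[OF U] A elementary_image[OF U]
      by (auto simp: openin_open_subtopology)
  qed
  then have "continuous_map (subtopology (mtop M) (proj E ` U)) (mtop (total E)) (inv_into U (proj E))"
    using UE openin_subset[OF elementary_image[OF U]] elementary_inj[OF U]
    by (auto simp: continuous_map_def inf.absorb2 inv_into_f_f)
  then show ?thesis
    by (rule continuous_map_into_subtopology) (use elementary_inj[OF U] in \<open>auto simp: inv_into_f_f\<close>)
qed

lemma compactin_vimage_elementary:
  assumes U: "openin (mtop (total E)) U" and V: "elementary E V" "V \<subseteq> U"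
    and K: "compactin (mtop M) K" "K \<subseteq> proj E ` V"
  shows "compactin (subtopology (mtop (total E)) U) (V \<inter> proj E -` K)"
proof -
  let ?L = "V \<inter> proj E -` K"
  have "compactin (subtopology (mtop M) (proj E ` V)) K" using K by (simp add: compactin_subtopology)
  then have "compactin (subtopology (mtop (total E)) V) (inv_into V (proj E) ` K)"
    using elementary_section_continuous[OF V(1)] image_compactin by blast
  moreover have "inv_into V (proj E) ` K = ?L"
  proof (intro equalityI subsetI)
    fix w assume "w \<in> inv_into V (proj E) ` K"
    then obtain x where x: "x \<in> K" "w = inv_into V (proj E) x" by blast
    then obtain v where "v \<in> V" "x = proj E v" using K by blast
    then show "w \<in> ?L" using elementary_inj[OF V(1)] x by (auto simp: inv_into_f_f)
  next
    fix v assume "v \<in> ?L"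
    then show "v \<in> inv_into V (proj E) ` K"
      using elementary_inj[OF V(1)] by (auto simp: inv_into_f_f intro!: image_eqI[of _ _ "proj E v"])
  qed
  ultimately show ?thesis using V(2) by (auto simp: compactin_subtopology)
qed

text \<open>The set L lies over the compact K inside V and is compact; in the Hausdorff space U it
  is therefore closed, and a point of U off V has a neighbourhood avoiding it. In E itself L need
  not be closed, which is why an extension by zero from V to E can be discontinuous.\<close>

lemma Cc_pullback_off_near_0:
  fixes f :: "'x \<Rightarrow> 'k::real_normed_field"
  assumes U: "openin (mtop (total E)) U" "Hausdorff_space (subtopology (mtop (total E)) U)"
    and V: "elementary E V" "V \<subseteq> U" and f: "f \<in> Cc (open_sub M (proj E ` V))" and e: "e \<in> U - V"
  shows "\<exists>W. openin (mtop (total E)) W \<and> e \<in> W \<and> W \<subseteq> U \<and> (\<forall>e'\<in>W. e' \<in> V \<longrightarrow> f (proj E e') = 0)"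
proof -
  obtain K where K: "compactin (mtop M) K" "K \<subseteq> proj E ` V" "{x. f x \<noteq> 0} \<subseteq> K"
    using f by (auto simp: Cc_open_sub_iff[OF elementary_image[OF V(1)]])
  let ?L = "V \<inter> proj E -` K"
  have UE: "U \<subseteq> epoints E" using openin_subset[OF U(1)] .
  have "openin (subtopology (mtop (total E)) U) (topspace (subtopology (mtop (total E)) U) - ?L)"
    using compactin_imp_closedin[OF U(2) compactin_vimage_elementary[OF U(1) V K(1,2)]] by blast
  then have "openin (mtop (total E)) (U - ?L)"
    using U(1) UE by (simp add: openin_open_subtopology inf.absorb2)
  then show ?thesis using e K(3) by (intro exI[of _ "U - ?L"]) auto
qed

lemma Cc_pullback:
  fixes f :: "'x \<Rightarrow> 'k::real_normed_field"
  assumes U: "openin (mtop (total E)) U" "Hausdorff_space (subtopology (mtop (total E)) U)"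
    and V: "elementary E V" "V \<subseteq> U" and f: "f \<in> Cc (open_sub M (proj E ` V))"
  shows "(\<lambda>e. if e \<in> V then f (proj E e) else 0) \<in> Cc (open_sub (total E) U)" (is "?f \<in> _")
proof -
  have pV: "openin (mtop M) (proj E ` V)" using elementary_image[OF V(1)] .
  obtain K where K: "compactin (mtop M) K" "K \<subseteq> proj E ` V" "{x. f x \<noteq> 0} \<subseteq> K"
    using f by (auto simp: Cc_open_sub_iff[OF pV])
  let ?L = "V \<inter> proj E -` K"
  have L: "compactin (subtopology (mtop (total E)) U) ?L"
    using compactin_vimage_elementary[OF U(1) V K(1,2)] .
  have UE: "U \<subseteq> epoints E" using openin_subset[OF U(1)] .
  have "smooth_fun (open_sub (total E) U) ?f"
  proof (rule smooth_fun_local[OF total_manifold U(1)])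
    fix e assume e: "e \<in> U"
    show "\<exists>W g. openin (mtop (total E)) W \<and> e \<in> W \<and> smooth_fun (open_sub (total E) W) g \<and> (\<forall>y\<in>W \<inter> U. ?f y = g y)"
    proof (cases "e \<in> V")
      case True
      have "smooth_fun (open_sub M (proj E ` V)) f" using f by (simp add: Cc_def)
      then have "smooth_fun (open_sub (total E) (epoints E \<inter> proj E -` (proj E ` V))) (f \<circ> proj E)"
        by (rule smooth_fun_comp_proj[OF pV])
      then have "smooth_fun (open_sub (total E) V) (f \<circ> proj E)"
        using UE V(2) by (intro smooth_fun_mono[OF total_manifold openin_map_vimage[OF proj_continuous pV] elementary_openin[OF V(1)]]) auto
      then show ?thesis
        using True elementary_openin[OF V(1)] by (intro exI[of _ V] exI[of _ "f \<circ> proj E"]) auto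
    next
      case False
      then obtain W where "openin (mtop (total E)) W" "e \<in> W" "\<forall>e'\<in>W. e' \<in> V \<longrightarrow> f (proj E e') = 0"
        using Cc_pullback_off_near_0[OF U V f, of e] e by blast
      then show ?thesis
        by (intro exI[of _ W] exI[of _ "\<lambda>_. 0"]) (auto intro: smooth_fun_const)
    qed
  qed
  moreover have "{e. ?f e \<noteq> 0} \<subseteq> ?L" using K(3) by auto
  moreover have "Hausdorff_space (mtop (open_sub (total E) U))" using U(2) by (simp add: mtop_open_sub)
  moreover have "compactin (mtop (open_sub (total E) U)) ?L" using L by (simp add: mtop_open_sub)
  ultimately show ?thesis
    using Cc_iff[OF manifold_open_sub[OF total_manifold U(1)]] by blast
qed

lemma pullback_in_sections:
  fixes f :: "'x \<Rightarrow> 'k::real_normed_field"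
  assumes V: "elementary E V" and f: "f \<in> Cc (open_sub M (proj E ` V))"
  shows "pullback E V f \<in> Cc_sections (total E)"
proof -
  \<comment> \<open>Elements of \<open>Cc\<close> are normalized to 0 off their domain, which the
    composite of f with the projection is not. Cutting it off outside V changes no germ at the
    points of V.\<close>
  have "pullback E V f = ext_zero (total E) V (\<lambda>e. if e \<in> V then f (proj E e) else 0)"
  proof (rule Cc_sections_eqI)
    fix e assume e: "e \<in> epoints E"
    have "germ (total E) e (f \<circ> proj E) = germ (total E) e (\<lambda>e. if e \<in> V then f (proj E e) else 0)" if "e \<in> V"
      using that elementary_openin[OF V] by (auto simp: germ_eq_iff[OF e] intro!: nearI[of _ V])
    then show "pullback E V f e = ext_zero (total E) V (\<lambda>e. if e \<in> V then f (proj E e) else 0) e"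
      by (simp add: pullback_apply[OF e] ext_zero_apply[OF e])
  qed (simp_all add: section_extensional)
  moreover have "ext_zero (total E) V (\<lambda>e. if e \<in> V then f (proj E e) else 0) \<in> Cc_sections (total E)"
    by (intro Cc_sections.gen elementary_openin[OF V] elementary_Hausdorff[OF V]
      Cc_pullback[OF elementary_openin[OF V] elementary_Hausdorff[OF V] V _ f]) simp
  ultimately show ?thesis by simp
qed

text \<open>A function with compact support in a Hausdorff open set is cut into pieces supported in small elementary
  sets by bump functions pulled back from the base, splitting off f b from f = f b + f (1 - b).\<close>

lemma ext_zero_induct:
  fixes f :: "'e \<Rightarrow> 'k::real_normed_field"
  assumes U: "openin (mtop (total E)) U" "Hausdorff_space (subtopology (mtop (total E)) U)"
    and f: "f \<in> Cc (open_sub (total E) U)"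
    and Q: "\<And>e. e \<in> epoints E \<Longrightarrow> \<exists>V. elementary E V \<and> e \<in> V \<and> Q V"
      "\<And>V W. Q V \<Longrightarrow> elementary E V \<Longrightarrow> openin (mtop (total E)) W \<Longrightarrow> W \<subseteq> V \<Longrightarrow> Q W"
    and zero: "P (ext_zero (total E) {} 0)"
    and pullback: "\<And>V g. elementary E V \<Longrightarrow> Q V \<Longrightarrow> g \<in> Cc (open_sub M (proj E ` V)) \<Longrightarrow> P (pullback E V (g :: 'x \<Rightarrow> 'k))"
    and add: "\<And>s t. s \<in> Cc_sections (total E) \<Longrightarrow> t \<in> Cc_sections (total E) \<Longrightarrow> P s \<Longrightarrow> P t \<Longrightarrow> P (sec_add (total E) s t)"
  shows "P (ext_zero (total E) U f)"
proof -
  have "Hausdorff_space (mtop (open_sub (total E) U))" using U(2) by (simp add: mtop_open_sub)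
  note CcU = Cc_iff[OF manifold_open_sub[OF total_manifold U(1)] this, unfolded mtop_open_sub]
  \<comment> \<open>Open pieces of U on which a bump pulled back from the base, supported over a
    small elementary V, is constantly 1. Finitely many of them cover the support of f.\<close>
  define \<O> where "\<O> = {A. openin (mtop (total E)) A \<and> (\<exists>V b. elementary E V \<and> Q V \<and> A \<subseteq> V \<and> V \<subseteq> U \<and>
      (b :: 'x \<Rightarrow> 'k) \<in> Cc (open_sub M (proj E ` V)) \<and> (\<forall>e\<in>A. b (proj E e) = 1))}"
  have UE: "U \<subseteq> epoints E" using openin_subset[OF U(1)] .
  obtain K where K: "compactin (subtopology (mtop (total E)) U) K" "{e. f e \<noteq> 0} \<subseteq> K"
    using f by (auto simp: CcU)
  then have K': "compactin (mtop (total E)) K" "K \<subseteq> U" by (auto simp: compactin_subtopology)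
  have "K \<subseteq> \<Union>\<O>"
  proof
    fix e assume "e \<in> K"
    then have e: "e \<in> U" "e \<in> epoints E" using K' UE by auto
    obtain V0 where V0: "elementary E V0" "e \<in> V0" "Q V0" using Q(1) e by blast
    let ?V = "V0 \<inter> U"
    have V: "elementary E ?V" "Q ?V" "e \<in> ?V"
      using V0 U e elementary_Int[OF V0(1) U(1)] Q(2)[OF V0(3,1), of ?V] elementary_openin by auto
    obtain b :: "'x \<Rightarrow> 'k" where b: "b \<in> Cc (open_sub M (proj E ` ?V))" "near M (proj E e) (\<lambda>y. b y = 1)"
      using Cc_bump[OF elementary_image[OF V(1)], of "proj E e"] V(3) by blast
    then have "near (total E) e (\<lambda>y. b (proj E y) = 1)" using near_proj_iff[OF e(2), of "\<lambda>y. b y = 1"] by simp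
    then obtain A where "openin (mtop (total E)) A" "e \<in> A" "\<forall>y\<in>A. b (proj E y) = 1"
      using e by (auto simp: near_iff)
    then have "A \<inter> ?V \<in> \<O>"
      unfolding \<O>_def using V b(1) elementary_openin[OF V(1)]
      by (auto intro!: exI[of _ ?V] exI[of _ b])
    then show "e \<in> \<Union>\<O>" using \<open>e \<in> A\<close> V by blast
  qed
  then obtain \<F> where F: "finite \<F>" "\<F> \<subseteq> \<O>" "K \<subseteq> \<Union>\<F>"
    using K'(1) unfolding compactin_def \<O>_def by (metis (no_types, lifting) mem_Collect_eq)
  have "{e. f e \<noteq> 0} \<subseteq> \<Union>\<F>" using F K by blast
  with F(1,2) f show ?thesis
  proof (induction \<F> arbitrary: f)
    case empty
    then have "f = 0" by (auto simp: fun_eq_iff)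
    then have "ext_zero (total E) U f = ext_zero (total E) {} 0" by (simp add: ext_zero_def)
    then show ?case using zero by simp
  next
    case (insert A \<F>)
    then obtain V b where V: "elementary E V" "Q V" "A \<subseteq> V" "V \<subseteq> U"
      and b: "(b :: 'x \<Rightarrow> 'k) \<in> Cc (open_sub M (proj E ` V))" "\<forall>e\<in>A. b (proj E e) = 1"
      by (auto simp: \<O>_def)
    let ?b = "\<lambda>e. if e \<in> V then b (proj E e) else 0"
    have bU: "?b \<in> Cc (open_sub (total E) U)" by (rule Cc_pullback[OF U V(1,4) b(1)])
    have sm: "smooth_fun (open_sub (total E) U) f" "smooth_fun (open_sub (total E) U) ?b"
      using insert.prems(2) bU by (auto simp: Cc_def)
    obtain L where L: "compactin (subtopology (mtop (total E)) U) L" "{e. f e \<noteq> 0} \<subseteq> L"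
      using insert.prems(2) by (auto simp: CcU)
    let ?f1 = "\<lambda>e. f e * ?b e" and ?f2 = "\<lambda>e. f e + (- 1) * (f e * ?b e)"
    have s1: "smooth_fun (open_sub (total E) U) ?f1"
      by (rule smooth_fun_mult[OF total_manifold U(1) sm])
    have "smooth_fun (open_sub (total E) U) (\<lambda>e. (- 1) * (f e * ?b e))"
      by (rule smooth_fun_mult[OF total_manifold U(1) smooth_fun_const s1])
    then have s2: "smooth_fun (open_sub (total E) U) ?f2"
      by (rule smooth_fun_add[OF total_manifold U(1) sm(1)])
    have f1: "?f1 \<in> Cc (open_sub (total E) U)" and f2: "?f2 \<in> Cc (open_sub (total E) U)"
      using s1 s2 L by (auto simp: CcU intro!: exI[of _ L])
    have "f = ?f1 + ?f2" by (auto simp: fun_eq_iff)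
    then have "ext_zero (total E) U f = ext_zero (total E) U (?f1 + ?f2)" by (rule arg_cong)
    then have split: "ext_zero (total E) U f = sec_add (total E) (ext_zero (total E) U ?f1) (ext_zero (total E) U ?f2)"
      by (simp only: ext_zero_add)
    \<comment> \<open>On A the bump is 1, so the second piece vanishes there and the remaining sets
      of the cover suffice for it.\<close>
    have "{e. ?f2 e \<noteq> 0} \<subseteq> \<Union>\<F>"
    proof
      fix e assume e: "e \<in> {e. ?f2 e \<noteq> 0}"
      then have "f e \<noteq> 0" by auto
      then have "e \<in> A \<union> \<Union>\<F>" using insert.prems by blast
      moreover have "e \<notin> A" using e V b(2) by (auto split: if_splits)
      ultimately show "e \<in> \<Union>\<F>" by blast
    qed
    then have P2: "P (ext_zero (total E) U ?f2)" using insert.IH insert.prems f2 by blast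
    \<comment> \<open>The function on the base whose pullback over V is the first piece. Off the
      image of V the inverse is arbitrary, so the first factor is 0 there; the factor b provides the
      compact support.\<close>
    let ?g = "\<lambda>x. (if x \<in> proj E ` V then f (inv_into V (proj E) x) else 0) * b x"
    have pV: "openin (mtop M) (proj E ` V)" using elementary_image[OF V(1)] .
    have "smooth_fun (open_sub (total E) V) f"
      using smooth_fun_mono[OF total_manifold U(1) elementary_openin[OF V(1)] V(4) sm(1)] .
    then have "smooth_fun (open_sub M (proj E ` V)) (f \<circ> inv_into V (proj E))"
      by (rule smooth_fun_comp_section[OF V(1)])
    moreover have "smooth_fun (open_sub M (proj E ` V)) b" using b(1) by (simp add: Cc_def)
    ultimately have "smooth_fun (open_sub M (proj E ` V)) (\<lambda>x. (f \<circ> inv_into V (proj E)) x * b x)"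
      by (rule smooth_fun_mult[OF manifold pV])
    then have gs: "smooth_fun (open_sub M (proj E ` V)) ?g"
      by (rule smooth_fun_cong[OF manifold pV]) auto
    obtain Kb where Kb: "compactin (mtop M) Kb" "Kb \<subseteq> proj E ` V" "{x. b x \<noteq> 0} \<subseteq> Kb"
      using b(1) by (auto simp: Cc_open_sub_iff[OF pV])
    have "Hausdorff_space (mtop (open_sub M (proj E ` V)))"
      by (simp add: mtop_open_sub Hausdorff_space_subtopology hausdorff)
    then have g: "?g \<in> Cc (open_sub M (proj E ` V))"
      using gs Kb by (auto simp: Cc_iff[OF manifold_open_sub[OF manifold pV]] mtop_open_sub compactin_subtopology intro!: exI[of _ Kb])
    have "ext_zero (total E) U ?f1 = pullback E V ?g"
    proof (rule Cc_sections_eqI)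
      fix e assume e: "e \<in> epoints E"
      have "near (total E) e (\<lambda>y. ?f1 y = (?g \<circ> proj E) y)" if "e \<in> V"
        using that elementary_openin[OF V(1)] elementary_inj[OF V(1)] by (intro nearI[of _ V]) (auto simp: inv_into_f_f)
      moreover have "near (total E) e (\<lambda>y. ?f1 y = 0 y)" if "e \<in> U" "e \<notin> V"
      proof -
        obtain W where "openin (mtop (total E)) W" "e \<in> W" "\<forall>e'\<in>W. e' \<in> V \<longrightarrow> b (proj E e') = 0"
          using Cc_pullback_off_near_0[OF U V(1,4) b(1), of e] \<open>e \<in> U\<close> \<open>e \<notin> V\<close> by blast
        then show ?thesis by (intro nearI[of _ W]) auto
      qed
      ultimately show "ext_zero (total E) U ?f1 e = pullback E V ?g e"
        using V(4) by (auto simp: ext_zero_apply[OF e] pullback_apply[OF e] germ_eq_iff[OF e])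
    qed (simp_all add: section_extensional)
    then have "P (ext_zero (total E) U ?f1)" using pullback V g by simp
    then show ?case
      unfolding split using P2 f1 f2 U by (intro add Cc_sections.gen)
  qed
qed

text \<open>Q restricts the pullback case to conveniently small elementary sets, for example those
  on which a family in the stalks has a single representative. Every section is still a sum of such
  pullbacks.\<close>

lemma sections_induct [consumes 1, case_names small small_subset zero pullback add]:
  fixes s :: "'e \<Rightarrow> ('e \<Rightarrow> 'k::real_normed_field) set"
  assumes s: "s \<in> Cc_sections (total E)"
    and Q: "\<And>e. e \<in> epoints E \<Longrightarrow> \<exists>V. elementary E V \<and> e \<in> V \<and> Q V"
      "\<And>V W. Q V \<Longrightarrow> elementary E V \<Longrightarrow> openin (mtop (total E)) W \<Longrightarrow> W \<subseteq> V \<Longrightarrow> Q W"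
    and "P (ext_zero (total E) {} 0)"
    and "\<And>V g. elementary E V \<Longrightarrow> Q V \<Longrightarrow> g \<in> Cc (open_sub M (proj E ` V)) \<Longrightarrow> P (pullback E V (g :: 'x \<Rightarrow> 'k))"
    and "\<And>s t. s \<in> Cc_sections (total E) \<Longrightarrow> t \<in> Cc_sections (total E) \<Longrightarrow> P s \<Longrightarrow> P t \<Longrightarrow> P (sec_add (total E) s t)"
  shows "P s"
  using s assms(4-)
proof (induction arbitrary: P rule: Cc_sections.induct)
  case (gen U f)
  show ?case using ext_zero_induct[OF gen.hyps Q gen.prems] .
next
  case (add s t)
  then show ?case by blast
next
  case (scale s a)
  \<comment> \<open>Scaling commutes with sums and maps pullbacks to pullbacks, so the induction
    hypothesis is applied to the predicate \<open>\<lambda>s. P (?m s)\<close>.\<close>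
  let ?m = "sec_mult (total E) (\<lambda>_. a :: 'k)"
  show ?case
  proof (rule scale.IH)
    have "?m (ext_zero (total E) {} 0) = ext_zero (total E) {} 0"
      using pullback_scale[of E a "{}" 0] by (simp add: pullback_0)
    then show "P (?m (ext_zero (total E) {} 0))" using scale.prems(1) by (simp add: zero_fun_def)
  next
    fix V g assume V: "elementary E V" "Q V" and g: "(g :: 'x \<Rightarrow> 'k) \<in> Cc (open_sub M (proj E ` V))"
    show "P (?m (pullback E V g))"
      unfolding pullback_scale using V by (intro scale.prems(2) Cc_open_sub_scale elementary_image g)
  next
    fix s t assume "s \<in> Cc_sections (total E)" "t \<in> Cc_sections (total E)" "P (?m s)" "P (?m t)"
    then show "P (?m (sec_add (total E) s t))"
      by (simp add: scale_sec_add scale.prems(3) Cc_sections.scale)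
  qed
qed

lemma sections_induct_pullback [consumes 1, case_names zero pullback add]:
  fixes s :: "'e \<Rightarrow> ('e \<Rightarrow> 'k::real_normed_field) set"
  assumes "s \<in> Cc_sections (total E)"
    and "P (ext_zero (total E) {} 0)"
    and "\<And>V g. elementary E V \<Longrightarrow> g \<in> Cc (open_sub M (proj E ` V)) \<Longrightarrow> P (pullback E V (g :: 'x \<Rightarrow> 'k))"
    and "\<And>s t. s \<in> Cc_sections (total E) \<Longrightarrow> t \<in> Cc_sections (total E) \<Longrightarrow> P s \<Longrightarrow> P t \<Longrightarrow> P (sec_add (total E) s t)"
  shows "P s"
  using assms(1)
  by (rule sections_induct[where Q = "\<lambda>_. True"]) (use assms elementary_point in \<open>blast+\<close>)

lemma Cc_module_simps:
  "carrier (Cc_module E) = Cc_sections (total E)"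
  "\<zero>\<^bsub>Cc_module E\<^esub> = ext_zero (total E) {} 0"
  "s \<oplus>\<^bsub>Cc_module E\<^esub> t = sec_add (total E) s t"
  "p \<odot>\<^bsub>Cc_module E\<^esub> s = sec_mult (total E) (p \<circ> proj E) s"
  by (simp_all add: Cc_module_def)

lemma elementary_empty: "elementary E {}"
  by (simp add: elementary_def)

lemma zero_in_sections: "ext_zero (total E) {} (0 :: _ \<Rightarrow> 'k::real_normed_field) \<in> Cc_sections (total E)"
  using pullback_in_sections[OF elementary_empty, of 0] Cc_open_sub_0[OF openin_empty] by (simp add: pullback_0)

lemma sec_mult_in_sections:
  fixes s :: "'e \<Rightarrow> ('e \<Rightarrow> 'k::real_normed_field) set"
  assumes p: "p \<in> Cc M" and s: "s \<in> Cc_sections (total E)"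
  shows "sec_mult (total E) (p \<circ> proj E) s \<in> Cc_sections (total E)"
  using s
proof (induction rule: sections_induct_pullback)
  case zero
  have "sec_mult (total E) (p \<circ> proj E) (ext_zero (total E) {} 0) = ext_zero (total E) {} 0"
    using pullback_mult[of E p "{}" 0] by (simp add: pullback_0)
  then show ?case using zero_in_sections by (simp add: o_def zero_fun_def)
next
  case (pullback V g)
  then show ?case
    unfolding pullback_mult by (intro pullback_in_sections Cc_open_sub_mult p elementary_image)
next
  case (add s t)
  then show ?case by (simp add: scale_sec_add Cc_sections.add)
qed

text \<open>Stronger than the existence of a unit: every r that is 1 on K works. In this form the
  compact sets of two sections can be united.\<close>

lemma sections_unit:
  fixes s :: "'e \<Rightarrow> ('e \<Rightarrow> 'k::real_normed_field) set"
  assumes s: "s \<in> Cc_sections (total E)"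
  shows "\<exists>K. compactin (mtop M) K \<and>
    (\<forall>r\<in>Cc M. (\<forall>x\<in>K. r x = 1) \<longrightarrow> sec_mult (total E) (r \<circ> proj E) s = s)"
  using s
proof (induction rule: sections_induct_pullback)
  case zero
  have "sec_mult (total E) (r \<circ> proj E) (ext_zero (total E) {} 0) = ext_zero (total E) {} 0" for r :: "'x \<Rightarrow> 'k"
    using pullback_mult[of E r "{}" 0] by (simp add: pullback_0)
  then show ?case by (intro exI[of _ "{}"]) (simp add: o_def zero_fun_def)
next
  case (pullback V g)
  then obtain K where K: "compactin (mtop M) K" "{x. g x \<noteq> 0} \<subseteq> K"
    by (auto simp: Cc_open_sub_iff[OF elementary_image])
  have "sec_mult (total E) (r \<circ> proj E) (pullback E V g) = pullback E V g" if "\<forall>x\<in>K. r x = 1" for r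
  proof -
    have "r * g = g" using that K by (auto simp: fun_eq_iff)
    then show ?thesis by (simp add: pullback_mult)
  qed
  then show ?case using K by blast
next
  case (add s t)
  then obtain K L where
    "compactin (mtop M) K" "\<forall>r\<in>Cc M. (\<forall>x\<in>K. r x = 1) \<longrightarrow> sec_mult (total E) (r \<circ> proj E) s = s"
    "compactin (mtop M) L" "\<forall>r\<in>Cc M. (\<forall>x\<in>L. r x = 1) \<longrightarrow> sec_mult (total E) (r \<circ> proj E) t = t" by blast
  then show ?case
    using add by (intro exI[of _ "K \<union> L"]) (simp add: compactin_Un scale_sec_add o_def)
qed

lemma Cc_module_lu: "Cc_lu_module M (Cc_module E :: ('x \<Rightarrow> 'k::real_normed_field, 'e \<Rightarrow> ('e \<Rightarrow> 'k) set) module)"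
proof
  let ?C = "Cc_module E :: ('x \<Rightarrow> 'k, 'e \<Rightarrow> ('e \<Rightarrow> 'k) set) module"
  let ?S = "Cc_sections (total E) :: ('e \<Rightarrow> ('e \<Rightarrow> 'k) set) set"
  have eqI: "s = t" if "s \<in> ?S" "t \<in> ?S" "\<And>e. e \<in> epoints E \<Longrightarrow> s e = t e" for s t
    using that Cc_sections_extensional by (intro Cc_sections_eqI) auto
  \<comment> \<open>A representative of the germ of s at e. The module laws are then checked point
    by point in the ring of functions.\<close>
  define r :: "('e \<Rightarrow> ('e \<Rightarrow> 'k) set) \<Rightarrow> 'e \<Rightarrow> 'e \<Rightarrow> 'k"
    where "r s e = (SOME f. s e = germ (total E) e f)" for s e
  have r: "s e = germ (total E) e (r s e)" if se: "s \<in> ?S" "e \<in> epoints E" for s e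
  proof -
    obtain f where "s e = germ (total E) e f" using Cc_sections_germ[OF se] .
    then show ?thesis unfolding r_def by (rule someI[of "\<lambda>f. s e = germ (total E) e f"])
  qed
  have add: "sec_add (total E) s t \<in> ?S" if "s \<in> ?S" "t \<in> ?S" for s t using that by (rule Cc_sections.add)
  have ae: "sec_add (total E) s t e = germ (total E) e (r s e + r t e)"
    if "s \<in> ?S" "t \<in> ?S" "e \<in> epoints E" for s t e
    by (rule sec_add_apply[OF that(3)]) (rule r[OF that(1,3)] r[OF that(2,3)])+
  have me: "sec_mult (total E) q s e = germ (total E) e (q * r s e)" if "s \<in> ?S" "e \<in> epoints E" for s e q
    by (rule sec_mult_apply[OF that(2)]) (rule r[OF that])
  have ag: "abelian_group ?C"
  proof (rule abelian_groupI)
    fix s t u assume *: "s \<in> carrier ?C" "t \<in> carrier ?C" "u \<in> carrier ?C"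
    show "s \<oplus>\<^bsub>?C\<^esub> t \<oplus>\<^bsub>?C\<^esub> u = s \<oplus>\<^bsub>?C\<^esub> (t \<oplus>\<^bsub>?C\<^esub> u)"
      unfolding Cc_module_simps using * unfolding Cc_module_simps
    proof (intro eqI add)
      fix e assume e: "e \<in> epoints E" and S: "s \<in> ?S" "t \<in> ?S" "u \<in> ?S"
      have "sec_add (total E) (sec_add (total E) s t) u e = germ (total E) e (r s e + r t e + r u e)"
        by (rule sec_add_apply[OF e]) (rule ae[OF S(1,2) e] r[OF S(3) e])+
      moreover have "sec_add (total E) s (sec_add (total E) t u) e = germ (total E) e (r s e + (r t e + r u e))"
        by (rule sec_add_apply[OF e]) (rule ae[OF S(2,3) e] r[OF S(1) e])+
      ultimately show "sec_add (total E) (sec_add (total E) s t) u e = sec_add (total E) s (sec_add (total E) t u) e"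
        by (simp add: add.assoc)
    qed
    show "s \<oplus>\<^bsub>?C\<^esub> t = t \<oplus>\<^bsub>?C\<^esub> s"
      using * unfolding Cc_module_simps by (intro eqI add) (auto simp: ae add.commute)
    show "\<zero>\<^bsub>?C\<^esub> \<oplus>\<^bsub>?C\<^esub> s = s"
      unfolding Cc_module_simps using * unfolding Cc_module_simps
    proof (intro eqI add zero_in_sections)
      fix e assume e: "e \<in> epoints E" and S: "s \<in> ?S"
      have "sec_add (total E) (ext_zero (total E) {} 0) s e = germ (total E) e ((if e \<in> {} then 0 else 0) + r s e)"
        by (rule sec_add_apply[OF e]) (rule ext_zero_apply[OF e] r[OF S e])+
      then show "sec_add (total E) (ext_zero (total E) {} 0) s e = s e"
        using r[OF S e] by simp
    qed
    show "\<exists>t\<in>carrier ?C. t \<oplus>\<^bsub>?C\<^esub> s = \<zero>\<^bsub>?C\<^esub>"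
    proof (intro bexI)
      show m: "sec_mult (total E) (\<lambda>_. - 1) s \<in> carrier ?C"
        using * unfolding Cc_module_simps by (intro Cc_sections.scale)
      show "sec_mult (total E) (\<lambda>_. - 1) s \<oplus>\<^bsub>?C\<^esub> s = \<zero>\<^bsub>?C\<^esub>"
        unfolding Cc_module_simps
      proof (intro eqI add zero_in_sections)
        fix e assume e: "e \<in> epoints E"
        have S: "s \<in> ?S" using * by (simp add: Cc_module_simps)
        have "(\<lambda>_. - 1) * r s e + r s e = 0" by (simp add: fun_eq_iff)
        moreover have "sec_add (total E) (sec_mult (total E) (\<lambda>_. - 1) s) s e = germ (total E) e ((\<lambda>_. - 1) * r s e + r s e)"
          by (rule sec_add_apply[OF e]) (rule me[OF S e] r[OF S e])+
        ultimately show "sec_add (total E) (sec_mult (total E) (\<lambda>_. - 1) s) s e = ext_zero (total E) {} 0 e"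
          by (simp add: ext_zero_apply[OF e])
      qed (use * m in \<open>simp_all add: Cc_module_simps\<close>)
    qed
  qed (auto simp: Cc_module_simps add zero_in_sections)
  moreover have "\<exists>r\<in>Cc M. \<forall>c\<in>F. r \<odot>\<^bsub>?C\<^esub> c = c" if F: "finite F" "F \<subseteq> carrier ?C" for F
  proof -
    have "\<exists>K. compactin (mtop M) K \<and> (\<forall>s\<in>F. \<forall>r\<in>Cc M. (\<forall>x\<in>K. r x = 1) \<longrightarrow> sec_mult (total E) (r \<circ> proj E) s = s)"
      using F
    proof (induction F)
      case (insert s F)
      then have "s \<in> ?S" by (simp add: Cc_module_simps)
      from sections_unit[OF this] insert obtain K L where
        "compactin (mtop M) K" "\<forall>s\<in>F. \<forall>r\<in>Cc M. (\<forall>x\<in>K. r x = 1) \<longrightarrow> sec_mult (total E) (r \<circ> proj E) s = s"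
        "compactin (mtop M) L" "\<forall>r\<in>Cc M. (\<forall>x\<in>L. r x = 1) \<longrightarrow> sec_mult (total E) (r \<circ> proj E) s = s" by (auto simp: o_def)
      then show ?case by (intro exI[of _ "K \<union> L"]) (simp add: compactin_Un o_def)
    qed (auto intro: exI[of _ "{}"])
    then obtain K where K: "compactin (mtop M) K"
      "\<forall>s\<in>F. \<forall>r\<in>Cc M. (\<forall>x\<in>K. r x = 1) \<longrightarrow> sec_mult (total E) (r \<circ> proj E) s = s" by blast
    obtain r :: "'x \<Rightarrow> 'k" where r: "r \<in> Cc (open_sub M (points M))" "\<And>x. x \<in> K \<Longrightarrow> near M x (\<lambda>y. r y = 1)"
      using Cc_bump_compact[OF openin_topspace K(1) compactin_subset_topspace[OF K(1)]] by blast
    then have "r \<in> Cc M" "\<forall>x\<in>K. r x = 1"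
      using near_imp_at[of _ M] compactin_subset_topspace[OF K(1)] by (auto simp: open_sub_points)
    then show ?thesis using K(2) by (intro bexI[of _ r]) (simp_all add: Cc_module_simps)
  qed
  moreover have "(p + q) \<odot>\<^bsub>?C\<^esub> s = p \<odot>\<^bsub>?C\<^esub> s \<oplus>\<^bsub>?C\<^esub> q \<odot>\<^bsub>?C\<^esub> s"
    if pq: "p \<in> Cc M" "q \<in> Cc M" and s: "s \<in> carrier ?C" for p q s
    unfolding Cc_module_simps using pq s[unfolded Cc_module_simps]
  proof (intro eqI add sec_mult_in_sections Cc_add)
    fix e assume e: "e \<in> epoints E" and S: "s \<in> ?S"
    have "((p + q) \<circ> proj E) * r s e = (p \<circ> proj E) * r s e + (q \<circ> proj E) * r s e"
      by (simp add: fun_eq_iff distrib_right)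
    moreover have "sec_add (total E) (sec_mult (total E) (p \<circ> proj E) s) (sec_mult (total E) (q \<circ> proj E) s) e =
        germ (total E) e ((p \<circ> proj E) * r s e + (q \<circ> proj E) * r s e)"
      by (rule sec_add_apply[OF e]) (rule me[OF S e])+
    ultimately show "sec_mult (total E) ((p + q) \<circ> proj E) s e =
        sec_add (total E) (sec_mult (total E) (p \<circ> proj E) s) (sec_mult (total E) (q \<circ> proj E) s) e"
      using me[OF S e, of "(p + q) \<circ> proj E"] by metis
  qed
  moreover have "(p * q) \<odot>\<^bsub>?C\<^esub> s = p \<odot>\<^bsub>?C\<^esub> (q \<odot>\<^bsub>?C\<^esub> s)"
    if pq: "p \<in> Cc M" "q \<in> Cc M" and s: "s \<in> carrier ?C" for p q s
    unfolding Cc_module_simps using pq s[unfolded Cc_module_simps]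
  proof (intro eqI sec_mult_in_sections Cc_mult)
    fix e assume e: "e \<in> epoints E" and S: "s \<in> ?S"
    have "((p * q) \<circ> proj E) * r s e = (p \<circ> proj E) * ((q \<circ> proj E) * r s e)"
      by (simp add: fun_eq_iff mult.assoc)
    moreover have "sec_mult (total E) (p \<circ> proj E) (sec_mult (total E) (q \<circ> proj E) s) e =
        germ (total E) e ((p \<circ> proj E) * ((q \<circ> proj E) * r s e))"
      by (rule sec_mult_apply[OF e]) (rule me[OF S e])
    ultimately show "sec_mult (total E) ((p * q) \<circ> proj E) s e =
        sec_mult (total E) (p \<circ> proj E) (sec_mult (total E) (q \<circ> proj E) s) e"
      using me[OF S e, of "(p * q) \<circ> proj E"] by metis
  qed
  ultimately show "locally_unitary_module (Cc M) ?C"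
    unfolding locally_unitary_module_def
    by (simp add: Cc_module_simps sec_mult_in_sections scale_sec_add)
qed

end

lemma linear_map_comp:
  "linear_map R C D g \<Longrightarrow> linear_map R D G h \<Longrightarrow> linear_map R C G (\<lambda>c. h (g c))"
  by (auto simp: linear_map_def Pi_iff)

text \<open>Two expansions over different finite sets of points can so be compared over their
  union.\<close>

lemma (in Cc_lu_module) finsum_smult_superset:
  assumes "finite B" "A \<subseteq> B" "\<And>e. e \<notin> A \<Longrightarrow> g e = 0" "\<And>e. g e \<in> Cc M" "\<sigma> \<in> B \<rightarrow> carrier C"
  shows "(\<Oplus>e\<in>A. g e \<odot> \<sigma> e) = (\<Oplus>e\<in>B. g e \<odot> \<sigma> e)"
proof (rule add.finprod_mono_neutral_cong_left)
  show "g i \<odot> \<sigma> i = \<zero>" if "i \<in> B - A" for i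
    using that assms(3)[of i] assms(5) smult_0[of "\<sigma> i"] by (auto simp: Pi_iff zero_fun_def)
qed (use assms in \<open>auto simp: Pi_iff\<close>)

section \<open>Linear maps out of the module of sections\<close>

locale sheaf_module = sheaf M E + Cc_lu_module M T
  for M :: "('x, 'b::real_inner) mfd" and E :: "('e, 'b, 'x) etale"
    and T :: "('x \<Rightarrow> 'k::real_normed_field, 'c, 'z) module_scheme" (structure)
begin

text \<open>A family \<open>\<sigma>\<close> of elements of T, indexed by the points of E, is considered up to \<open>eq_at\<close> at the base points,
  that is, as a map to the stalks of T.  The section s expands to t if near each x the element t is the
  combination of the members of the family over x with the germs of s as coefficients.\<close>

definition locally_constant :: "('e \<Rightarrow> 'c) \<Rightarrow> bool" where
  "locally_constant \<sigma> \<longleftrightarrow> (\<forall>e\<in>epoints E. \<sigma> e \<in> carrier T) \<and>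
     (\<forall>e\<in>epoints E. \<exists>V c. elementary E V \<and> e \<in> V \<and> c \<in> carrier T \<and> (\<forall>e'\<in>V. eq_at M T (proj E e') c (\<sigma> e')))"

definition expands :: "('e \<Rightarrow> 'c) \<Rightarrow> ('e \<Rightarrow> ('e \<Rightarrow> 'k) set) \<Rightarrow> 'c \<Rightarrow> bool" where
  "expands \<sigma> s t \<longleftrightarrow> (\<forall>x\<in>points M. \<exists>A g. finite A \<and> A \<subseteq> {e \<in> epoints E. proj E e = x} \<and>
     (\<forall>e. g e \<in> Cc M) \<and> (\<forall>e. e \<notin> A \<longrightarrow> g e = 0) \<and>
     (\<forall>e\<in>epoints E. proj E e = x \<longrightarrow> s e = germ (total E) e (g e \<circ> proj E)) \<and>
     eq_at M T x t (\<Oplus>e\<in>A. g e \<odot> \<sigma> e))"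

lemma expandsE:
  assumes "expands \<sigma> s t" "x \<in> points M"
  obtains A g where "finite A" "A \<subseteq> {e \<in> epoints E. proj E e = x}" "\<And>e. g e \<in> Cc M" "\<And>e. e \<notin> A \<Longrightarrow> g e = 0"
    "\<And>e. e \<in> epoints E \<Longrightarrow> proj E e = x \<Longrightarrow> s e = germ (total E) e (g e \<circ> proj E)"
    "eq_at M T x t (\<Oplus>e\<in>A. g e \<odot> \<sigma> e)"
proof -
  have "\<exists>A g. finite A \<and> A \<subseteq> {e \<in> epoints E. proj E e = x} \<and>
     (\<forall>e. g e \<in> Cc M) \<and> (\<forall>e. e \<notin> A \<longrightarrow> g e = 0) \<and>
     (\<forall>e\<in>epoints E. proj E e = x \<longrightarrow> s e = germ (total E) e (g e \<circ> proj E)) \<and>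
     eq_at M T x t (\<Oplus>e\<in>A. g e \<odot> \<sigma> e)"
    using assms unfolding expands_def by (rule bspec)
  then show ?thesis by (elim exE conjE) (rule that; simp)
qed

text \<open>An elementary set has at most one point over x. The expansion has that point as its only
  term if x lies under U, and is empty otherwise.\<close>

lemma expands_pullback:
  assumes U: "elementary E U" and f: "f \<in> Cc (open_sub M (proj E ` U))" and t: "t \<in> carrier T"
    and \<sigma>: "\<And>e. e \<in> U \<Longrightarrow> \<sigma> e \<in> carrier T" "\<And>e. e \<in> U \<Longrightarrow> eq_at M T (proj E e) t (f \<odot> \<sigma> e)"
    and off: "\<And>x. x \<in> points M \<Longrightarrow> x \<notin> proj E ` U \<Longrightarrow> eq_at M T x t \<zero>"
  shows "expands \<sigma> (pullback E U f) t"
  unfolding expands_def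
proof
  fix x assume x: "x \<in> points M"
  have c0: "0 \<circ> proj E = (0 :: 'e \<Rightarrow> 'k)" by (simp add: fun_eq_iff)
  have fM: "f \<in> Cc M" using Cc_open_sub_subset[OF elementary_image[OF U] f] .
  show "\<exists>A g. finite A \<and> A \<subseteq> {e \<in> epoints E. proj E e = x} \<and> (\<forall>e. g e \<in> Cc M) \<and> (\<forall>e. e \<notin> A \<longrightarrow> g e = 0) \<and>
     (\<forall>e\<in>epoints E. proj E e = x \<longrightarrow> pullback E U f e = germ (total E) e (g e \<circ> proj E)) \<and>
     eq_at M T x t (\<Oplus>e\<in>A. g e \<odot> \<sigma> e)"
  proof (cases "x \<in> proj E ` U")
    case True
    then obtain e where e: "e \<in> U" "proj E e = x" by blast
    let ?g = "\<lambda>e'. if e' = e then f else 0"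
    have "e' \<notin> U" if "proj E e' = x" "e' \<noteq> e" for e'
      using that e inj_onD[OF elementary_inj[OF U]] by blast
    then have "pullback E U f e' = germ (total E) e' (?g e' \<circ> proj E)" if "e' \<in> epoints E" "proj E e' = x" for e'
      using that e c0 by (auto simp: pullback_apply)
    moreover have "(\<Oplus>e'\<in>{e}. ?g e' \<odot> \<sigma> e') = f \<odot> \<sigma> e" using e \<sigma>(1) fM by simp
    ultimately show ?thesis
      using e \<sigma>(2)[OF e(1)] fM Cc_0 openin_subset[OF elementary_openin[OF U]]
      by (intro exI[of _ "{e}"] exI[of _ ?g]) auto
  next
    case False
    then have "e \<notin> U" if "proj E e = x" for e using that by blast
    then show ?thesis
      using off[OF x False] Cc_0 c0 by (intro exI[of _ "{}"] exI[of _ "\<lambda>_. 0"]) (auto simp: pullback_apply)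
  qed
qed

text \<open>The germs of s determine the coefficients near x, whatever finite sets index them, so t
  and t' agree near every x; elements of T with the same germs are equal.\<close>

lemma expands_unique:
  assumes "expands \<sigma> s t" "expands \<sigma> s t'" and t: "t \<in> carrier T" "t' \<in> carrier T"
    and \<sigma>: "\<And>e. e \<in> epoints E \<Longrightarrow> \<sigma> e \<in> carrier T"
  shows "t = t'"
proof (rule eq_at_imp_eq[OF t])
  fix x assume x: "x \<in> points M"
  obtain A g where A: "finite A" "A \<subseteq> {e \<in> epoints E. proj E e = x}" "\<And>e. g e \<in> Cc M" "\<And>e. e \<notin> A \<Longrightarrow> g e = 0"
    "\<And>e. e \<in> epoints E \<Longrightarrow> proj E e = x \<Longrightarrow> s e = germ (total E) e (g e \<circ> proj E)"
    "eq_at M T x t (\<Oplus>e\<in>A. g e \<odot> \<sigma> e)"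
    using expandsE[OF assms(1) x] by blast
  obtain B h where B: "finite B" "B \<subseteq> {e \<in> epoints E. proj E e = x}" "\<And>e. h e \<in> Cc M" "\<And>e. e \<notin> B \<Longrightarrow> h e = 0"
    "\<And>e. e \<in> epoints E \<Longrightarrow> proj E e = x \<Longrightarrow> s e = germ (total E) e (h e \<circ> proj E)"
    "eq_at M T x t' (\<Oplus>e\<in>B. h e \<odot> \<sigma> e)"
    using expandsE[OF assms(2) x] by blast
  have \<sigma>': "\<sigma> \<in> A \<union> B \<rightarrow> carrier T" using A B \<sigma> by auto
  have "near M x (\<lambda>y. g e y = h e y)" if e: "e \<in> A \<union> B" for e
  proof -
    have e': "e \<in> epoints E" "proj E e = x" using e A B by auto
    then have "germ (total E) e (g e \<circ> proj E) = germ (total E) e (h e \<circ> proj E)" using A(5) B(5) by metis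
    then show ?thesis
      using near_proj_iff[OF e'(1), of "\<lambda>y. g e y = h e y"] e' by (simp add: germ_eq_iff)
  qed
  then have "eq_at M T x (\<Oplus>e\<in>A \<union> B. g e \<odot> \<sigma> e) (\<Oplus>e\<in>A \<union> B. h e \<odot> \<sigma> e)"
    using A(1,3) B(1,3) \<sigma>' by (intro eq_at_finsum x eq_at_smult_near) (auto simp: Pi_iff)
  moreover have "(\<Oplus>e\<in>A. g e \<odot> \<sigma> e) = (\<Oplus>e\<in>A \<union> B. g e \<odot> \<sigma> e)"
    using A B \<sigma>' by (intro finsum_smult_superset) auto
  moreover have "(\<Oplus>e\<in>B. h e \<odot> \<sigma> e) = (\<Oplus>e\<in>A \<union> B. h e \<odot> \<sigma> e)"
    using A B \<sigma>' by (intro finsum_smult_superset) auto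
  moreover have "(\<Oplus>e\<in>A \<union> B. g e \<odot> \<sigma> e) \<in> carrier T" "(\<Oplus>e\<in>A \<union> B. h e \<odot> \<sigma> e) \<in> carrier T"
    using A(3) B(3) \<sigma>' by (auto intro!: finsum_closed simp: Pi_iff)
  ultimately have *: "eq_at M T x t (\<Oplus>e\<in>A \<union> B. h e \<odot> \<sigma> e)" "eq_at M T x (\<Oplus>e\<in>A \<union> B. h e \<odot> \<sigma> e) t'"
      "(\<Oplus>e\<in>A \<union> B. h e \<odot> \<sigma> e) \<in> carrier T"
    using A(6) eq_at_sym[OF B(6)] t eq_at_trans[of x t "\<Oplus>e\<in>A \<union> B. g e \<odot> \<sigma> e"] by auto
  show "eq_at M T x t t'" using eq_at_trans[OF *(1,2) t(1) *(3) t(2)] .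
qed

lemma expands_add:
  assumes "expands \<sigma> s t" "expands \<sigma> s' t'" and t: "t \<in> carrier T" "t' \<in> carrier T"
    and \<sigma>: "\<And>e. e \<in> epoints E \<Longrightarrow> \<sigma> e \<in> carrier T"
  shows "expands \<sigma> (sec_add (total E) s s') (t \<oplus> t')"
  unfolding expands_def
proof
  fix x assume x: "x \<in> points M"
  obtain A g where A: "finite A" "A \<subseteq> {e \<in> epoints E. proj E e = x}" "\<And>e. g e \<in> Cc M" "\<And>e. e \<notin> A \<Longrightarrow> g e = 0"
    "\<And>e. e \<in> epoints E \<Longrightarrow> proj E e = x \<Longrightarrow> s e = germ (total E) e (g e \<circ> proj E)"
    "eq_at M T x t (\<Oplus>e\<in>A. g e \<odot> \<sigma> e)"
    using expandsE[OF assms(1) x] by blast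
  obtain B h where B: "finite B" "B \<subseteq> {e \<in> epoints E. proj E e = x}" "\<And>e. h e \<in> Cc M" "\<And>e. e \<notin> B \<Longrightarrow> h e = 0"
    "\<And>e. e \<in> epoints E \<Longrightarrow> proj E e = x \<Longrightarrow> s' e = germ (total E) e (h e \<circ> proj E)"
    "eq_at M T x t' (\<Oplus>e\<in>B. h e \<odot> \<sigma> e)"
    using expandsE[OF assms(2) x] by blast
  have \<sigma>': "\<sigma> \<in> A \<union> B \<rightarrow> carrier T" using A B \<sigma> by auto
  have gA: "(\<Oplus>e\<in>A. g e \<odot> \<sigma> e) = (\<Oplus>e\<in>A \<union> B. g e \<odot> \<sigma> e)"
    using A B \<sigma>' by (intro finsum_smult_superset) auto
  have hB: "(\<Oplus>e\<in>B. h e \<odot> \<sigma> e) = (\<Oplus>e\<in>A \<union> B. h e \<odot> \<sigma> e)"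
    using A B \<sigma>' by (intro finsum_smult_superset) auto
  have cl: "(\<lambda>e. g e \<odot> \<sigma> e) \<in> A \<union> B \<rightarrow> carrier T" "(\<lambda>e. h e \<odot> \<sigma> e) \<in> A \<union> B \<rightarrow> carrier T"
    using A(3) B(3) \<sigma>' by (auto simp: Pi_iff)
  have "(\<Oplus>e\<in>A \<union> B. (g e + h e) \<odot> \<sigma> e) = (\<Oplus>e\<in>A \<union> B. g e \<odot> \<sigma> e \<oplus> h e \<odot> \<sigma> e)"
    using A(3) B(3) \<sigma>' cl by (intro finsum_cong') (auto simp: smult_l_distr Pi_iff)
  also have "\<dots> = (\<Oplus>e\<in>A \<union> B. g e \<odot> \<sigma> e) \<oplus> (\<Oplus>e\<in>A \<union> B. h e \<odot> \<sigma> e)"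
    using cl by (rule finsum_addf)
  finally have "eq_at M T x (t \<oplus> t') (\<Oplus>e\<in>A \<union> B. (g e + h e) \<odot> \<sigma> e)"
    using A(6) B(6) t cl gA hB by (auto intro!: eq_at_add finsum_closed)
  moreover have "sec_add (total E) s s' e = germ (total E) e ((g e + h e) \<circ> proj E)" if e: "e \<in> epoints E" "proj E e = x" for e
  proof -
    have "sec_add (total E) s s' e = germ (total E) e ((g e \<circ> proj E) + (h e \<circ> proj E))"
      by (rule sec_add_apply[OF e(1)]) (rule A(5)[OF e] B(5)[OF e])+
    moreover have "(g e \<circ> proj E) + (h e \<circ> proj E) = (g e + h e) \<circ> proj E" by (simp add: fun_eq_iff)
    ultimately show ?thesis by simp
  qed
  ultimately show "\<exists>A g. finite A \<and> A \<subseteq> {e \<in> epoints E. proj E e = x} \<and> (\<forall>e. g e \<in> Cc M) \<and> (\<forall>e. e \<notin> A \<longrightarrow> g e = 0) \<and>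
     (\<forall>e\<in>epoints E. proj E e = x \<longrightarrow> sec_add (total E) s s' e = germ (total E) e (g e \<circ> proj E)) \<and>
     eq_at M T x (t \<oplus> t') (\<Oplus>e\<in>A. g e \<odot> \<sigma> e)"
    using A B by (intro exI[of _ "A \<union> B"] exI[of _ "\<lambda>e. g e + h e"]) (auto simp: Cc_add)
qed

lemma expands_smult:
  assumes "expands \<sigma> s t" and r: "r \<in> Cc M" and t: "t \<in> carrier T"
    and \<sigma>: "\<And>e. e \<in> epoints E \<Longrightarrow> \<sigma> e \<in> carrier T"
  shows "expands \<sigma> (sec_mult (total E) (r \<circ> proj E) s) (r \<odot> t)"
  unfolding expands_def
proof
  fix x assume x: "x \<in> points M"
  obtain A g where A: "finite A" "A \<subseteq> {e \<in> epoints E. proj E e = x}" "\<And>e. g e \<in> Cc M" "\<And>e. e \<notin> A \<Longrightarrow> g e = 0"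
    "\<And>e. e \<in> epoints E \<Longrightarrow> proj E e = x \<Longrightarrow> s e = germ (total E) e (g e \<circ> proj E)"
    "eq_at M T x t (\<Oplus>e\<in>A. g e \<odot> \<sigma> e)"
    using expandsE[OF assms(1) x] by blast
  have cl: "(\<lambda>e. g e \<odot> \<sigma> e) \<in> A \<rightarrow> carrier T" using A \<sigma> by auto
  have "(\<Oplus>e\<in>A. (r * g e) \<odot> \<sigma> e) = (\<Oplus>e\<in>A. r \<odot> (g e \<odot> \<sigma> e))"
    using A \<sigma> r cl by (intro finsum_cong') (auto simp: smult_assoc Pi_iff)
  also have "\<dots> = r \<odot> (\<Oplus>e\<in>A. g e \<odot> \<sigma> e)" using smult_finsum[OF r A(1) cl] by simp
  finally have "eq_at M T x (r \<odot> t) (\<Oplus>e\<in>A. (r * g e) \<odot> \<sigma> e)"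
    using A(6) t cl r by (auto intro!: eq_at_smult finsum_closed)
  moreover have "sec_mult (total E) (r \<circ> proj E) s e = germ (total E) e ((r * g e) \<circ> proj E)"
    if e: "e \<in> epoints E" "proj E e = x" for e
  proof -
    have "sec_mult (total E) (r \<circ> proj E) s e = germ (total E) e ((r \<circ> proj E) * (g e \<circ> proj E))"
      by (rule sec_mult_apply[OF e(1)]) (rule A(5)[OF e])
    moreover have "(r \<circ> proj E) * (g e \<circ> proj E) = (r * g e) \<circ> proj E" by (simp add: fun_eq_iff)
    ultimately show ?thesis by simp
  qed
  ultimately show "\<exists>A g. finite A \<and> A \<subseteq> {e \<in> epoints E. proj E e = x} \<and> (\<forall>e. g e \<in> Cc M) \<and> (\<forall>e. e \<notin> A \<longrightarrow> g e = 0) \<and>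
     (\<forall>e\<in>epoints E. proj E e = x \<longrightarrow> sec_mult (total E) (r \<circ> proj E) s e = germ (total E) e (g e \<circ> proj E)) \<and>
     eq_at M T x (r \<odot> t) (\<Oplus>e\<in>A. g e \<odot> \<sigma> e)"
    using A r by (intro exI[of _ A] exI[of _ "\<lambda>e. r * g e"]) (auto simp: Cc_mult)
qed

text \<open>Linear maps from sections to T correspond to sections of the stalks of T over E.\<close>

lemma linear_extension:
  assumes \<sigma>: "locally_constant \<sigma>"
  shows "\<exists>H. H \<in> extensional (carrier (Cc_module E)) \<and> linear_map (Cc M) (Cc_module E) T H \<and>
    (\<forall>s\<in>Cc_sections (total E). expands \<sigma> s (H s)) \<and>
    (\<forall>s\<in>Cc_sections (total E). \<forall>t\<in>carrier T. expands \<sigma> s t \<longrightarrow> H s = t)"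
proof -
  have \<sigma>c: "\<sigma> e \<in> carrier T" if "e \<in> epoints E" for e using \<sigma> that by (simp add: locally_constant_def)
  have ex: "\<exists>t\<in>carrier T. expands \<sigma> s t" if "s \<in> Cc_sections (total E)" for s
    using that
  \<comment> \<open>Small sets are those on which one element c represents the whole family. Over
    such a set the pullback of f expands to f c, and local constancy provides enough of
    them.\<close>
  proof (induction rule: sections_induct[where Q = "\<lambda>V. \<exists>c\<in>carrier T. \<forall>e'\<in>V. eq_at M T (proj E e') c (\<sigma> e')"])
    case (small e)
    then show ?case using \<sigma> unfolding locally_constant_def by blast
  next
    case (small_subset V W)
    then show ?case by blast
  next
    case zero
    have "expands \<sigma> (pullback E {} 0) \<zero>"
      using Cc_open_sub_0[OF openin_empty] eq_at_refl by (intro expands_pullback elementary_empty) auto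
    then show ?case unfolding pullback_0 by (auto simp: zero_fun_def)
  next
    case (pullback V f)
    then obtain c where c: "c \<in> carrier T" "\<And>e'. e' \<in> V \<Longrightarrow> eq_at M T (proj E e') c (\<sigma> e')" by blast
    have V: "V \<subseteq> epoints E" using openin_subset[OF elementary_openin[OF pullback(1)]] .
    have f: "f \<in> Cc M" using Cc_open_sub_subset[OF elementary_image[OF pullback(1)] pullback(3)] .
    have "expands \<sigma> (pullback E V f) (f \<odot> c)"
    proof (rule expands_pullback[OF pullback(1,3)])
      show "\<sigma> e \<in> carrier T" if "e \<in> V" for e using that V \<sigma>c by auto
      then show "eq_at M T (proj E e) (f \<odot> c) (f \<odot> \<sigma> e)" if "e \<in> V" for e
        using that c f by (intro eq_at_smult) auto
      show "eq_at M T x (f \<odot> c) \<zero>" if "x \<in> points M" "x \<notin> proj E ` V" for x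
        using that c f Cc_off_near_0[OF elementary_image[OF pullback(1)] pullback(3)] by (intro eq_at_near_0) auto
    qed (use f c in simp)
    then show ?case using smult_closed[OF f c(1)] by blast
  next
    case (add s t)
    then show ?case using expands_add[OF _ _ _ _ \<sigma>c] by (meson a_closed)
  qed
  \<comment> \<open>Uniqueness of expansions makes the values well defined, and their compatibility
    with sums and scalars makes H linear.\<close>
  define H where "H = (\<lambda>s\<in>Cc_sections (total E). THE t. t \<in> carrier T \<and> expands \<sigma> s t)"
  have H: "H s = t" if "s \<in> Cc_sections (total E)" "t \<in> carrier T" "expands \<sigma> s t" for s t
    unfolding H_def using that expands_unique[OF _ _ _ _ \<sigma>c] by (auto intro!: the_equality)
  have H': "H s \<in> carrier T" "expands \<sigma> s (H s)" if "s \<in> Cc_sections (total E)" for s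
    using ex[OF that] H[OF that] by auto
  have "linear_map (Cc M) (Cc_module E) T H"
    unfolding linear_map_def Cc_module_simps
  proof (intro conjI ballI)
    show "H (sec_add (total E) s s') = H s \<oplus> H s'" if "s \<in> Cc_sections (total E)" "s' \<in> Cc_sections (total E)" for s s'
      using that H' by (intro H Cc_sections.add expands_add \<sigma>c) auto
    show "H (sec_mult (total E) (r \<circ> proj E) s) = r \<odot> H s" if "r \<in> Cc M" "s \<in> Cc_sections (total E)" for r s
      using that H' by (intro H sec_mult_in_sections expands_smult \<sigma>c) auto
  qed (use H' in auto)
  moreover have "H \<in> extensional (carrier (Cc_module E))" by (simp add: H_def Cc_module_simps)
  ultimately show ?thesis using H H' by blast
qed

lemma linear_map_eqI:
  assumes h: "linear_map (Cc M) (Cc_module E) T h" "linear_map (Cc M) (Cc_module E) T h'"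
    and eq: "\<And>U f. elementary E U \<Longrightarrow> f \<in> Cc (open_sub M (proj E ` U)) \<Longrightarrow> h (pullback E U f) = h' (pullback E U f)"
    and s: "s \<in> Cc_sections (total E)"
  shows "h s = h' s"
  using s
proof (induction rule: sections_induct_pullback)
  case zero
  interpret C: Cc_lu_module M "Cc_module E :: ('x \<Rightarrow> 'k, 'e \<Rightarrow> ('e \<Rightarrow> 'k) set) module" by (rule Cc_module_lu)
  have "h \<zero>\<^bsub>Cc_module E\<^esub> = h' \<zero>\<^bsub>Cc_module E\<^esub>"
    using linear_map_zero[OF h(1) C.abelian_group_axioms abelian_group_axioms]
      linear_map_zero[OF h(2) C.abelian_group_axioms abelian_group_axioms] by simp
  then show ?case by (simp add: Cc_module_simps zero_fun_def)
next
  case (add s t)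
  then show ?case using linear_map_add[OF h(1), of s t] linear_map_add[OF h(2), of s t] by (simp add: Cc_module_simps)
qed (rule eq)

text \<open>Evaluates the definite descriptions in \<open>Cc_counit\<close>,
  \<open>Cc_comult\<close> and \<open>Cc_map\<close> once a candidate with the prescribed values on
  pullbacks has been constructed.\<close>

lemma linear_map_the:
  assumes "H \<in> extensional (carrier (Cc_module E))" "linear_map (Cc M) (Cc_module E) T H" "P H"
    and "\<And>h U f. P h \<Longrightarrow> linear_map (Cc M) (Cc_module E) T h \<Longrightarrow>
      elementary E U \<Longrightarrow> f \<in> Cc (open_sub M (proj E ` U)) \<Longrightarrow> h (pullback E U f) = H (pullback E U f)"
  shows "(THE h. h \<in> extensional (carrier (Cc_module E)) \<and> linear_map (Cc M) (Cc_module E) T h \<and> P h) = H"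
proof (rule the_equality)
  fix h assume h: "h \<in> extensional (carrier (Cc_module E)) \<and> linear_map (Cc M) (Cc_module E) T h \<and> P h"
  show "h = H"
  proof (rule extensionalityI[of _ "carrier (Cc_module E)"])
    fix s :: "'e \<Rightarrow> ('e \<Rightarrow> 'k) set" assume "s \<in> carrier (Cc_module E)"
    then have s: "s \<in> Cc_sections (total E)" by (simp add: Cc_module_simps)
    show "h s = H s"
    proof (rule linear_map_eqI[OF _ assms(2) _ s])
      show "h (pullback E U f) = H (pullback E U f)" if "elementary E U" "f \<in> Cc (open_sub M (proj E ` U))" for U f
        using assms(4) h that by blast
    qed (use h in blast)
  qed (use h assms in auto)
qed (use assms in auto)

end

section \<open>The coalgebra of a sheaf\<close>

text \<open>The scalar field occurs in the type of neither M nor E; the argument K fixes it.\<close>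

locale field_sheaf = sheaf M E
  for M :: "('x, 'b::real_inner) mfd" and E :: "('e, 'b, 'x) etale" +
  fixes K :: "'k::real_normed_field itself"
begin

abbreviation C :: "('x \<Rightarrow> 'k, 'e \<Rightarrow> ('e \<Rightarrow> 'k) set) module" where "C \<equiv> Cc_module E"

end

sublocale field_sheaf \<subseteq> Cc_lu_module_pair M "Cc_module E :: ('x \<Rightarrow> 'k, 'e \<Rightarrow> ('e \<Rightarrow> 'k) set) module"
    "Cc_module E :: ('x \<Rightarrow> 'k, 'e \<Rightarrow> ('e \<Rightarrow> 'k) set) module"
proof -
  interpret C: Cc_lu_module M "Cc_module E :: ('x \<Rightarrow> 'k, 'e \<Rightarrow> ('e \<Rightarrow> 'k) set) module" by (rule Cc_module_lu)
  show "Cc_lu_module_pair M (Cc_module E :: ('x \<Rightarrow> 'k, 'e \<Rightarrow> ('e \<Rightarrow> 'k) set) module)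
    (Cc_module E :: ('x \<Rightarrow> 'k, 'e \<Rightarrow> ('e \<Rightarrow> 'k) set) module)" ..
qed

context field_sheaf
begin

lemma pullback_closed: "elementary E U \<Longrightarrow> f \<in> Cc (open_sub M (proj E ` U)) \<Longrightarrow> pullback E U f \<in> carrier C"
  by (simp add: Cc_module_simps pullback_in_sections)

lemma smult_pullback: "r \<odot>\<^bsub>C\<^esub> pullback E U f = pullback E U (r * f)"
  by (simp add: Cc_module_simps pullback_mult)

lemma pullback_zero: "pullback E U 0 = \<zero>\<^bsub>C\<^esub>"
  by (simp add: Cc_module_simps pullback_0)

lemma Cc_image_subset: "elementary E U \<Longrightarrow> f \<in> Cc (open_sub M (proj E ` U)) \<Longrightarrow> f \<in> Cc M"
  by (rule Cc_open_sub_subset[OF elementary_image])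

text \<open>A point of U off V projects outside the image of V by injectivity, and f vanishes near
  that projection.\<close>

lemma pullback_shrink:
  assumes U: "elementary E U" and V: "elementary E V" "V \<subseteq> U" and f: "(f :: 'x \<Rightarrow> 'k) \<in> Cc (open_sub M (proj E ` V))"
  shows "pullback E U f = pullback E V f"
proof (rule Cc_sections_eqI)
  fix e assume e: "e \<in> epoints E"
  have "germ (total E) e (f \<circ> proj E) = germ (total E) e 0" if "e \<in> U" "e \<notin> V"
  proof -
    have "proj E e \<notin> proj E ` V" using that V inj_onD[OF elementary_inj[OF U]] by blast
    then have "near M (proj E e) (\<lambda>y. f y = 0)"
      using Cc_off_near_0[OF elementary_image[OF V(1)] f] proj_in_points[OF e] by blast
    then show ?thesis using near_proj_iff[OF e, of "\<lambda>y. f y = 0"] by (simp add: germ_eq_iff[OF e])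
  qed
  then show "pullback E U f e = pullback E V f e"
    using V by (auto simp: pullback_apply[OF e])
qed (simp_all add: pullback_extensional)

text \<open>A bump supported under U \<inter> V, where also f = g, makes both products supported
  there, and the two pullbacks coincide after shrinking to the intersection.\<close>

lemma pullback_eq_at:
  assumes U: "elementary E U" "elementary E V" "e \<in> U" "e \<in> V"
    and f: "f \<in> Cc (open_sub M (proj E ` U))" "g \<in> Cc (open_sub M (proj E ` V))"
    and near: "near M (proj E e) (\<lambda>y. f y = g y)"
  shows "eq_at M C (proj E e) (pullback E U f) (pullback E V g)"
proof -
  have UV: "elementary E (U \<inter> V)" using elementary_Int[OF U(1) elementary_openin[OF U(2)]] .
  have x: "proj E e \<in> points M" using openin_subset[OF elementary_openin[OF U(1)]] U(3) proj_in_points by blast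
  obtain W where W: "openin (mtop M) W" "proj E e \<in> W" "\<forall>y\<in>W. f y = g y" using near x by (auto simp: near_iff)
  let ?W = "W \<inter> proj E ` (U \<inter> V)"
  have oW: "openin (mtop M) ?W" using W(1) elementary_image[OF UV] by blast
  have eW: "proj E e \<in> ?W" using W U by blast
  obtain r :: "'x \<Rightarrow> 'k" where r: "r \<in> Cc (open_sub M ?W)" "near M (proj E e) (\<lambda>y. r y = 1)"
    using Cc_bump[OF oW eW] .
  have "r y = 0" if "y \<notin> ?W" for y using r(1) that by (auto simp: Cc_open_sub_iff[OF oW])
  then have rfg: "r * f = r * g" using W(3) by (auto simp: fun_eq_iff)
  have rM: "r \<in> Cc (open_sub M (proj E ` (U \<inter> V)))"
    using Cc_open_sub_mono[OF oW elementary_image[OF UV] _ r(1)] by blast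
  have rf: "r * f \<in> Cc (open_sub M (proj E ` (U \<inter> V)))"
    using Cc_open_sub_mult[OF elementary_image[OF UV] Cc_image_subset[OF U(1) f(1)] rM] by (simp add: mult.commute)
  have "pullback E U (r * f) = pullback E (U \<inter> V) (r * f)"
    by (rule pullback_shrink[OF U(1) UV _ rf]) blast
  also have "\<dots> = pullback E V (r * g)"
    using pullback_shrink[OF U(2) UV _ rf] rfg by simp
  finally show ?thesis
    unfolding eq_at_def smult_pullback using r(2) Cc_open_sub_subset[OF oW r(1)] by blast
qed

lemma pullback_eq_at_0:
  assumes U: "elementary E U" and f: "f \<in> Cc (open_sub M (proj E ` U))" and x: "x \<in> points M" "x \<notin> proj E ` U"
  shows "eq_at M C x (pullback E U f) \<zero>\<^bsub>C\<^esub>"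
proof -
  obtain r :: "'x \<Rightarrow> 'k" where r: "r \<in> Cc M" "near M x (\<lambda>y. r y = 1)" "\<And>y. r y \<noteq> 0 \<Longrightarrow> f y = 0"
    using Cc_bump_near[OF x(1) Cc_off_near_0[OF elementary_image[OF U] f x]] by blast
  then have "r * f = 0" by (auto simp: fun_eq_iff)
  then have "r \<odot>\<^bsub>C\<^esub> pullback E U f = r \<odot>\<^bsub>C\<^esub> \<zero>\<^bsub>C\<^esub>"
    using r by (simp add: smult_pullback pullback_zero C.smult_zero)
  then show ?thesis unfolding eq_at_def using r by blast
qed

text \<open>A global element whose class in the stalk over the base point is the basis vector
  belonging to e. Different choices differ away from e, but are equal in the sense of
  \<open>eq_at\<close> at the base point.\<close>

definition point_section :: "'e \<Rightarrow> 'e \<Rightarrow> ('e \<Rightarrow> 'k) set" where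
  "point_section e = (SOME s. \<exists>U f. elementary E U \<and> e \<in> U \<and> f \<in> Cc (open_sub M (proj E ` U)) \<and>
     near M (proj E e) (\<lambda>y. f y = 1) \<and> s = pullback E U f)"

lemma bump_on_elementary:
  assumes U: "elementary E U" "e \<in> U"
  obtains f :: "'x \<Rightarrow> 'k" where "f \<in> Cc (open_sub M (proj E ` U))" "near M (proj E e) (\<lambda>y. f y = 1)"
  using Cc_bump[OF elementary_image[OF U(1)], of "proj E e"] U(2) by blast

lemma point_section_eq:
  assumes e: "e \<in> epoints E"
  obtains U f where "elementary E U" "e \<in> U" "f \<in> Cc (open_sub M (proj E ` U))"
     "near M (proj E e) (\<lambda>y. f y = 1)" "point_section e = pullback E U f"
proof -
  have "\<exists>s U f. elementary E U \<and> e \<in> U \<and> f \<in> Cc (open_sub M (proj E ` U)) \<and>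
     near M (proj E e) (\<lambda>y. f y = 1) \<and> s = pullback E U (f :: 'x \<Rightarrow> 'k)"
    using elementary_point[OF e] bump_on_elementary by metis
  from someI_ex[OF this] show ?thesis using that unfolding point_section_def by blast
qed

lemma point_section_closed: "e \<in> epoints E \<Longrightarrow> point_section e \<in> carrier C"
  using point_section_eq pullback_closed by metis

lemma pullback_eq_at_point:
  assumes U: "elementary E U" "e \<in> U" and f: "f \<in> Cc (open_sub M (proj E ` U))"
  shows "eq_at M C (proj E e) (pullback E U f) (f \<odot>\<^bsub>C\<^esub> point_section e)"
    and "near M (proj E e) (\<lambda>y. f y = 1) \<Longrightarrow> eq_at M C (proj E e) (pullback E U f) (point_section e)"
proof -
  have e: "e \<in> epoints E" using openin_subset[OF elementary_openin[OF U(1)]] U(2) by blast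
  obtain V g where V: "elementary E V" "e \<in> V" "g \<in> Cc (open_sub M (proj E ` V))"
     "near M (proj E e) (\<lambda>y. g y = 1)" "point_section e = pullback E V g"
    using point_section_eq[OF e] .
  have "near M (proj E e) (\<lambda>y. f y = (f * g) y)" using V(4) by eventually_elim simp
  then show "eq_at M C (proj E e) (pullback E U f) (f \<odot>\<^bsub>C\<^esub> point_section e)"
    unfolding V(5) smult_pullback
    using V U f Cc_image_subset[OF U(1) f] by (intro pullback_eq_at Cc_open_sub_mult elementary_image) auto
  assume "near M (proj E e) (\<lambda>y. f y = 1)"
  then have "near M (proj E e) (\<lambda>y. f y = g y)" using V(4) by eventually_elim simp
  then show "eq_at M C (proj E e) (pullback E U f) (point_section e)"
    unfolding V(5) using V U f by (intro pullback_eq_at) auto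
qed

text \<open>One function that is 1 near the projections of all points of a neighbourhood; families
  such as \<open>point_section\<close> are seen to be locally constant with it.\<close>

lemma bump_nbhd:
  assumes e: "e \<in> epoints E"
  obtains U V f where "elementary E U" "elementary E V" "e \<in> V" "V \<subseteq> U" "(f :: 'x \<Rightarrow> 'k) \<in> Cc (open_sub M (proj E ` U))"
    "\<And>e'. e' \<in> V \<Longrightarrow> near M (proj E e') (\<lambda>y. f y = 1)"
proof -
  obtain U where U: "elementary E U" "e \<in> U" using elementary_point[OF e] .
  obtain f :: "'x \<Rightarrow> 'k" where f: "f \<in> Cc (open_sub M (proj E ` U))" "near M (proj E e) (\<lambda>y. f y = 1)"
    using bump_on_elementary[OF U] .
  obtain W where W: "openin (mtop M) W" "proj E e \<in> W" "\<forall>y\<in>W. f y = 1"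
    using f(2) proj_in_points[OF e] by (auto simp: near_iff)
  have "near M (proj E e') (\<lambda>y. f y = 1)" if "e' \<in> U \<inter> proj E -` W" for e'
    using that W by (intro nearI[of _ W]) auto
  then show ?thesis using that[of U "U \<inter> proj E -` W" f] U W f(1) elementary_vimage[OF U(1) W(1)] by blast
qed

text \<open>The counit is the linear extension of the family that is the germ of 1 at every point of
  E, with values in the ring.\<close>

lemma counit_properties:
  shows "(Cc_counit M E :: _ \<Rightarrow> 'x \<Rightarrow> 'k) \<in> extensional (carrier C)"
    and "linear_map (Cc M) C (regular_module (Cc M)) (Cc_counit M E)"
    and "\<And>U f. elementary E U \<Longrightarrow> f \<in> Cc (open_sub M (proj E ` U)) \<Longrightarrow> Cc_counit M E (pullback E U f) = (f :: 'x \<Rightarrow> 'k)"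
proof -
  let ?R = "regular_module (Cc M) :: ('x \<Rightarrow> 'k, 'x \<Rightarrow> 'k) module"
  interpret R: Cc_lu_module M ?R by (rule regular_Cc_lu_module)
  interpret S: sheaf_module M E ?R ..
  have Rs: "carrier ?R = Cc M" "\<zero>\<^bsub>?R\<^esub> = 0" "\<And>f g. f \<odot>\<^bsub>?R\<^esub> g = f * g" by (simp_all add: regular_module_def)
  \<comment> \<open>The constant 1 need not have compact support, so the germ is represented at each
    point by a different function.\<close>
  define \<sigma> where "\<sigma> e = (SOME f :: 'x \<Rightarrow> 'k. f \<in> Cc M \<and> near M (proj E e) (\<lambda>y. f y = 1))" for e
  have \<sigma>: "\<sigma> e \<in> Cc M \<and> near M (proj E e) (\<lambda>y. \<sigma> e y = 1)" if e: "e \<in> epoints E" for e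
  proof -
    obtain f :: "'x \<Rightarrow> 'k" where "f \<in> Cc M" "near M (proj E e) (\<lambda>y. f y = 1)"
      using Cc_bump_near[OF proj_in_points[OF e], of "\<lambda>_. True"] by auto
    then show ?thesis unfolding \<sigma>_def by (intro someI[where P = "\<lambda>f. f \<in> Cc M \<and> near M (proj E e) (\<lambda>y. f y = 1)"]) simp
  qed
  have lc: "S.locally_constant \<sigma>"
    unfolding S.locally_constant_def Rs
  proof (intro conjI ballI)
    fix e assume e: "e \<in> epoints E"
    then obtain U V f where V: "elementary E U" "elementary E V" "e \<in> V" "V \<subseteq> U" "(f :: 'x \<Rightarrow> 'k) \<in> Cc (open_sub M (proj E ` U))"
      "\<And>e'. e' \<in> V \<Longrightarrow> near M (proj E e') (\<lambda>y. f y = 1)" using bump_nbhd by metis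
    have "eq_at M ?R (proj E e') f (\<sigma> e')" if "e' \<in> V" for e'
    proof -
      have e': "e' \<in> epoints E" using that openin_subset[OF elementary_openin[OF V(2)]] by blast
      have "near M (proj E e') (\<lambda>y. f y = \<sigma> e' y)"
        using V(6)[OF that] conjunct2[OF \<sigma>[OF e']] by eventually_elim simp
      then show ?thesis
        using \<sigma>[OF e'] proj_in_points[OF e'] Cc_image_subset[OF V(1,5)] by (simp add: eq_at_regular_iff)
    qed
    then show "\<exists>V c. elementary E V \<and> e \<in> V \<and> c \<in> Cc M \<and> (\<forall>e'\<in>V. eq_at M ?R (proj E e') c (\<sigma> e'))"
      using V Cc_image_subset[OF V(1,5)] by blast
  qed (use \<sigma> in blast)
  obtain H where H0: "H \<in> extensional (carrier C) \<and> linear_map (Cc M) C ?R H \<and>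
      (\<forall>s\<in>Cc_sections (total E). S.expands \<sigma> s (H s)) \<and>
      (\<forall>s\<in>Cc_sections (total E). \<forall>t\<in>carrier ?R. S.expands \<sigma> s t \<longrightarrow> H s = t)"
    using S.linear_extension[OF lc] by (rule exE)
  have H: "H \<in> extensional (carrier C)" "linear_map (Cc M) C ?R H"
    "\<And>s t. s \<in> Cc_sections (total E) \<Longrightarrow> t \<in> carrier ?R \<Longrightarrow> S.expands \<sigma> s t \<Longrightarrow> H s = t"
    using H0 by blast+
  have Hp: "H (pullback E U f) = f" if U: "elementary E U" and f: "f \<in> Cc (open_sub M (proj E ` U))" for U f
  proof (rule H(3)[OF pullback_in_sections[OF U f]])
    have fM: "f \<in> Cc M" using Cc_image_subset[OF U f] .
    then show "f \<in> carrier ?R" by (simp add: Rs)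
    have ep: "e \<in> epoints E" if "e \<in> U" for e using that openin_subset[OF elementary_openin[OF U]] by blast
    show "S.expands \<sigma> (pullback E U f) f"
    proof (rule S.expands_pullback[OF U f])
      fix e assume "e \<in> U"
      have "near M (proj E e) (\<lambda>y. f y = (f * \<sigma> e) y)"
        using conjunct2[OF \<sigma>[OF ep[OF \<open>e \<in> U\<close>]]] by eventually_elim simp
      then show "eq_at M ?R (proj E e) f (f \<odot>\<^bsub>?R\<^esub> \<sigma> e)"
        using \<sigma>[OF ep[OF \<open>e \<in> U\<close>]] proj_in_points[OF ep[OF \<open>e \<in> U\<close>]] fM
        by (simp add: Rs eq_at_regular_iff Cc_mult)
    next
      fix x assume "x \<in> points M" "x \<notin> proj E ` U"
      then show "eq_at M ?R x f \<zero>\<^bsub>?R\<^esub>"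
        using Cc_off_near_0[OF elementary_image[OF U] f] fM by (simp add: Rs eq_at_regular_iff Cc_0)
    qed (use \<sigma> ep fM in \<open>auto simp: Rs\<close>)
  qed
  have eq: "Cc_counit M E = H"
    unfolding Cc_counit_def Let_def
    by (rule S.linear_map_the[OF H(1,2)]) (use Hp in auto)
  show "Cc_counit M E \<in> extensional (carrier C)" "linear_map (Cc M) C ?R (Cc_counit M E)"
    "\<And>U f. elementary E U \<Longrightarrow> f \<in> Cc (open_sub M (proj E ` U)) \<Longrightarrow> Cc_counit M E (pullback E U f) = (f :: 'x \<Rightarrow> 'k)"
    unfolding eq by (rule H(1), rule H(2), rule Hp)
qed

lemma pure_zero_left: "d \<in> carrier C \<Longrightarrow> pure \<zero>\<^bsub>C\<^esub> d = \<zero>\<^bsub>tensor (Cc M) C C\<^esub>"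
proof -
  assume d: "d \<in> carrier C"
  have "pure \<zero>\<^bsub>C\<^esub> d = pure (0 \<odot>\<^bsub>C\<^esub> \<zero>\<^bsub>C\<^esub>) d" using Cl.smult_0[of "\<zero>\<^bsub>C\<^esub>"] by simp
  also have "\<dots> = 0 \<odot>\<^bsub>tensor (Cc M) C C\<^esub> pure \<zero>\<^bsub>C\<^esub> d" using tensor_smult_pure[OF Cc_0] by simp
  also have "\<dots> = \<zero>\<^bsub>tensor (Cc M) C C\<^esub>" using d by (intro T.smult_0 pure_closed) auto
  finally show ?thesis .
qed

text \<open>The comultiplication is the linear extension of the family that sends e to the tensor
  square of its point section. This shows at once that its value on a pullback does not depend on
  \<eta>.\<close>

lemma comult_properties:
  shows "Cc_comult M E \<in> extensional (carrier C)"
    and "linear_map (Cc M) C (tensor (Cc M) C C) (Cc_comult M E)"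
    and "\<And>U f g. elementary E U \<Longrightarrow> f \<in> Cc (open_sub M (proj E ` U)) \<Longrightarrow> g \<in> Cc (open_sub M (proj E ` U)) \<Longrightarrow>
      g * f = f \<Longrightarrow> Cc_comult M E (pullback E U f) = pure (pullback E U f) (pullback E U g)"
proof -
  let ?T = "tensor (Cc M) C C"
  interpret S: sheaf_module M E ?T ..
  let ?\<tau> = "point_section"
  define \<sigma> where "\<sigma> e = pure (?\<tau> e) (?\<tau> e)" for e
  have ep: "e \<in> epoints E" if "elementary E U" "e \<in> U" for e U
    using that openin_subset[OF elementary_openin] by blast
  have \<sigma>: "\<sigma> e \<in> carrier ?T" if "e \<in> epoints E" for e
    unfolding \<sigma>_def using point_section_closed[OF that] by (intro pure_closed) auto
  have lc: "S.locally_constant \<sigma>"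
    unfolding S.locally_constant_def
  proof (intro conjI ballI)
    fix e assume e: "e \<in> epoints E"
    then obtain U V f where V: "elementary E U" "elementary E V" "e \<in> V" "V \<subseteq> U" "(f :: 'x \<Rightarrow> 'k) \<in> Cc (open_sub M (proj E ` U))"
      "\<And>e'. e' \<in> V \<Longrightarrow> near M (proj E e') (\<lambda>y. f y = 1)" using bump_nbhd by metis
    have "eq_at M ?T (proj E e') (pure (pullback E U f) (pullback E U f)) (\<sigma> e')" if "e' \<in> V" for e'
    proof -
      have "eq_at M C (proj E e') (pullback E U f) (?\<tau> e')"
        using V that by (intro pullback_eq_at_point(2)) auto
      then show ?thesis
        unfolding \<sigma>_def using pullback_closed[OF V(1,5)] point_section_closed[OF ep[OF V(2) that]] by (intro eq_at_pure) auto
    qed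
    then show "\<exists>V c. elementary E V \<and> e \<in> V \<and> c \<in> carrier ?T \<and> (\<forall>e'\<in>V. eq_at M ?T (proj E e') c (\<sigma> e'))"
      using V pure_closed[OF pullback_closed[OF V(1,5)] pullback_closed[OF V(1,5)]] by blast
  qed (use \<sigma> in blast)
  obtain H where H0: "H \<in> extensional (carrier C) \<and> linear_map (Cc M) C ?T H \<and>
      (\<forall>s\<in>Cc_sections (total E). S.expands \<sigma> s (H s)) \<and>
      (\<forall>s\<in>Cc_sections (total E). \<forall>t\<in>carrier ?T. S.expands \<sigma> s t \<longrightarrow> H s = t)"
    using S.linear_extension[OF lc] by (rule exE)
  have H: "H \<in> extensional (carrier C)" "linear_map (Cc M) C ?T H"
    "\<And>s t. s \<in> Cc_sections (total E) \<Longrightarrow> t \<in> carrier ?T \<Longrightarrow> S.expands \<sigma> s t \<Longrightarrow> H s = t"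
    using H0 by blast+
  have Hp: "H (pullback E U f) = pure (pullback E U f) (pullback E U g)"
    if U: "elementary E U" and f: "f \<in> Cc (open_sub M (proj E ` U))" and g: "g \<in> Cc (open_sub M (proj E ` U))" and gf: "g * f = f" for U f g
  proof (rule H(3)[OF pullback_in_sections[OF U f]])
    have fM: "f \<in> Cc M" "g \<in> Cc M" using Cc_image_subset[OF U] f g by auto
    have cl: "pullback E U f \<in> carrier C" "pullback E U g \<in> carrier C" using pullback_closed[OF U] f g by auto
    then show pc: "pure (pullback E U f) (pullback E U g) \<in> carrier ?T" by (rule pure_closed)
    show "S.expands \<sigma> (pullback E U f) (pure (pullback E U f) (pullback E U g))"
    proof (rule S.expands_pullback[OF U f pc])
      fix e assume e: "e \<in> U"
      have te: "?\<tau> e \<in> carrier C" using point_section_closed[OF ep[OF U e]] .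
      have "eq_at M ?T (proj E e) (pure (pullback E U f) (pullback E U g)) (pure (f \<odot>\<^bsub>C\<^esub> ?\<tau> e) (g \<odot>\<^bsub>C\<^esub> ?\<tau> e))"
        using cl te fM pullback_eq_at_point(1)[OF U e] f g by (intro eq_at_pure) auto
      \<comment> \<open>The scalar g is moved to the left factor, where g f = f absorbs it; the
        result is f times the member of the family at e.\<close>
      moreover have "pure (f \<odot>\<^bsub>C\<^esub> ?\<tau> e) (g \<odot>\<^bsub>C\<^esub> ?\<tau> e) = pure (g \<odot>\<^bsub>C\<^esub> (f \<odot>\<^bsub>C\<^esub> ?\<tau> e)) (?\<tau> e)"
        using te fM by (simp add: pure_balanced)
      moreover have "g \<odot>\<^bsub>C\<^esub> (f \<odot>\<^bsub>C\<^esub> ?\<tau> e) = f \<odot>\<^bsub>C\<^esub> ?\<tau> e"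
        using C.smult_assoc[OF fM(2,1) te] gf by simp
      ultimately show "eq_at M ?T (proj E e) (pure (pullback E U f) (pullback E U g)) (f \<odot>\<^bsub>?T\<^esub> \<sigma> e)"
        using fM by (simp add: \<sigma>_def tensor_smult_pure)
    next
      fix x assume x: "x \<in> points M" "x \<notin> proj E ` U"
      have "eq_at M ?T x (pure (pullback E U f) (pullback E U g)) (pure \<zero>\<^bsub>C\<^esub> (pullback E U g))"
        using cl pullback_eq_at_0[OF U f x] Cl.eq_at_refl[OF x(1)] by (intro eq_at_pure) auto
      then show "eq_at M ?T x (pure (pullback E U f) (pullback E U g)) \<zero>\<^bsub>?T\<^esub>"
        using pure_zero_left[OF cl(2)] by simp
    qed (use \<sigma> ep[OF U] in blast)
  qed
  have eq: "Cc_comult M E = H"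
    unfolding Cc_comult_def Let_def
  proof (rule S.linear_map_the[OF H(1,2)])
    show "\<forall>U f g. elementary E U \<and> f \<in> Cc (open_sub M (proj E ` U)) \<and> g \<in> Cc (open_sub M (proj E ` U)) \<and> g * f = f
      \<longrightarrow> H (pullback E U f) = pure (pullback E U f) (pullback E U g)"
      using Hp by blast
    fix h U and f :: "'x \<Rightarrow> 'k"
    assume *: "\<forall>U f g. elementary E U \<and> f \<in> Cc (open_sub M (proj E ` U)) \<and> g \<in> Cc (open_sub M (proj E ` U)) \<and> g * f = f
      \<longrightarrow> h (pullback E U f) = pure (pullback E U f) (pullback E U g)"
      and U: "elementary E U" and f: "f \<in> Cc (open_sub M (proj E ` U))"
    \<comment> \<open>The prescription speaks of a pullback only if some \<eta> with \<eta> f = f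
      exists, so uniqueness rests on local units.\<close>
    obtain g :: "'x \<Rightarrow> 'k" where "g \<in> Cc (open_sub M (proj E ` U))" "g * f = f"
      using Cc_local_unit[OF elementary_image[OF U] f] .
    then show "h (pullback E U f) = H (pullback E U f)" using * Hp U f by metis
  qed
  show "Cc_comult M E \<in> extensional (carrier C)" "linear_map (Cc M) C ?T (Cc_comult M E)"
    "\<And>U f g. elementary E U \<Longrightarrow> f \<in> Cc (open_sub M (proj E ` U)) \<Longrightarrow> g \<in> Cc (open_sub M (proj E ` U)) \<Longrightarrow>
      g * f = f \<Longrightarrow> Cc_comult M E (pullback E U f) = pure (pullback E U f) (pullback E U g)"
    unfolding eq by (rule H(1), rule H(2), rule Hp)
qed

end

text \<open>The record \<open>Cc_coalg\<close> extends \<open>Cc_module\<close>; module notions do not see the difference.\<close>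

lemma Cc_coalg_simps:
  "carrier (Cc_coalg M E) = carrier (Cc_module E)"
  "ring.zero (Cc_coalg M E) = ring.zero (Cc_module E)"
  "ring.add (Cc_coalg M E) = ring.add (Cc_module E)"
  "smult (Cc_coalg M E) = smult (Cc_module E)"
  "comult (Cc_coalg M E) = Cc_comult M E"
  "counit (Cc_coalg M E) = Cc_counit M E"
  by (simp_all add: Cc_coalg_def module.extend_def)

lemma Cc_coalg_tensor:
  "tensor_class R (Cc_coalg M E) (Cc_coalg M F) = tensor_class R (Cc_module E) (Cc_module F)"
  "tensor R (Cc_coalg M E) (Cc_coalg M F) = tensor R (Cc_module E) (Cc_module F)"
  "pure_tensor R (Cc_coalg M E) (Cc_coalg M F) = pure_tensor R (Cc_module E) (Cc_module F)"
  "tensor_map R (Cc_coalg M E) (Cc_coalg M F) = tensor_map R (Cc_module E) (Cc_module F)"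
proof -
  have "tensor_relations R (Cc_coalg M E) (Cc_coalg M F) = tensor_relations R (Cc_module E) (Cc_module F)"
    by (simp add: tensor_relations_def Cc_coalg_simps)
  then show *: "tensor_class R (Cc_coalg M E) (Cc_coalg M F) = tensor_class R (Cc_module E) (Cc_module F)"
    and "tensor R (Cc_coalg M E) (Cc_coalg M F) = tensor R (Cc_module E) (Cc_module F)"
    by (simp_all add: tensor_class_def tensor_def Cc_coalg_simps fun_eq_iff)
  then show "pure_tensor R (Cc_coalg M E) (Cc_coalg M F) = pure_tensor R (Cc_module E) (Cc_module F)"
    "tensor_map R (Cc_coalg M E) (Cc_coalg M F) = tensor_map R (Cc_module E) (Cc_module F)"
    by (simp_all add: pure_tensor_def tensor_map_def fun_eq_iff)
qed

lemma Cc_coalg_tensor_lift: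
  fixes M :: "('x, 'b::real_inner) mfd" and E :: "('e, 'b, 'x) etale"
  defines "A \<equiv> Cc_coalg M E :: ('x \<Rightarrow> 'k::real_normed_field, 'e \<Rightarrow> ('e \<Rightarrow> 'k) set) coalg"
    and "B \<equiv> Cc_module E :: ('x \<Rightarrow> 'k, 'e \<Rightarrow> ('e \<Rightarrow> 'k) set) module"
  shows "tensor_lift A (\<beta> :: 'p \<Rightarrow> 'q \<Rightarrow> _) T = tensor_lift B \<beta> T"
proof -
  have simps: "carrier A = carrier B" "ring.zero A = ring.zero B" "ring.add A = ring.add B"
    by (simp_all add: A_def B_def Cc_coalg_simps)
  have inv: "m_inv (add_monoid A) = m_inv (add_monoid B)"
    by (rule ext) (simp add: m_inv_def simps)
  have "add_pow A (k :: int) a = add_pow B k a" for k a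
    unfolding add_pow_def int_pow_def nat_pow_def inv by (simp add: simps)
  moreover have "finsum A f I = finsum B f I" for f :: "'p \<times> 'q \<Rightarrow> _" and I
    by (simp add: finsum_def finprod_def simps)
  ultimately show ?thesis by (simp add: tensor_lift_def)
qed

lemma abelian_group_cong:
  assumes "abelian_group G" "carrier H = carrier G" "ring.zero H = ring.zero G" "ring.add H = ring.add G"
  shows "abelian_group H"
proof -
  interpret abelian_group G by fact
  show ?thesis
    by (rule abelian_groupI) (use assms(2-) a_assoc a_comm l_neg in \<open>auto intro!: bexI[of _ "\<ominus>\<^bsub>G\<^esub> x" for x]\<close>)
qed

lemma Cc_coalg_linear_map:
  "linear_map R (Cc_coalg M E) T = linear_map R (Cc_module E) T"
  "linear_map R T (Cc_coalg M E) = linear_map R T (Cc_module E)"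
  by (simp_all add: linear_map_def Cc_coalg_simps fun_eq_iff)

lemma Cc_coalg_locally_unitary:
  fixes M :: "('x, 'b::real_inner) mfd" and E :: "('e, 'b, 'x) etale" and R :: "('x \<Rightarrow> 'k::real_normed_field) set"
  shows "locally_unitary_module R (Cc_coalg M E) = locally_unitary_module R (Cc_module E)"
proof -
  let ?C = "Cc_coalg M E :: ('x \<Rightarrow> 'k, 'e \<Rightarrow> ('e \<Rightarrow> 'k) set) coalg"
  let ?D = "Cc_module E :: ('x \<Rightarrow> 'k, 'e \<Rightarrow> ('e \<Rightarrow> 'k) set) module"
  have "abelian_group ?C = abelian_group ?D"
    using abelian_group_cong[of ?C ?D] abelian_group_cong[of ?D ?C]
    by (auto simp: Cc_coalg_simps)
  then show ?thesis unfolding locally_unitary_module_def Cc_coalg_simps by simp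
qed

lemma Cc_coalg_eq_at: "eq_at M (Cc_coalg M' E) = eq_at M (Cc_module E)"
  by (simp add: eq_at_def Cc_coalg_simps fun_eq_iff)

lemmas Cc_coalg_transfer = Cc_coalg_simps Cc_coalg_tensor Cc_coalg_tensor_lift Cc_coalg_linear_map
  Cc_coalg_locally_unitary Cc_coalg_eq_at

context field_sheaf
begin

text \<open>Each counit law compares two linear maps, so it may be checked on pullbacks, where it
  amounts to g f = f for a local unit g.\<close>

theorem Cc_coalg_coalgebra: "coalgebra (Cc M) (Cc_coalg M E :: ('x \<Rightarrow> 'k, 'e \<Rightarrow> ('e \<Rightarrow> 'k) set) coalg)"
proof -
  interpret S: sheaf_module M E C ..
  let ?\<epsilon> = "Cc_counit M E :: _ \<Rightarrow> 'x \<Rightarrow> 'k" and ?\<Delta> = "Cc_comult M E :: ('e \<Rightarrow> ('e \<Rightarrow> 'k) set) \<Rightarrow> _"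
  note \<epsilon> = counit_properties and \<Delta> = comult_properties
  have \<epsilon>s: "?\<epsilon> s \<in> Cc M" "?\<epsilon> (s \<oplus>\<^bsub>C\<^esub> t) = ?\<epsilon> s + ?\<epsilon> t" "r \<in> Cc M \<Longrightarrow> ?\<epsilon> (r \<odot>\<^bsub>C\<^esub> s) = r * ?\<epsilon> s"
    if "s \<in> carrier C" "t \<in> carrier C" for s t r
    using that linear_map_closed[OF \<epsilon>(2)] linear_map_add[OF \<epsilon>(2)] linear_map_smult[OF \<epsilon>(2)] by (auto simp: regular_module_def)
  have idlin: "linear_map (Cc M) C C (\<lambda>s. s)" by (simp add: linear_map_def)
  let ?\<beta> = "\<lambda>a b. ?\<epsilon> b \<odot>\<^bsub>C\<^esub> a" and ?\<gamma> = "\<lambda>a b. ?\<epsilon> a \<odot>\<^bsub>C\<^esub> b"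
  have \<beta>: "linear_map (Cc M) (tensor (Cc M) C C) C (tensor_lift C ?\<beta>)"
      "\<And>c d. c \<in> carrier C \<Longrightarrow> d \<in> carrier C \<Longrightarrow> tensor_lift C ?\<beta> (pure c d) = ?\<beta> c d"
    by (rule tensor_lift_linear[OF C.lu_module_axioms];
      simp add: \<epsilon>s C.smult_r_distr C.smult_l_distr C.smult_assoc C.smult_commute)+
  have \<gamma>: "linear_map (Cc M) (tensor (Cc M) C C) C (tensor_lift C ?\<gamma>)"
      "\<And>c d. c \<in> carrier C \<Longrightarrow> d \<in> carrier C \<Longrightarrow> tensor_lift C ?\<gamma> (pure c d) = ?\<gamma> c d"
    by (rule tensor_lift_linear[OF C.lu_module_axioms];
      simp add: \<epsilon>s C.smult_r_distr C.smult_l_distr C.smult_assoc C.smult_commute)+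
  have "tensor_lift C ?\<beta> (?\<Delta> s) = s" "tensor_lift C ?\<gamma> (?\<Delta> s) = s" if s: "s \<in> carrier C" for s
  proof -
    have *: "tensor_lift C ?\<beta> (?\<Delta> (pullback E U f)) = pullback E U f" "tensor_lift C ?\<gamma> (?\<Delta> (pullback E U f)) = pullback E U f"
      if U: "elementary E U" and f: "f \<in> Cc (open_sub M (proj E ` U))" for U f
    proof -
      obtain g :: "'x \<Rightarrow> 'k" where g: "g \<in> Cc (open_sub M (proj E ` U))" "g * f = f"
        using Cc_local_unit[OF elementary_image[OF U] f] .
      then have "?\<Delta> (pullback E U f) = pure (pullback E U f) (pullback E U g)" using \<Delta>(3)[OF U f g(1)] by simp
      then show "tensor_lift C ?\<beta> (?\<Delta> (pullback E U f)) = pullback E U f" "tensor_lift C ?\<gamma> (?\<Delta> (pullback E U f)) = pullback E U f"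
        using \<beta>(2) \<gamma>(2) pullback_closed[OF U f] pullback_closed[OF U g(1)] \<epsilon>(3)[OF U f] \<epsilon>(3)[OF U g(1)] g(2)
        by (simp_all add: smult_pullback mult.commute[of f g])
    qed
    show "tensor_lift C ?\<beta> (?\<Delta> s) = s"
      by (rule S.linear_map_eqI[OF linear_map_comp[OF \<Delta>(2) \<beta>(1)] idlin *(1)]) (use s in \<open>simp_all add: Cc_module_simps\<close>)
    show "tensor_lift C ?\<gamma> (?\<Delta> s) = s"
      by (rule S.linear_map_eqI[OF linear_map_comp[OF \<Delta>(2) \<gamma>(1)] idlin *(2)]) (use s in \<open>simp_all add: Cc_module_simps\<close>)
  qed
  then show ?thesis
    using \<Delta>(2) \<epsilon>(2) C.lu unfolding coalgebra_def Cc_coalg_transfer by blast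
qed

end

section \<open>Functoriality of the coalgebra of sections\<close>

locale field_two_sheaves = two_sheaves M E F
  for M :: "('x, 'b::real_inner) mfd" and E :: "('e, 'b, 'x) etale" and F :: "('f, 'b, 'x) etale" +
  fixes K :: "'k::real_normed_field itself"

sublocale field_two_sheaves \<subseteq> Es: field_sheaf M E K + Fs: field_sheaf M F K ..

context field_two_sheaves
begin

text \<open>The induced map is the linear extension of the family sending e to the point section of
  \<phi> e. It is locally constant because \<phi> sends elementary sets to elementary sets with the
  same projection.\<close>

lemma map_properties:
  assumes \<phi>: "\<phi> \<in> sh_hom E F"
  shows "Cc_map M E F \<phi> \<in> extensional (carrier Es.C)"
    and "linear_map (Cc M) Es.C Fs.C (Cc_map M E F \<phi>)"
    and "\<And>U f. elementary E U \<Longrightarrow> f \<in> Cc (open_sub M (proj E ` U)) \<Longrightarrow>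
      Cc_map M E F \<phi> (pullback E U f) = pullback F (\<phi> ` U) (f :: 'x \<Rightarrow> 'k)"
proof -
  interpret S: sheaf_module M E Fs.C ..
  define \<sigma> where "\<sigma> e = Fs.point_section (\<phi> e)" for e
  have ep: "e \<in> epoints E" if "elementary E U" "e \<in> U" for e U
    using that openin_subset[OF elementary_openin] by blast
  have \<sigma>: "\<sigma> e \<in> carrier Fs.C" if "e \<in> epoints E" for e
    unfolding \<sigma>_def using Fs.point_section_closed sh_hom_points[OF \<phi> that] by blast
  have im: "f \<in> Cc (open_sub M (proj F ` \<phi> ` U))" if "elementary E U" "f \<in> Cc (open_sub M (proj E ` U))" for U and f :: "'x \<Rightarrow> 'k"
    using that sh_hom_elementary(2)[OF \<phi> that(1)] by simp
  have lc: "S.locally_constant \<sigma>"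
    unfolding S.locally_constant_def
  proof (intro conjI ballI)
    fix e assume e: "e \<in> epoints E"
    then obtain U V f where V: "elementary E U" "elementary E V" "e \<in> V" "V \<subseteq> U" "(f :: 'x \<Rightarrow> 'k) \<in> Cc (open_sub M (proj E ` U))"
      "\<And>e'. e' \<in> V \<Longrightarrow> near M (proj E e') (\<lambda>y. f y = 1)" using Es.bump_nbhd by metis
    have "eq_at M Fs.C (proj E e') (pullback F (\<phi> ` U) f) (\<sigma> e')" if "e' \<in> V" for e'
    proof -
      have "near M (proj F (\<phi> e')) (\<lambda>y. f y = 1)" using V(6)[OF that] sh_hom_proj[OF \<phi> ep[OF V(2) that]] by simp
      then have "eq_at M Fs.C (proj F (\<phi> e')) (pullback F (\<phi> ` U) f) (\<sigma> e')"
        unfolding \<sigma>_def using V that im[OF V(1,5)] sh_hom_elementary(1)[OF \<phi> V(1)]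
        by (intro Fs.pullback_eq_at_point(2)) auto
      then show ?thesis using sh_hom_proj[OF \<phi> ep[OF V(2) that]] by simp
    qed
    then show "\<exists>V c. elementary E V \<and> e \<in> V \<and> c \<in> carrier Fs.C \<and> (\<forall>e'\<in>V. eq_at M Fs.C (proj E e') c (\<sigma> e'))"
      using V Fs.pullback_closed[OF sh_hom_elementary(1)[OF \<phi> V(1)] im[OF V(1,5)]] by blast
  qed (use \<sigma> in blast)
  obtain H where H0: "H \<in> extensional (carrier Es.C) \<and> linear_map (Cc M) Es.C Fs.C H \<and>
      (\<forall>s\<in>Cc_sections (total E). S.expands \<sigma> s (H s)) \<and>
      (\<forall>s\<in>Cc_sections (total E). \<forall>t\<in>carrier Fs.C. S.expands \<sigma> s t \<longrightarrow> H s = t)"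
    using S.linear_extension[OF lc] by (rule exE)
  have H: "H \<in> extensional (carrier Es.C)" "linear_map (Cc M) Es.C Fs.C H"
    "\<And>s t. s \<in> Cc_sections (total E) \<Longrightarrow> t \<in> carrier Fs.C \<Longrightarrow> S.expands \<sigma> s t \<Longrightarrow> H s = t"
    using H0 by blast+
  have Hp: "H (pullback E U f) = pullback F (\<phi> ` U) f"
    if U: "elementary E U" and f: "f \<in> Cc (open_sub M (proj E ` U))" for U f
  proof (rule H(3)[OF pullback_in_sections[OF U f]])
    note U' = sh_hom_elementary[OF \<phi> U] and f' = im[OF U f]
    show cl: "pullback F (\<phi> ` U) f \<in> carrier Fs.C" using Fs.pullback_closed[OF U'(1) f'] .
    show "S.expands \<sigma> (pullback E U f) (pullback F (\<phi> ` U) f)"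
    proof (rule S.expands_pullback[OF U f cl])
      fix e assume e: "e \<in> U"
      then have "eq_at M Fs.C (proj F (\<phi> e)) (pullback F (\<phi> ` U) f) (f \<odot>\<^bsub>Fs.C\<^esub> \<sigma> e)"
        unfolding \<sigma>_def by (intro Fs.pullback_eq_at_point(1) U'(1) f') auto
      then show "eq_at M Fs.C (proj E e) (pullback F (\<phi> ` U) f) (f \<odot>\<^bsub>Fs.C\<^esub> \<sigma> e)"
        using sh_hom_proj[OF \<phi> ep[OF U e]] by simp
    next
      fix x assume "x \<in> points M" "x \<notin> proj E ` U"
      then show "eq_at M Fs.C x (pullback F (\<phi> ` U) f) \<zero>\<^bsub>Fs.C\<^esub>"
        using Fs.pullback_eq_at_0[OF U'(1) f'] U'(2) by simp
    qed (use \<sigma> ep[OF U] in blast)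
  qed
  have eq: "Cc_map M E F \<phi> = H"
    unfolding Cc_map_def
    by (rule S.linear_map_the[OF H(1,2)]) (use Hp in auto)
  show "Cc_map M E F \<phi> \<in> extensional (carrier Es.C)" "linear_map (Cc M) Es.C Fs.C (Cc_map M E F \<phi>)"
    "\<And>U f. elementary E U \<Longrightarrow> f \<in> Cc (open_sub M (proj E ` U)) \<Longrightarrow> Cc_map M E F \<phi> (pullback E U f) = pullback F (\<phi> ` U) (f :: 'x \<Rightarrow> 'k)"
    unfolding eq by (rule H(1), rule H(2), rule Hp)
qed

text \<open>Both compatibilities are equalities of linear maps and reduce to pullbacks. The same
  \<eta> serves over U and over its image under \<phi>, since these have the same
  projection.\<close>

theorem Cc_map_hom:
  assumes \<phi>: "\<phi> \<in> sh_hom E F"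
  shows "Cc_map M E F \<phi> \<in> coalg_hom (Cc M) (Cc_coalg M E) (Cc_coalg M F :: ('x \<Rightarrow> 'k, 'f \<Rightarrow> ('f \<Rightarrow> 'k) set) coalg)"
proof -
  let ?h = "Cc_map M E F \<phi> :: ('e \<Rightarrow> ('e \<Rightarrow> 'k) set) \<Rightarrow> _"
  note h = map_properties[OF \<phi>] and U' = sh_hom_elementary[OF \<phi>]
  have im: "f \<in> Cc (open_sub M (proj F ` \<phi> ` U))" if "elementary E U" "f \<in> Cc (open_sub M (proj E ` U))" for U and f :: "'x \<Rightarrow> 'k"
    using that U'(2)[OF that(1)] by simp
  interpret T: sheaf_module M E "tensor (Cc M) Fs.C Fs.C" ..
  interpret R: Cc_lu_module M "regular_module (Cc M) :: ('x \<Rightarrow> 'k, 'x \<Rightarrow> 'k) module" by (rule regular_Cc_lu_module)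
  interpret Rs: sheaf_module M E "regular_module (Cc M) :: ('x \<Rightarrow> 'k, 'x \<Rightarrow> 'k) module" ..
  have "Cc_counit M F (?h s) = Cc_counit M E s" if "s \<in> carrier Es.C" for s
    by (rule Rs.linear_map_eqI[OF linear_map_comp[OF h(2) Fs.counit_properties(2)] Es.counit_properties(2)])
      (use that in \<open>simp_all add: h(3) Es.counit_properties(3) Fs.counit_properties(3)[OF U'(1) im] Cc_module_simps\<close>)
  moreover have "tensor_map (Cc M) Fs.C Fs.C ?h ?h (Cc_comult M E s) = Cc_comult M F (?h s)" if "s \<in> carrier Es.C" for s
  proof (rule T.linear_map_eqI[OF linear_map_comp[OF Es.comult_properties(2) Es.tensor_map_linear(1)[OF Fs.lu_module_pair_axioms h(2) h(2)]]
      linear_map_comp[OF h(2) Fs.comult_properties(2)]])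
    fix U and f :: "'x \<Rightarrow> 'k" assume U: "elementary E U" and f: "f \<in> Cc (open_sub M (proj E ` U))"
    obtain g :: "'x \<Rightarrow> 'k" where g: "g \<in> Cc (open_sub M (proj E ` U))" "g * f = f"
      using Cc_local_unit[OF elementary_image[OF U] f] .
    show "tensor_map (Cc M) Fs.C Fs.C ?h ?h (Cc_comult M E (pullback E U f)) = Cc_comult M F (?h (pullback E U f))"
      using Es.comult_properties(3)[OF U f g] Fs.comult_properties(3)[OF U'(1)[OF U] im[OF U f] im[OF U g(1)] g(2)]
      by (simp add: Es.tensor_map_pure[OF Fs.lu_module_pair_axioms h(2) h(2)] h(3)[OF U f] h(3)[OF U g(1)])
  qed (use that in \<open>simp add: Cc_module_simps\<close>)
  ultimately show ?thesis using h(1,2) unfolding coalg_hom_def Cc_coalg_transfer by blast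
qed

end

section \<open>The spectral sheaf\<close>

context Cc_coalgebra
begin

abbreviation S :: "('x \<times> 'c set, 'b, 'x) etale" where "S \<equiv> spectral_sheaf M C"
abbreviation SP :: "('x \<times> 'c set) set" where "SP \<equiv> spectral_points M C"
abbreviation patch :: "'c \<Rightarrow> 'x set \<Rightarrow> ('x \<times> 'c set) set" where "patch \<equiv> spectral_patch M C"

definition local_section :: "'c \<Rightarrow> 'x set \<Rightarrow> bool" where
  "local_section c W \<longleftrightarrow> openin (mtop M) W \<and> weakly_grouplike (Cc M) C c \<and> normalized_on M C W c"

lemma
  assumes "local_section c W"
  shows local_section_openin: "openin (mtop M) W" and local_section_points: "x \<in> W \<Longrightarrow> x \<in> points M"
    and local_section_closed: "c \<in> carrier C"
    and local_section_counit: "x \<in> W \<Longrightarrow> near M x (\<lambda>y. counit C c y = 1)"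
proof -
  show W: "openin (mtop M) W" and "c \<in> carrier C" using assms by (auto simp: local_section_def weakly_grouplike_def)
  show x: "x \<in> points M" if "x \<in> W" for x using openin_subset[OF W] that by blast
  show "near M x (\<lambda>y. counit C c y = 1)" if "x \<in> W"
    using assms that x[OF that] by (auto simp: local_section_def normalized_on_def germ_eq_iff one_fun_def)
qed

lemma local_section_subset:
  "local_section c W \<Longrightarrow> openin (mtop M) V \<Longrightarrow> V \<subseteq> W \<Longrightarrow> local_section c V"
  by (auto simp: local_section_def normalized_on_def)

text \<open>The counit law gives c as the product of its counit with c', and the counit is 1 near
  each point of W.\<close>

lemma local_section_comult:
  assumes c: "local_section c W"
  obtains c' where "c' \<in> carrier C" "comult C c = pure c c'" "\<And>x. x \<in> W \<Longrightarrow> eq_at M C x c c'"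
proof -
  obtain c' where c': "c' \<in> carrier C" "comult C c = pure c c'"
    using c by (auto simp: local_section_def weakly_grouplike_def)
  have cc: "c \<in> carrier C" using local_section_closed[OF c] .
  have "eq_at M C x c c'" if x: "x \<in> W" for x
  proof -
    have "eq_at M C x (counit C c \<odot>\<^bsub>C\<^esub> c') c'"
      using local_section_counit[OF c x] local_section_points[OF c x] counit_closed[OF cc] c'
      by (intro Cl.eq_at_near_1) auto
    then show ?thesis using weakly_grouplike_counit(2)[OF cc c'] by simp
  qed
  then show ?thesis using that c' by blast
qed

text \<open>Weak grouplikeness involves c' instead of c. Near a point of W the two agree, so the
  germ of c is grouplike.\<close>

lemma patch_subset:
  assumes c: "local_section c W" shows "patch c W \<subseteq> SP"
proof
  fix z assume "z \<in> patch c W"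
  then obtain x where x: "x \<in> W" "z = (x, stalk_class M C x c)" by (auto simp: spectral_patch_def)
  have xM: "x \<in> points M" using local_section_points[OF c x(1)] .
  have cc: "c \<in> carrier C" using local_section_closed[OF c] .
  obtain c' where c': "c' \<in> carrier C" "comult C c = pure c c'" "eq_at M C x c c'"
    using local_section_comult[OF c] x(1) by metis
  have "eq_at M CC x (pure c c') (pure c c)"
    using c' cc eq_at_sym Cl.eq_at_refl[OF xM] by (intro eq_at_pure) auto
  then have "stalk_class M C x c \<in> stalk_grouplikes M C x"
    using c'(2) local_section_counit[OF c x(1)] by (simp add: stalk_grouplike_iff[OF xM cc])
  then show "z \<in> SP" using x xM by (simp add: spectral_points_def)
qed

text \<open>If \<open>\<Delta> c\<close> and \<open>c \<otimes> c\<close> agree near x then r c is weakly grouplike for a suitable bump function r, since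
  \<open>\<Delta> (r c) = r (c \<otimes> c) = r c \<otimes> c\<close>.\<close>

lemma spectral_point_rep:
  assumes z: "z \<in> SP" and V: "openin (mtop M) V" "fst z \<in> V"
  obtains c W where "local_section c W" "fst z \<in> W" "W \<subseteq> V" "z = (fst z, stalk_class M C (fst z) c)" "z \<in> patch c W"
proof -
  define x where "x = fst z"
  have xM: "x \<in> points M" and "snd z \<in> stalk_grouplikes M C x" using z by (auto simp: spectral_points_def x_def)
  moreover from this obtain c where c: "c \<in> carrier C" "snd z = stalk_class M C x c"
    by (auto simp: stalk_grouplikes_def carrier_stalk)
  ultimately have g: "eq_at M CC x (comult C c) (pure c c)" "near M x (\<lambda>y. counit C c y = 1)"
    by (simp_all add: stalk_grouplike_iff[OF xM c(1)])
  obtain r where r: "r \<in> Cc M" "near M x (\<lambda>y. r y = 1)" "r \<odot>\<^bsub>CC\<^esub> comult C c = r \<odot>\<^bsub>CC\<^esub> pure c c"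
    using g(1) by (auto simp: eq_at_def)
  let ?c = "r \<odot>\<^bsub>C\<^esub> c"
  have cc: "?c \<in> carrier C" using r c by simp
  have "comult C ?c = pure ?c c"
    using linear_map_smult[OF comult_linear r(1) c(1)] r by (simp add: tensor_smult_pure)
  then have wg: "weakly_grouplike (Cc M) C ?c" using cc c by (auto simp: weakly_grouplike_def)
  \<comment> \<open>Normalization is given at x as a condition on germs and is spread over a
    neighbourhood, because a patch has to be normalized at each of its points.\<close>
  have "near M x (\<lambda>y. counit C ?c y = 1)"
    using r(2) g(2) by eventually_elim (simp add: counit_smult r(1) c(1))
  then obtain W0 where W0: "openin (mtop M) W0" "x \<in> W0" "\<forall>y\<in>W0. counit C ?c y = 1"
    using xM by (auto simp: near_iff)
  let ?W = "W0 \<inter> V"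
  have W: "openin (mtop M) ?W" using W0 V by blast
  have "germ M y (counit C ?c) = germ M y 1" if y: "y \<in> ?W" for y
  proof -
    have yM: "y \<in> points M" using y openin_subset[OF W] by blast
    have "near M y (\<lambda>u. counit C ?c u = 1)" using y W0 by (intro nearI[of _ W0]) auto
    then show ?thesis by (simp add: germ_eq_iff[OF yM] one_fun_def)
  qed
  then have ls: "local_section ?c ?W" using wg W by (simp add: local_section_def normalized_on_def)
  have "stalk_class M C x ?c = stalk_class M C x c"
    using r c xM cc Cl.eq_at_near_1[OF xM] by (simp add: stalk_class_eq_iff)
  then have "z = (x, stalk_class M C x ?c)" using c(2) by (simp add: x_def prod_eq_iff)
  then show ?thesis using that[OF ls] W0 V by (auto simp: x_def spectral_patch_def)
qed

lemma mem_patch_iff: "z \<in> patch c W \<longleftrightarrow> fst z \<in> W \<and> snd z = stalk_class M C (fst z) c"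
  by (cases z) (auto simp: spectral_patch_def)

lemma fst_patch: "fst ` patch c W = W"
  by (force simp: spectral_patch_def)

lemma inj_fst_patch: "inj_on fst (patch c W)"
  by (auto simp: spectral_patch_def inj_on_def)

lemma patch_mono: "V \<subseteq> W \<Longrightarrow> patch c V \<subseteq> patch c W"
  by (auto simp: spectral_patch_def)

lemma mtop_S: "mtop (total S) = topology_generated_by (insert SP {patch c W | c W. local_section c W})"
  by (simp add: spectral_sheaf_def local_section_def)

lemma atlas_S: "atlas (total S) =
    {(patch c W, \<kappa> \<circ> fst) | c W V \<kappa>. local_section c W \<and> (V, \<kappa>) \<in> atlas M \<and> W \<subseteq> V}"
  by (auto simp: spectral_sheaf_def local_section_def)

lemma proj_S: "proj S = fst"
  by (simp add: spectral_sheaf_def)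

lemma epoints_S: "epoints S = SP"
  unfolding mtop_S topology_generated_by_topspace using patch_subset by blast

lemma openin_patch: "local_section c W \<Longrightarrow> openin (mtop (total S)) (patch c W)"
  unfolding mtop_S by (rule topology_generated_by_Basis) blast

text \<open>The generating patches form a basis and not merely a subbasis: two patches through one
  point are given by elements with the same class at x, and these agree on a neighbourhood of x,
  over which the patches coincide.\<close>

lemma openin_S_iff:
  "openin (mtop (total S)) A \<longleftrightarrow> A \<subseteq> SP \<and> (\<forall>z\<in>A. \<exists>c W. local_section c W \<and> z \<in> patch c W \<and> patch c W \<subseteq> A)"
proof
  let ?P = "\<lambda>A. \<forall>z\<in>A. \<exists>c W. local_section c W \<and> z \<in> patch c W \<and> patch c W \<subseteq> A"
  assume A: "openin (mtop (total S)) A"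
  then have "generate_topology_on (insert SP {patch c W | c W. local_section c W}) A"
    by (simp add: mtop_S openin_topology_generated_by_iff)
  then have "?P A"
  proof (induction rule: generate_topology_on.induct)
    case (Int A B)
    show ?case
    proof
      fix z assume "z \<in> A \<inter> B"
      then obtain c W d V where cW: "local_section c W" "z \<in> patch c W" "patch c W \<subseteq> A"
        and dV: "local_section d V" "z \<in> patch d V" "patch d V \<subseteq> B" using Int.IH by (meson IntD1 IntD2)
      let ?x = "fst z"
      have x: "?x \<in> W" "?x \<in> V" "?x \<in> points M" "stalk_class M C ?x c = stalk_class M C ?x d"
        using cW dV local_section_points[OF cW(1)] by (auto simp: mem_patch_iff)
      note cd = local_section_closed[OF cW(1)] local_section_closed[OF dV(1)]
      have "eq_at M C ?x c d" using x cd by (simp add: stalk_class_eq_iff)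
      then obtain N where N: "openin (mtop M) N" "?x \<in> N" "\<forall>y\<in>N. eq_at M C y c d"
        using Cl.eq_at_near[OF x(3), of c d] near_iff[OF x(3)] by blast
      let ?N = "N \<inter> (W \<inter> V)"
      have oN: "openin (mtop M) ?N"
        using N local_section_openin[OF cW(1)] local_section_openin[OF dV(1)] by blast
      have "patch c ?N \<subseteq> patch d V"
        using N(3) cd openin_subset[OF oN] by (auto simp: mem_patch_iff stalk_class_eq_iff subset_iff)
      then have "patch c ?N \<subseteq> A \<inter> B" using cW(3) dV(3) patch_mono[of ?N W c] by blast
      moreover have "z \<in> patch c ?N" using cW N x by (simp add: mem_patch_iff)
      ultimately show "\<exists>c W. local_section c W \<and> z \<in> patch c W \<and> patch c W \<subseteq> A \<inter> B"
        using local_section_subset[OF cW(1) oN] by blast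
    qed
  next
    case (UN K)
    then show ?case by blast
  next
    case (Basis A)
    then show ?case
    proof
      assume A: "A = SP"
      show ?thesis
      proof
        fix z assume "z \<in> A"
        then have z: "z \<in> SP" "fst z \<in> points M" using A by (auto simp: spectral_points_def)
        then obtain c W where "local_section c W" "z \<in> patch c W"
          using spectral_point_rep[OF z(1) openin_topspace] by metis
        then show "\<exists>c W. local_section c W \<and> z \<in> patch c W \<and> patch c W \<subseteq> A" using A patch_subset by blast
      qed
    next
      assume "A \<in> {patch c W | c W. local_section c W}"
      then show ?thesis by blast
    qed
  qed simp
  then show "A \<subseteq> SP \<and> ?P A" using openin_subset[OF A] epoints_S by simp
next
  assume *: "A \<subseteq> SP \<and> (\<forall>z\<in>A. \<exists>c W. local_section c W \<and> z \<in> patch c W \<and> patch c W \<subseteq> A)"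
  show "openin (mtop (total S)) A"
    by (subst openin_subopen) (use * openin_patch in blast)
qed

lemma fst_continuous: "continuous_map (mtop (total S)) (mtop M) fst"
proof -
  have "openin (mtop (total S)) {z \<in> epoints S. fst z \<in> V}" if V: "openin (mtop M) V" for V
    unfolding openin_S_iff epoints_S
  proof (intro conjI ballI)
    fix z assume "z \<in> {z \<in> SP. fst z \<in> V}"
    then have z: "z \<in> SP" "fst z \<in> V" by auto
    obtain c W where c: "local_section c W" "W \<subseteq> V" "z \<in> patch c W"
      using spectral_point_rep[OF z(1) V z(2)] by metis
    then show "\<exists>c W. local_section c W \<and> z \<in> patch c W \<and> patch c W \<subseteq> {z \<in> SP. fst z \<in> V}"
      using patch_subset[OF c(1)] by (intro exI[of _ c] exI[of _ W]) (auto simp: mem_patch_iff)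
  qed auto
  then show ?thesis by (auto simp: continuous_map_def epoints_S spectral_points_def)
qed

lemma fst_open: "openin (mtop (total S)) A \<Longrightarrow> openin (mtop M) (fst ` A)"
proof (subst openin_subopen, clarify)
  fix x \<zeta> assume A: "openin (mtop (total S)) A" and z: "(x, \<zeta>) \<in> A"
  then obtain c W where c: "local_section c W" "(x, \<zeta>) \<in> patch c W" "patch c W \<subseteq> A" unfolding openin_S_iff by blast
  then show "\<exists>T. openin (mtop M) T \<and> fst (x, \<zeta>) \<in> T \<and> T \<subseteq> fst ` A"
    using local_section_openin[OF c(1)] fst_patch[of c W] image_mono[OF c(3), of fst]
    by (intro exI[of _ W]) (simp add: mem_patch_iff)
qed

lemma patch_homeomorphic:
  assumes c: "local_section c W"
  shows "homeomorphic_map (subtopology (mtop (total S)) (patch c W)) (subtopology (mtop M) W) fst"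
proof (rule bijective_open_imp_homeomorphic_map)
  have ts: "topspace (subtopology (mtop (total S)) (patch c W)) = patch c W"
    using patch_subset[OF c] by (auto simp: epoints_S)
  show "continuous_map (subtopology (mtop (total S)) (patch c W)) (subtopology (mtop M) W) fst"
    by (intro continuous_map_into_subtopology continuous_map_from_subtopology fst_continuous)
      (use ts in \<open>auto simp: mem_patch_iff\<close>)
  show "open_map (subtopology (mtop (total S)) (patch c W)) (subtopology (mtop M) W) fst"
    unfolding open_map_def
    using openin_patch[OF c] local_section_openin[OF c] fst_open fst_patch
    by (auto simp: openin_open_subtopology) (force simp: mem_patch_iff)
  show "fst ` topspace (subtopology (mtop (total S)) (patch c W)) = topspace (subtopology (mtop M) W)"
    unfolding ts fst_patch using openin_subset[OF local_section_openin[OF c]] by auto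
  show "inj_on fst (topspace (subtopology (mtop (total S)) (patch c W)))"
    unfolding ts by (rule inj_fst_patch)
qed

lemma spectral_chart_inv:
  assumes W: "W \<subseteq> V" and \<kappa>: "inj_on \<kappa> V" and x: "x \<in> W"
  shows "inv_into (patch c W) (\<kappa> \<circ> fst) (\<kappa> x) = (x, stalk_class M C x c)"
proof -
  have "inj_on (\<kappa> \<circ> fst) (patch c W)"
    using inj_fst_patch by (rule comp_inj_on) (simp add: fst_patch inj_on_subset[OF \<kappa> W])
  moreover have "(x, stalk_class M C x c) \<in> patch c W" using x by (simp add: mem_patch_iff)
  ultimately show ?thesis using inv_into_f_f[of "\<kappa> \<circ> fst" "patch c W" "(x, stalk_class M C x c)"] by simp
qed

text \<open>Charts are charts of M composed with the projection of a patch, so transition maps are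
  restrictions of transition maps of M to the projection of an overlap, which is open.\<close>

lemma spectral_manifold: "manifold (total S)"
  unfolding manifold_def
proof (intro conjI)
  show "\<exists>B::'b set. finite B \<and> span B = UNIV" using manifold by (simp add: manifold_def)
  show "\<forall>(U, \<phi>)\<in>atlas (total S). openin (mtop (total S)) U \<and> open (\<phi> ` U) \<and>
        homeomorphic_map (subtopology (mtop (total S)) U) (top_of_set (\<phi> ` U)) \<phi>"
  proof clarify
    fix U \<phi> assume "(U, \<phi>) \<in> atlas (total S)"
    then obtain c W V \<kappa> where U: "U = patch c W" "\<phi> = \<kappa> \<circ> fst" and c: "local_section c W"
      and V: "(V, \<kappa>) \<in> atlas M" "W \<subseteq> V" unfolding atlas_S by blast
    have W: "openin (mtop M) W" using local_section_openin[OF c] .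
    have im: "\<phi> ` U = \<kappa> ` W" unfolding U image_comp[symmetric] fst_patch ..
    have VW: "V \<inter> W = W" using V by blast
    have "(V \<inter> W, \<kappa>) \<in> atlas (open_sub M W)" using V by (force simp: atlas_open_sub)
    then have "homeomorphic_map (subtopology (mtop (open_sub M W)) W) (top_of_set (\<kappa> ` W)) \<kappa>"
      using chart_homeomorphic[OF manifold_open_sub[OF manifold W]] VW by metis
    then have "homeomorphic_map (subtopology (mtop M) W) (top_of_set (\<kappa> ` W)) \<kappa>"
      by (simp add: mtop_open_sub subtopology_subtopology)
    then have "homeomorphic_map (subtopology (mtop (total S)) U) (top_of_set (\<phi> ` U)) \<phi>"
      unfolding im unfolding U by (rule homeomorphic_map_compose[OF patch_homeomorphic[OF c]])
    moreover have "open (\<phi> ` U)" unfolding im using chart_image[OF manifold V(1) W] VW by simp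
    ultimately show "openin (mtop (total S)) U \<and> open (\<phi> ` U) \<and>
        homeomorphic_map (subtopology (mtop (total S)) U) (top_of_set (\<phi> ` U)) \<phi>"
      using openin_patch[OF c] U by simp
  qed
  show "(\<Union>(U, \<phi>)\<in>atlas (total S). U) = epoints S"
  proof
    show "(\<Union>(U, \<phi>)\<in>atlas (total S). U) \<subseteq> epoints S"
      unfolding epoints_S atlas_S using patch_subset by blast
    show "epoints S \<subseteq> (\<Union>(U, \<phi>)\<in>atlas (total S). U)"
    proof
      fix z assume z: "z \<in> epoints S"
      then have "fst z \<in> points M" by (auto simp: epoints_S spectral_points_def)
      then obtain V \<kappa> where V: "(V, \<kappa>) \<in> atlas M" "fst z \<in> V" using chart_exists[OF manifold] by blast
      obtain c W where "local_section c W" "W \<subseteq> V" "z \<in> patch c W"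
        using spectral_point_rep[OF z[unfolded epoints_S] chart_openin[OF manifold V(1)] V(2)] by metis
      then have "(patch c W, \<kappa> \<circ> fst) \<in> atlas (total S)" unfolding atlas_S using V by blast
      then show "z \<in> (\<Union>(U, \<phi>)\<in>atlas (total S). U)" using \<open>z \<in> patch c W\<close> by blast
    qed
  qed
  show "\<forall>(U, \<phi>)\<in>atlas (total S). \<forall>(U', \<psi>)\<in>atlas (total S). smooth_on (\<phi> ` (U \<inter> U')) (\<psi> \<circ> inv_into U \<phi>)"
  proof clarify
    fix U \<phi> U' \<psi> assume "(U, \<phi>) \<in> atlas (total S)" "(U', \<psi>) \<in> atlas (total S)"
    then obtain c W V \<kappa> c' W' V' \<kappa>' where
      U: "U = patch c W" "\<phi> = \<kappa> \<circ> fst" and c: "local_section c W" and V: "(V, \<kappa>) \<in> atlas M" "W \<subseteq> V" and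
      U': "U' = patch c' W'" "\<psi> = \<kappa>' \<circ> fst" and c': "local_section c' W'" and V': "(V', \<kappa>') \<in> atlas M" "W' \<subseteq> V'"
      unfolding atlas_S by blast
    let ?N = "fst ` (U \<inter> U')"
    have oN: "openin (mtop M) ?N"
      using fst_open openin_patch[OF c] openin_patch[OF c'] U U' by (simp add: openin_Int)
    have N: "?N \<subseteq> W" "?N \<subseteq> W'" unfolding U U' by (auto simp: mem_patch_iff)
    then have im: "\<phi> ` (U \<inter> U') = \<kappa> ` (V \<inter> ?N)" using V U by (auto simp: image_comp[symmetric] image_image)
    have "smooth_on (\<kappa> ` (V \<inter> V')) (\<kappa>' \<circ> inv_into V \<kappa>)"
      using smooth_fun_chart[OF manifold V'(1)] V(1)
      unfolding smooth_fun_open_sub_iff[OF manifold chart_openin[OF manifold V'(1)]] by blast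
    then have "smooth_on (\<kappa> ` (V \<inter> ?N)) (\<kappa>' \<circ> inv_into V \<kappa>)"
      by (rule smooth_on_subset) (use N V' in blast)
    then have "smooth_on (\<kappa> ` (V \<inter> ?N)) (\<psi> \<circ> inv_into U \<phi>)"
    proof (rule smooth_on_cong)
      show "open (\<kappa> ` (V \<inter> ?N))" by (rule chart_image[OF manifold V(1) oN])
      fix y assume "y \<in> \<kappa> ` (V \<inter> ?N)"
      then obtain x where x: "y = \<kappa> x" "x \<in> V" "x \<in> ?N" by blast
      then have "x \<in> W" using N by blast
      then show "(\<kappa>' \<circ> inv_into V \<kappa>) y = (\<psi> \<circ> inv_into U \<phi>) y"
        using x spectral_chart_inv[OF V(2) chart_inj[OF manifold V(1)], of x c] chart_inj[OF manifold V(1)]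
        by (simp add: U U' inv_into_f_f)
    qed
    then show "smooth_on (\<phi> ` (U \<inter> U')) (\<psi> \<circ> inv_into U \<phi>)" unfolding im .
  qed
qed

text \<open>In the transported charts both directions are expressed by chart functions of M, so
  smoothness reduces to smoothness of the latter.\<close>

lemma spectral_patch_diffeo:
  assumes c: "local_section c W"
  shows "diffeo (open_sub (total S) (patch c W)) (open_sub M W) fst"
proof -
  let ?X = "open_sub (total S) (patch c W)" and ?Y = "open_sub M W"
  have W: "openin (mtop M) W" using local_section_openin[OF c] .
  note oP = openin_patch[OF c]
  have X: "manifold ?X" "points ?X = patch c W"
    using manifold_open_sub[OF spectral_manifold oP] openin_subset[OF oP] by auto
  have Y: "manifold ?Y" "points ?Y = W"
    using manifold_open_sub[OF manifold W] openin_subset[OF W] by auto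
  have hom: "homeomorphic_map (mtop ?X) (mtop ?Y) fst" using patch_homeomorphic[OF c] by (simp add: mtop_open_sub)
  have bij: "bij_betw fst (points ?X) (points ?Y)"
    unfolding X Y bij_betw_def using inj_fst_patch fst_patch by blast
  have "smooth_map ?X ?Y fst"
  proof (rule smooth_mapI[OF X(1) Y(1) homeomorphic_imp_continuous_map[OF hom]])
    fix Q \<psi> assume "(Q, \<psi>) \<in> atlas ?Y"
    then obtain V where V: "(V, \<psi>) \<in> atlas M" "Q = V \<inter> W" by (auto simp: atlas_open_sub)
    have oV: "openin (mtop M) (V \<inter> W)" using chart_openin[OF manifold V(1)] W by blast
    have "(patch c (V \<inter> W), \<psi> \<circ> fst) \<in> atlas (total S)"
      unfolding atlas_S using V local_section_subset[OF c oV] by blast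
    then have "smooth_fun (open_sub (total S) (patch c (V \<inter> W))) (\<psi> \<circ> fst)"
      by (rule smooth_fun_chart[OF spectral_manifold])
    moreover have "patch c (V \<inter> W) = patch c W \<inter> (points ?X \<inter> fst -` Q)"
      unfolding X V by (auto simp: mem_patch_iff)
    ultimately show "smooth_fun (open_sub ?X (points ?X \<inter> fst -` Q)) (\<psi> \<circ> fst)"
      by (simp add: open_sub_open_sub)
  qed
  moreover have "smooth_map ?Y ?X (inv_into (points ?X) fst)"
  proof -
    let ?g = "inv_into (points ?X) fst"
    have g: "?g x = (x, stalk_class M C x c)" if "x \<in> W" for x
    proof -
      have "(x, stalk_class M C x c) \<in> patch c W" using that by (simp add: mem_patch_iff)
      then show ?thesis unfolding X using inv_into_f_f[OF inj_fst_patch] by fastforce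
    qed
    have "continuous_map (mtop ?Y) (mtop ?X) ?g"
    proof -
      obtain h where h: "homeomorphic_maps (mtop ?X) (mtop ?Y) fst h" using hom by (auto simp: homeomorphic_map_maps)
      then have "h x = ?g x" if "x \<in> points ?Y" for x
        using that g[of x] inj_onD[OF inj_fst_patch, of "h x" "?g x" c W] unfolding homeomorphic_maps_def continuous_map_def X Y
        by (auto simp: mem_patch_iff Pi_iff)
      then show ?thesis using h continuous_map_eq unfolding homeomorphic_maps_def by metis
    qed
    then show ?thesis
    proof (rule smooth_mapI[OF Y(1) X(1)])
      fix Q \<psi> assume "(Q, \<psi>) \<in> atlas ?X"
      then obtain c' W' V \<kappa> where Q: "Q = patch c' W' \<inter> patch c W" "\<psi> = \<kappa> \<circ> fst"
        and c': "local_section c' W'" and V: "(V, \<kappa>) \<in> atlas M" "W' \<subseteq> V"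
        by (auto simp: atlas_open_sub atlas_S)
      let ?N = "fst ` Q"
      have oN: "openin (mtop M) ?N" using Q fst_open openin_patch[OF c'] oP by (simp add: openin_Int)
      have N: "?N \<subseteq> V" using Q V by (auto simp: mem_patch_iff)
      have "smooth_fun (open_sub M ?N) \<kappa>"
        using smooth_fun_mono[OF manifold chart_openin[OF manifold V(1)] oN N smooth_fun_chart[OF manifold V(1)]] .
      then have "smooth_fun (open_sub M ?N) (\<psi> \<circ> ?g)"
      proof (rule smooth_fun_cong[OF manifold oN])
        fix x assume "x \<in> ?N"
        then have "x \<in> W" using Q by (auto simp: mem_patch_iff)
        then show "(\<psi> \<circ> ?g) x = \<kappa> x" using g Q by simp
      qed
      moreover have "?N = W \<inter> (points ?Y \<inter> ?g -` Q)"
      proof (intro equalityI subsetI)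
        fix x assume "x \<in> ?N"
        then obtain z where z: "z \<in> Q" "x = fst z" by blast
        then have x: "x \<in> W" "z = (x, stalk_class M C x c)" using Q by (auto simp: mem_patch_iff prod_eq_iff)
        then have "?g x \<in> Q" using z(1) g by metis
        then show "x \<in> W \<inter> (points ?Y \<inter> ?g -` Q)" using x(1) Y(2) by blast
      next
        fix x assume "x \<in> W \<inter> (points ?Y \<inter> ?g -` Q)"
        then show "x \<in> ?N" using g[of x] by (force simp: image_iff)
      qed
      ultimately show "smooth_fun (open_sub ?Y (points ?Y \<inter> ?g -` Q)) (\<psi> \<circ> ?g)"
        by (simp add: open_sub_open_sub)
    qed
  qed
  ultimately show ?thesis using bij by (simp add: diffeo_def)
qed

theorem spectral_sh_obj: "sh_obj M S"
  unfolding sh_obj_def local_diffeo_def proj_S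
proof (intro conjI spectral_manifold ballI)
  fix z assume "z \<in> epoints S"
  then have z: "z \<in> SP" "fst z \<in> points M" by (auto simp: epoints_S spectral_points_def)
  then obtain c W where c: "local_section c W" "z \<in> patch c W"
    using spectral_point_rep[OF z(1) openin_topspace] by metis
  then show "\<exists>U. openin (mtop (total S)) U \<and> z \<in> U \<and> openin (mtop M) (fst ` U) \<and>
      diffeo (open_sub (total S) U) (open_sub M (fst ` U)) fst"
    using openin_patch[OF c(1)] local_section_openin[OF c(1)] spectral_patch_diffeo[OF c(1)]
    by (intro exI[of _ "patch c W"]) (simp add: fst_patch)
qed

lemma patch_elementary: "local_section c W \<Longrightarrow> elementary S (patch c W)"
  by (simp add: elementary_def openin_patch proj_S inj_fst_patch)

lemma sheaf_S: "sheaf M S"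
  by unfold_locales (rule spectral_sh_obj)

end

section \<open>Functoriality of the spectral sheaf\<close>

locale Cc_coalgebra_pair = Cs: Cc_coalgebra M C + Ds: Cc_coalgebra M D
  for M :: "('x, 'b::real_inner) mfd" and C :: "('x \<Rightarrow> 'k::real_normed_field, 'c) coalg"
    and D :: "('x \<Rightarrow> 'k, 'd) coalg"
begin

lemma
  assumes "\<alpha> \<in> coalg_hom (Cc M) C D"
  shows hom_extensional: "\<alpha> \<in> extensional (carrier C)" and hom_linear: "linear_map (Cc M) C D \<alpha>"
    and hom_closed: "c \<in> carrier C \<Longrightarrow> \<alpha> c \<in> carrier D"
    and hom_comult: "c \<in> carrier C \<Longrightarrow> tensor_map (Cc M) D D \<alpha> \<alpha> (comult C c) = comult D (\<alpha> c)"
    and hom_counit: "c \<in> carrier C \<Longrightarrow> counit D (\<alpha> c) = counit C c"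
    and hom_eq_at: "eq_at M C x c c' \<Longrightarrow> c \<in> carrier C \<Longrightarrow> c' \<in> carrier C \<Longrightarrow> eq_at M D x (\<alpha> c) (\<alpha> c')"
  using assms by (auto simp: coalg_hom_def linear_map_def intro!: eq_at_linear_map[of M C D \<alpha>])

text \<open>A homomorphism turns a comultiplication of the form c \<otimes> c' into one of its
  images and preserves the counit. Patches therefore go to patches over the same W, which gives
  continuity of the spectral map.\<close>

lemma hom_local_section:
  assumes \<alpha>: "\<alpha> \<in> coalg_hom (Cc M) C D" and c: "Cs.local_section c W"
  shows "Ds.local_section (\<alpha> c) W"
proof -
  have cc: "c \<in> carrier C" using Cs.local_section_closed[OF c] .
  obtain c' where c': "c' \<in> carrier C" "comult C c = Cs.pure c c'"
    using c by (auto simp: Cs.local_section_def weakly_grouplike_def)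
  have "comult D (\<alpha> c) = Ds.pure (\<alpha> c) (\<alpha> c')"
    using hom_comult[OF \<alpha> cc] c' Cs.tensor_map_pure[OF Ds.lu_module_pair_axioms hom_linear[OF \<alpha>] hom_linear[OF \<alpha>]] by simp
  then have "weakly_grouplike (Cc M) D (\<alpha> c)"
    using hom_closed[OF \<alpha>] cc c' by (auto simp: weakly_grouplike_def)
  then show ?thesis
    using c hom_counit[OF \<alpha> cc] by (simp add: Cs.local_section_def Ds.local_section_def normalized_on_def)
qed

lemma spectral_map_apply:
  assumes \<alpha>: "\<alpha> \<in> coalg_hom (Cc M) C D" and c: "c \<in> carrier C" and z: "(x, stalk_class M C x c) \<in> Cs.SP"
  shows "spectral_map M C D \<alpha> (x, stalk_class M C x c) = (x, stalk_class M D x (\<alpha> c))"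
proof -
  have x: "x \<in> points M" using z by (simp add: spectral_points_def)
  have "the_elem ((\<lambda>c. stalk_class M D x (\<alpha> c)) ` stalk_class M C x c) = stalk_class M D x (\<alpha> c)"
  proof (rule Cs.the_elem_stalk_class[OF x c])
    fix d assume "d \<in> carrier C" "eq_at M C x d c"
    then show "stalk_class M D x (\<alpha> d) = stalk_class M D x (\<alpha> c)"
      using hom_eq_at[OF \<alpha>] hom_closed[OF \<alpha>] c by (simp add: Ds.stalk_class_eq_iff[OF x])
  qed
  then show ?thesis using z by (simp add: spectral_map_def)
qed

lemma spectral_map_patch:
  assumes \<alpha>: "\<alpha> \<in> coalg_hom (Cc M) C D" and c: "Cs.local_section c W" and x: "x \<in> W"
  shows "spectral_map M C D \<alpha> (x, stalk_class M C x c) = (x, stalk_class M D x (\<alpha> c))"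
proof (rule spectral_map_apply[OF \<alpha> Cs.local_section_closed[OF c]])
  show "(x, stalk_class M C x c) \<in> Cs.SP" using Cs.patch_subset[OF c] x by (auto simp: spectral_patch_def)
qed

theorem spectral_map_hom:
  assumes \<alpha>: "\<alpha> \<in> coalg_hom (Cc M) C D"
  shows "spectral_map M C D \<alpha> \<in> sh_hom Cs.S Ds.S"
proof -
  interpret two_sheaves M Cs.S Ds.S
    using Cs.sheaf_S Ds.sheaf_S by (simp add: two_sheaves_def)
  show ?thesis
  proof (rule sh_homI)
    show "spectral_map M C D \<alpha> \<in> extensional (epoints Cs.S)"
      by (simp add: spectral_map_def Cs.epoints_S)
    fix z assume "z \<in> epoints Cs.S"
    then have z: "z \<in> Cs.SP" "fst z \<in> points M" by (auto simp: Cs.epoints_S spectral_points_def)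
    then obtain c W where c: "Cs.local_section c W" "fst z \<in> W" "z = (fst z, stalk_class M C (fst z) c)" "z \<in> Cs.patch c W"
      using Cs.spectral_point_rep[OF z(1) openin_topspace] by metis
    show "proj Ds.S (spectral_map M C D \<alpha> z) = proj Cs.S z"
      using spectral_map_patch[OF \<alpha> c(1,2)] c(3) by (simp add: Cs.proj_S Ds.proj_S)
    have "spectral_map M C D \<alpha> ` Cs.patch c W \<subseteq> Ds.patch (\<alpha> c) W"
      using spectral_map_patch[OF \<alpha> c(1)] by (auto simp: spectral_patch_def)
    then show "\<exists>V U. openin (mtop (total Cs.S)) V \<and> z \<in> V \<and> elementary Ds.S U \<and> spectral_map M C D \<alpha> ` V \<subseteq> U"
      using Cs.openin_patch[OF c(1)] c(4) Ds.patch_elementary[OF hom_local_section[OF \<alpha> c(1)]] by blast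
  qed
qed

end

lemma (in Cc_coalgebra) spectral_map_id:
  assumes "\<And>c. c \<in> carrier C \<Longrightarrow> \<alpha> c = c"
  shows "spectral_map M C C \<alpha> = (\<lambda>z\<in>epoints S. z)"
proof (rule extensionalityI[of _ SP])
  fix z assume z: "z \<in> SP"
  then have "fst z \<in> points M" by (auto simp: spectral_points_def)
  then obtain c W where c: "local_section c W" "fst z \<in> W" "z = (fst z, stalk_class M C (fst z) c)"
    using spectral_point_rep[OF z openin_topspace] by metis
  have "the_elem ((\<lambda>c. stalk_class M C (fst z) (\<alpha> c)) ` stalk_class M C (fst z) c) = stalk_class M C (fst z) (\<alpha> c)"
    using \<open>fst z \<in> points M\<close> local_section_closed[OF c(1)] assms
    by (intro the_elem_stalk_class) (auto simp: stalk_class_eq_iff)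
  moreover have "(fst z, stalk_class M C (fst z) c) \<in> SP" using z c(3) by metis
  ultimately have "spectral_map M C C \<alpha> (fst z, stalk_class M C (fst z) c) = (fst z, stalk_class M C (fst z) c)"
    using assms[OF local_section_closed[OF c(1)]] by (simp add: spectral_map_def)
  then show "spectral_map M C C \<alpha> z = (\<lambda>z\<in>epoints S. z) z"
    using z c(3) by (simp add: epoints_S)
qed (simp_all add: spectral_map_def epoints_S)

lemma spectral_map_compose:
  assumes BC: "Cc_coalgebra_pair M B C" and CD: "Cc_coalgebra_pair M C D"
    and \<alpha>: "\<alpha> \<in> coalg_hom (Cc M) B C" and \<beta>: "\<beta> \<in> coalg_hom (Cc M) C D"
    and \<gamma>: "compose (carrier B) \<beta> \<alpha> \<in> coalg_hom (Cc M) B D"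
  shows "spectral_map M B D (compose (carrier B) \<beta> \<alpha>) =
    compose (epoints (spectral_sheaf M B)) (spectral_map M C D \<beta>) (spectral_map M B C \<alpha>)"
proof -
  interpret BC: Cc_coalgebra_pair M B C by fact
  interpret CD: Cc_coalgebra_pair M C D by fact
  interpret BD: Cc_coalgebra_pair M B D ..
  show ?thesis
  proof (rule extensionalityI[of _ BC.Cs.SP])
    fix z assume z: "z \<in> BC.Cs.SP"
    then have "fst z \<in> points M" by (auto simp: spectral_points_def)
    then obtain c W where c: "BC.Cs.local_section c W" "fst z \<in> W" "z = (fst z, stalk_class M B (fst z) c)"
      using BC.Cs.spectral_point_rep[OF z openin_topspace] by metis
    show "spectral_map M B D (compose (carrier B) \<beta> \<alpha>) z =
      compose (epoints (spectral_sheaf M B)) (spectral_map M C D \<beta>) (spectral_map M B C \<alpha>) z"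
      using BD.spectral_map_patch[OF \<gamma> c(1,2)] BC.spectral_map_patch[OF \<alpha> c(1,2)]
        CD.spectral_map_patch[OF \<beta> BC.hom_local_section[OF \<alpha> c(1)] c(2)] c(3) z
        BC.Cs.local_section_closed[OF c(1)]
      by (metis compose_eq BC.Cs.epoints_S)
  qed (simp_all add: spectral_map_def BC.Cs.epoints_S)
qed

lemma (in lu_module_pair) tensor_linear_eqI:
  assumes G: "abelian_group G" and h: "linear_map R (tensor R C D) G h" "linear_map R (tensor R C D) G h'"
    and eq: "\<And>c d. c \<in> carrier C \<Longrightarrow> d \<in> carrier D \<Longrightarrow> h (pure c d) = h' (pure c d)"
    and T: "T \<in> carrier (tensor R C D)"
  shows "h T = h' T"
proof -
  interpret G: abelian_group G by fact
  show ?thesis using T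
  proof (induction rule: tensor_induct)
    case (pure c d)
    then show ?case by (rule eq)
  next
    case zero
    show "h \<zero>\<^bsub>tensor R C D\<^esub> = h' \<zero>\<^bsub>tensor R C D\<^esub>"
      using linear_map_zero[OF h(1) tensor_abelian_group G] linear_map_zero[OF h(2) tensor_abelian_group G] by simp
  next
    case (diff T U V)
    then have "h V \<oplus>\<^bsub>G\<^esub> h U = h' V \<oplus>\<^bsub>G\<^esub> h U"
      using linear_map_add[OF h(1), of V U] linear_map_add[OF h(2), of V U] by simp
    then show ?case
      using diff linear_map_closed[OF h(1)] linear_map_closed[OF h(2)] by simp
  qed
qed

lemma coalg_hom_compose:
  assumes BC: "Cc_coalgebra_pair M B C" and CD: "Cc_coalgebra_pair M C D"
    and \<alpha>: "\<alpha> \<in> coalg_hom (Cc M) B C" and \<beta>: "\<beta> \<in> coalg_hom (Cc M) C D"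
  shows "compose (carrier B) \<beta> \<alpha> \<in> coalg_hom (Cc M) B D"
proof -
  interpret BC: Cc_coalgebra_pair M B C by fact
  interpret CD: Cc_coalgebra_pair M C D by fact
  let ?\<gamma> = "compose (carrier B) \<beta> \<alpha>"
  have \<gamma>: "linear_map (Cc M) B D ?\<gamma>"
    using linear_map_compose[OF BC.Cs.C.lu_module_axioms BC.hom_linear[OF \<alpha>] CD.hom_linear[OF \<beta>]] .
  have ev: "?\<gamma> b = \<beta> (\<alpha> b)" if "b \<in> carrier B" for b using that by (simp add: compose_eq)
  have "tensor_map (Cc M) D D ?\<gamma> ?\<gamma> (comult B b) = comult D (?\<gamma> b)" if b: "b \<in> carrier B" for b
  proof -
    note t1 = BC.Cs.tensor_map_linear(1)[OF CD.Ds.lu_module_pair_axioms \<gamma> \<gamma>]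
      and t2 = BC.Cs.tensor_map_linear(1)[OF BC.Ds.lu_module_pair_axioms BC.hom_linear[OF \<alpha>] BC.hom_linear[OF \<alpha>]]
      and t3 = BC.Ds.tensor_map_linear(1)[OF CD.Ds.lu_module_pair_axioms CD.hom_linear[OF \<beta>] CD.hom_linear[OF \<beta>]]
    have "tensor_map (Cc M) D D ?\<gamma> ?\<gamma> (comult B b) = tensor_map (Cc M) D D \<beta> \<beta> (tensor_map (Cc M) C C \<alpha> \<alpha> (comult B b))"
    proof (rule BC.Cs.tensor_linear_eqI[OF CD.Ds.T.abelian_group_axioms t1 linear_map_comp[OF t2 t3] _ BC.Cs.comult_closed[OF b]])
      fix c d assume "c \<in> carrier B" "d \<in> carrier B"
      then show "tensor_map (Cc M) D D ?\<gamma> ?\<gamma> (BC.Cs.pure c d) = tensor_map (Cc M) D D \<beta> \<beta> (tensor_map (Cc M) C C \<alpha> \<alpha> (BC.Cs.pure c d))"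
        by (simp add: BC.Cs.tensor_map_pure[OF CD.Ds.lu_module_pair_axioms \<gamma> \<gamma>]
            BC.Cs.tensor_map_pure[OF BC.Ds.lu_module_pair_axioms BC.hom_linear[OF \<alpha>] BC.hom_linear[OF \<alpha>]]
            BC.Ds.tensor_map_pure[OF CD.Ds.lu_module_pair_axioms CD.hom_linear[OF \<beta>] CD.hom_linear[OF \<beta>]] ev)
    qed
    then show ?thesis
      using b BC.hom_comult[OF \<alpha> b] CD.hom_comult[OF \<beta> BC.hom_closed[OF \<alpha> b]] by (simp add: ev)
  qed
  moreover have "counit D (?\<gamma> b) = counit B b" if b: "b \<in> carrier B" for b
    using b BC.hom_counit[OF \<alpha> b] CD.hom_counit[OF \<beta> BC.hom_closed[OF \<alpha> b]] by (simp add: ev)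
  ultimately show ?thesis using \<gamma> by (simp add: coalg_hom_def)
qed

lemma sh_hom_compose:
  assumes EF: "two_sheaves M E F" and FG: "two_sheaves M F G"
    and \<phi>: "\<phi> \<in> sh_hom E F" and \<psi>: "\<psi> \<in> sh_hom F G"
  shows "compose (epoints E) \<psi> \<phi> \<in> sh_hom E G"
proof -
  interpret EF: two_sheaves M E F by fact
  interpret FG: two_sheaves M F G by fact
  interpret EG: two_sheaves M E G ..
  show ?thesis
  proof (rule EG.sh_homI)
    fix e assume e: "e \<in> epoints E"
    then have \<phi>e: "\<phi> e \<in> epoints F" by (rule EF.sh_hom_points[OF \<phi>])
    show "proj G (compose (epoints E) \<psi> \<phi> e) = proj E e"
      using e \<phi>e EF.sh_hom_proj[OF \<phi>] FG.sh_hom_proj[OF \<psi>] by (simp add: compose_eq)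
    obtain U where U: "elementary G U" "\<psi> (\<phi> e) \<in> U"
      using FG.F.elementary_point[OF FG.sh_hom_points[OF \<psi> \<phi>e]] .
    let ?V = "epoints E \<inter> \<phi> -` (epoints F \<inter> \<psi> -` U)"
    have "openin (mtop (total E)) ?V"
      by (intro openin_map_vimage[OF EF.sh_hom_continuous[OF \<phi>]] openin_map_vimage[OF FG.sh_hom_continuous[OF \<psi>]] elementary_openin U)
    moreover have "compose (epoints E) \<psi> \<phi> ` ?V \<subseteq> U" by (auto simp: compose_eq)
    ultimately show "\<exists>V U. openin (mtop (total E)) V \<and> e \<in> V \<and> elementary G U \<and> compose (epoints E) \<psi> \<phi> ` V \<subseteq> U"
      using e \<phi>e U by (intro exI[of _ ?V] exI[of _ U]) simp
  qed (rule compose_extensional)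
qed

text \<open>Needed where a linear map is known explicitly only on pullbacks over sets that a given
  morphism sends into a single patch.\<close>

lemma (in sheaf_module) linear_map_eqI_small:
  assumes h: "linear_map (Cc M) (Cc_module E) T h" "linear_map (Cc M) (Cc_module E) T h'"
    and Q: "\<And>e. e \<in> epoints E \<Longrightarrow> \<exists>V. elementary E V \<and> e \<in> V \<and> Q V"
      "\<And>V W. Q V \<Longrightarrow> W \<subseteq> V \<Longrightarrow> Q W"
    and eq: "\<And>U f. elementary E U \<Longrightarrow> Q U \<Longrightarrow> f \<in> Cc (open_sub M (proj E ` U)) \<Longrightarrow> h (pullback E U f) = h' (pullback E U f)"
    and s: "s \<in> Cc_sections (total E)"
  shows "h s = h' s"
  using s
proof (induction rule: sections_induct[where Q = Q])
  case (small e)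
  then show ?case by (rule Q)
next
  case (small_subset V W)
  then show ?case using Q(2) by blast
next
  case zero
  interpret C: Cc_lu_module M "Cc_module E :: ('x \<Rightarrow> 'k, 'e \<Rightarrow> ('e \<Rightarrow> 'k) set) module" by (rule Cc_module_lu)
  have "h \<zero>\<^bsub>Cc_module E\<^esub> = h' \<zero>\<^bsub>Cc_module E\<^esub>"
    using linear_map_zero[OF h(1) C.abelian_group_axioms abelian_group_axioms]
      linear_map_zero[OF h(2) C.abelian_group_axioms abelian_group_axioms] by simp
  then show ?case by (simp add: Cc_module_simps zero_fun_def)
next
  case (add s t)
  then show ?case using linear_map_add[OF h(1), of s t] linear_map_add[OF h(2), of s t] by (simp add: Cc_module_simps)
qed (rule eq)

section \<open>The unit of the adjunction\<close>

sublocale field_sheaf \<subseteq> Coalg: Cc_coalgebra M "Cc_coalg M E :: ('x \<Rightarrow> 'k, 'e \<Rightarrow> ('e \<Rightarrow> 'k) set) coalg"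
  by unfold_locales (rule Cc_coalg_coalgebra)

context field_sheaf
begin

abbreviation CA :: "('x \<Rightarrow> 'k, 'e \<Rightarrow> ('e \<Rightarrow> 'k) set) coalg" where "CA \<equiv> Cc_coalg M E"

lemma pullback_closed_coalg: "elementary E U \<Longrightarrow> f \<in> Cc (open_sub M (proj E ` U)) \<Longrightarrow> pullback E U f \<in> carrier CA"
  by (simp add: Cc_coalg_simps pullback_closed)

text \<open>The pullback of a local unit of f is the second tensor factor required by weak
  grouplikeness; the counit is f itself.\<close>

lemma pullback_local_section:
  assumes U: "elementary E U" and f: "f \<in> Cc (open_sub M (proj E ` U))"
    and W: "openin (mtop M) W" "\<And>y. y \<in> W \<Longrightarrow> near M y (\<lambda>y. f y = 1)"
  shows "Coalg.local_section (pullback E U f) W"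
proof -
  obtain g :: "'x \<Rightarrow> 'k" where g: "g \<in> Cc (open_sub M (proj E ` U))" "g * f = f"
    using Cc_local_unit[OF elementary_image[OF U] f] .
  have "comult CA (pullback E U f) = Coalg.pure (pullback E U f) (pullback E U g)"
    using comult_properties(3)[OF U f g] by (simp add: Cc_coalg_simps Cc_coalg_tensor)
  then have "weakly_grouplike (Cc M) CA (pullback E U f)"
    using pullback_closed_coalg[OF U] f g by (auto simp: weakly_grouplike_def)
  moreover have "germ M y (counit CA (pullback E U f)) = germ M y 1" if "y \<in> W" for y
  proof -
    have "y \<in> points M" using that openin_subset[OF W(1)] by blast
    then show ?thesis using W(2)[OF that] by (simp add: Cc_coalg_simps counit_properties(3)[OF U f] germ_eq_iff one_fun_def)
  qed
  ultimately show ?thesis using W(1) by (simp add: Coalg.local_section_def normalized_on_def)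
qed

text \<open>Any two admissible functions agree near the base point, so the set under
  \<open>the_elem\<close> has one element.\<close>

lemma adj_unit_eq:
  assumes U: "elementary E U" "e \<in> U" and f: "f \<in> Cc (open_sub M (proj E ` U))" "near M (proj E e) (\<lambda>y. f y = 1)"
  shows "adj_unit M E e = (proj E e, stalk_class M CA (proj E e) (pullback E U f))"
proof -
  let ?x = "proj E e"
  have e: "e \<in> epoints E" using openin_subset[OF elementary_openin[OF U(1)]] U(2) by blast
  have x: "?x \<in> points M" using proj_in_points[OF e] .
  have g1: "germ M ?x g = germ M ?x 1 \<longleftrightarrow> near M ?x (\<lambda>y. g y = 1)" for g :: "'x \<Rightarrow> 'k"
    by (simp add: germ_eq_iff[OF x] one_fun_def)
  have eq: "stalk_class M CA ?x (pullback E U' g) = stalk_class M CA ?x (pullback E U f)"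
    if g: "elementary E U'" "e \<in> U'" "g \<in> Cc (open_sub M (proj E ` U'))" "near M ?x (\<lambda>y. g y = 1)" for U' and g :: "'x \<Rightarrow> 'k"
  proof -
    have "near M ?x (\<lambda>y. g y = f y)" using g(4) f(2) by eventually_elim simp
    then have "eq_at M CA ?x (pullback E U' g) (pullback E U f)"
      using pullback_eq_at[OF g(1) U(1) g(2) U(2) g(3) f(1)] by (simp add: Cc_coalg_eq_at)
    then show ?thesis using pullback_closed_coalg g U f by (simp add: Coalg.stalk_class_eq_iff[OF x])
  qed
  have "{stalk_class M CA ?x (pullback E U g) | U g. elementary E U \<and> e \<in> U \<and> g \<in> Cc (open_sub M (proj E ` U)) \<and>
        germ M ?x g = germ M ?x 1} = {stalk_class M CA ?x (pullback E U f)}"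
    unfolding g1 using eq U f by blast
  then show ?thesis using e by (simp add: adj_unit_def)
qed

lemma adj_unit_nbhd:
  assumes e: "e \<in> epoints E"
  obtains U V f where "elementary E U" "elementary E V" "e \<in> V" "V \<subseteq> U" "f \<in> Cc (open_sub M (proj E ` U))"
    "Coalg.local_section (pullback E U f) (proj E ` V)"
    "\<And>e'. e' \<in> V \<Longrightarrow> near M (proj E e') (\<lambda>y. f y = 1)"
    "\<And>e'. e' \<in> V \<Longrightarrow> adj_unit M E e' = (proj E e', stalk_class M CA (proj E e') (pullback E U f))"
proof -
  obtain U V f where V: "elementary E U" "elementary E V" "e \<in> V" "V \<subseteq> U" "(f :: 'x \<Rightarrow> 'k) \<in> Cc (open_sub M (proj E ` U))"
    "\<And>e'. e' \<in> V \<Longrightarrow> near M (proj E e') (\<lambda>y. f y = 1)" using bump_nbhd[OF e] by metis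
  moreover have "Coalg.local_section (pullback E U f) (proj E ` V)"
    using V elementary_image[OF V(2)] by (intro pullback_local_section) auto
  moreover have "adj_unit M E e' = (proj E e', stalk_class M CA (proj E e') (pullback E U f))" if "e' \<in> V" for e'
    using V that by (intro adj_unit_eq) auto
  ultimately show ?thesis using that by blast
qed

lemma two_sheaves_S: "two_sheaves M E Coalg.S"
  using sheaf_axioms Coalg.sheaf_S by (simp add: two_sheaves_def)

lemma adj_unit_hom: "adj_unit M E \<in> sh_hom E Coalg.S"
proof -
  interpret two_sheaves M E Coalg.S by (rule two_sheaves_S)
  show ?thesis
  proof (rule sh_homI)
    show "adj_unit M E \<in> extensional (epoints E)" by (simp add: adj_unit_def)
    fix e assume e: "e \<in> epoints E"
    show "proj Coalg.S (adj_unit M E e) = proj E e" using e by (simp add: adj_unit_def Coalg.proj_S)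
    obtain U V f where V: "elementary E U" "elementary E V" "e \<in> V" "V \<subseteq> U" "f \<in> Cc (open_sub M (proj E ` U))"
      "Coalg.local_section (pullback E U f) (proj E ` V)"
      "\<And>e'. e' \<in> V \<Longrightarrow> near M (proj E e') (\<lambda>y. f y = 1)"
      "\<And>e'. e' \<in> V \<Longrightarrow> adj_unit M E e' = (proj E e', stalk_class M CA (proj E e') (pullback E U f))"
      using adj_unit_nbhd[OF e] by metis
    have "adj_unit M E ` V \<subseteq> Coalg.patch (pullback E U f) (proj E ` V)"
      using V(8) by (auto simp: spectral_patch_def)
    then show "\<exists>V U. openin (mtop (total E)) V \<and> e \<in> V \<and> elementary Coalg.S U \<and> adj_unit M E ` V \<subseteq> U"
      using V(3) elementary_openin[OF V(2)] Coalg.patch_elementary[OF V(6)] by blast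
  qed
qed

text \<open>Germs at e separate it from the other points of its fibre: if e differed from e', it
  would lie outside the elementary set U' around e', where the second pullback is 0, while the first
  has value 1 at e.\<close>

lemma adj_unit_inj: "inj_on (adj_unit M E :: 'e \<Rightarrow> 'x \<times> ('e \<Rightarrow> ('e \<Rightarrow> 'k) set) set) (epoints E)"
proof (rule inj_onI)
  fix e e' assume e: "e \<in> epoints E" "e' \<in> epoints E"
    and eq: "(adj_unit M E e :: 'x \<times> ('e \<Rightarrow> ('e \<Rightarrow> 'k) set) set) = adj_unit M E e'"
  obtain U where U: "elementary E U" "e \<in> U" using elementary_point[OF e(1)] .
  obtain f :: "'x \<Rightarrow> 'k" where f: "f \<in> Cc (open_sub M (proj E ` U))" "near M (proj E e) (\<lambda>y. f y = 1)"
    using bump_on_elementary[OF U] .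
  obtain U' where U': "elementary E U'" "e' \<in> U'" using elementary_point[OF e(2)] .
  obtain f' :: "'x \<Rightarrow> 'k" where f': "f' \<in> Cc (open_sub M (proj E ` U'))" "near M (proj E e') (\<lambda>y. f' y = 1)"
    using bump_on_elementary[OF U'] .
  let ?x = "proj E e"
  have x: "?x \<in> points M" using proj_in_points[OF e(1)] .
  have eq': "(?x, stalk_class M CA ?x (pullback E U f)) = (proj E e', stalk_class M CA (proj E e') (pullback E U' f'))"
    by (rule trans[OF trans[OF adj_unit_eq[OF U f, symmetric] eq] adj_unit_eq[OF U' f']])
  then have px: "proj E e' = ?x" by (simp only: prod.inject)
  from eq' have "stalk_class M CA ?x (pullback E U f) = stalk_class M CA ?x (pullback E U' f')"
    unfolding px by (simp only: prod.inject)
  then have "eq_at M CA ?x (pullback E U f) (pullback E U' f')"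
    using pullback_closed_coalg U U' f f' by (simp add: Coalg.stalk_class_eq_iff[OF x])
  then obtain r where r: "r \<in> Cc M" "near M ?x (\<lambda>y. r y = 1)" "pullback E U (r * f) = pullback E U' (r * f')"
    by (auto simp: Cc_coalg_eq_at eq_at_def smult_pullback)
  show "e = e'"
  proof (rule ccontr)
    assume "e \<noteq> e'"
    then have "e \<notin> U'" using inj_onD[OF elementary_inj[OF U'(1)] px[symmetric]] U' by blast
    then have "germ (total E) e ((r * f) \<circ> proj E) = germ (total E) e 0"
      using fun_cong[OF r(3), of e] U by (simp add: pullback_apply[OF e(1)])
    then have "near (total E) e (\<lambda>y. ((r * f) \<circ> proj E) y = 0 y)" by (simp only: germ_eq_iff[OF e(1)])
    from near_imp_at[OF this e(1)] have "r ?x * f ?x = 0" by simp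
    moreover have "r ?x = 1" "f ?x = 1" using near_imp_at[OF r(2) x] near_imp_at[OF f(2) x] by auto
    ultimately show False by simp
  qed
qed

end

section \<open>Coefficients in the stalks and surjectivity of the unit\<close>

text \<open>This is locality of the ring of germs, in the form that an idempotent germ with nonzero
  value at x can be cancelled near x.\<close>

lemma (in hausdorff_manifold) smooth_nonzero_near:
  fixes f :: "'x \<Rightarrow> 'k::real_normed_field"
  assumes f: "smooth_fun M f" and x: "x \<in> points M" "f x \<noteq> 0"
  shows "near M x (\<lambda>y. f y \<noteq> 0)"
proof -
  obtain U \<phi> where c: "(U, \<phi>) \<in> atlas M" "x \<in> U" using chart_exists[OF manifold x(1)] .
  have "smooth_on (\<phi> ` U) (f \<circ> inv_into U \<phi>)" using f c by (auto simp: smooth_fun_def)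
  then have "continuous_on (\<phi> ` U) (f \<circ> inv_into U \<phi>)" by (rule smooth_on_imp_continuous_on)
  moreover have "open (\<phi> ` U)" using chart_image[OF manifold c(1) openin_topspace] chart_subset[OF manifold c(1)] by (simp add: inf.absorb1)
  ultimately have "open ((f \<circ> inv_into U \<phi>) -` (- {0}) \<inter> \<phi> ` U)"
    using continuous_on_open_vimage by (metis open_Compl closed_singleton)
  then have oN: "openin (mtop M) {y \<in> U. \<phi> y \<in> (f \<circ> inv_into U \<phi>) -` (- {0}) \<inter> \<phi> ` U}"
    by (rule chart_preimage[OF manifold c(1)])
  show ?thesis
    by (intro nearI[OF oN]) (use c x chart_inj[OF manifold c(1)] in \<open>auto simp: inv_into_f_f inj_on_eq_iff\<close>)
qed

context field_sheaf
begin

text \<open>The germ of s at e, represented by a function on the base. It is meaningful only near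
  the base point of e, so all its properties are stated with \<open>near\<close>.\<close>

definition stalk_coeff :: "'e \<Rightarrow> ('e \<Rightarrow> ('e \<Rightarrow> 'k) set) \<Rightarrow> 'x \<Rightarrow> 'k" where
  "stalk_coeff e s = (SOME g. s e = germ (total E) e (g \<circ> proj E))"

text \<open>The family of point sections extends to the identity: the stalk over x is spanned by the
  points over x, with the germs of s as coefficients.\<close>

lemma expands_point_section:
  assumes s: "s \<in> carrier C"
  shows "sheaf_module.expands M E C point_section s s"
proof -
  interpret S: sheaf_module M E C ..
  have "s \<in> Cc_sections (total E)" using s by (simp add: Cc_module_simps)
  then show ?thesis
  proof (induction rule: sections_induct_pullback)
    case zero
    have "S.expands point_section (pullback E {} 0) (pullback E {} 0)"
      using pullback_closed[OF elementary_empty] Cc_open_sub_0[OF openin_empty] Cl.eq_at_refl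
      by (intro S.expands_pullback elementary_empty) (auto simp: pullback_zero)
    then have "S.expands point_section (ext_zero (total E) {} 0) (ext_zero (total E) {} (0 :: 'e \<Rightarrow> 'k))"
      by (simp only: pullback_0)
    then show ?case by (simp add: zero_fun_def)
  next
    case (pullback V g)
    have ep: "e \<in> epoints E" if "e \<in> V" for e using that openin_subset[OF elementary_openin[OF pullback(1)]] by blast
    show ?case
      using pullback pullback_closed ep point_section_closed pullback_eq_at_point(1) pullback_eq_at_0
      by (intro S.expands_pullback) auto
  next
    case (add s t)
    then show ?case
      using S.expands_add[of point_section s s t t] point_section_closed by (simp add: Cc_module_simps o_def)
  qed
qed

lemma stalk_coeff:
  assumes s: "s \<in> carrier C" and e: "e \<in> epoints E"
  shows "s e = germ (total E) e (stalk_coeff e s \<circ> proj E)"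
proof -
  interpret S: sheaf_module M E C ..
  obtain A g where "\<And>e'. e' \<in> epoints E \<Longrightarrow> proj E e' = proj E e \<Longrightarrow> s e' = germ (total E) e' (g e' \<circ> proj E)"
    using S.expandsE[OF expands_point_section[OF s] proj_in_points[OF e]] by metis
  then have "s e = germ (total E) e (g e \<circ> proj E)" using e by blast
  then show ?thesis unfolding stalk_coeff_def by (rule someI[of "\<lambda>g. s e = germ (total E) e (g \<circ> proj E)"])
qed

lemma stalk_coeff_near:
  assumes s: "s \<in> carrier C" and e: "e \<in> epoints E" and g: "s e = germ (total E) e (g \<circ> proj E)"
  shows "near M (proj E e) (\<lambda>y. stalk_coeff e s y = g y)"
proof -
  have "germ (total E) e (stalk_coeff e s \<circ> proj E) = germ (total E) e (g \<circ> proj E)"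
    using stalk_coeff[OF s e] g by simp
  then have "near (total E) e (\<lambda>y. stalk_coeff e s (proj E y) = g (proj E y))"
    by (simp add: germ_eq_iff[OF e])
  then show ?thesis by (simp only: near_proj_iff[OF e, of "\<lambda>y. stalk_coeff e s y = g y"])
qed

lemma stalk_coeff_add:
  assumes s: "s \<in> carrier C" "t \<in> carrier C" and e: "e \<in> epoints E"
  shows "near M (proj E e) (\<lambda>y. stalk_coeff e (s \<oplus>\<^bsub>C\<^esub> t) y = stalk_coeff e s y + stalk_coeff e t y)"
proof -
  have "sec_add (total E) s t e = germ (total E) e ((stalk_coeff e s \<circ> proj E) + (stalk_coeff e t \<circ> proj E))"
    by (rule sec_add_apply[OF e]) (rule stalk_coeff[OF s(1) e] stalk_coeff[OF s(2) e])+
  moreover have "(stalk_coeff e s \<circ> proj E) + (stalk_coeff e t \<circ> proj E) = (\<lambda>y. stalk_coeff e s y + stalk_coeff e t y) \<circ> proj E"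
    by (simp add: fun_eq_iff)
  ultimately show ?thesis using s e by (intro stalk_coeff_near C.a_closed) (simp_all add: Cc_module_simps)
qed

lemma stalk_coeff_smult:
  assumes s: "s \<in> carrier C" and r: "r \<in> Cc M" and e: "e \<in> epoints E"
  shows "near M (proj E e) (\<lambda>y. stalk_coeff e (r \<odot>\<^bsub>C\<^esub> s) y = r y * stalk_coeff e s y)"
proof -
  have "sec_mult (total E) (r \<circ> proj E) s e = germ (total E) e ((r \<circ> proj E) * (stalk_coeff e s \<circ> proj E))"
    by (rule sec_mult_apply[OF e]) (rule stalk_coeff[OF s e])
  moreover have "(r \<circ> proj E) * (stalk_coeff e s \<circ> proj E) = (\<lambda>y. r y * stalk_coeff e s y) \<circ> proj E"
    by (simp add: fun_eq_iff)
  ultimately show ?thesis using s r e by (intro stalk_coeff_near C.smult_closed) (simp_all add: Cc_module_simps)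
qed

lemma stalk_coeff_pullback:
  assumes U: "elementary E U" and f: "f \<in> Cc (open_sub M (proj E ` U))" and e: "e \<in> epoints E"
  shows "near M (proj E e) (\<lambda>y. stalk_coeff e (pullback E U f) y = (if e \<in> U then f y else 0))"
proof -
  have "0 \<circ> proj E = (0 :: 'e \<Rightarrow> 'k)" by (simp add: fun_eq_iff)
  then have "pullback E U f e = germ (total E) e ((\<lambda>y. if e \<in> U then f y else 0) \<circ> proj E)"
    by (cases "e \<in> U") (simp_all add: pullback_apply[OF e] o_def zero_fun_def)
  then show ?thesis by (rule stalk_coeff_near[OF pullback_closed[OF U f] e])
qed

lemma stalk_coeff_eq_at:
  assumes st: "eq_at M C (proj E e) s t" "s \<in> carrier C" "t \<in> carrier C" and e: "e \<in> epoints E"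
  shows "near M (proj E e) (\<lambda>y. stalk_coeff e s y = stalk_coeff e t y)"
proof -
  obtain r where r: "r \<in> Cc M" "near M (proj E e) (\<lambda>y. r y = 1)" "r \<odot>\<^bsub>C\<^esub> s = r \<odot>\<^bsub>C\<^esub> t"
    using st(1) by (auto simp: eq_at_def)
  show ?thesis
    using r(2) stalk_coeff_smult[OF st(2) r(1) e] stalk_coeff_smult[OF st(3) r(1) e]
    by eventually_elim (simp add: r(3))
qed

text \<open>Coefficients of a tensor at a pair of points over x are functions modulo equality near x; on a
  comultiplication only the diagonal coefficients survive.\<close>

definition pair_coeff :: "'e \<Rightarrow> 'e \<Rightarrow> (('e \<Rightarrow> ('e \<Rightarrow> 'k) set) \<times> ('e \<Rightarrow> ('e \<Rightarrow> 'k) set) \<Rightarrow>\<^sub>0 int) \<Rightarrow> 'x \<Rightarrow> 'k" where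
  "pair_coeff e e' = frag_sum (regular_module UNIV) (\<lambda>p. stalk_coeff e (fst p) * stalk_coeff e' (snd p))"

lemma pair_coeff_simps:
  "pair_coeff e e' (t + u) = pair_coeff e e' t + pair_coeff e e' u"
  "pair_coeff e e' (- t) = - pair_coeff e e' t"
  "pair_coeff e e' (t - u) = pair_coeff e e' t - pair_coeff e e' u"
  "pair_coeff e e' 0 = 0"
  "pair_coeff e e' (frag_of (s, s')) = stalk_coeff e s * stalk_coeff e' s'"
proof -
  let ?G = "regular_module UNIV :: ('x \<Rightarrow> 'k, 'x \<Rightarrow> 'k) module"
  have "abelian_group ?G"
    by (rule abelian_groupI) (auto simp: regular_module_def algebra_simps intro: exI[of _ "- x" for x])
  then interpret G: abelian_group ?G .
  have G: "carrier ?G = UNIV" "x \<oplus>\<^bsub>?G\<^esub> y = x + y" "\<zero>\<^bsub>?G\<^esub> = 0" for x y by (simp_all add: regular_module_def)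
  show add: "pair_coeff e e' (t + u) = pair_coeff e e' t + pair_coeff e e' u" for t u
    unfolding pair_coeff_def by (subst G.frag_sum_add) (auto simp: G)
  show zero: "pair_coeff e e' 0 = 0"
    unfolding pair_coeff_def by (simp add: G.frag_sum_0 G)
  show minus: "pair_coeff e e' (- t) = - pair_coeff e e' t" for t
    using add[of "- t" t] zero by (simp add: eq_neg_iff_add_eq_0)
  show "pair_coeff e e' (t - u) = pair_coeff e e' t - pair_coeff e e' u"
    using add[of t "- u"] minus[of u] by simp
  show "pair_coeff e e' (frag_of (s, s')) = stalk_coeff e s * stalk_coeff e' s'"
    unfolding pair_coeff_def by (subst G.frag_sum_of) (auto simp: G)
qed

text \<open>Both points lie over x, so the two coefficients are multiplied by the same germ when a
  scalar acts, and their product respects the balancing relation.\<close>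

lemma pair_coeff_null:
  assumes e: "e \<in> epoints E" "e' \<in> epoints E" "proj E e = x" "proj E e' = x" and n: "n \<in> null_frags"
  shows "near M x (\<lambda>y. pair_coeff e e' n y = 0)"
  using n
proof (induction rule: null_frags_induct)
  case (rel n)
  from rel show ?case
  proof (cases rule: tensor_relations_cases)
    case (add_left c c' d)
    show ?thesis
      using stalk_coeff_add[OF add_left(2,3) e(1), unfolded e(3)]
      by eventually_elim (simp add: add_left(1) pair_coeff_simps algebra_simps)
  next
    case (add_right c d d')
    show ?thesis
      using stalk_coeff_add[OF add_right(3,4) e(2), unfolded e(4)]
      by eventually_elim (simp add: add_right(1) pair_coeff_simps algebra_simps)
  next
    case (balanced r c d)
    show ?thesis
      using stalk_coeff_smult[OF balanced(3,2) e(1), unfolded e(3)] stalk_coeff_smult[OF balanced(4,2) e(2), unfolded e(4)]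
      by eventually_elim (simp add: balanced(1) pair_coeff_simps algebra_simps)
  qed
next
  case (add a b)
  then show ?case by eventually_elim (simp add: pair_coeff_simps)
next
  case (uminus a)
  then show ?case by eventually_elim (simp add: pair_coeff_simps)
qed (simp add: pair_coeff_simps)

lemma pair_coeff_comult:
  assumes e: "e \<in> epoints E" "e' \<in> epoints E" "proj E e = x" "proj E e' = x"
    and s: "s \<in> carrier C" and t: "t \<in> frags" "Cc_comult M E s = cls t"
  shows "near M x (\<lambda>y. pair_coeff e e' t y = (if e = e' then stalk_coeff e s y else 0))"
proof -
  have cong: "near M x (\<lambda>y. pair_coeff e e' t y = pair_coeff e e' u y)" if "cls t = cls u" for t u
    using pair_coeff_null[OF e, of "t - u"] that by (simp add: cls_eq_iff pair_coeff_simps)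
  have "s \<in> Cc_sections (total E)" using s by (simp add: Cc_module_simps)
  define P where "P s \<longleftrightarrow> (\<exists>u\<in>frags. Cc_comult M E s = cls u \<and> near M x (\<lambda>y. pair_coeff e e' u y = (if e = e' then stalk_coeff e s y else 0)))" for s
  have "P s" using \<open>s \<in> Cc_sections (total E)\<close>
  proof (induction rule: sections_induct_pullback)
    case zero
    have m0: "Cc_comult M E (\<zero>\<^bsub>C\<^esub>) = cls 0"
      using linear_map_zero[OF comult_properties(2) C.abelian_group_axioms T.abelian_group_axioms] by (simp add: tensor_zero)
    have c0: "near M x (\<lambda>y. stalk_coeff e \<zero>\<^bsub>C\<^esub> y = 0)"
      using stalk_coeff_pullback[OF elementary_empty Cc_open_sub_0 e(1)] e(3) by (simp add: pullback_zero)
    from c0 have "near M x (\<lambda>y. pair_coeff e e' 0 y = (if e = e' then stalk_coeff e \<zero>\<^bsub>C\<^esub> y else 0))"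
      by eventually_elim (auto simp: pair_coeff_simps)
    with m0 have "P \<zero>\<^bsub>C\<^esub>"
      unfolding P_def by (intro bexI[of _ 0]) auto
    then show ?case by (simp add: Cc_module_simps zero_fun_def)
  next
    case (pullback V g)
    obtain h :: "'x \<Rightarrow> 'k" where h: "h \<in> Cc (open_sub M (proj E ` V))" "h * g = g"
      using Cc_local_unit[OF elementary_image[OF pullback(1)] pullback(2)] .
    let ?t = "frag_of (pullback E V g, pullback E V h)"
    \<comment> \<open>Two points of V over the same x coincide, which kills the off-diagonal
      coefficients; on the diagonal g h = g leaves the coefficient of the pullback.\<close>
    have ee: "e \<in> V \<and> e' \<in> V \<longrightarrow> e = e'" using e inj_onD[OF elementary_inj[OF pullback(1)]] by metis
    have gh: "g y * h y = g y" for y using fun_cong[OF h(2), of y] by (simp add: mult.commute)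
    have "near M x (\<lambda>y. pair_coeff e e' ?t y = (if e = e' then stalk_coeff e (pullback E V g) y else 0))"
      using stalk_coeff_pullback[OF pullback e(1), unfolded e(3)] stalk_coeff_pullback[OF pullback(1) h(1) e(2), unfolded e(4)]
      by eventually_elim (use ee gh in \<open>auto simp: pair_coeff_simps\<close>)
    moreover have "Cc_comult M E (pullback E V g) = cls ?t"
      using comult_properties(3)[OF pullback h] by (simp add: pure_tensor_def)
    ultimately show ?case
      using pullback_closed[OF pullback] pullback_closed[OF pullback(1) h(1)] unfolding P_def by (intro bexI[of _ ?t]) auto
  next
    case (add s t)
    then obtain u v where u: "u \<in> frags" "Cc_comult M E s = cls u" "near M x (\<lambda>y. pair_coeff e e' u y = (if e = e' then stalk_coeff e s y else 0))"
      and v: "v \<in> frags" "Cc_comult M E t = cls v" "near M x (\<lambda>y. pair_coeff e e' v y = (if e = e' then stalk_coeff e t y else 0))"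
      unfolding P_def by blast
    have st: "s \<in> carrier C" "t \<in> carrier C" using add by (simp_all add: Cc_module_simps)
    have "Cc_comult M E (s \<oplus>\<^bsub>C\<^esub> t) = cls (u + v)"
      using linear_map_add[OF comult_properties(2) st] u v by (simp add: tensor_add)
    moreover have "near M x (\<lambda>y. pair_coeff e e' (u + v) y = (if e = e' then stalk_coeff e (s \<oplus>\<^bsub>C\<^esub> t) y else 0))"
      using u(3) v(3) stalk_coeff_add[OF st e(1), unfolded e(3)] by eventually_elim (auto simp: pair_coeff_simps)
    ultimately have "P (s \<oplus>\<^bsub>C\<^esub> t)"
      using frags_add[OF u(1) v(1)] unfolding P_def by blast
    then show ?case by (simp add: Cc_module_simps)
  qed
  then obtain u where u: "Cc_comult M E s = cls u" "near M x (\<lambda>y. pair_coeff e e' u y = (if e = e' then stalk_coeff e s y else 0))"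
    unfolding P_def by blast
  have "near M x (\<lambda>y. pair_coeff e e' t y = pair_coeff e e' u y)" using cong t(2) u(1) by simp
  then show ?thesis using u(2) by eventually_elim simp
qed

lemma sum_fun_apply: "(\<Sum>i\<in>A. f i) x = (\<Sum>i\<in>A. f i x)" for f :: "'i \<Rightarrow> 'y \<Rightarrow> 'z::comm_monoid_add"
  by (induction A rule: infinite_finite_induct) simp_all

lemma counit_finsum:
  assumes "finite A" "c \<in> A \<rightarrow> carrier C"
  shows "Cc_counit M E (\<Oplus>\<^bsub>C\<^esub>i\<in>A. c i) = (\<Sum>i\<in>A. Cc_counit M E (c i) :: 'x \<Rightarrow> 'k)"
  using assms
proof (induction A)
  case empty
  have "Cc_counit M E (pullback E {} 0) = (0 :: 'x \<Rightarrow> 'k)"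
    using counit_properties(3)[OF elementary_empty, of 0] Cc_open_sub_0[OF openin_empty] by simp
  then show ?case by (simp add: pullback_zero)
next
  case (insert a A)
  have "Cc_counit M E (c a \<oplus>\<^bsub>C\<^esub> (\<Oplus>\<^bsub>C\<^esub>i\<in>A. c i)) = (Cc_counit M E (c a) + Cc_counit M E (\<Oplus>\<^bsub>C\<^esub>i\<in>A. c i) :: 'x \<Rightarrow> 'k)"
    using linear_map_add[OF counit_properties(2), of "c a" "\<Oplus>\<^bsub>C\<^esub>i\<in>A. c i"] insert
    by (simp add: regular_module_def C.finsum_closed)
  then show ?case using insert by simp
qed

text \<open>The germs of the coefficients of a grouplike element are orthogonal idempotents with sum 1. They are
  continuous, so exactly one of them is 1 and the others vanish.\<close>

lemma adj_unit_surj: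
  assumes z: "z \<in> Coalg.SP"
  shows "\<exists>e\<in>epoints E. adj_unit M E e = z"
proof -
  interpret S: sheaf_module M E C ..
  have "fst z \<in> points M" using z by (auto simp: spectral_points_def)
  then obtain s W where s: "Coalg.local_section s W" "fst z \<in> W" "z = (fst z, stalk_class M CA (fst z) s)"
    using Coalg.spectral_point_rep[OF z openin_topspace] by metis
  define x where "x = fst z"
  have x: "x \<in> points M" "x \<in> W" using s \<open>fst z \<in> points M\<close> by (simp_all add: x_def)
  have sc: "s \<in> carrier C" using Coalg.local_section_closed[OF s(1)] by (simp add: Cc_coalg_simps)
  obtain s' where "s' \<in> carrier CA" "comult CA s = Coalg.pure s s'" "eq_at M CA x s s'"
    using Coalg.local_section_comult[OF s(1)] x(2) by metis
  then have s': "s' \<in> carrier C" "Cc_comult M E s = pure s s'" "eq_at M C x s s'"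
    by (simp_all add: Cc_coalg_simps Cc_coalg_tensor Cc_coalg_eq_at)
  obtain A g where A: "finite A" "A \<subseteq> {e \<in> epoints E. proj E e = x}" "\<And>e. g e \<in> Cc M" "\<And>e. e \<notin> A \<Longrightarrow> g e = 0"
    "\<And>e. e \<in> epoints E \<Longrightarrow> proj E e = x \<Longrightarrow> s e = germ (total E) e (g e \<circ> proj E)"
    "eq_at M C x s (\<Oplus>\<^bsub>C\<^esub>e\<in>A. g e \<odot>\<^bsub>C\<^esub> point_section e)"
    using S.expandsE[OF expands_point_section[OF sc] x(1)] by blast
  have Ae: "e \<in> epoints E" "proj E e = x" if "e \<in> A" for e using A(2) that by auto
  have cl: "(\<lambda>e. h e \<odot>\<^bsub>C\<^esub> point_section e) \<in> A \<rightarrow> carrier C" if "\<And>e. h e \<in> Cc M" for h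
    using that Ae point_section_closed by auto
  have coeff: "near M x (\<lambda>y. stalk_coeff e s y = g e y)" if "e \<in> A" for e
    using stalk_coeff_near[OF sc Ae(1)[OF that] A(5)[OF Ae[OF that]]] Ae(2)[OF that] by simp
  \<comment> \<open>The coefficient of the comultiplication at (e, e') is computed from the diagonal
    rule and from the pure tensor s \<otimes> s'; since s' agrees with s near x, the latter is the
    product of two coefficients of s.\<close>
  have orth: "near M x (\<lambda>y. g e y * g e' y = (if e = e' then g e y else 0))" if "e \<in> A" "e' \<in> A" for e e'
  proof -
    have "near M x (\<lambda>y. pair_coeff e e' (frag_of (s, s')) y = (if e = e' then stalk_coeff e s y else 0))"
      using Ae that sc s' by (intro pair_coeff_comult) (auto simp: pure_tensor_def)
    moreover have "near M x (\<lambda>y. stalk_coeff e' s y = stalk_coeff e' s' y)"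
      using stalk_coeff_eq_at[of e' s s'] s' sc Ae[OF that(2)] by simp
    ultimately show ?thesis
      using coeff[OF that(1)] coeff[OF that(2)]
      by eventually_elim (simp add: pair_coeff_simps)
  qed
  \<comment> \<open>If every coefficient vanished at x, so would the counit of s, which is 1 there
    by normalization.\<close>
  have "\<exists>e\<in>A. g e x \<noteq> 0"
  proof (rule ccontr)
    assume *: "\<not> (\<exists>e\<in>A. g e x \<noteq> 0)"
    have eC: "Cc_counit M E u \<in> (Cc M :: ('x \<Rightarrow> 'k) set)" if "u \<in> carrier C" for u
      using linear_map_closed[OF counit_properties(2) that] by (simp add: regular_module_def)
    have sumC: "(\<Oplus>\<^bsub>C\<^esub>e\<in>A. g e \<odot>\<^bsub>C\<^esub> point_section e) \<in> carrier C" by (rule C.finsum_closed[OF cl[OF A(3)]])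
    have "near M x (\<lambda>y. (Cc_counit M E s :: 'x \<Rightarrow> 'k) y = Cc_counit M E (\<Oplus>\<^bsub>C\<^esub>e\<in>A. g e \<odot>\<^bsub>C\<^esub> point_section e) y)"
      using eq_at_linear_map[OF counit_properties(2) A(6) sc sumC] eq_at_regular_iff[OF x(1) eC[OF sc] eC[OF sumC]] by simp
    then have "(Cc_counit M E s :: 'x \<Rightarrow> 'k) x = Cc_counit M E (\<Oplus>\<^bsub>C\<^esub>e\<in>A. g e \<odot>\<^bsub>C\<^esub> point_section e) x"
      using near_imp_at[OF _ x(1)] by blast
    also have "\<dots> = (\<Sum>e\<in>A. Cc_counit M E (g e \<odot>\<^bsub>C\<^esub> point_section e) :: 'x \<Rightarrow> 'k) x"
      by (simp only: counit_finsum[OF A(1) cl[OF A(3)]])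
    also have "\<dots> = (\<Sum>e\<in>A. (g e * Cc_counit M E (point_section e)) x)"
      using linear_map_smult[OF counit_properties(2) A(3) point_section_closed[OF Ae(1)]]
      by (simp add: sum_fun_apply regular_module_def)
    also have "\<dots> = 0" using * by (intro sum.neutral) simp
    finally have "(Cc_counit M E s :: 'x \<Rightarrow> 'k) x = 0" .
    moreover have "near M x (\<lambda>y. (Cc_counit M E s :: 'x \<Rightarrow> 'k) y = 1)"
      using Coalg.local_section_counit[OF s(1) x(2)] by (simp add: Cc_coalg_simps)
    ultimately show False using near_imp_at[OF _ x(1)] by (metis zero_neq_one)
  qed
  then obtain e0 where e0: "e0 \<in> A" "g e0 x \<noteq> 0" by blast
  have nz: "near M x (\<lambda>y. g e0 y \<noteq> 0)" using smooth_nonzero_near[OF Cc_smooth[OF A(3)] x(1) e0(2)] .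
  \<comment> \<open>The coefficient is idempotent and nonzero near x, so cancelling it in g g = g
    gives 1; orthogonality then annihilates the others.\<close>
  have one: "near M x (\<lambda>y. g e0 y = 1)" using nz orth[OF e0(1) e0(1)] by eventually_elim simp
  have zero: "near M x (\<lambda>y. g e y = 0)" if "e \<in> A" "e \<noteq> e0" for e
    using one orth[OF e0(1) that(1)] by eventually_elim (use that(2) in auto)
  let ?h = "\<lambda>e. if e = e0 then g e0 else 0"
  have hM: "?h e \<in> Cc M" for e by (simp add: A(3) Cc_0)
  have "eq_at M C x (\<Oplus>\<^bsub>C\<^esub>e\<in>A. g e \<odot>\<^bsub>C\<^esub> point_section e) (\<Oplus>\<^bsub>C\<^esub>e\<in>A. ?h e \<odot>\<^bsub>C\<^esub> point_section e)"
  proof (intro Cl.eq_at_finsum x(1) A(1) cl A(3) hM)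
    fix e assume e: "e \<in> A"
    have "near M x (\<lambda>y. g e y = ?h e y)" using zero[OF e] by (cases "e = e0") auto
    then show "eq_at M C x (g e \<odot>\<^bsub>C\<^esub> point_section e) (?h e \<odot>\<^bsub>C\<^esub> point_section e)"
      by (rule Cl.eq_at_smult_near[OF x(1) _ A(3) hM point_section_closed[OF Ae(1)[OF e]]])
  qed
  moreover have "(\<Oplus>\<^bsub>C\<^esub>e\<in>{e0}. ?h e \<odot>\<^bsub>C\<^esub> point_section e) = (\<Oplus>\<^bsub>C\<^esub>e\<in>A. ?h e \<odot>\<^bsub>C\<^esub> point_section e)"
    using A(1) e0(1) hM Ae point_section_closed by (intro Cl.finsum_smult_superset) auto
  moreover have te: "point_section e0 \<in> carrier C" using point_section_closed Ae e0 by blast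
  moreover from this have "(\<Oplus>\<^bsub>C\<^esub>e\<in>{e0}. ?h e \<odot>\<^bsub>C\<^esub> point_section e) = g e0 \<odot>\<^bsub>C\<^esub> point_section e0"
    using A(3) by simp
  ultimately have "eq_at M C x (\<Oplus>\<^bsub>C\<^esub>e\<in>A. g e \<odot>\<^bsub>C\<^esub> point_section e) (g e0 \<odot>\<^bsub>C\<^esub> point_section e0)"
    by simp
  moreover have gc: "g e0 \<odot>\<^bsub>C\<^esub> point_section e0 \<in> carrier C" using te A(3) by (intro C.smult_closed)
  ultimately have "eq_at M C x s (g e0 \<odot>\<^bsub>C\<^esub> point_section e0)"
    by (rule Cl.eq_at_trans[OF A(6) _ sc C.finsum_closed[OF cl[OF A(3)]]])
  then have se: "eq_at M C x s (point_section e0)"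
    using Cl.eq_at_trans[OF _ Cl.eq_at_near_1[OF x(1) one A(3) te] sc _ te] A(3) te by simp
  obtain U f where U: "elementary E U" "e0 \<in> U" "f \<in> Cc (open_sub M (proj E ` U))"
     "near M (proj E e0) (\<lambda>y. f y = 1)" "point_section e0 = pullback E U f"
    using point_section_eq[OF Ae(1)[OF e0(1)]] .
  have "stalk_class M CA x s = stalk_class M CA x (pullback E U f)"
    using se U(5) sc te by (simp add: Coalg.stalk_class_eq_iff[OF x(1)] Cc_coalg_simps Cc_coalg_eq_at)
  then have "adj_unit M E e0 = z"
    using adj_unit_eq[OF U(1-4)] Ae(2)[OF e0(1)] s(3) x_def by simp
  then show ?thesis using Ae(1)[OF e0(1)] by blast
qed

end

section \<open>The transposition bijection\<close>

locale transposition = Es: field_sheaf M E K + Cs: Cc_coalgebra M C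
  for M :: "('x, 'b::real_inner) mfd" and E :: "('e, 'b, 'x) etale" and K :: "'k::real_normed_field itself"
    and C :: "('x \<Rightarrow> 'k, 'c) coalg"

sublocale transposition \<subseteq> P: Cc_coalgebra_pair M "Cc_coalg M E :: ('x \<Rightarrow> 'k, 'e \<Rightarrow> ('e \<Rightarrow> 'k) set) coalg" C ..

sublocale transposition \<subseteq> ES: two_sheaves M E "spectral_sheaf M C"
  using Es.sheaf_axioms Cs.sheaf_S by (simp add: two_sheaves_def)

sublocale transposition \<subseteq> EC: sheaf_module M E C ..

lemma (in field_sheaf) adj_unit_SP: "e \<in> epoints E \<Longrightarrow> adj_unit M E e \<in> Coalg.SP"
  using two_sheaves.sh_hom_points[OF two_sheaves_S adj_unit_hom, of e] by (simp add: Coalg.epoints_S)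

context transposition
begin

lemma hom_linear_module: "\<alpha> \<in> coalg_hom (Cc M) Es.CA C \<Longrightarrow> linear_map (Cc M) Es.C C \<alpha>"
  using P.hom_linear[of \<alpha>] by (simp add: Cc_coalg_linear_map)

lemma transpose_apply:
  assumes \<alpha>: "\<alpha> \<in> coalg_hom (Cc M) Es.CA C" and U: "elementary E U" "e \<in> U"
    and f: "f \<in> Cc (open_sub M (proj E ` U))" "near M (proj E e) (\<lambda>y. f y = 1)"
  shows "transpose_hom M E C \<alpha> e = (proj E e, stalk_class M C (proj E e) (\<alpha> (pullback E U f)))"
proof -
  have e: "e \<in> epoints E" using openin_subset[OF elementary_openin[OF U(1)]] U(2) by blast
  note ae = Es.adj_unit_eq[OF U f]
  have "(proj E e, stalk_class M Es.CA (proj E e) (pullback E U f)) \<in> Es.Coalg.SP"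
    using Es.adj_unit_SP[OF e] unfolding ae .
  then show ?thesis
    using P.spectral_map_apply[OF \<alpha> Es.pullback_closed_coalg[OF U(1) f(1)]] e
    by (simp add: transpose_hom_def compose_eq ae)
qed

lemma transpose_sh_hom:
  assumes \<alpha>: "\<alpha> \<in> coalg_hom (Cc M) Es.CA C"
  shows "transpose_hom M E C \<alpha> \<in> sh_hom E Cs.S"
proof -
  have "two_sheaves M Es.Coalg.S Cs.S"
    using Es.Coalg.sheaf_S Cs.sheaf_S by (simp add: two_sheaves_def)
  then show ?thesis
    unfolding transpose_hom_def
    by (rule sh_hom_compose[OF Es.two_sheaves_S _ Es.adj_unit_hom P.spectral_map_hom[OF \<alpha>]])
qed

text \<open>Near the base point f equals f g, so by linearity the germ of \<alpha> on any pullback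
  is f times its germ on one normalized pullback. This germ is what the transpose records at
  e.\<close>

lemma hom_pullback_eq_at:
  assumes \<alpha>: "\<alpha> \<in> coalg_hom (Cc M) Es.CA C" and U: "elementary E U" "e \<in> U"
    and f: "f \<in> Cc (open_sub M (proj E ` U))"
    and g: "g \<in> Cc (open_sub M (proj E ` U))" "near M (proj E e) (\<lambda>y. g y = 1)"
  shows "eq_at M C (proj E e) (\<alpha> (pullback E U f)) (f \<odot>\<^bsub>C\<^esub> \<alpha> (pullback E U g))"
proof -
  have fM: "f \<in> Cc M" using Es.Cc_image_subset[OF U(1) f] .
  have fg: "f * g \<in> Cc (open_sub M (proj E ` U))"
    using Es.Cc_open_sub_mult[OF Es.elementary_image[OF U(1)] fM g(1)] by (simp add: mult.commute)
  have "near M (proj E e) (\<lambda>y. f y = (f * g) y)" using g(2) by eventually_elim simp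
  then have "eq_at M Es.CA (proj E e) (pullback E U f) (pullback E U (f * g))"
    using Es.pullback_eq_at[OF U(1,1,2,2) f fg] by (simp add: Cc_coalg_eq_at)
  then have "eq_at M C (proj E e) (\<alpha> (pullback E U f)) (\<alpha> (pullback E U (f * g)))"
    by (rule P.hom_eq_at[OF \<alpha>]) (simp_all add: Es.pullback_closed_coalg[OF U(1)] f fg)
  moreover have "\<alpha> (pullback E U (f * g)) = f \<odot>\<^bsub>C\<^esub> \<alpha> (pullback E U g)"
    using linear_map_smult[OF hom_linear_module[OF \<alpha>] fM Es.pullback_closed[OF U(1) g(1)]] by (simp add: Es.smult_pullback)
  ultimately show ?thesis by simp
qed

lemma hom_pullback_eq_at_0:
  assumes \<alpha>: "\<alpha> \<in> coalg_hom (Cc M) Es.CA C" and U: "elementary E U"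
    and f: "f \<in> Cc (open_sub M (proj E ` U))" and x: "x \<in> points M" "x \<notin> proj E ` U"
  shows "eq_at M C x (\<alpha> (pullback E U f)) \<zero>\<^bsub>C\<^esub>"
proof -
  have "eq_at M Es.CA x (pullback E U f) \<zero>\<^bsub>Es.CA\<^esub>"
    using Es.pullback_eq_at_0[OF U f x] by (simp add: Cc_coalg_eq_at Cc_coalg_simps)
  then have "eq_at M C x (\<alpha> (pullback E U f)) (\<alpha> \<zero>\<^bsub>Es.CA\<^esub>)"
    by (rule P.hom_eq_at[OF \<alpha>]) (simp_all add: Es.pullback_closed_coalg[OF U f])
  then show ?thesis
    using linear_map_zero[OF P.hom_linear[OF \<alpha>] Es.Coalg.C.abelian_group_axioms Cs.C.abelian_group_axioms] by simp
qed

text \<open>Equal transposes give equal germs on normalized pullbacks, hence on all pullbacks at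
  points under U; off U both germs are 0. Elements of C with equal germs are equal.\<close>

lemma transpose_inj: "inj_on (transpose_hom M E C) (coalg_hom (Cc M) Es.CA C)"
proof (rule inj_onI)
  fix \<alpha> \<beta> assume \<alpha>: "\<alpha> \<in> coalg_hom (Cc M) Es.CA C" and \<beta>: "\<beta> \<in> coalg_hom (Cc M) Es.CA C"
    and eq: "transpose_hom M E C \<alpha> = transpose_hom M E C \<beta>"
  have pb: "\<alpha> (pullback E U f) = \<beta> (pullback E U f)" if U: "elementary E U" and f: "f \<in> Cc (open_sub M (proj E ` U))" for U f
  proof (rule Cs.Cl.eq_at_imp_eq)
    have cl: "\<gamma> (pullback E U g) \<in> carrier C" if "\<gamma> \<in> coalg_hom (Cc M) Es.CA C" "g \<in> Cc (open_sub M (proj E ` U))" for \<gamma> g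
      using P.hom_closed[OF that(1) Es.pullback_closed_coalg[OF U that(2)]] .
    show "\<alpha> (pullback E U f) \<in> carrier C" "\<beta> (pullback E U f) \<in> carrier C" using cl \<alpha> \<beta> f by auto
    note clf = this
    fix x assume x: "x \<in> points M"
    show "eq_at M C x (\<alpha> (pullback E U f)) (\<beta> (pullback E U f))"
    proof (cases "x \<in> proj E ` U")
      case True
      then obtain e where e: "e \<in> U" "x = proj E e" by blast
      obtain g :: "'x \<Rightarrow> 'k" where g: "g \<in> Cc (open_sub M (proj E ` U))" "near M (proj E e) (\<lambda>y. g y = 1)"
        using Es.bump_on_elementary[OF U e(1)] .
      have fM: "f \<in> Cc M" using Es.Cc_image_subset[OF U f] .
      have "stalk_class M C x (\<alpha> (pullback E U g)) = stalk_class M C x (\<beta> (pullback E U g))"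
        using transpose_apply[OF \<alpha> U e(1) g] transpose_apply[OF \<beta> U e(1) g] eq e(2) by simp
      then have "eq_at M C x (\<alpha> (pullback E U g)) (\<beta> (pullback E U g))"
        using Cs.stalk_class_eq_iff[OF x cl[OF \<alpha> g(1)] cl[OF \<beta> g(1)]] by simp
      then have mid: "eq_at M C x (f \<odot>\<^bsub>C\<^esub> \<alpha> (pullback E U g)) (f \<odot>\<^bsub>C\<^esub> \<beta> (pullback E U g))"
        using Cs.Cl.eq_at_smult[OF _ fM cl[OF \<alpha> g(1)] cl[OF \<beta> g(1)]] by blast
      have sm: "f \<odot>\<^bsub>C\<^esub> \<alpha> (pullback E U g) \<in> carrier C" "f \<odot>\<^bsub>C\<^esub> \<beta> (pullback E U g) \<in> carrier C"
        using Cs.C.smult_closed[OF fM] cl[OF _ g(1)] \<alpha> \<beta> by auto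
      have l: "eq_at M C x (\<alpha> (pullback E U f)) (f \<odot>\<^bsub>C\<^esub> \<alpha> (pullback E U g))"
        and r: "eq_at M C x (\<beta> (pullback E U f)) (f \<odot>\<^bsub>C\<^esub> \<beta> (pullback E U g))"
        using hom_pullback_eq_at[OF \<alpha> U e(1) f g] hom_pullback_eq_at[OF \<beta> U e(1) f g] e(2) by simp_all
      show ?thesis
        using Cs.Cl.eq_at_trans[OF Cs.Cl.eq_at_trans[OF l mid clf(1) sm] eq_at_sym[OF r] clf(1) sm(2) clf(2)] .
    next
      case False
      show ?thesis
        using Cs.Cl.eq_at_trans[OF hom_pullback_eq_at_0[OF \<alpha> U f x False] eq_at_sym[OF hom_pullback_eq_at_0[OF \<beta> U f x False]] clf(1) _ clf(2)]
        by simp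
    qed
  qed
  show "\<alpha> = \<beta>"
  proof (rule extensionalityI[OF P.hom_extensional[OF \<alpha>] P.hom_extensional[OF \<beta>]])
    fix s assume "s \<in> carrier Es.CA"
    then have "s \<in> Cc_sections (total E)" by (simp add: Cc_coalg_simps Es.Cc_module_simps)
    with pb show "\<alpha> s = \<beta> s"
      by (rule EC.linear_map_eqI[OF hom_linear_module[OF \<alpha>] hom_linear_module[OF \<beta>]])
  qed
qed

text \<open>A morphism to the spectral sheaf is a locally constant family in the stalks of C, to which the linear extension
  applies; over a patch of a local section c it maps the pullback of f to f c.\<close>

lemma transpose_surj:
  assumes \<psi>: "\<psi> \<in> sh_hom E Cs.S"
  shows "\<exists>\<alpha>\<in>coalg_hom (Cc M) Es.CA C. transpose_hom M E C \<alpha> = \<psi>"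
proof -
  \<comment> \<open>Sets V on which \<psi> is given by one weakly grouplike element c, normalized on
    a set W containing the projection of V.\<close>
  define good where "good V c W \<longleftrightarrow> Cs.local_section c W \<and> \<psi> ` V \<subseteq> Cs.patch c W" for V c W
  have ep: "e \<in> epoints E" if "elementary E U" "e \<in> U" for e U
    using that openin_subset[OF elementary_openin] by blast
  have rep: "\<exists>V c W. elementary E V \<and> e \<in> V \<and> good V c W" if e: "e \<in> epoints E" for e
  proof -
    have z: "\<psi> e \<in> Cs.SP" using ES.sh_hom_points[OF \<psi> e] by (simp add: Cs.epoints_S)
    then have "fst (\<psi> e) \<in> points M" by (auto simp: spectral_points_def)
    then obtain c W where c: "Cs.local_section c W" "\<psi> e \<in> Cs.patch c W"
      using Cs.spectral_point_rep[OF z openin_topspace] by metis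
    obtain U where U: "elementary E U" "e \<in> U" using Es.elementary_point[OF e] .
    have "elementary E (U \<inter> (epoints E \<inter> \<psi> -` Cs.patch c W))"
      by (rule elementary_Int[OF U(1) openin_map_vimage[OF ES.sh_hom_continuous[OF \<psi>] Cs.openin_patch[OF c(1)]]])
    then show ?thesis using U(2) e c unfolding good_def
      by (intro exI[of _ "U \<inter> (epoints E \<inter> \<psi> -` Cs.patch c W)"] exI[of _ c] exI[of _ W]) auto
  qed
  have goodD: "\<psi> e = (proj E e, stalk_class M C (proj E e) c)" "proj E e \<in> W" if "good V c W" "elementary E V" "e \<in> V" for V c W e
  proof -
    have "fst (\<psi> e) = proj E e" using ES.sh_hom_proj[OF \<psi> ep[OF that(2,3)]] by (simp add: Cs.proj_S)
    moreover have "\<psi> e \<in> Cs.patch c W" using that by (auto simp: good_def)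
    ultimately show "\<psi> e = (proj E e, stalk_class M C (proj E e) c)" "proj E e \<in> W"
      by (simp_all add: Cs.mem_patch_iff prod_eq_iff)
  qed
  have gc: "c \<in> carrier C" if "good V c W" for V c W using that Cs.local_section_closed unfolding good_def by blast
  \<comment> \<open>The values of \<psi> are classes, whereas the linear extension takes
    representatives; over a good set c represents the family, so it is locally constant.\<close>
  define \<sigma> where "\<sigma> e = (SOME c. c \<in> carrier C \<and> \<psi> e = (proj E e, stalk_class M C (proj E e) c))" for e
  have \<sigma>: "\<sigma> e \<in> carrier C \<and> \<psi> e = (proj E e, stalk_class M C (proj E e) (\<sigma> e))" if e: "e \<in> epoints E" for e
  proof -
    obtain V c W where "elementary E V" "e \<in> V" "good V c W" using rep[OF e] by blast
    then have "\<exists>c. c \<in> carrier C \<and> \<psi> e = (proj E e, stalk_class M C (proj E e) c)" using goodD(1) gc by metis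
    then show ?thesis unfolding \<sigma>_def by (rule someI_ex)
  qed
  have eq: "eq_at M C (proj E e) c (\<sigma> e)" if "good V c W" "elementary E V" "e \<in> V" for V c W e
  proof -
    have e: "e \<in> epoints E" using ep that by blast
    have "stalk_class M C (proj E e) c = stalk_class M C (proj E e) (\<sigma> e)"
      using goodD(1)[OF that] \<sigma>[OF e] by simp
    then show ?thesis using Cs.stalk_class_eq_iff[OF Es.proj_in_points[OF e] gc[OF that(1)]] \<sigma>[OF e] by simp
  qed
  have lc: "EC.locally_constant \<sigma>"
    unfolding EC.locally_constant_def using \<sigma> rep gc eq by metis
  obtain H where H0: "H \<in> extensional (carrier Es.C) \<and> linear_map (Cc M) Es.C C H \<and>
      (\<forall>s\<in>Cc_sections (total E). EC.expands \<sigma> s (H s)) \<and>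
      (\<forall>s\<in>Cc_sections (total E). \<forall>t\<in>carrier C. EC.expands \<sigma> s t \<longrightarrow> H s = t)"
    using EC.linear_extension[OF lc] by (rule exE)
  have H: "H \<in> extensional (carrier Es.C)" "linear_map (Cc M) Es.C C H"
    "\<And>s t. s \<in> Cc_sections (total E) \<Longrightarrow> t \<in> carrier C \<Longrightarrow> EC.expands \<sigma> s t \<Longrightarrow> H s = t"
    using H0 by blast+
  have Hp: "H (pullback E V f) = f \<odot>\<^bsub>C\<^esub> c"
    if V: "elementary E V" and f: "f \<in> Cc (open_sub M (proj E ` V))" and g: "good V c W" for V f c W
  proof (rule H(3)[OF Es.pullback_in_sections[OF V f]])
    have fM: "f \<in> Cc M" using Es.Cc_image_subset[OF V f] .
    show cl: "f \<odot>\<^bsub>C\<^esub> c \<in> carrier C" using Cs.C.smult_closed[OF fM gc[OF g]] .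
    show "EC.expands \<sigma> (pullback E V f) (f \<odot>\<^bsub>C\<^esub> c)"
    proof (rule EC.expands_pullback[OF V f cl])
      show "\<sigma> e \<in> carrier C" if "e \<in> V" for e using \<sigma> ep[OF V that] by blast
      then show "eq_at M C (proj E e) (f \<odot>\<^bsub>C\<^esub> c) (f \<odot>\<^bsub>C\<^esub> \<sigma> e)" if "e \<in> V" for e
        using Cs.Cl.eq_at_smult[OF eq[OF g V that] fM gc[OF g]] that by blast
      show "eq_at M C x (f \<odot>\<^bsub>C\<^esub> c) \<zero>\<^bsub>C\<^esub>" if "x \<in> points M" "x \<notin> proj E ` V" for x
        using Cs.Cl.eq_at_near_0[OF that(1) Es.Cc_off_near_0[OF Es.elementary_image[OF V] f that] fM gc[OF g]] .
    qed
  qed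
  \<comment> \<open>The support of f lies under V and hence in W, where the counit of c is
    1.\<close>
  have fc: "f * counit C c = f" if V: "elementary E V" and f: "f \<in> Cc (open_sub M (proj E ` V))" and g: "good V c W" for V f c W
  proof
    fix y
    have "counit C c y = 1" if "f y \<noteq> 0"
    proof -
      have "y \<in> proj E ` V" using f that by (auto simp: Es.Cc_open_sub_iff[OF Es.elementary_image[OF V]])
      then have "y \<in> W" using goodD(2)[OF g V] by blast
      then show ?thesis
        using near_imp_at[OF Cs.local_section_counit Cs.local_section_points] g unfolding good_def by blast
    qed
    then show "(f * counit C c) y = f y" by auto
  qed
  interpret R: Cc_lu_module M "regular_module (Cc M) :: ('x \<Rightarrow> 'k, 'x \<Rightarrow> 'k) module" by (rule Es.regular_Cc_lu_module)
  interpret ER: sheaf_module M E "regular_module (Cc M) :: ('x \<Rightarrow> 'k, 'x \<Rightarrow> 'k) module" ..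
  interpret ET: sheaf_module M E "tensor (Cc M) C C" ..
  let ?Q = "\<lambda>V. \<exists>c W. good V c W"
  have Q1: "\<exists>V. elementary E V \<and> e \<in> V \<and> ?Q V" if "e \<in> epoints E" for e
    using rep[OF that] by blast
  have Q2: "?Q U" if "?Q V" "U \<subseteq> V" for U V
    using that image_mono[OF that(2), of \<psi>] unfolding good_def by (meson order_trans)
  have counit: "counit C (H s) = Cc_counit M E s" if "s \<in> Cc_sections (total E)" for s
  proof (rule ER.linear_map_eqI_small[OF linear_map_comp[OF H(2) Cs.counit_linear] Es.counit_properties(2) Q1 Q2 _ that])
    fix U and f :: "'x \<Rightarrow> 'k" assume U: "elementary E U" "?Q U" and f: "f \<in> Cc (open_sub M (proj E ` U))"
    then obtain c W where g: "good U c W" by blast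
    show "counit C (H (pullback E U f)) = Cc_counit M E (pullback E U f)"
      using Es.counit_properties(3)[OF U(1) f] fc[OF U(1) f g] Cs.counit_smult[OF Es.Cc_image_subset[OF U(1) f] gc[OF g]]
      by (simp add: Hp[OF U(1) f g])
  qed auto
  have comult: "tensor_map (Cc M) C C H H (Cc_comult M E s) = comult C (H s)" if "s \<in> Cc_sections (total E)" for s
  proof (rule ET.linear_map_eqI_small[OF linear_map_comp[OF Es.comult_properties(2) Es.tensor_map_linear(1)[OF Cs.lu_module_pair_axioms H(2) H(2)]]
      linear_map_comp[OF H(2) Cs.comult_linear] Q1 Q2 _ that])
    fix U and f :: "'x \<Rightarrow> 'k" assume U: "elementary E U" "?Q U" and f: "f \<in> Cc (open_sub M (proj E ` U))"
    then obtain c W where gd: "good U c W" by blast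
    obtain g :: "'x \<Rightarrow> 'k" where g: "g \<in> Cc (open_sub M (proj E ` U))" "g * f = f"
      using Es.Cc_local_unit[OF Es.elementary_image[OF U(1)] f] .
    have fM: "f \<in> Cc M" and gM: "g \<in> Cc M" using Es.Cc_image_subset[OF U(1)] f g(1) by auto
    have cC: "c \<in> carrier C" using gc[OF gd] .
    have fcC: "f \<odot>\<^bsub>C\<^esub> c \<in> carrier C" using Cs.C.smult_closed[OF fM cC] .
    obtain c' where c': "c' \<in> carrier C" "comult C c = Cs.pure c c'"
      using gd by (auto simp: good_def Cs.local_section_def weakly_grouplike_def)
    have "f \<odot>\<^bsub>C\<^esub> c = f \<odot>\<^bsub>C\<^esub> (counit C c \<odot>\<^bsub>C\<^esub> c')" using Cs.weakly_grouplike_counit(2)[OF cC c'] by simp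
    also have "\<dots> = f \<odot>\<^bsub>C\<^esub> c'"
      using Cs.C.smult_assoc[OF fM Cs.counit_closed[OF cC] c'(1)] fc[OF U(1) f gd] by simp
    finally have fcc: "f \<odot>\<^bsub>C\<^esub> c = f \<odot>\<^bsub>C\<^esub> c'" .
    \<comment> \<open>The elements c and c' need not be equal, but f c = f c'. With g f = f the
      tensor is moved from f c \<otimes> g c to f c \<otimes> c, then to c \<otimes> f c', and
      finally to f times c \<otimes> c'.\<close>
    have "tensor_map (Cc M) C C H H (Cc_comult M E (pullback E U f)) = Cs.pure (f \<odot>\<^bsub>C\<^esub> c) (g \<odot>\<^bsub>C\<^esub> c)"
      using Es.comult_properties(3)[OF U(1) f g] Hp[OF U(1) f gd] Hp[OF U(1) g(1) gd]
      by (simp add: Es.tensor_map_pure[OF Cs.lu_module_pair_axioms H(2) H(2)])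
    also have "\<dots> = Cs.pure (g \<odot>\<^bsub>C\<^esub> (f \<odot>\<^bsub>C\<^esub> c)) c"
      using Cs.pure_balanced[OF gM fcC cC] by simp
    also have "g \<odot>\<^bsub>C\<^esub> (f \<odot>\<^bsub>C\<^esub> c) = f \<odot>\<^bsub>C\<^esub> c"
      using Cs.C.smult_assoc[OF gM fM cC] g(2) by simp
    also have "Cs.pure (f \<odot>\<^bsub>C\<^esub> c) c = Cs.pure c (f \<odot>\<^bsub>C\<^esub> c')"
      using Cs.pure_balanced[OF fM cC cC] fcc by simp
    also have "\<dots> = Cs.pure (f \<odot>\<^bsub>C\<^esub> c) c'"
      using Cs.pure_balanced[OF fM cC c'(1)] by simp
    also have "\<dots> = comult C (f \<odot>\<^bsub>C\<^esub> c)"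
      using linear_map_smult[OF Cs.comult_linear fM cC] c' Cs.tensor_smult_pure[OF fM] by simp
    finally show "tensor_map (Cc M) C C H H (Cc_comult M E (pullback E U f)) = comult C (H (pullback E U f))"
      using Hp[OF U(1) f gd] by simp
  qed auto
  have hom: "H \<in> coalg_hom (Cc M) Es.CA C"
    using H(1,2) counit comult by (simp add: coalg_hom_def Cc_coalg_transfer Es.Cc_module_simps)
  moreover have "transpose_hom M E C H = \<psi>"
  proof (rule extensionalityI[of _ "epoints E"])
    show "transpose_hom M E C H \<in> extensional (epoints E)" by (simp add: transpose_hom_def)
    show "\<psi> \<in> extensional (epoints E)" using \<psi> by (simp add: sh_hom_def)
    fix e assume e: "e \<in> epoints E"
    then obtain V c W where V: "elementary E V" "e \<in> V" "good V c W" using rep by blast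
    obtain f :: "'x \<Rightarrow> 'k" where f: "f \<in> Cc (open_sub M (proj E ` V))" "near M (proj E e) (\<lambda>y. f y = 1)"
      using Es.bump_on_elementary[OF V(1,2)] .
    have x: "proj E e \<in> points M" using Es.proj_in_points[OF e] .
    have fM: "f \<in> Cc M" using Es.Cc_image_subset[OF V(1) f(1)] .
    have "stalk_class M C (proj E e) (f \<odot>\<^bsub>C\<^esub> c) = stalk_class M C (proj E e) c"
      using Cs.Cl.eq_at_near_1[OF x f(2) fM gc[OF V(3)]]
        Cs.stalk_class_eq_iff[OF x Cs.C.smult_closed[OF fM gc[OF V(3)]] gc[OF V(3)]] by blast
    then show "transpose_hom M E C H e = \<psi> e"
      using transpose_apply[OF hom V(1,2) f] Hp[OF V(1) f(1) V(3)] goodD(1)[OF V(3,1,2)] by simp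
  qed
  ultimately show ?thesis by blast
qed

lemma transpose_bij:
  "bij_betw (transpose_hom M E C) (coalg_hom (Cc M) Es.CA C) (sh_hom E Cs.S)"
  unfolding bij_betw_def using transpose_inj transpose_sh_hom transpose_surj by blast

end

section \<open>Naturality and full faithfulness\<close>

context field_two_sheaves
begin

abbreviation Cmap :: "('e \<Rightarrow> 'f) \<Rightarrow> ('e \<Rightarrow> ('e \<Rightarrow> 'k) set) \<Rightarrow> 'f \<Rightarrow> ('f \<Rightarrow> 'k) set" where "Cmap \<equiv> Cc_map M E F"

lemma Cc_map_extensional: "\<phi> \<in> sh_hom E F \<Longrightarrow> Cmap \<phi> \<in> extensional (carrier Es.CA)"
  using map_properties(1) by (simp add: Cc_coalg_simps)

lemma image_Cc: "\<phi> \<in> sh_hom E F \<Longrightarrow> elementary E U \<Longrightarrow> f \<in> Cc (open_sub M (proj E ` U)) \<Longrightarrow>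
    f \<in> Cc (open_sub M (proj F ` \<phi> ` U))"
  using sh_hom_elementary(2) by simp

lemma Fs_coalgebra_pair: "Cc_coalgebra_pair M Es.CA Fs.CA"
  by (intro Cc_coalgebra_pair.intro Es.Coalg.Cc_coalgebra_axioms Fs.Coalg.Cc_coalgebra_axioms)

text \<open>At e both sides are read off from one bump over an elementary U: its pullback over the
  image of U is admissible for the transpose at \<phi> e.\<close>

lemma transpose_natural:
  assumes "Cc_coalgebra M C" and \<phi>: "\<phi> \<in> sh_hom E F" and \<alpha>: "\<alpha> \<in> coalg_hom (Cc M) Fs.CA C"
  shows "transpose_hom M E C (compose (carrier Es.CA) \<alpha> (Cmap \<phi>)) = compose (epoints E) (transpose_hom M F C \<alpha>) \<phi>"
proof -
  interpret C: Cc_coalgebra M C by fact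
  interpret ET: transposition M E K C ..
  interpret FT: transposition M F K C ..
  have hom: "compose (carrier Es.CA) \<alpha> (Cmap \<phi>) \<in> coalg_hom (Cc M) Es.CA C"
    by (rule coalg_hom_compose[OF Fs_coalgebra_pair FT.P.Cc_coalgebra_pair_axioms Cc_map_hom[OF \<phi>] \<alpha>])
  show ?thesis
  proof (rule extensionalityI[of _ "epoints E"])
    fix e assume e: "e \<in> epoints E"
    obtain U where U: "elementary E U" "e \<in> U" using elementary_point[OF e] .
    obtain f :: "'x \<Rightarrow> 'k" where f: "f \<in> Cc (open_sub M (proj E ` U))" "near M (proj E e) (\<lambda>y. f y = 1)"
      using Es.bump_on_elementary[OF U] .
    have "compose (carrier Es.CA) \<alpha> (Cmap \<phi>) (pullback E U f) = \<alpha> (pullback F (\<phi> ` U) f)"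
      using Es.pullback_closed_coalg[OF U(1) f(1)] map_properties(3)[OF \<phi> U(1) f(1)] by (simp add: compose_eq)
    moreover have "transpose_hom M F C \<alpha> (\<phi> e) = (proj F (\<phi> e), stalk_class M C (proj F (\<phi> e)) (\<alpha> (pullback F (\<phi> ` U) f)))"
      using U f image_Cc[OF \<phi> U(1) f(1)] sh_hom_proj[OF \<phi> e] by (intro FT.transpose_apply \<alpha> sh_hom_elementary(1)[OF \<phi>]) auto
    ultimately show "transpose_hom M E C (compose (carrier Es.CA) \<alpha> (Cmap \<phi>)) e = compose (epoints E) (transpose_hom M F C \<alpha>) \<phi> e"
      using e sh_hom_proj[OF \<phi> e] by (simp add: ET.transpose_apply[OF hom U f] compose_eq)
  qed (simp_all add: transpose_hom_def)
qed

text \<open>Naturality of the unit. As transposition is bijective, full faithfulness reduces to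
  lifting morphisms uniquely through the unit of F.\<close>

lemma transpose_Cc_map:
  assumes \<phi>: "\<phi> \<in> sh_hom E F"
  shows "transpose_hom M E Fs.CA (Cmap \<phi>) = compose (epoints E) (adj_unit M F) \<phi>"
proof -
  interpret ET: transposition M E K Fs.CA ..
  show ?thesis
  proof (rule extensionalityI[of _ "epoints E"])
    fix e assume e: "e \<in> epoints E"
    obtain U where U: "elementary E U" "e \<in> U" using elementary_point[OF e] .
    obtain f :: "'x \<Rightarrow> 'k" where f: "f \<in> Cc (open_sub M (proj E ` U))" "near M (proj E e) (\<lambda>y. f y = 1)"
      using Es.bump_on_elementary[OF U] .
    have "adj_unit M F (\<phi> e) = (proj F (\<phi> e), stalk_class M Fs.CA (proj F (\<phi> e)) (pullback F (\<phi> ` U) f))"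
      using U f image_Cc[OF \<phi> U(1) f(1)] sh_hom_proj[OF \<phi> e] by (intro Fs.adj_unit_eq sh_hom_elementary(1)[OF \<phi>]) auto
    then show "transpose_hom M E Fs.CA (Cmap \<phi>) e = compose (epoints E) (adj_unit M F) \<phi> e"
      using e sh_hom_proj[OF \<phi> e] map_properties(3)[OF \<phi> U(1) f(1)]
      by (simp add: ET.transpose_apply[OF Cc_map_hom[OF \<phi>] U f] compose_eq)
  qed (simp_all add: transpose_hom_def)
qed

lemma Cc_map_inj: "inj_on Cmap (sh_hom E F)"
proof (rule inj_onI)
  fix \<phi> \<psi> assume \<phi>: "\<phi> \<in> sh_hom E F" and \<psi>: "\<psi> \<in> sh_hom E F" and "Cmap \<phi> = Cmap \<psi>"
  then have eq: "compose (epoints E) (adj_unit M F :: 'f \<Rightarrow> 'x \<times> ('f \<Rightarrow> ('f \<Rightarrow> 'k) set) set) \<phi> = compose (epoints E) (adj_unit M F) \<psi>"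
    using transpose_Cc_map by metis
  show "\<phi> = \<psi>"
  proof (rule extensionalityI[of _ "epoints E"])
    fix e assume e: "e \<in> epoints E"
    have "(adj_unit M F (\<phi> e) :: 'x \<times> ('f \<Rightarrow> ('f \<Rightarrow> 'k) set) set) = adj_unit M F (\<psi> e)"
      using fun_cong[OF eq, of e] e by (simp add: compose_eq)
    then show "\<phi> e = \<psi> e" using inj_onD[OF Fs.adj_unit_inj] sh_hom_points[OF \<phi> e] sh_hom_points[OF \<psi> e] by blast
  qed (use \<phi> \<psi> in \<open>simp_all add: sh_hom_def\<close>)
qed

text \<open>The transpose of \<alpha> is composed with the inverse of the unit of F. The inverse map
  causes no continuity problem, because the unit sends elementary sets to elementary, in particular
  open, sets.\<close>

lemma Cc_map_surj:
  assumes \<alpha>: "\<alpha> \<in> coalg_hom (Cc M) Es.CA Fs.CA"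
  shows "\<exists>\<phi>\<in>sh_hom E F. Cmap \<phi> = \<alpha>"
proof -
  interpret ET: transposition M E K Fs.CA ..
  interpret FS: two_sheaves M F Fs.Coalg.S by (rule Fs.two_sheaves_S)
  let ?u = "adj_unit M F :: 'f \<Rightarrow> 'x \<times> ('f \<Rightarrow> ('f \<Rightarrow> 'k) set) set"
  define \<psi> where "\<psi> = transpose_hom M E Fs.CA \<alpha>"
  have \<psi>: "\<psi> \<in> sh_hom E Fs.Coalg.S" unfolding \<psi>_def by (rule ET.transpose_sh_hom[OF \<alpha>])
  have "\<exists>\<phi>\<in>extensional (epoints E). \<forall>e\<in>epoints E. \<phi> e \<in> epoints F \<and> ?u (\<phi> e) = \<psi> e"
  proof (intro bexI[of _ "\<lambda>e\<in>epoints E. SOME y. y \<in> epoints F \<and> ?u y = \<psi> e"] ballI)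
    fix e assume e: "e \<in> epoints E"
    then have "\<psi> e \<in> Fs.Coalg.SP" using ET.ES.sh_hom_points[OF \<psi> e] by (simp add: Fs.Coalg.epoints_S)
    then have "\<exists>y. y \<in> epoints F \<and> ?u y = \<psi> e" using Fs.adj_unit_surj by blast
    from someI_ex[OF this] e show "(\<lambda>e\<in>epoints E. SOME y. y \<in> epoints F \<and> ?u y = \<psi> e) e \<in> epoints F \<and>
        ?u ((\<lambda>e\<in>epoints E. SOME y. y \<in> epoints F \<and> ?u y = \<psi> e) e) = \<psi> e" by simp
  qed simp
  then obtain \<phi> where \<phi>0: "\<phi> \<in> extensional (epoints E)"
    and \<phi>: "\<And>e. e \<in> epoints E \<Longrightarrow> \<phi> e \<in> epoints F" "\<And>e. e \<in> epoints E \<Longrightarrow> ?u (\<phi> e) = \<psi> e" by blast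
  have hom: "\<phi> \<in> sh_hom E F"
  proof (rule sh_homI[OF \<phi>0])
    fix e assume e: "e \<in> epoints E"
    show "proj F (\<phi> e) = proj E e"
      using FS.sh_hom_proj[OF Fs.adj_unit_hom \<phi>(1)[OF e]] ET.ES.sh_hom_proj[OF \<psi> e] \<phi>(2)[OF e] by simp
    obtain U where U: "elementary F U" "\<phi> e \<in> U" using F.elementary_point[OF \<phi>(1)[OF e]] .
    \<comment> \<open>Points whose transpose lies in the image of U under the unit; injectivity of
      the unit puts their \<phi>-values into U.\<close>
    let ?V = "epoints E \<inter> \<psi> -` (?u ` U)"
    have V: "openin (mtop (total E)) ?V"
      using openin_map_vimage[OF ET.ES.sh_hom_continuous[OF \<psi>] elementary_openin[OF FS.sh_hom_elementary(1)[OF Fs.adj_unit_hom U(1)]]] .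
    have UF: "U \<subseteq> epoints F" using openin_subset[OF elementary_openin[OF U(1)]] .
    have "\<phi> e' \<in> U" if e': "e' \<in> ?V" for e'
    proof -
      obtain y where y: "y \<in> U" "?u (\<phi> e') = ?u y" using \<phi>(2)[of e'] e' by auto
      then have "\<phi> e' = y" using inj_onD[OF Fs.adj_unit_inj y(2)] \<phi>(1)[of e'] e' UF by blast
      then show ?thesis using y(1) by simp
    qed
    moreover have "e \<in> ?V" using e \<phi>(2)[OF e] U(2) by (metis IntI imageI vimageI2)
    ultimately show "\<exists>V U. openin (mtop (total E)) V \<and> e \<in> V \<and> elementary F U \<and> \<phi> ` V \<subseteq> U"
      using V U(1) by blast
  qed
  have "transpose_hom M E Fs.CA (Cmap \<phi>) = \<psi>"
    unfolding transpose_Cc_map[OF hom]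
    by (rule extensionalityI[of _ "epoints E"]) (use \<psi> \<phi>(2) in \<open>auto simp: compose_eq sh_hom_def\<close>)
  then have "Cmap \<phi> = \<alpha>"
    using inj_onD[OF ET.transpose_inj _ Cc_map_hom[OF hom] \<alpha>] unfolding \<psi>_def by blast
  then show ?thesis using hom by blast
qed

lemma Cc_map_bij: "bij_betw Cmap (sh_hom E F) (coalg_hom (Cc M) Es.CA Fs.CA)"
  unfolding bij_betw_def using Cc_map_inj Cc_map_hom Cc_map_surj by blast

end

lemma (in field_sheaf) Cc_map_id: "Cc_map M E E (\<lambda>e\<in>epoints E. e) = (\<lambda>s\<in>carrier CA. s)"
proof -
  interpret EE: field_two_sheaves M E E K ..
  interpret sheaf_module M E C ..
  have id: "(\<lambda>e\<in>epoints E. e) \<in> sh_hom E E"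
  proof (rule EE.sh_homI)
    fix e assume e: "e \<in> epoints E"
    obtain U where U: "elementary E U" "e \<in> U" using elementary_point[OF e] .
    have "(\<lambda>e\<in>epoints E. e) ` U \<subseteq> U" using openin_subset[OF elementary_openin[OF U(1)]] by auto
    then show "\<exists>V U. openin (mtop (total E)) V \<and> e \<in> V \<and> elementary E U \<and> (\<lambda>e\<in>epoints E. e) ` V \<subseteq> U"
      using U elementary_openin by blast
  qed simp_all
  show ?thesis
  proof (rule extensionalityI[OF EE.Cc_map_extensional[OF id]])
    fix s assume s: "s \<in> carrier CA"
    have "EE.Cmap (\<lambda>e\<in>epoints E. e) s = (\<lambda>s. s) s"
    proof (rule linear_map_eqI[OF EE.map_properties(2)[OF id]])
      show "linear_map (Cc M) C C (\<lambda>s. s)" by (simp add: linear_map_def)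
      fix U and f :: "'x \<Rightarrow> 'k" assume U: "elementary E U" "f \<in> Cc (open_sub M (proj E ` U))"
      have "(\<lambda>e\<in>epoints E. e) ` U = U" using openin_subset[OF elementary_openin[OF U(1)]] by force
      then show "EE.Cmap (\<lambda>e\<in>epoints E. e) (pullback E U f) = pullback E U f"
        using EE.map_properties(3)[OF id U] by simp
    qed (use s in \<open>simp add: Cc_coalg_simps Cc_module_simps\<close>)
    then show "EE.Cmap (\<lambda>e\<in>epoints E. e) s = (\<lambda>s\<in>carrier CA. s) s" using s by simp
  qed simp
qed

lemma Cc_map_compose:
  fixes M :: "('x, 'b::real_inner) mfd"
  assumes EF: "two_sheaves M E F" and FG: "two_sheaves M F G"
    and \<phi>: "\<phi> \<in> sh_hom E F" and \<psi>: "\<psi> \<in> sh_hom F G"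
  shows "(Cc_map M E G (compose (epoints E) \<psi> \<phi>) :: ('e \<Rightarrow> ('e \<Rightarrow> 'k::real_normed_field) set) \<Rightarrow> 'g \<Rightarrow> ('g \<Rightarrow> 'k) set) =
    compose (carrier (Cc_coalg M E :: ('x \<Rightarrow> 'k, _) coalg)) (Cc_map M F G \<psi>) (Cc_map M E F \<phi>)"
proof -
  interpret EF: field_two_sheaves M E F "TYPE('k)" unfolding field_two_sheaves_def by fact
  interpret FG: field_two_sheaves M F G "TYPE('k)" unfolding field_two_sheaves_def by fact
  interpret EG: field_two_sheaves M E G "TYPE('k)"
    using EF.sheaf_axioms FG.F.sheaf_axioms by (simp add: field_two_sheaves_def two_sheaves_def)
  interpret sheaf_module M E FG.Fs.C ..
  have hom: "compose (epoints E) \<psi> \<phi> \<in> sh_hom E G"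
    by (rule sh_hom_compose[OF EF.two_sheaves_axioms FG.two_sheaves_axioms \<phi> \<psi>])
  show ?thesis
  proof (rule extensionalityI[OF EG.Cc_map_extensional[OF hom] compose_extensional])
    fix s assume s: "s \<in> carrier EF.Es.CA"
    have "EG.Cmap (compose (epoints E) \<psi> \<phi>) s = (\<lambda>s. FG.Cmap \<psi> (EF.Cmap \<phi> s)) s"
    proof (rule linear_map_eqI[OF EG.map_properties(2)[OF hom] linear_map_comp[OF EF.map_properties(2)[OF \<phi>] FG.map_properties(2)[OF \<psi>]]])
      fix U and f :: "'x \<Rightarrow> 'k" assume U: "elementary E U" "f \<in> Cc (open_sub M (proj E ` U))"
      have "compose (epoints E) \<psi> \<phi> ` U = \<psi> ` \<phi> ` U"
        using openin_subset[OF elementary_openin[OF U(1)]] by (force simp: compose_eq)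
      then show "EG.Cmap (compose (epoints E) \<psi> \<phi>) (pullback E U f) = FG.Cmap \<psi> (EF.Cmap \<phi> (pullback E U f))"
        using EG.map_properties(3)[OF hom U] EF.map_properties(3)[OF \<phi> U]
          FG.map_properties(3)[OF \<psi> EF.sh_hom_elementary(1)[OF \<phi> U(1)] EF.image_Cc[OF \<phi> U]] by simp
    qed (use s in \<open>simp add: Cc_coalg_simps EF.Cc_module_simps\<close>)
    then show "EG.Cmap (compose (epoints E) \<psi> \<phi>) s = compose (carrier EF.Es.CA) (FG.Cmap \<psi>) (EF.Cmap \<phi>) s"
      using s by (simp add: compose_eq)
  qed
qed

text \<open>Transposition is composition with the unit after applying the spectral map, so this is
  functoriality of the latter together with associativity.\<close>

lemma (in transposition) transpose_natural_right:
  assumes CD: "Cc_coalgebra_pair M C D" and \<alpha>: "\<alpha> \<in> coalg_hom (Cc M) Es.CA C" and \<beta>: "\<beta> \<in> coalg_hom (Cc M) C D"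
  shows "transpose_hom M E D (compose (carrier Es.CA) \<beta> \<alpha>) =
    compose (epoints E) (spectral_map M C D \<beta>) (transpose_hom M E C \<alpha>)"
proof -
  have "adj_unit M E \<in> epoints E \<rightarrow> epoints Es.Coalg.S"
    using Es.adj_unit_SP by (simp add: Es.Coalg.epoints_S)
  then show ?thesis
    unfolding transpose_hom_def spectral_map_compose[OF P.Cc_coalgebra_pair_axioms CD \<alpha> \<beta>
      coalg_hom_compose[OF P.Cc_coalgebra_pair_axioms CD \<alpha> \<beta>]]
    by (simp only: compose_assoc)
qed

theorem theorem2p6:
  fixes M :: "('x, 'b::real_inner) mfd"
    and R :: "('x \<Rightarrow> 'k::real_normed_field) set"
  assumes "manifold M" and "Hausdorff_space (mtop M)" and "R = Cc M"
  shows
    "((\<forall>E :: ('e, 'b, 'x) etale. sh_obj M E \<longrightarrow>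
         coalgebra R (Cc_coalg M E)) \<and>
      (\<forall>(E :: ('e, 'b, 'x) etale) (F :: ('f, 'b, 'x) etale) \<phi>.
         sh_obj M E \<and> sh_obj M F \<and> \<phi> \<in> sh_hom E F \<longrightarrow>
         Cc_map M E F \<phi> \<in> coalg_hom R (Cc_coalg M E) (Cc_coalg M F)) \<and>
      (\<forall>E :: ('e, 'b, 'x) etale. sh_obj M E \<longrightarrow>
         Cc_map M E E (\<lambda>e\<in>epoints E. e) =
           (\<lambda>s\<in>carrier (Cc_coalg M E :: ('x \<Rightarrow> 'k, _) coalg). s)) \<and>
      (\<forall>(E :: ('e, 'b, 'x) etale) (F :: ('f, 'b, 'x) etale) (G :: ('g, 'b, 'x) etale) \<phi> \<psi>.
         sh_obj M E \<and> sh_obj M F \<and> sh_obj M G \<and> \<phi> \<in> sh_hom E F \<and> \<psi> \<in> sh_hom F G \<longrightarrow>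
         Cc_map M E G (compose (epoints E) \<psi> \<phi>) =
           compose (carrier (Cc_coalg M E :: ('x \<Rightarrow> 'k, _) coalg)) (Cc_map M F G \<psi>) (Cc_map M E F \<phi>)))
   \<and>
     ((\<forall>C :: ('x \<Rightarrow> 'k, 'c) coalg. coalgebra R C \<longrightarrow>
         sh_obj M (spectral_sheaf M C)) \<and>
      (\<forall>(C :: ('x \<Rightarrow> 'k, 'c) coalg) (D :: ('x \<Rightarrow> 'k, 'd) coalg) \<alpha>.
         coalgebra R C \<and> coalgebra R D \<and> \<alpha> \<in> coalg_hom R C D \<longrightarrow>
         spectral_map M C D \<alpha> \<in> sh_hom (spectral_sheaf M C) (spectral_sheaf M D)) \<and>
      (\<forall>C :: ('x \<Rightarrow> 'k, 'c) coalg. coalgebra R C \<longrightarrow>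
         spectral_map M C C (\<lambda>c\<in>carrier C. c) = (\<lambda>z\<in>epoints (spectral_sheaf M C). z)) \<and>
      (\<forall>(B :: ('x \<Rightarrow> 'k, 'h) coalg) (C :: ('x \<Rightarrow> 'k, 'c) coalg) (D :: ('x \<Rightarrow> 'k, 'd) coalg) \<alpha> \<beta>.
         coalgebra R B \<and> coalgebra R C \<and> coalgebra R D \<and>
         \<alpha> \<in> coalg_hom R B C \<and> \<beta> \<in> coalg_hom R C D \<longrightarrow>
         spectral_map M B D (compose (carrier B) \<beta> \<alpha>) =
           compose (epoints (spectral_sheaf M B)) (spectral_map M C D \<beta>) (spectral_map M B C \<alpha>)))
   \<and>
     (\<forall>(E :: ('e, 'b, 'x) etale) (F :: ('f, 'b, 'x) etale).
         sh_obj M E \<and> sh_obj M F \<longrightarrow>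
         bij_betw (Cc_map M E F) (sh_hom E F) (coalg_hom R (Cc_coalg M E) (Cc_coalg M F)))
   \<and>
     ((\<forall>(E :: ('e, 'b, 'x) etale) (C :: ('x \<Rightarrow> 'k, 'c) coalg).
         sh_obj M E \<and> coalgebra R C \<longrightarrow>
         bij_betw (transpose_hom M E C)
           (coalg_hom R (Cc_coalg M E) C) (sh_hom E (spectral_sheaf M C))) \<and>
      (\<forall>(E :: ('e, 'b, 'x) etale) (F :: ('f, 'b, 'x) etale) (C :: ('x \<Rightarrow> 'k, 'c) coalg) \<phi> \<alpha>.
         sh_obj M E \<and> sh_obj M F \<and> coalgebra R C \<and>
         \<phi> \<in> sh_hom E F \<and> \<alpha> \<in> coalg_hom R (Cc_coalg M F) C \<longrightarrow>
         transpose_hom M E C (compose (carrier (Cc_coalg M E)) \<alpha> (Cc_map M E F \<phi>)) =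
           compose (epoints E) (transpose_hom M F C \<alpha>) \<phi>) \<and>
      (\<forall>(E :: ('e, 'b, 'x) etale) (C :: ('x \<Rightarrow> 'k, 'c) coalg) (D :: ('x \<Rightarrow> 'k, 'd) coalg) \<alpha> \<beta>.
         sh_obj M E \<and> coalgebra R C \<and> coalgebra R D \<and>
         \<alpha> \<in> coalg_hom R (Cc_coalg M E) C \<and> \<beta> \<in> coalg_hom R C D \<longrightarrow>
         transpose_hom M E D (compose (carrier (Cc_coalg M E)) \<beta> \<alpha>) =
           compose (epoints E) (spectral_map M C D \<beta>) (transpose_hom M E C \<alpha>)))"
proof -
  note R = \<open>R = Cc M\<close>
  have M: "hausdorff_manifold M" using assms by (simp add: hausdorff_manifold_def)
  have fs: "field_sheaf M X" if "sh_obj M X" for X :: "('y, 'b, 'x) etale"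
    using that M by (simp add: field_sheaf_def sheaf_def sheaf_axioms_def)
  have ts: "two_sheaves M X Y" if "sh_obj M X" "sh_obj M Y" for X :: "('y, 'b, 'x) etale" and Y :: "('z, 'b, 'x) etale"
    using that M by (simp add: two_sheaves_def sheaf_def sheaf_axioms_def)
  have fts: "field_two_sheaves M X Y" if "sh_obj M X" "sh_obj M Y" for X :: "('y, 'b, 'x) etale" and Y :: "('z, 'b, 'x) etale"
    using ts[OF that] by (simp add: field_two_sheaves_def)
  have cc: "Cc_coalgebra M A" if "coalgebra (Cc M) A" for A :: "('x \<Rightarrow> 'k, 'y) coalg"
    using that M by (simp add: Cc_coalgebra_def Cc_coalgebra_axioms_def)
  have cp: "Cc_coalgebra_pair M A A'" if "coalgebra (Cc M) A" "coalgebra (Cc M) A'"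
    for A :: "('x \<Rightarrow> 'k, 'y) coalg" and A' :: "('x \<Rightarrow> 'k, 'z) coalg"
    using cc[OF that(1)] cc[OF that(2)] by (simp add: Cc_coalgebra_pair_def)
  have tr: "transposition M X A" if "sh_obj M X" "coalgebra (Cc M) A"
    for X :: "('y, 'b, 'x) etale" and A :: "('x \<Rightarrow> 'k, 'z) coalg"
    using fs[OF that(1)] cc[OF that(2)] by (simp add: transposition_def)
  show ?thesis
    unfolding R
  \<comment> \<open>Cases 1 to 4 give functoriality of the coalgebra of sections, 5 to 8 that of the
    spectral sheaf, 9 full faithfulness, and 10 to 12 the adjunction as a bijection natural in both
    variables.\<close>
  proof ((intro conjI allI impI; (elim conjE)?), goal_cases)
    case 1
    then show ?case by (intro field_sheaf.Cc_coalg_coalgebra fs)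
  next
    case 2
    then show ?case by (intro field_two_sheaves.Cc_map_hom fts)
  next
    case 3
    then show ?case by (intro field_sheaf.Cc_map_id fs)
  next
    case 4
    then show ?case by (intro Cc_map_compose ts)
  next
    case 5
    then show ?case by (intro Cc_coalgebra.spectral_sh_obj cc)
  next
    case 6
    then show ?case by (intro Cc_coalgebra_pair.spectral_map_hom cp)
  next
    case 7
    then show ?case by (intro Cc_coalgebra.spectral_map_id cc) simp_all
  next
    case (8 B C D \<alpha> \<beta>)
    then show ?case by (intro spectral_map_compose coalg_hom_compose[of M B C D] cp)
  next
    case 9
    then show ?case by (intro field_two_sheaves.Cc_map_bij fts)
  next
    case 10
    then show ?case by (intro transposition.transpose_bij tr)
  next
    case 11
    then show ?case by (intro field_two_sheaves.transpose_natural fts cc)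
  next
    case 12
    then show ?case by (intro transposition.transpose_natural_right tr cp)
  qed
qed

end
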